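(* Let $P\subset\mathbb R^2$ be a simple polygon satisfying (P0)–(P2) of the context, let $\mathrm{Conv}(P)$ be its convex hull and $h_P$ its diameter, and let $I_P\boldsymbol u\in V_h(P)$ be the edge interpolation defined in the context. Then for all $\boldsymbol u\in\boldsymbol H^1(\mathrm{curl};\mathrm{Conv}(P))$, $$\|\boldsymbol u-I_P\boldsymbol u\|_{\boldsymbol H(\mathrm{curl};P)}\le C\,h_P\,\|\boldsymbol u\|_{\boldsymbol H^1(\mathrm{curl};\mathrm{Conv}(P))},$$ where the constant $C$ depends only on the maximum angle bound in (P1), the constant in (P2), the number of vertices of $P$, and an upper bound for $h_P$ (in particular not on any aspect ratio of $P$ or of the triangles).
   Context: $\mathrm{curl}\,\boldsymbol v=\partial_{x_1}v_2-\partial_{x_2}v_1$; $\boldsymbol H^1(\mathrm{curl};\omega)=\{\boldsymbol v\in H^1(\omega)^2:\mathrm{curl}\,\boldsymbol v\in H^1(\omega)\}$ with its graph norm. Assumptions on $P$: (P0) $P$ admits a triangulation $\mathcal T_h(P)$ with no additional interior vertices, i.e. all edges of the triangulation are formed solely by the vertices on $\partial P$; (P1) all angles of the triangles of $\mathcal T_h(P)$ are bounded above by a fixed constant $<\pi$; (P2) no short interior edges: $h_P\le C'|e|$ for every interior edge $e$ of $\mathcal T_h(P)$, with a fixed constant $C'$. The space is $$V_h(P)=\{\boldsymbol v_h\in\boldsymbol H(\mathrm{curl};P):\boldsymbol v_h|_K\in\mathcal{ND}_h(K)\ \forall K\in\mathcal T_h(P),\ \mathrm{curl}\,\boldsymbol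 v_h\in\mathbb P_0(P)\},$$ with $\mathcal{ND}_h(K)=\{\boldsymbol a+b(x_2,-x_1)^\intercal:\boldsymbol a\in\mathbb R^2,b\in\mathbb R\}$; its functions are uniquely determined by the (constant) tangential components on the edges of $\partial P$. The interpolation $I_P\boldsymbol u\in V_h(P)$ is defined by $\int_eI_P\boldsymbol u\cdot\boldsymbol t\,ds=\int_e\boldsymbol u\cdot\boldsymbol t\,ds$ for every edge $e\subset\partial P$. *)

theory Defs
  imports "HOL-Analysis.Analysis"
begin

section \<open>Square-integrable functions, weak derivatives and Sobolev spaces in the plane\<close>

text \<open>
  Elements of Lebesgue and Sobolev spaces are represented by functions on the whole plane (or
  vector fields), of which only the values almost everywhere on the domain matter.
\<close>

definition L2 :: "'a measure \<Rightarrow> ('a \<Rightarrow> 'b::euclidean_space) set" where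
  "L2 M = {f \<in> borel_measurable M. integrable M (\<lambda>x. (norm (f x))\<^sup>2)}"

definition L2_norm :: "'a measure \<Rightarrow> ('a \<Rightarrow> 'b::euclidean_space) \<Rightarrow> real" where
  "L2_norm M f = sqrt (LINT x|M. (norm (f x))\<^sup>2)"

definition partial :: "2 \<Rightarrow> (real^2 \<Rightarrow> real) \<Rightarrow> real^2 \<Rightarrow> real" where
  "partial i f x = frechet_derivative f (at x) (axis i 1)"

primrec cont_diff :: "nat \<Rightarrow> (real^2 \<Rightarrow> real) \<Rightarrow> bool" where
  "cont_diff 0 f \<longleftrightarrow> continuous_on UNIV f"
| "cont_diff (Suc k) f \<longleftrightarrow> (\<forall>x. f differentiable (at x)) \<and> (\<forall>i. cont_diff k (partial i f))"

definition smooth :: "(real^2 \<Rightarrow> real) \<Rightarrow> bool" where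
  "smooth f \<longleftrightarrow> (\<forall>k. cont_diff k f)"

definition test_functions :: "(real^2) set \<Rightarrow> (real^2 \<Rightarrow> real) set" where
  "test_functions \<omega> =
     {\<phi>. smooth \<phi> \<and> compact (closure {x. \<phi> x \<noteq> 0}) \<and> closure {x. \<phi> x \<noteq> 0} \<subseteq> \<omega>}"

definition is_weak_partial ::
  "(real^2) set \<Rightarrow> 2 \<Rightarrow> (real^2 \<Rightarrow> real) \<Rightarrow> (real^2 \<Rightarrow> real) \<Rightarrow> bool" where
  "is_weak_partial \<omega> i f g \<longleftrightarrow>
     (\<forall>\<phi>\<in>test_functions \<omega>.
        (LINT x|lebesgue_on \<omega>. f x * partial i \<phi> x) = - (LINT x|lebesgue_on \<omega>. g x * \<phi> x))"

definition weak_partial :: "(real^2) set \<Rightarrow> 2 \<Rightarrow> (real^2 \<Rightarrow> real) \<Rightarrow> real^2 \<Rightarrow> real" where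
  "weak_partial \<omega> i f = (SOME g. g \<in> L2 (lebesgue_on \<omega>) \<and> is_weak_partial \<omega> i f g)"

definition H1 :: "(real^2) set \<Rightarrow> (real^2 \<Rightarrow> real) set" where
  "H1 \<omega> = {f \<in> L2 (lebesgue_on \<omega>). \<forall>i. \<exists>g\<in>L2 (lebesgue_on \<omega>). is_weak_partial \<omega> i f g}"

definition H1_norm :: "(real^2) set \<Rightarrow> (real^2 \<Rightarrow> real) \<Rightarrow> real" where
  "H1_norm \<omega> f = sqrt ((L2_norm (lebesgue_on \<omega>) f)\<^sup>2
     + (\<Sum>i\<in>UNIV. (L2_norm (lebesgue_on \<omega>) (weak_partial \<omega> i f))\<^sup>2))"

definition H1_vec :: "(real^2) set \<Rightarrow> (real^2 \<Rightarrow> real^2) set" where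
  "H1_vec \<omega> = {v. \<forall>i. (\<lambda>x. v x $ i) \<in> H1 \<omega>}"

definition H1_vec_norm :: "(real^2) set \<Rightarrow> (real^2 \<Rightarrow> real^2) \<Rightarrow> real" where
  "H1_vec_norm \<omega> v = sqrt (\<Sum>i\<in>UNIV. (H1_norm \<omega> (\<lambda>x. v x $ i))\<^sup>2)"

text \<open>
  The distributional form of \<open>w = \<partial>\<^sub>1 v\<^sub>2 - \<partial>\<^sub>2 v\<^sub>1\<close>: both derivatives are moved to the
  test function, so that the two terms on the right change sign.
\<close>

definition is_weak_curl ::
  "(real^2) set \<Rightarrow> (real^2 \<Rightarrow> real^2) \<Rightarrow> (real^2 \<Rightarrow> real) \<Rightarrow> bool" where
  "is_weak_curl \<omega> v w \<longleftrightarrow>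
     (\<forall>\<phi>\<in>test_functions \<omega>.
        (LINT x|lebesgue_on \<omega>. w x * \<phi> x) =
        (LINT x|lebesgue_on \<omega>. v x $ 1 * partial 2 \<phi> x - v x $ 2 * partial 1 \<phi> x))"

definition weak_curl :: "(real^2) set \<Rightarrow> (real^2 \<Rightarrow> real^2) \<Rightarrow> real^2 \<Rightarrow> real" where
  "weak_curl \<omega> v = (SOME w. w \<in> L2 (lebesgue_on \<omega>) \<and> is_weak_curl \<omega> v w)"

definition Hcurl :: "(real^2) set \<Rightarrow> (real^2 \<Rightarrow> real^2) set" where
  "Hcurl \<omega> = {v \<in> L2 (lebesgue_on \<omega>). \<exists>w\<in>L2 (lebesgue_on \<omega>). is_weak_curl \<omega> v w}"

definition Hcurl_norm :: "(real^2) set \<Rightarrow> (real^2 \<Rightarrow> real^2) \<Rightarrow> real" where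
  "Hcurl_norm \<omega> v = sqrt ((L2_norm (lebesgue_on \<omega>) v)\<^sup>2
     + (L2_norm (lebesgue_on \<omega>) (weak_curl \<omega> v))\<^sup>2)"

definition H1curl :: "(real^2) set \<Rightarrow> (real^2 \<Rightarrow> real^2) set" where
  "H1curl \<omega> = {v \<in> H1_vec \<omega>. \<exists>w\<in>H1 \<omega>. is_weak_curl \<omega> v w}"

definition H1curl_norm :: "(real^2) set \<Rightarrow> (real^2 \<Rightarrow> real^2) \<Rightarrow> real" where
  "H1curl_norm \<omega> v = sqrt ((H1_vec_norm \<omega> v)\<^sup>2 + (H1_norm \<omega> (weak_curl \<omega> v))\<^sup>2)"


section \<open>Traces on segments\<close>

definition arc_length :: "real^2 \<Rightarrow> real^2 \<Rightarrow> (real^2) measure" where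
  "arc_length a b =
     scale_measure (ennreal (dist a b)) (distr (restrict_space lborel {0..1}) borel (linepath a b))"

text \<open>
  The trace of \<open>f \<in> H1 \<omega>\<close> on a segment contained in the closure of \<open>\<omega>\<close> is the continuous extension of
  the restriction operator on smooth functions, i.e. the limit in \<open>L\<^sup>2\<close> of the segment of the
  restrictions of smooth functions converging to \<open>f\<close> in \<open>H1 \<omega>\<close>.
\<close>

definition is_trace ::
  "(real^2) set \<Rightarrow> real^2 \<Rightarrow> real^2 \<Rightarrow> (real^2 \<Rightarrow> real) \<Rightarrow> (real^2 \<Rightarrow> real) \<Rightarrow> bool" where
  "is_trace \<omega> a b f g \<longleftrightarrow> g \<in> L2 (arc_length a b) \<and>
     (\<exists>\<phi> :: nat \<Rightarrow> real^2 \<Rightarrow> real.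
        (\<forall>n. smooth (\<phi> n) \<and> (\<lambda>x. f x - \<phi> n x) \<in> H1 \<omega>) \<and>
        (\<lambda>n. H1_norm \<omega> (\<lambda>x. f x - \<phi> n x)) \<longlonglongrightarrow> 0 \<and>
        (\<lambda>n. L2_norm (arc_length a b) (\<lambda>x. g x - \<phi> n x)) \<longlonglongrightarrow> 0)"

definition trace_on ::
  "(real^2) set \<Rightarrow> real^2 \<Rightarrow> real^2 \<Rightarrow> (real^2 \<Rightarrow> real) \<Rightarrow> real^2 \<Rightarrow> real" where
  "trace_on \<omega> a b f = (SOME g. is_trace \<omega> a b f g)"

text \<open>
  \<open>\<integral>\<^sub>e v \<cdot> t ds\<close> for the edge \<open>e\<close> from \<open>a\<close> to \<open>b\<close>, where \<open>v\<close> on \<open>e\<close> is the trace taken from \<open>\<omega>\<close> and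
  \<open>t\<close> is the unit tangent pointing from \<open>a\<close> to \<open>b\<close>.
\<close>

definition edge_integral ::
  "(real^2) set \<Rightarrow> (real^2 \<Rightarrow> real^2) \<Rightarrow> real^2 \<Rightarrow> real^2 \<Rightarrow> real" where
  "edge_integral \<omega> v a b =
     (LINT x|arc_length a b. (\<chi> i. trace_on \<omega> a b (\<lambda>y. v y $ i) x) \<bullet> ((b - a) /\<^sub>R norm (b - a)))"


section \<open>Polygons and their triangulations\<close>

text \<open>
  A polygon is given by the cyclic list of its vertices. A straight angle at a vertex is allowed.
\<close>

definition next_vertex :: "(real^2) list \<Rightarrow> nat \<Rightarrow> real^2" where
  "next_vertex vs i = vs ! (Suc i mod length vs)"

definition polygon_edge :: "(real^2) list \<Rightarrow> nat \<Rightarrow> (real^2) set" where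
  "polygon_edge vs i = closed_segment (vs ! i) (next_vertex vs i)"

definition polygon_boundary :: "(real^2) list \<Rightarrow> (real^2) set" where
  "polygon_boundary vs = (\<Union>i<length vs. polygon_edge vs i)"

definition simple_polygon :: "(real^2) list \<Rightarrow> bool" where
  "simple_polygon vs \<longleftrightarrow> length vs \<ge> 3 \<and> distinct vs \<and>
     (\<forall>i<length vs. \<forall>j<length vs. i \<noteq> j \<longrightarrow>
        polygon_edge vs i \<inter> polygon_edge vs j =
        {vs ! i, next_vertex vs i} \<inter> {vs ! j, next_vertex vs j})"

definition polygon_region :: "(real^2) list \<Rightarrow> (real^2) set" where
  "polygon_region vs = inside (polygon_boundary vs)"

text \<open>
  The elements of \<open>T\<close> are closed triangles, meeting along common faces, whose vertices are exactly
  the vertices of the polygon. (A vertex of the polygon with a straight angle thus is a vertex of the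
  triangulation, too, so that every edge of the polygon is an edge of some triangle.)
\<close>

definition polygon_triangulation :: "(real^2) list \<Rightarrow> (real^2) set set \<Rightarrow> bool" where
  "polygon_triangulation vs T \<longleftrightarrow>
     triangulation T \<and> (\<forall>K\<in>T. 2 simplex K) \<and>
     \<Union>T = closure (polygon_region vs) \<and>
     (\<Union>K\<in>T. {x. x extreme_point_of K}) = set vs"

definition angle_at :: "real^2 \<Rightarrow> real^2 \<Rightarrow> real^2 \<Rightarrow> real" where
  "angle_at a b c = arccos (((b - a) \<bullet> (c - a)) / (norm (b - a) * norm (c - a)))"

definition angles_bounded :: "real \<Rightarrow> (real^2) set set \<Rightarrow> bool" where
  "angles_bounded \<theta> T \<longleftrightarrow>
     (\<forall>K\<in>T. \<forall>a b c. a extreme_point_of K \<and> b extreme_point_of K \<and> c extreme_point_of K \<and>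
        a \<noteq> b \<and> a \<noteq> c \<and> b \<noteq> c \<longrightarrow> angle_at a b c \<le> \<theta>)"

text \<open>The diameter of an edge is its length.\<close>

definition no_short_interior_edges :: "real \<Rightarrow> (real^2) list \<Rightarrow> (real^2) set set \<Rightarrow> bool" where
  "no_short_interior_edges C' vs T \<longleftrightarrow>
     (\<forall>K\<in>T. \<forall>e. e edge_of K \<and> \<not> e \<subseteq> polygon_boundary vs \<longrightarrow>
        diameter (polygon_region vs) \<le> C' * diameter e)"


section \<open>The virtual edge space and the edge interpolation\<close>

definition ND :: "(real^2 \<Rightarrow> real^2) set" where
  "ND = {p. \<exists>(a::real^2) (b::real). p = (\<lambda>x. a + b *\<^sub>R vector [x $ 2, - (x $ 1)])}"

definition Vh :: "(real^2) list \<Rightarrow> (real^2) set set \<Rightarrow> (real^2 \<Rightarrow> real^2) set" where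
  "Vh vs T = {v \<in> Hcurl (polygon_region vs).
     (\<forall>K\<in>T. \<exists>p\<in>ND. AE x in lebesgue_on K. v x = p x) \<and>
     (\<exists>c. is_weak_curl (polygon_region vs) v (\<lambda>_. c))}"

text \<open>
  A function in \<open>Vh\<close> need not be in \<open>H\<^sup>1\<close> of the polygon, only in \<open>H\<^sup>1\<close> of each triangle. So its trace
  on a boundary edge is taken from the triangle containing that edge.
\<close>

definition is_interpolant ::
  "(real^2) list \<Rightarrow> (real^2) set set \<Rightarrow> (real^2 \<Rightarrow> real^2) \<Rightarrow> (real^2 \<Rightarrow> real^2) \<Rightarrow> bool" where
  "is_interpolant vs T u w \<longleftrightarrow> w \<in> Vh vs T \<and>
     (\<forall>i<length vs. \<forall>K\<in>T. polygon_edge vs i \<subseteq> K \<longrightarrow>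
        edge_integral (interior K) w (vs ! i) (next_vertex vs i) =
        edge_integral (polygon_region vs) u (vs ! i) (next_vertex vs i))"

definition interpolation ::
  "(real^2) list \<Rightarrow> (real^2) set set \<Rightarrow> (real^2 \<Rightarrow> real^2) \<Rightarrow> real^2 \<Rightarrow> real^2" where
  "interpolation vs T u = (SOME w. is_interpolant vs T u w)"

end

theory Submission
  imports Defs
begin

section \<open>Square-integrable functions\<close>

text \<open>Let h be the diameter of P, u the given field and w its interpolant. On each triangle w
  is a field \<open>nd \<alpha> \<beta>\<close>: its tangential component along any segment is
  constant, and its curl is -2 \<beta>. As curl w is a single constant c on P, all the \<beta>
  coincide.

  Curl error. Along the edges of P the line integrals of w and u agree, so Stokes' theorem makes c
  the mean of curl u over P, which is the best constant in L^2(P) (\<open>curl_mean\<close>,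
  \<open>E_le\<close>). Hence the error does not decrease if c is replaced by the mean over the
  convex hull, and the Poincare inequality on convex sets (\<open>poincare\<close>), whose constant
  depends on the diameter alone, bounds it by h times the gradient of curl u
  (\<open>curl_error\<close>). P need not be convex, which is why u is given on the hull.

  Interior edges. There the line integrals of w and u differ by some \<delta>. An interior edge is a
  chord that cuts off a subpolygon (\<open>chord_split\<close>). On it Stokes' theorem expresses
  \<delta> by the integral of curl u - c, because all other edges of the subpolygon are edges of P,
  where nothing deviates (\<open>\<delta>_le\<close>). By Cauchy-Schwarz, by |P| <= 4 h^2 and by the
  lower bound h / C' on the length of the edge e, the quotient \<delta> / |e| is at most 2 C' times
  the curl error (\<open>edge_deviation\<close>). No shape regularity enters.

  Error on one triangle. At the vertex opposite the longest edge the angle is at least 60 degrees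
  and at most \<theta>, so the unit tangents of the two edges meeting there control every vector
  (\<open>inner_two_directions\<close>, \<open>cos_bound_opposite_longest_edge\<close>). In each of
  these two directions the error is a scalar function whose mean over the edge is known up to
  \<delta> / |e|. The Poincare inequality with the mean over an edge has a constant that does not
  see the shape of the triangle (\<open>edge_poincare\<close>): by \<open>edge_formula\<close> the
  edge mean differs from the mean over the triangle only by an average of the gradient against x -
  d, where d is the opposite vertex. This gives \<open>element_error\<close>, and summation gives
  \<open>L2_error\<close>.

  Existence of the interpolant. The line integrals along the interior edges have to be chosen so
  that every triangle has circulation c times its area. The correction to the line integrals of u is
  a flow on the dual graph of the triangulation, which is connected because P is; it exists because
  the required corrections sum to zero (\<open>exists_flow\<close>,
  \<open>exists_interpolant\<close>).

  Analytic foundation. Mollification with a contraction approximates H^1 functions on convex sets by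
  smooth ones up to the boundary (\<open>smooth_dense_weak_grad\<close>). This yields the Poincare
  inequality, existence of traces (\<open>trace_exists\<close>) and the identity of the mean of a
  trace with the volume integrals \<open>edge_mean\<close>, after which traces no longer
  occur.\<close>

lemma L2_real_iff:
  "f \<in> L2 M \<longleftrightarrow> f \<in> borel_measurable M \<and> integrable M (\<lambda>x. (f x)\<^sup>2)" for f :: "'a \<Rightarrow> real"
  by (simp add: L2_def)

lemma L2_norm_real: "L2_norm M f = sqrt (LINT x|M. (f x)\<^sup>2)" for f :: "'a \<Rightarrow> real"
  by (simp add: L2_norm_def)

lemma L2_norm_nonneg [simp]: "0 \<le> L2_norm M f"
  by (simp add: L2_norm_def)

lemma L2_norm_sq: "(L2_norm M f)\<^sup>2 = (LINT x|M. (f x)\<^sup>2)" for f :: "'a \<Rightarrow> real"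
  by (simp add: L2_norm_def)

lemma L2_measurable [measurable_dest]: "f \<in> L2 M \<Longrightarrow> f \<in> borel_measurable M"
  by (simp add: L2_def)

lemma L2_mult_integrable:
  fixes f g :: "'a \<Rightarrow> real"
  assumes f: "f \<in> L2 M" and g: "g \<in> L2 M"
  shows "integrable M (\<lambda>x. f x * g x)"
proof (rule Bochner_Integration.integrable_bound)
  show "integrable M (\<lambda>x. (f x)\<^sup>2 + (g x)\<^sup>2)"
    using f g by (simp add: L2_real_iff)
  show "(\<lambda>x. f x * g x) \<in> borel_measurable M"
    using f g by (auto simp: L2_real_iff)
  have "\<bar>a * b\<bar> \<le> \<bar>a\<^sup>2 + b\<^sup>2\<bar>" for a b :: real
  proof -
    have "2 * \<bar>a * b\<bar> \<le> a\<^sup>2 + b\<^sup>2"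
      using sum_squares_bound [of "\<bar>a\<bar>" "\<bar>b\<bar>"] by (simp add: abs_mult)
    then show ?thesis
      by simp
  qed
  then show "AE x in M. norm (f x * g x) \<le> norm ((f x)\<^sup>2 + (g x)\<^sup>2)"
    by auto
qed

lemma L2_add:
  fixes f g :: "'a \<Rightarrow> real"
  assumes f: "f \<in> L2 M" and g: "g \<in> L2 M"
  shows "(\<lambda>x. f x + g x) \<in> L2 M"
proof -
  have "integrable M (\<lambda>x. (f x)\<^sup>2 + 2 * (f x * g x) + (g x)\<^sup>2)"
    using f g L2_mult_integrable [OF f g] by (simp add: L2_real_iff)
  moreover have "(\<lambda>x. (f x + g x)\<^sup>2) = (\<lambda>x. (f x)\<^sup>2 + 2 * (f x * g x) + (g x)\<^sup>2)"
    by (simp add: power2_sum fun_eq_iff)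
  moreover have "(\<lambda>x. f x + g x) \<in> borel_measurable M"
    using f g by (intro borel_measurable_add) (simp_all add: L2_real_iff)
  ultimately show ?thesis
    unfolding L2_real_iff by metis
qed

lemma L2_cmult:
  fixes f :: "'a \<Rightarrow> real"
  assumes "f \<in> L2 M"
  shows "(\<lambda>x. c * f x) \<in> L2 M"
  using assms by (auto simp: L2_real_iff power_mult_distrib)

lemma L2_diff:
  fixes f g :: "'a \<Rightarrow> real"
  assumes f: "f \<in> L2 M" and g: "g \<in> L2 M"
  shows "(\<lambda>x. f x - g x) \<in> L2 M"
  using L2_add [OF f L2_cmult [OF g, of "-1"]] by simp

lemma L2_zero [simp]: "(\<lambda>x. 0 :: real) \<in> L2 M"
  by (simp add: L2_real_iff)

lemma L2_cong_AE:
  fixes f g :: "'a \<Rightarrow> real"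
  assumes "f \<in> L2 M" "g \<in> borel_measurable M" "AE x in M. f x = g x"
  shows "g \<in> L2 M"
proof -
  have "integrable M (\<lambda>x. (g x)\<^sup>2)"
    using assms by (subst integrable_cong_AE [of _ _ "\<lambda>x. (f x)\<^sup>2"]) (auto simp: L2_real_iff)
  with assms show ?thesis
    by (simp add: L2_real_iff)
qed

lemma L2_norm_cong_AE:
  fixes f g :: "'a \<Rightarrow> real"
  assumes "f \<in> borel_measurable M" "g \<in> borel_measurable M" "AE x in M. f x = g x"
  shows "L2_norm M f = L2_norm M g"
  unfolding L2_norm_real using assms by (subst integral_cong_AE [of _ _ "\<lambda>x. (g x)\<^sup>2"]) auto

lemma L2_norm_cmult: "L2_norm M (\<lambda>x. c * f x) = \<bar>c\<bar> * L2_norm M f" for f :: "'a \<Rightarrow> real"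
  by (simp add: L2_norm_real power_mult_distrib real_sqrt_mult)

lemma L2_norm_minus_commute: "L2_norm M (\<lambda>x. f x - g x) = L2_norm M (\<lambda>x. g x - f x)"
  for f :: "'a \<Rightarrow> real"
  by (simp add: L2_norm_real power2_commute)

text \<open>The polynomial \<open>A + 2 * t * B + t\<^sup>2 * C\<close> in t is the integral of (f +
  t g)^2, hence nonnegative for all t. It is evaluated at its minimiser -B / C if C is
  positive.\<close>

lemma L2_cauchy_schwarz_sq:
  fixes f g :: "'a \<Rightarrow> real"
  assumes f: "f \<in> L2 M" and g: "g \<in> L2 M"
  shows "(LINT x|M. f x * g x)\<^sup>2 \<le> (LINT x|M. (f x)\<^sup>2) * (LINT x|M. (g x)\<^sup>2)"
proof -
  define A B C where "A = (LINT x|M. (f x)\<^sup>2)" and "B = (LINT x|M. f x * g x)"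
    and "C = (LINT x|M. (g x)\<^sup>2)"
  have fg: "integrable M (\<lambda>x. f x * g x)" "integrable M (\<lambda>x. (f x)\<^sup>2)" "integrable M (\<lambda>x. (g x)\<^sup>2)"
    using L2_mult_integrable [OF f g] f g by (auto simp: L2_real_iff)
  have pos: "0 \<le> A + 2 * t * B + t\<^sup>2 * C" for t
  proof -
    have "0 \<le> (LINT x|M. (f x + t * g x)\<^sup>2)"
      by simp
    also have "\<dots> = (LINT x|M. (f x)\<^sup>2 + 2 * t * (f x * g x) + t\<^sup>2 * (g x)\<^sup>2)"
      by (intro Bochner_Integration.integral_cong) (auto simp: power2_sum power_mult_distrib)
    also have "\<dots> = A + 2 * t * B + t\<^sup>2 * C"
      using fg by (simp add: A_def B_def C_def)
    finally show ?thesis .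
  qed
  have "B\<^sup>2 \<le> A * C"
  proof (cases "C = 0")
    case True
    have "B = 0"
    proof (rule ccontr)
      assume "B \<noteq> 0"
      \<comment> \<open>For C = 0 the polynomial is affine in t, and this t gives it the value
        -1.\<close>
      then show False
        using pos [of "- (A + 1) / (2 * B)"] True by (simp add: field_simps)
    qed
    then show ?thesis
      using True by simp
  next
    case False
    then have "C > 0"
      by (simp add: C_def less_le)
    then show ?thesis
      using pos [of "- B / C"] by (simp add: field_simps power2_eq_square)
  qed
  then show ?thesis
    by (simp add: A_def B_def C_def)
qed

lemma L2_cauchy_schwarz:
  fixes f g :: "'a \<Rightarrow> real"
  assumes f: "f \<in> L2 M" and g: "g \<in> L2 M"
  shows "\<bar>LINT x|M. f x * g x\<bar> \<le> L2_norm M f * L2_norm M g"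
  using real_sqrt_le_mono [OF L2_cauchy_schwarz_sq [OF f g]]
  by (simp add: L2_norm_real real_sqrt_mult)

lemma L2_norm_triangle:
  fixes f g :: "'a \<Rightarrow> real"
  assumes f: "f \<in> L2 M" and g: "g \<in> L2 M"
  shows "L2_norm M (\<lambda>x. f x + g x) \<le> L2_norm M f + L2_norm M g"
proof (rule power2_le_imp_le)
  have fg: "integrable M (\<lambda>x. f x * g x)" "integrable M (\<lambda>x. (f x)\<^sup>2)" "integrable M (\<lambda>x. (g x)\<^sup>2)"
    using L2_mult_integrable [OF f g] f g by (auto simp: L2_real_iff)
  have "(L2_norm M (\<lambda>x. f x + g x))\<^sup>2 = (LINT x|M. (f x)\<^sup>2 + 2 * (f x * g x) + (g x)\<^sup>2)"
    unfolding L2_norm_sq by (intro Bochner_Integration.integral_cong) (auto simp: power2_sum)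
  also have "\<dots> = (L2_norm M f)\<^sup>2 + 2 * (LINT x|M. f x * g x) + (L2_norm M g)\<^sup>2"
    using fg by (simp add: L2_norm_sq)
  also have "\<dots> \<le> (L2_norm M f)\<^sup>2 + 2 * (L2_norm M f * L2_norm M g) + (L2_norm M g)\<^sup>2"
    using L2_cauchy_schwarz [OF f g] by simp
  also have "\<dots> = (L2_norm M f + L2_norm M g)\<^sup>2"
    by (simp add: power2_sum)
  finally show "(L2_norm M (\<lambda>x. f x + g x))\<^sup>2 \<le> (L2_norm M f + L2_norm M g)\<^sup>2" .
qed simp

lemma L2_norm_diff_triangle:
  fixes f g :: "'a \<Rightarrow> real"
  assumes f: "f \<in> L2 M" and g: "g \<in> L2 M" and h: "h \<in> L2 M"
  shows "L2_norm M (\<lambda>x. f x - h x) \<le> L2_norm M (\<lambda>x. f x - g x) + L2_norm M (\<lambda>x. g x - h x)"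
  using L2_norm_triangle [OF L2_diff [OF f g] L2_diff [OF g h]] by simp

lemma L2_norm_reverse_triangle:
  fixes f g :: "'a \<Rightarrow> real"
  assumes f: "f \<in> L2 M" and g: "g \<in> L2 M"
  shows "\<bar>L2_norm M f - L2_norm M g\<bar> \<le> L2_norm M (\<lambda>x. f x - g x)"
  using L2_norm_triangle [OF L2_diff [OF f g] g] L2_norm_triangle [OF L2_diff [OF g f] f]
  by (simp add: L2_norm_minus_commute [of M g f])

lemma L2_norm_tendsto:
  fixes f :: "'a \<Rightarrow> real" and F :: "nat \<Rightarrow> 'a \<Rightarrow> real"
  assumes f: "f \<in> L2 M" and F: "\<And>n. F n \<in> L2 M"
    and lim: "(\<lambda>n. L2_norm M (\<lambda>x. f x - F n x)) \<longlonglongrightarrow> 0"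
  shows "(\<lambda>n. L2_norm M (F n)) \<longlonglongrightarrow> L2_norm M f"
proof (rule LIM_zero_cancel, rule Lim_null_comparison [OF _ lim])
  show "\<forall>\<^sub>F n in sequentially. norm (L2_norm M (F n) - L2_norm M f) \<le> L2_norm M (\<lambda>x. f x - F n x)"
    using L2_norm_reverse_triangle [OF f F] by (simp add: abs_minus_commute)
qed

lemma L2_inner_tendsto:
  fixes f g :: "'a \<Rightarrow> real" and F :: "nat \<Rightarrow> 'a \<Rightarrow> real"
  assumes f: "f \<in> L2 M" and F: "\<And>n. F n \<in> L2 M" and g: "g \<in> L2 M"
    and lim: "(\<lambda>n. L2_norm M (\<lambda>x. f x - F n x)) \<longlonglongrightarrow> 0"
  shows "(\<lambda>n. LINT x|M. F n x * g x) \<longlonglongrightarrow> (LINT x|M. f x * g x)"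
proof (rule LIM_zero_cancel, rule Lim_null_comparison)
  show "(\<lambda>n. L2_norm M (\<lambda>x. f x - F n x) * L2_norm M g) \<longlonglongrightarrow> 0"
    using lim by (auto intro: tendsto_eq_intros)
  have "(LINT x|M. F n x * g x) - (LINT x|M. f x * g x) = (LINT x|M. (F n x - f x) * g x)" for n
    using L2_mult_integrable [OF f g] L2_mult_integrable [OF F g]
    by (simp add: left_diff_distrib)
  then show "\<forall>\<^sub>F n in sequentially. norm ((LINT x|M. F n x * g x) - (LINT x|M. f x * g x))
      \<le> L2_norm M (\<lambda>x. f x - F n x) * L2_norm M g"
    using L2_cauchy_schwarz [OF L2_diff [OF F f] g] by (simp add: L2_norm_minus_commute [of M f])
qed

lemma L2_const [simp]: "finite_measure M \<Longrightarrow> (\<lambda>x. c :: real) \<in> L2 M"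
  by (simp add: L2_real_iff finite_measure.integrable_const)

lemma L2_integrable:
  fixes f :: "'a \<Rightarrow> real"
  assumes "finite_measure M" "f \<in> L2 M"
  shows "integrable M f"
  using L2_mult_integrable [OF assms(2) L2_const [OF assms(1), of 1]] by simp

lemma L2_integral_tendsto:
  fixes f :: "'a \<Rightarrow> real" and F :: "nat \<Rightarrow> 'a \<Rightarrow> real"
  assumes "finite_measure M" and f: "f \<in> L2 M" and F: "\<And>n. F n \<in> L2 M"
    and lim: "(\<lambda>n. L2_norm M (\<lambda>x. f x - F n x)) \<longlonglongrightarrow> 0"
  shows "(\<lambda>n. LINT x|M. F n x) \<longlonglongrightarrow> (LINT x|M. f x)"
  using L2_inner_tendsto [OF f F L2_const [OF assms(1), of 1] lim] by simp

lemma bounded_imp_L2: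
  fixes f :: "'a \<Rightarrow> real"
  assumes M: "finite_measure M" and f: "f \<in> borel_measurable M" and b: "\<And>x. x \<in> space M \<Longrightarrow> \<bar>f x\<bar> \<le> B"
  shows "f \<in> L2 M"
proof -
  have "integrable M (\<lambda>x. (f x)\<^sup>2)"
  proof (rule finite_measure.integrable_const_bound [OF M, where B="B\<^sup>2"])
    show "AE x in M. norm ((f x)\<^sup>2) \<le> B\<^sup>2"
      using b by (auto intro!: AE_I2 simp: abs_le_square_iff [symmetric] intro: order_trans [OF b abs_ge_self])
  qed (use f in measurable)
  then show ?thesis
    using f by (simp add: L2_real_iff)
qed

lemma borel_measurable_vec2_iff:
  fixes f :: "'a \<Rightarrow> real^2"
  shows "f \<in> borel_measurable M \<longleftrightarrow> (\<forall>i. (\<lambda>x. f x $ i) \<in> borel_measurable M)"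
  by (subst borel_measurable_euclidean_space) (auto simp: Basis_vec_def inner_axis)

lemma L2_vec_iff:
  fixes f :: "'a \<Rightarrow> real^2"
  shows "(\<lambda>x. f x) \<in> L2 M \<longleftrightarrow> (\<forall>i. (\<lambda>x. f x $ i) \<in> L2 M)"
proof
  assume f: "f \<in> L2 M"
  show "\<forall>i. (\<lambda>x. f x $ i) \<in> L2 M"
  proof
    fix i
    have m: "(\<lambda>x. f x $ i) \<in> borel_measurable M"
      using f unfolding L2_def by (simp add: borel_measurable_vec2_iff)
    have "integrable M (\<lambda>x. (f x $ i)\<^sup>2)"
    proof (rule Bochner_Integration.integrable_bound)
      show "integrable M (\<lambda>x. (norm (f x))\<^sup>2)"
        using f by (simp add: L2_def)
      show "AE x in M. norm ((f x $ i)\<^sup>2) \<le> norm ((norm (f x))\<^sup>2)"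
        using component_le_norm_cart by (auto simp: abs_le_square_iff [symmetric])
    qed (use m in measurable)
    with m show "(\<lambda>x. f x $ i) \<in> L2 M"
      by (simp add: L2_real_iff)
  qed
next
  assume *: "\<forall>i. (\<lambda>x. f x $ i) \<in> L2 M"
  then have "f \<in> borel_measurable M"
    by (simp add: borel_measurable_vec2_iff L2_real_iff)
  moreover have "integrable M (\<lambda>x. (norm (f x))\<^sup>2)"
    using * by (simp add: norm_vec_def L2_set_def sum_2 L2_real_iff)
  ultimately show "f \<in> L2 M"
    by (simp add: L2_def)
qed

section \<open>Smooth functions and smooth bumps\<close>

lemma partial_eqI: "(f has_derivative D) (at x) \<Longrightarrow> partial i f x = D (axis i 1)"
  by (simp add: partial_def frechet_derivative_at [symmetric])

lemma frechet_derivative_worksI: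
  "f differentiable (at x) \<Longrightarrow> (f has_derivative frechet_derivative f (at x)) (at x)"
  by (simp add: frechet_derivative_works)

lemma has_derivative_partials:
  assumes "f differentiable (at x)"
  shows "(f has_derivative (\<lambda>h. h $ 1 * partial 1 f x + h $ 2 * partial 2 f x)) (at x)"
proof -
  obtain D where D: "(f has_derivative D) (at x)"
    using assms by (auto simp: differentiable_def)
  then interpret D: bounded_linear D
    by (rule has_derivative_bounded_linear)
  have "D h = h $ 1 * partial 1 f x + h $ 2 * partial 2 f x" for h
  proof -
    have "h = h $ 1 *\<^sub>R axis 1 1 + h $ 2 *\<^sub>R axis 2 1"
      by (simp add: vec_eq_iff forall_2 axis_def)
    then have "D h = D (h $ 1 *\<^sub>R axis 1 1 + h $ 2 *\<^sub>R axis 2 1)"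
      by simp
    then show ?thesis
      by (simp add: D.add D.scaleR partial_eqI [OF D])
  qed
  then have "D = (\<lambda>h. h $ 1 * partial 1 f x + h $ 2 * partial 2 f x)"
    by auto
  with D show ?thesis
    by simp
qed

lemma partial_const [simp]: "partial i (\<lambda>x. c) = (\<lambda>x. 0)"
  by (rule ext, subst partial_eqI [OF has_derivative_const]) simp

lemma partial_coord: "partial i (\<lambda>x. x $ j) = (\<lambda>x. if i = j then 1 else 0)"
proof
  fix x :: "real^2"
  have "((\<lambda>x. x $ j) has_derivative (\<lambda>h. h $ j)) (at x)"
    by (intro bounded_linear.has_derivative [OF bounded_linear_vec_nth] has_derivative_ident)
  then show "partial i (\<lambda>x. x $ j) x = (if i = j then 1 else 0)"
    by (simp add: partial_eqI axis_def)
qed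

lemma partial_add:
  assumes "f differentiable (at x)" "g differentiable (at x)"
  shows "partial i (\<lambda>x. f x + g x) x = partial i f x + partial i g x"
  using partial_eqI [OF has_derivative_add [OF frechet_derivative_worksI [OF assms(1)] frechet_derivative_worksI [OF assms(2)]]]
  by (simp add: partial_def)

lemma partial_diff:
  assumes "f differentiable (at x)" "g differentiable (at x)"
  shows "partial i (\<lambda>x. f x - g x) x = partial i f x - partial i g x"
  using partial_eqI [OF has_derivative_diff [OF frechet_derivative_worksI [OF assms(1)] frechet_derivative_worksI [OF assms(2)]]]
  by (simp add: partial_def)

lemma partial_mult:
  assumes "f differentiable (at x)" "g differentiable (at x)"
  shows "partial i (\<lambda>x. f x * g x) x = f x * partial i g x + partial i f x * g x"
  using partial_eqI [OF has_derivative_mult [OF frechet_derivative_worksI [OF assms(1)] frechet_derivative_worksI [OF assms(2)]]]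
  by (simp add: partial_def)

lemma partial_cmult:
  assumes "f differentiable (at x)"
  shows "partial i (\<lambda>x. c * f x) x = c * partial i f x"
  using partial_mult [OF differentiable_const assms] by simp

lemma partial_compose_real:
  assumes "f differentiable (at x)" "(h has_real_derivative d) (at (f x))"
  shows "partial i (\<lambda>x. h (f x)) x = d * partial i f x" "(\<lambda>x. h (f x)) differentiable (at x)"
proof -
  have *: "((\<lambda>x. h (f x)) has_derivative (\<lambda>y. d * frechet_derivative f (at x) y)) (at x)"
    using assms(2)
    by (intro has_derivative_compose [OF frechet_derivative_worksI [OF assms(1)], of h "\<lambda>y. d * y"])
       (simp add: has_field_derivative_def)
  show "partial i (\<lambda>x. h (f x)) x = d * partial i f x"
    by (subst partial_eqI [OF *]) (simp add: partial_def)
  show "(\<lambda>x. h (f x)) differentiable (at x)"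
    using * by (auto simp: differentiable_def)
qed

lemma cont_diff_Suc_imp: "cont_diff (Suc k) f \<Longrightarrow> cont_diff k f"
proof (induction k arbitrary: f)
  case 0
  then show ?case
    by (auto intro!: differentiable_imp_continuous_on simp: differentiable_on_def differentiable_at_withinI)
next
  case (Suc k)
  then show ?case
    by (metis cont_diff.simps(2))
qed

lemma cont_diff_const: "cont_diff k (\<lambda>x. c)"
  by (induction k arbitrary: c) auto

lemma cont_diff_coord: "cont_diff k (\<lambda>x. x $ j)"
proof (cases k)
  case (Suc k')
  have "(\<lambda>x::real^2. x $ j) differentiable (at x)" for x
    by (intro bounded_linear_imp_differentiable bounded_linear_vec_nth)
  with Suc show ?thesis
    by (auto simp: partial_coord cont_diff_const)
qed (auto intro!: continuous_intros)

lemma cont_diff_add: "cont_diff k f \<Longrightarrow> cont_diff k g \<Longrightarrow> cont_diff k (\<lambda>x. f x + g x)"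
proof (induction k arbitrary: f g)
  case (Suc k)
  then have "partial i (\<lambda>x. f x + g x) = (\<lambda>x. partial i f x + partial i g x)" for i
    by (auto simp: partial_add)
  with Suc show ?case
    by simp
qed (auto intro!: continuous_intros)

lemma cont_diff_mult: "cont_diff k f \<Longrightarrow> cont_diff k g \<Longrightarrow> cont_diff k (\<lambda>x. f x * g x)"
proof (induction k arbitrary: f g)
  case (Suc k)
  then have "partial i (\<lambda>x. f x * g x) = (\<lambda>x. f x * partial i g x + partial i f x * g x)" for i
    by (auto simp: partial_mult)
  moreover have "cont_diff k f" "cont_diff k g"
    using Suc.prems cont_diff_Suc_imp by blast+
  ultimately show ?case
    using Suc by (simp add: cont_diff_add)
qed (auto intro!: continuous_intros)

text \<open>A class S closed under differentiation supplies derivatives of all orders at once: the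
  induction on k passes from h to some h' that is again in S.\<close>

lemma cont_diff_compose_real:
  assumes S: "\<And>h. h \<in> S \<Longrightarrow> \<exists>h'\<in>S. \<forall>t. (h has_real_derivative h' t) (at t)"
    and h: "h \<in> S" and f: "cont_diff k f"
  shows "cont_diff k (\<lambda>x. h (f x))"
  using h f
proof (induction k arbitrary: h)
  case 0
  then obtain h' where "\<And>t. (h has_real_derivative h' t) (at t)"
    using S by blast
  then have "continuous_on UNIV h"
    by (auto intro!: continuous_at_imp_continuous_on DERIV_isCont)
  with 0 show ?case
    using continuous_on_compose2 [of UNIV h UNIV f] by simp
next
  case (Suc k)
  obtain h' where h': "h' \<in> S" "\<And>t. (h has_real_derivative h' t) (at t)"
    using S Suc.prems by blast
  have f: "\<And>x. f differentiable (at x)" "\<And>i. cont_diff k (partial i f)" "cont_diff k f"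
    using Suc.prems cont_diff_Suc_imp by auto
  have "partial i (\<lambda>x. h (f x)) = (\<lambda>x. h' (f x) * partial i f x)" for i
    using partial_compose_real(1) [OF f(1) h'(2)] by auto
  moreover have "cont_diff k (\<lambda>x. h' (f x))"
    using Suc.IH h' f by blast
  ultimately show ?case
    using partial_compose_real(2) [OF f(1) h'(2)] f by (auto intro: cont_diff_mult)
qed

lemma smooth_const: "smooth (\<lambda>x. c)"
  and smooth_coord: "smooth (\<lambda>x. x $ j)"
  and smooth_add: "smooth f \<Longrightarrow> smooth g \<Longrightarrow> smooth (\<lambda>x. f x + g x)"
  and smooth_mult: "smooth f \<Longrightarrow> smooth g \<Longrightarrow> smooth (\<lambda>x. f x * g x)"
  by (simp_all add: smooth_def cont_diff_const cont_diff_coord cont_diff_add cont_diff_mult)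

lemma smooth_diff: "smooth f \<Longrightarrow> smooth g \<Longrightarrow> smooth (\<lambda>x. f x - g x)"
  using smooth_add [OF _ smooth_mult [OF smooth_const [of "-1"]]] by fastforce

lemma smooth_imp_C1: "smooth f \<Longrightarrow> cont_diff 1 f"
  by (simp add: smooth_def)

lemma smooth_partial: "smooth f \<Longrightarrow> smooth (partial i f)"
  unfolding smooth_def by (metis cont_diff.simps(2))

lemma C1_differentiable: "cont_diff 1 f \<Longrightarrow> f differentiable (at x)"
  and C1_partial_continuous: "cont_diff 1 f \<Longrightarrow> continuous_on A (partial i f)"
  by (auto intro: continuous_on_subset)

lemma C1_continuous: "cont_diff 1 f \<Longrightarrow> continuous_on A f"
  using cont_diff_Suc_imp [of 0 f] by (auto intro: continuous_on_subset)

lemma C1_measurable: "cont_diff 1 f \<Longrightarrow> f \<in> borel_measurable borel"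
  and C1_partial_measurable: "cont_diff 1 f \<Longrightarrow> partial i f \<in> borel_measurable borel"
  by (intro borel_measurable_continuous_onI C1_continuous C1_partial_continuous, assumption)+

section \<open>Flat functions and smooth bumps\<close>

text \<open>The functions \<open>p (1 / t) exp (- 1 / t)\<close>, extended by zero to \<open>t \<le> 0\<close>: a class closed under
  differentiation.\<close>

definition flat :: "real poly \<Rightarrow> real \<Rightarrow> real" where
  "flat p t = (if t > 0 then poly p (1 / t) * exp (- (1 / t)) else 0)"

lemma poly_exp_tendsto_0: "((\<lambda>x. poly p x * exp (- x)) \<longlongrightarrow> (0::real)) at_top"
proof -
  have "((\<lambda>x. \<Sum>i\<le>degree p. coeff p i * (x ^ i / exp x)) \<longlongrightarrow> (\<Sum>i\<le>degree p. coeff p i * 0)) at_top"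
    by (intro tendsto_intros tendsto_power_div_exp_0)
  then show ?thesis
    by (simp add: poly_altdef sum_distrib_right exp_minus divide_inverse mult.assoc)
qed

text \<open>For t > 0 the chain rule gives (p - p')(1/t) exp(-1/t) / t^2, and the factor 1/t^2 is
  the polynomial X^2 at 1/t. At 0 the difference quotient is (X p)(1/t) exp(-1/t), which tends to 0
  from the right.\<close>

lemma flat_has_derivative:
  "(flat p has_real_derivative flat ([:0, 0, 1:] * (p - pderiv p)) t) (at t)"
proof (cases t "0::real" rule: linorder_cases)
  case less
  have "((\<lambda>t. 0) has_real_derivative flat ([:0, 0, 1:] * (p - pderiv p)) t) (at t)"
    using less by (simp add: flat_def)
  then show ?thesis
    using less by (rule_tac has_field_derivative_transform_within_open [of "\<lambda>t. 0" _ _ "{..<0}"]) (auto simp: flat_def)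
next
  case greater
  have "((\<lambda>t. poly p (1 / t) * exp (- (1 / t))) has_real_derivative flat ([:0, 0, 1:] * (p - pderiv p)) t) (at t)"
    using greater
    by (auto intro!: derivative_eq_intros DERIV_chain2 [OF poly_DERIV] simp: flat_def power2_eq_square field_simps)
  then show ?thesis
    using greater
    by (rule_tac has_field_derivative_transform_within_open [of "\<lambda>t. poly p (1 / t) * exp (- (1 / t))" _ _ "{0<..}"])
       (auto simp: flat_def)
next
  case equal
  have "((\<lambda>h. flat p h / h) \<longlongrightarrow> 0) (at_right 0)"
  proof (rule Lim_transform_eventually)
    have "((\<lambda>h. poly ([:0, 1:] * p) (inverse h) * exp (- (inverse h))) \<longlongrightarrow> 0) (at_right 0)"
      by (rule filterlim_compose [OF poly_exp_tendsto_0 filterlim_inverse_at_top_right])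
    then show "((\<lambda>h. poly ([:0, 1:] * p) (inverse h) * exp (- (inverse h))) \<longlongrightarrow> 0) (at_right 0)" .
    show "\<forall>\<^sub>F h in at_right 0. poly ([:0, 1:] * p) (inverse h) * exp (- (inverse h)) = flat p h / h"
      by (auto simp: eventually_at_right_less flat_def field_simps eventually_at_filter)
  qed
  moreover have "((\<lambda>h. flat p h / h) \<longlongrightarrow> 0) (at_left 0)"
    by (rule tendsto_eventually) (auto simp: eventually_at_filter flat_def)
  ultimately have "((\<lambda>h. flat p h / h) \<longlongrightarrow> 0) (at 0)"
    by (simp add: filterlim_split_at)
  with equal show ?thesis
    by (simp add: DERIV_def flat_def)
qed

lemma smooth_flat: "smooth f \<Longrightarrow> smooth (\<lambda>x. flat p (f x))"
  unfolding smooth_def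
  by (intro allI cont_diff_compose_real [of "range flat" "flat p"]) (use flat_has_derivative in blast)+

text \<open>exp(-1/t) is composed with r^2 - |x - c|^2. That the function is nonzero on exactly the
  open ball is what later makes its integrals over the plane and over a segment strictly
  positive.\<close>

lemma exists_bump:
  fixes c :: "real^2"
  assumes "r > 0"
  obtains \<eta> where "smooth \<eta>" "\<And>x. 0 \<le> \<eta> x" "\<And>x. \<eta> x \<noteq> 0 \<longleftrightarrow> x \<in> ball c r"
proof
  let ?\<eta> = "\<lambda>x. flat 1 (r\<^sup>2 - ((x $ 1 - c $ 1) * (x $ 1 - c $ 1) + (x $ 2 - c $ 2) * (x $ 2 - c $ 2)))"
  show "smooth ?\<eta>"
    by (intro smooth_flat smooth_diff smooth_add smooth_mult smooth_const smooth_coord)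
  show "0 \<le> ?\<eta> x" for x
    by (simp add: flat_def)
  show "?\<eta> x \<noteq> 0 \<longleftrightarrow> x \<in> ball c r" for x
  proof -
    have "?\<eta> x \<noteq> 0 \<longleftrightarrow> (norm (x - c))\<^sup>2 < r\<^sup>2"
      by (simp add: flat_def norm_vec_def L2_set_def sum_2 power2_eq_square)
    also have "\<dots> \<longleftrightarrow> norm (x - c) < r"
      using assms by (intro iffI) (auto intro: power2_less_imp_less power_strict_mono)
    also have "\<dots> \<longleftrightarrow> x \<in> ball c r"
      by (simp add: dist_norm norm_minus_commute)
    finally show ?thesis .
  qed
qed

section \<open>Mollification\<close>

lemma integrable_continuous_compact_support:
  fixes g :: "'a::euclidean_space \<Rightarrow> real"
  assumes "continuous_on UNIV g" "\<And>x. x \<notin> cball c R \<Longrightarrow> g x = 0"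
  shows "integrable lborel g"
proof -
  have "integrable lborel (\<lambda>x. indicator (cball c R) x *\<^sub>R g x)"
    using assms(1) by (intro borel_integrable_compact) (auto intro: continuous_on_subset)
  moreover have "(\<lambda>x. indicator (cball c R) x *\<^sub>R g x) = g"
    using assms(2) by (auto simp: fun_eq_iff indicator_def)
  ultimately show ?thesis
    by simp
qed

lemma bounded_continuous_compact_support:
  fixes g :: "'a::euclidean_space \<Rightarrow> real"
  assumes "continuous_on UNIV g" "\<And>x. x \<notin> cball c R \<Longrightarrow> g x = 0"
  obtains B where "\<And>x. \<bar>g x\<bar> \<le> B" "B \<ge> 0"
proof -
  have "compact (g ` cball c R)"
    using assms(1) by (intro compact_continuous_image) (auto intro: continuous_on_subset)
  then obtain B where "\<And>x. x \<in> cball c R \<Longrightarrow> \<bar>g x\<bar> \<le> B"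
    using compact_imp_bounded bounded_iff by (metis image_eqI real_norm_def)
  then have "\<bar>g x\<bar> \<le> max B 0" for x
    using assms(2) [of x] by (cases "x \<in> cball c R") (auto simp: le_max_iff_disj)
  with that [of "max B 0"] show thesis
    by simp
qed

lemma uniformly_continuous_compact_support:
  fixes g :: "'a::euclidean_space \<Rightarrow> real"
  assumes g: "continuous_on UNIV g" "\<And>x. x \<notin> cball c R \<Longrightarrow> g x = 0"
  shows "uniformly_continuous_on UNIV g"
proof -
  have "uniformly_continuous_on (cball c (R + 1)) g"
    using g(1) by (intro compact_uniformly_continuous) (auto intro: continuous_on_subset)
  then have *: "\<exists>d>0. \<forall>x\<in>cball c (R + 1). \<forall>y\<in>cball c (R + 1). dist y x < d \<longrightarrow> dist (g y) (g x) < e"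
    if "e > 0" for e
    using that by (auto simp: uniformly_continuous_on_def)
  show ?thesis
    unfolding uniformly_continuous_on_def
  proof (intro allI impI)
    fix e :: real assume e: "e > 0"
    obtain d where d: "d > 0" and
      D: "\<And>x y. x \<in> cball c (R + 1) \<Longrightarrow> y \<in> cball c (R + 1) \<Longrightarrow> dist y x < d \<Longrightarrow> dist (g y) (g x) < e"
      using * [OF e] by blast
    have "dist (g y) (g x) < e" if "dist y x < min d 1" for x y
    proof (cases "x \<in> cball c R \<or> y \<in> cball c R")
      case True
      have "dist c y \<le> dist c x + dist y x" "dist c x \<le> dist c y + dist y x"
        by (metis dist_commute dist_triangle)+
      with True that D show ?thesis
        by auto
    qed (use g(2) e in auto)
    with d show "\<exists>d>0. \<forall>x\<in>UNIV. \<forall>y\<in>UNIV. dist y x < d \<longrightarrow> dist (g y) (g x) < e"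
      by (intro exI [of _ "min d 1"]) auto
  qed
qed

lemma partial_compact_support:
  assumes "\<And>x. x \<notin> cball c R \<Longrightarrow> g x = 0" "x \<notin> cball c R"
  shows "partial i g x = 0"
proof -
  have "(g has_derivative (\<lambda>h. 0)) (at x)"
    by (rule has_derivative_transform_within_open [of "\<lambda>x. 0" _ _ _ "- cball c R"])
       (use assms in auto)
  then show ?thesis
    by (simp add: partial_eqI)
qed

lemma normalized_bump:
  fixes c :: "real^2"
  assumes r: "r > 0"
  obtains \<eta> where "smooth \<eta>" "\<And>x. 0 \<le> \<eta> x" "\<And>x. \<eta> x \<noteq> 0 \<longleftrightarrow> x \<in> ball c r"
    "integrable lborel \<eta>" "(LINT x|lborel. \<eta> x) = 1"
proof -
  obtain \<eta> where \<eta>: "smooth \<eta>" "\<And>x. 0 \<le> \<eta> x" "\<And>x. \<eta> x \<noteq> 0 \<longleftrightarrow> x \<in> ball c r"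
    using exists_bump [OF r] by blast
  have cont: "continuous_on UNIV \<eta>"
    using \<eta>(1) C1_continuous smooth_imp_C1 by blast
  have int: "integrable lborel \<eta>"
    using \<eta>(3) ball_subset_cball by (intro integrable_continuous_compact_support [OF cont, of c r]) blast
  define m where "m = (LINT x|lborel. \<eta> x)"
  have "m \<noteq> 0"
  proof
    assume "m = 0"
    then have "AE x in lborel. \<eta> x = 0"
      using integral_nonneg_eq_0_iff_AE [OF int] \<eta>(2) by (auto simp: m_def)
    then have "AE x in lebesgue. \<eta> x = 0"
      by (rule AE_completion)
    then have "negligible {x. \<eta> x \<noteq> 0}"
      by (simp add: eventually_ae_filter_negligible) (metis (mono_tags, lifting) negligible_subset mem_Collect_eq subsetI)
    moreover have "{x. \<eta> x \<noteq> 0} = ball c r"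
      using \<eta>(3) by blast
    ultimately show False
      using r open_not_negligible [of "ball c r"] by auto
  qed
  moreover have "m \<ge> 0"
    unfolding m_def using \<eta>(2) by simp
  ultimately have m: "m > 0"
    by simp
  show thesis
  proof (rule that [of "\<lambda>x. inverse m * \<eta> x"])
    show "smooth (\<lambda>x. inverse m * \<eta> x)"
      by (intro smooth_mult smooth_const \<eta>)
  qed (use m \<eta> int in \<open>auto simp: m_def\<close>)
qed

section \<open>Mollified functions, their derivatives and their norms\<close>

lemma C1_line_derivative:
  assumes "cont_diff 1 f"
  shows "((\<lambda>t. f (w + t *\<^sub>R k)) has_real_derivative
    (k $ 1 * partial 1 f (w + t *\<^sub>R k) + k $ 2 * partial 2 f (w + t *\<^sub>R k))) (at t)"
proof -
  have "((\<lambda>t. w + t *\<^sub>R k) has_derivative (\<lambda>t. t *\<^sub>R k)) (at t)"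
    by (auto intro!: derivative_eq_intros)
  from has_derivative_compose [OF this has_derivative_partials [OF C1_differentiable [OF assms]]]
  show ?thesis
    by (auto intro: has_derivative_eq_rhs simp: has_field_derivative_def algebra_simps fun_eq_iff)
qed

lemma C1_mean_value:
  assumes "cont_diff 1 f"
  obtains t where "0 < t" "t < (1::real)"
    "f (w + k) - f w = k $ 1 * partial 1 f (w + t *\<^sub>R k) + k $ 2 * partial 2 f (w + t *\<^sub>R k)"
  using MVT2 [of 0 1 "\<lambda>t. f (w + t *\<^sub>R k)"
      "\<lambda>t. k $ 1 * partial 1 f (w + t *\<^sub>R k) + k $ 2 * partial 2 f (w + t *\<^sub>R k)"]
    C1_line_derivative [OF assms] that by auto

text \<open>For s = 1 this is convolution with a reflected kernel. With s < 1 the average is taken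
  near the contracted point s x, so that on a convex domain only values of f inside the domain
  enter, even for x close to the boundary. The value s = -1 produces translates of an
  integral.\<close>

definition mollify :: "real \<Rightarrow> (real^2 \<Rightarrow> real) \<Rightarrow> (real^2 \<Rightarrow> real) \<Rightarrow> real^2 \<Rightarrow> real" where
  "mollify s \<eta> f x = (LINT y|lborel. f y * \<eta> (y - s *\<^sub>R x))"

lemma integrable_mult_bounded_continuous:
  fixes f g :: "real^2 \<Rightarrow> real"
  assumes f: "integrable lborel f" and g: "continuous_on UNIV g" "\<And>x. \<bar>g x\<bar> \<le> B"
  shows "integrable lborel (\<lambda>x. f x * g x)"
proof (rule Bochner_Integration.integrable_bound)
  show "integrable lborel (\<lambda>x. B * f x)"
    using f by simp
  show "(\<lambda>x. f x * g x) \<in> borel_measurable lborel"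
    using f borel_measurable_continuous_onI [OF g(1)] by auto
  show "AE x in lborel. norm (f x * g x) \<le> norm (B * f x)"
  proof (rule AE_I2)
    fix x
    have "\<bar>g x\<bar> * \<bar>f x\<bar> \<le> \<bar>B\<bar> * \<bar>f x\<bar>"
      using order_trans [OF g(2) abs_ge_self] by (rule mult_right_mono) simp
    then show "norm (f x * g x) \<le> norm (B * f x)"
      by (simp add: abs_mult mult.commute)
  qed
qed

lemma mollify_integrable:
  fixes f \<eta> :: "real^2 \<Rightarrow> real"
  assumes f: "integrable lborel f" and \<eta>: "continuous_on UNIV \<eta>" "\<And>x. x \<notin> cball c R \<Longrightarrow> \<eta> x = 0"
  shows "integrable lborel (\<lambda>y. f y * \<eta> (y - s *\<^sub>R x))"
proof -
  obtain B where "\<And>x. \<bar>\<eta> x\<bar> \<le> B"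
    using bounded_continuous_compact_support [OF \<eta>] by blast
  then show ?thesis
    by (intro integrable_mult_bounded_continuous [OF f, where B=B] continuous_on_compose2 [OF \<eta>(1)])
       (auto intro!: continuous_intros)
qed

text \<open>Differentiation under the integral sign with f merely integrable: the partial
  derivatives of the kernel are uniformly continuous, so its first-order Taylor remainder is small
  uniformly in the base point and can be integrated against |f|.\<close>

lemma mollify_has_derivative:
  assumes f: "integrable lborel f" and \<eta>: "cont_diff 1 \<eta>" "\<And>x. x \<notin> cball c R \<Longrightarrow> \<eta> x = 0"
  shows "(mollify s \<eta> f has_derivative
    (\<lambda>h. h $ 1 * (- s * mollify s (partial 1 \<eta>) f x) + h $ 2 * (- s * mollify s (partial 2 \<eta>) f x))) (at x)"
  unfolding has_derivative_at_alt
proof (intro conjI allI impI)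
  show "bounded_linear (\<lambda>h::real^2. h $ 1 * (- s * mollify s (partial 1 \<eta>) f x) + h $ 2 * (- s * mollify s (partial 2 \<eta>) f x))"
    by (intro bounded_linear_add bounded_linear_mult_left bounded_linear_compose [OF bounded_linear_mult_left bounded_linear_vec_nth])
next
  fix e :: real assume e: "e > 0"
  define N where "N = (LINT y|lborel. \<bar>f y\<bar>)"
  have N: "N \<ge> 0"
    by (simp add: N_def)
  \<comment> \<open>The Taylor remainder is at most 2 e' |k| with |k| = |s| |y - x|, and integration
    against |f| contributes N. The summand 1 keeps the denominator positive.\<close>
  define e' where "e' = e / (2 * \<bar>s\<bar> * N + 1)"
  have e': "e' > 0"
    using e N by (simp add: e'_def add_nonneg_pos)
  have cont: "continuous_on UNIV (partial i \<eta>)" for i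
    using C1_partial_continuous [OF \<eta>(1)] .
  have supp: "x \<notin> cball c R \<Longrightarrow> partial i \<eta> x = 0" for i x
    using partial_compact_support [of c R \<eta>] \<eta>(2) by blast
  have "\<exists>d>0. \<forall>w v. dist v w < d \<longrightarrow> \<bar>partial i \<eta> v - partial i \<eta> w\<bar> < e'" for i
    using uniformly_continuous_compact_support [OF cont [of i] supp] e'
    by (simp add: uniformly_continuous_on_def dist_real_def)
  then obtain d where d: "\<And>i. d i > 0" "\<And>i v w. dist v w < d i \<Longrightarrow> \<bar>partial i \<eta> v - partial i \<eta> w\<bar> < e'"
    by metis
  define \<delta> where "\<delta> = min (d 1) (d 2) / (\<bar>s\<bar> + 1)"
  have \<delta>: "\<delta> > 0"
    using d by (simp add: \<delta>_def add_nonneg_pos)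
  have taylor: "\<bar>\<eta> (w + k) - \<eta> w - (k $ 1 * partial 1 \<eta> w + k $ 2 * partial 2 \<eta> w)\<bar> \<le> 2 * e' * norm k"
    if k: "norm k < min (d 1) (d 2)" for w k :: "real^2"
  proof -
    obtain t where t: "0 < t" "t < 1" and eq:
      "\<eta> (w + k) - \<eta> w = k $ 1 * partial 1 \<eta> (w + t *\<^sub>R k) + k $ 2 * partial 2 \<eta> (w + t *\<^sub>R k)"
      using C1_mean_value [OF \<eta>(1)] by blast
    have "dist (w + t *\<^sub>R k) w \<le> norm k"
      using t by (simp add: dist_norm mult_left_le_one_le)
    then have *: "\<bar>partial i \<eta> (w + t *\<^sub>R k) - partial i \<eta> w\<bar> \<le> e'" if "i = 1 \<or> i = 2" for i
      using d(2) [of "w + t *\<^sub>R k" w i] k that by fastforce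
    have "\<bar>k $ i * (partial i \<eta> (w + t *\<^sub>R k) - partial i \<eta> w)\<bar> \<le> norm k * e'" if "i = 1 \<or> i = 2" for i
      unfolding abs_mult using * [OF that] component_le_norm_cart by (intro mult_mono) auto
    from this [of 1] this [of 2] show ?thesis
      unfolding eq by (simp add: algebra_simps) 
  qed
  show "\<exists>d>0. \<forall>y. norm (y - x) < d \<longrightarrow> norm (mollify s \<eta> f y - mollify s \<eta> f x
      - ((y - x) $ 1 * (- s * mollify s (partial 1 \<eta>) f x) + (y - x) $ 2 * (- s * mollify s (partial 2 \<eta>) f x)))
      \<le> e * norm (y - x)"
  proof (intro exI [of _ \<delta>] conjI \<delta> allI impI)
    fix y assume y: "norm (y - x) < \<delta>"
    define k where "k = - s *\<^sub>R (y - x)"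
    have nk: "norm k = \<bar>s\<bar> * norm (y - x)"
      unfolding k_def by (simp only: norm_scaleR abs_minus_cancel)
    have "\<bar>s\<bar> * norm (y - x) \<le> (\<bar>s\<bar> + 1) * norm (y - x)"
      by (simp add: mult_right_mono)
    also have "\<dots> < (\<bar>s\<bar> + 1) * \<delta>"
      using y by (intro mult_strict_left_mono) auto
    also have "\<dots> = min (d 1) (d 2)"
      unfolding \<delta>_def by (simp add: add_nonneg_pos less_imp_neq [symmetric])
    finally have k: "norm k < min (d 1) (d 2)"
      using nk by simp
    have ints: "integrable lborel (\<lambda>z. f z * \<eta> (z - s *\<^sub>R v))"
      "integrable lborel (\<lambda>z. f z * partial i \<eta> (z - s *\<^sub>R v))" for v i
      using mollify_integrable [OF f C1_continuous [OF \<eta>(1)] \<eta>(2)]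
        mollify_integrable [OF f cont supp] by auto
    let ?R = "\<lambda>z. \<eta> (z - s *\<^sub>R x + k) - \<eta> (z - s *\<^sub>R x)
      - (k $ 1 * partial 1 \<eta> (z - s *\<^sub>R x) + k $ 2 * partial 2 \<eta> (z - s *\<^sub>R x))"
    have sy: "z - s *\<^sub>R y = z - s *\<^sub>R x + k" for z
      by (simp add: k_def algebra_simps)
    have R: "f z * ?R z = f z * \<eta> (z - s *\<^sub>R y) - f z * \<eta> (z - s *\<^sub>R x)
      - (k $ 1 * (f z * partial 1 \<eta> (z - s *\<^sub>R x)) + k $ 2 * (f z * partial 2 \<eta> (z - s *\<^sub>R x)))" for z
      unfolding sy by (simp add: algebra_simps)
    have intR: "integrable lborel (\<lambda>z. f z * ?R z)"
      unfolding R using ints by (intro Bochner_Integration.integrable_diff Bochner_Integration.integrable_add integrable_mult_right) auto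
    have "mollify s \<eta> f y - mollify s \<eta> f x
      - ((y - x) $ 1 * (- s * mollify s (partial 1 \<eta>) f x) + (y - x) $ 2 * (- s * mollify s (partial 2 \<eta>) f x))
      = (LINT z|lborel. f z * ?R z)"
      unfolding R using ints by (simp add: mollify_def k_def)
    also have "norm \<dots> \<le> (LINT z|lborel. \<bar>f z\<bar> * (2 * e' * norm k))"
    proof (rule Bochner_Integration.integral_norm_bound_integral [OF intR])
      show "integrable lborel (\<lambda>z. \<bar>f z\<bar> * (2 * e' * norm k))"
        using f by simp
      show "norm (f z * ?R z) \<le> \<bar>f z\<bar> * (2 * e' * norm k)" for z
        using taylor [OF k] by (simp add: abs_mult mult_left_mono)
    qed
    also have "\<dots> = (e' * (2 * \<bar>s\<bar> * N)) * norm (y - x)"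
      by (simp add: nk N_def)
    also have "\<dots> \<le> e * norm (y - x)"
    proof (rule mult_right_mono)
      have "e' * (2 * \<bar>s\<bar> * N) \<le> e' * (2 * \<bar>s\<bar> * N + 1)"
        using e' by simp
      also have "\<dots> = e"
        unfolding e'_def using N by (simp add: add_nonneg_pos less_imp_neq [symmetric])
      finally show "e' * (2 * \<bar>s\<bar> * N) \<le> e" .
    qed simp
    finally show "norm (mollify s \<eta> f y - mollify s \<eta> f x
      - ((y - x) $ 1 * (- s * mollify s (partial 1 \<eta>) f x) + (y - x) $ 2 * (- s * mollify s (partial 2 \<eta>) f x)))
      \<le> e * norm (y - x)" .
  qed
qed

lemma partial_mollify:
  assumes f: "integrable lborel f" and \<eta>: "cont_diff 1 \<eta>" "\<And>x. x \<notin> cball c R \<Longrightarrow> \<eta> x = 0"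
  shows "partial i (mollify s \<eta> f) = (\<lambda>x. - s * mollify s (partial i \<eta>) f x)"
  using partial_eqI [OF mollify_has_derivative [OF f \<eta>]] exhaust_2 [of i] by (auto simp: axis_def)

lemma smooth_mollify:
  assumes f: "integrable lborel f" and \<eta>: "smooth \<eta>" "\<And>x. x \<notin> cball c R \<Longrightarrow> \<eta> x = 0"
  shows "smooth (mollify s \<eta> f)"
proof -
  have "cont_diff k (mollify s \<eta> f)" for k
    using \<eta>
  proof (induction k arbitrary: \<eta>)
    case (0 \<eta>)
    then have "mollify s \<eta> f differentiable (at x)" for x
      using mollify_has_derivative [OF f smooth_imp_C1] unfolding differentiable_def by blast
    then show ?case
      by (simp add: continuous_at_imp_continuous_on differentiable_imp_continuous_within)
  next
    case (Suc k \<eta>)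
    have "mollify s \<eta> f differentiable (at x)" for x
      using mollify_has_derivative [OF f smooth_imp_C1 [OF Suc.prems(1)] Suc.prems(2)]
      unfolding differentiable_def by blast
    moreover have "cont_diff k (mollify s (partial i \<eta>) f)" for i
      using Suc.prems partial_compact_support [of c R \<eta>] by (intro Suc.IH smooth_partial) blast+
    ultimately show ?case
      using partial_mollify [OF f smooth_imp_C1 [OF Suc.prems(1)] Suc.prems(2)]
      by (simp add: cont_diff_mult [OF cont_diff_const [of _ "- s"], simplified])
  qed
  then show ?thesis
    by (simp add: smooth_def)
qed

lemma mollify_diff:
  assumes "integrable lborel f" "integrable lborel g" "continuous_on UNIV \<eta>" "\<And>x. x \<notin> cball c R \<Longrightarrow> \<eta> x = 0"
  shows "mollify s \<eta> (\<lambda>x. f x - g x) x = mollify s \<eta> f x - mollify s \<eta> g x"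
  unfolding mollify_def
  using mollify_integrable [OF assms(1,3,4)] mollify_integrable [OF assms(2,3,4)]
  by (simp add: left_diff_distrib)

lemma nn_integral_affine_lborel:
  fixes g :: "real^2 \<Rightarrow> ennreal"
  assumes [measurable]: "g \<in> borel_measurable borel" and "c \<noteq> 0"
  shows "(\<integral>\<^sup>+x. g x \<partial>lborel) = ennreal (c\<^sup>2) * (\<integral>\<^sup>+x. g (t + c *\<^sub>R x) \<partial>lborel)"
proof -
  have "(\<integral>\<^sup>+x. g x \<partial>lborel) = (\<integral>\<^sup>+x. g x \<partial>(density (distr lborel borel (\<lambda>x. t + c *\<^sub>R x)) (\<lambda>_. \<bar>c\<bar>^DIM(real^2))))"
    using lborel_affine [OF \<open>c \<noteq> 0\<close>, of t] by simp
  also have "\<dots> = (\<integral>\<^sup>+x. ennreal (c\<^sup>2) * g x \<partial>distr lborel borel (\<lambda>x. t + c *\<^sub>R x))"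
    by (subst nn_integral_density) auto
  also have "\<dots> = ennreal (c\<^sup>2) * (\<integral>\<^sup>+x. g (t + c *\<^sub>R x) \<partial>lborel)"
    by (subst nn_integral_distr) (auto simp: nn_integral_cmult)
  finally show ?thesis .
qed

lemma integral_lborel_shift:
  fixes f :: "real^2 \<Rightarrow> real"
  assumes f: "integrable lborel f"
  shows "integrable lborel (\<lambda>y. f (y - v))" "(LINT y|lborel. f (y - v)) = (LINT y|lborel. f y)"
proof -
  have "integrable (distr lborel borel ((+) (- v))) f"
    using f by (simp add: lborel_distr_plus)
  then show "integrable lborel (\<lambda>y. f (y - v))"
    by (subst (asm) integrable_distr_eq) (use f in auto)
  have "(LINT y|distr lborel borel ((+) (- v)). f y) = (LINT y|lborel. f (y - v))"
    by (subst integral_distr) (use f in auto)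
  then show "(LINT y|lborel. f (y - v)) = (LINT y|lborel. f y)"
    by (simp add: lborel_distr_plus)
qed

text \<open>For fixed x the kernel is a probability density in y, so Jensen's inequality bounds the
  square of the average by the average of the squares. By Tonelli, integrating the kernel in x then
  gives 1/s^2, the Jacobian of a dilation in the plane.\<close>

lemma mollify_L2_bound:
  assumes f: "integrable lborel f" "integrable lborel (\<lambda>x. (f x)\<^sup>2)"
    and \<eta>: "continuous_on UNIV \<eta>" "\<And>x. x \<notin> cball c R \<Longrightarrow> \<eta> x = 0" "\<And>x. 0 \<le> \<eta> x" "(LINT x|lborel. \<eta> x) = 1"
    and s: "s \<noteq> 0"
  shows "(\<integral>\<^sup>+x. ennreal ((mollify s \<eta> f x)\<^sup>2) \<partial>lborel) \<le> ennreal (1 / s\<^sup>2) * (\<integral>\<^sup>+x. ennreal ((f x)\<^sup>2) \<partial>lborel)"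
proof -
  have [measurable]: "\<eta> \<in> borel_measurable borel" "f \<in> borel_measurable borel"
    using \<eta>(1) f(1) by (auto intro: borel_measurable_continuous_onI)
  have int\<eta>: "integrable lborel \<eta>"
    using integrable_continuous_compact_support [OF \<eta>(1,2)] .
  have int\<eta>_shift: "integrable lborel (\<lambda>y. \<eta> (y - v))" "(LINT y|lborel. \<eta> (y - v)) = 1" for v
    using integral_lborel_shift [OF int\<eta>, of v] \<eta>(4) by auto
  have jensen: "(mollify s \<eta> f x)\<^sup>2 \<le> (LINT y|lborel. (f y)\<^sup>2 * \<eta> (y - s *\<^sub>R x))" for x
  proof -
    let ?m = "mollify s \<eta> f x"
    have ints: "integrable lborel (\<lambda>y. f y * \<eta> (y - s *\<^sub>R x))" "integrable lborel (\<lambda>y. (f y)\<^sup>2 * \<eta> (y - s *\<^sub>R x))"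
      using mollify_integrable [OF _ \<eta>(1,2)] f by blast+
    have "0 \<le> (LINT y|lborel. (f y - ?m)\<^sup>2 * \<eta> (y - s *\<^sub>R x))"
      using \<eta>(3) by simp
    also have "\<dots> = (LINT y|lborel. (f y)\<^sup>2 * \<eta> (y - s *\<^sub>R x) - 2 * ?m * (f y * \<eta> (y - s *\<^sub>R x)) + ?m\<^sup>2 * \<eta> (y - s *\<^sub>R x))"
      by (intro Bochner_Integration.integral_cong) (auto simp: power2_eq_square algebra_simps)
    also have "\<dots> = (LINT y|lborel. (f y)\<^sup>2 * \<eta> (y - s *\<^sub>R x)) - 2 * ?m * ?m + ?m\<^sup>2"
      using ints int\<eta>_shift by (simp add: mollify_def)
    finally show ?thesis
      by (simp add: power2_eq_square)
  qed
  have "(\<integral>\<^sup>+x. ennreal ((mollify s \<eta> f x)\<^sup>2) \<partial>lborel)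
      \<le> (\<integral>\<^sup>+x. (\<integral>\<^sup>+y. ennreal ((f y)\<^sup>2 * \<eta> (y - s *\<^sub>R x)) \<partial>lborel) \<partial>lborel)"
  proof (rule nn_integral_mono)
    fix x
    have "integrable lborel (\<lambda>y. (f y)\<^sup>2 * \<eta> (y - s *\<^sub>R x))"
      using mollify_integrable [OF f(2) \<eta>(1,2)] .
    then have "(\<integral>\<^sup>+y. ennreal ((f y)\<^sup>2 * \<eta> (y - s *\<^sub>R x)) \<partial>lborel) = ennreal (LINT y|lborel. (f y)\<^sup>2 * \<eta> (y - s *\<^sub>R x))"
      using \<eta>(3) by (intro nn_integral_eq_integral) auto
    then show "ennreal ((mollify s \<eta> f x)\<^sup>2) \<le> (\<integral>\<^sup>+y. ennreal ((f y)\<^sup>2 * \<eta> (y - s *\<^sub>R x)) \<partial>lborel)"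
      using jensen [of x] by (simp add: ennreal_leI)
  qed
  also have "\<dots> = (\<integral>\<^sup>+y. (\<integral>\<^sup>+x. ennreal ((f y)\<^sup>2 * \<eta> (y - s *\<^sub>R x)) \<partial>lborel) \<partial>lborel)"
    by (rule lborel_pair.Fubini') measurable
  also have "\<dots> = (\<integral>\<^sup>+y. ennreal (1 / s\<^sup>2) * ennreal ((f y)\<^sup>2) \<partial>lborel)"
  proof (rule nn_integral_cong)
    fix y
    have "1 = (\<integral>\<^sup>+x. ennreal (\<eta> x) \<partial>lborel)"
      using nn_integral_eq_integral [OF int\<eta>] \<eta>(3,4) by simp
    also have "\<dots> = ennreal (s\<^sup>2) * (\<integral>\<^sup>+x. ennreal (\<eta> (y - s *\<^sub>R x)) \<partial>lborel)"
      using nn_integral_affine_lborel [of "\<lambda>x. ennreal (\<eta> x)" "- s" y] s by simp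
    finally have *: "ennreal (s\<^sup>2) * (\<integral>\<^sup>+x. ennreal (\<eta> (y - s *\<^sub>R x)) \<partial>lborel) = 1" by simp
    have "(\<integral>\<^sup>+x. ennreal (\<eta> (y - s *\<^sub>R x)) \<partial>lborel) = ennreal (1 / s\<^sup>2) * (ennreal (s\<^sup>2) * (\<integral>\<^sup>+x. ennreal (\<eta> (y - s *\<^sub>R x)) \<partial>lborel))"
      using s by (simp add: mult.assoc [symmetric] ennreal_mult' [symmetric])
    then have "(\<integral>\<^sup>+x. ennreal (\<eta> (y - s *\<^sub>R x)) \<partial>lborel) = ennreal (1 / s\<^sup>2)"
      using * by simp
    then show "(\<integral>\<^sup>+x. ennreal ((f y)\<^sup>2 * \<eta> (y - s *\<^sub>R x)) \<partial>lborel) = ennreal (1 / s\<^sup>2) * ennreal ((f y)\<^sup>2)"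
      using \<eta>(3) by (simp add: ennreal_mult nn_integral_cmult mult.commute)
  qed
  also have "\<dots> = ennreal (1 / s\<^sup>2) * (\<integral>\<^sup>+x. ennreal ((f x)\<^sup>2) \<partial>lborel)"
    by (rule nn_integral_cmult) measurable
  finally show ?thesis .
qed

lemma mollify_close:
  assumes g: "integrable lborel g"
    and \<eta>: "continuous_on UNIV \<eta>" "\<And>x. x \<notin> cball c R \<Longrightarrow> \<eta> x = 0" "\<And>x. 0 \<le> \<eta> x" "(LINT x|lborel. \<eta> x) = 1"
    and close: "\<And>y. \<eta> (y - s *\<^sub>R x) \<noteq> 0 \<Longrightarrow> \<bar>g y - g x\<bar> \<le> e"
  shows "\<bar>mollify s \<eta> g x - g x\<bar> \<le> e"
proof -
  have int\<eta>: "integrable lborel (\<lambda>y. \<eta> (y - s *\<^sub>R x))" "(LINT y|lborel. \<eta> (y - s *\<^sub>R x)) = 1"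
    using integral_lborel_shift [OF integrable_continuous_compact_support [OF \<eta>(1,2)]] \<eta>(4) by auto
  have ints: "integrable lborel (\<lambda>y. g y * \<eta> (y - s *\<^sub>R x))"
    using mollify_integrable [OF g \<eta>(1,2)] .
  have "mollify s \<eta> g x - g x = (LINT y|lborel. g y * \<eta> (y - s *\<^sub>R x) - g x * \<eta> (y - s *\<^sub>R x))"
    using ints int\<eta> by (simp add: mollify_def)
  also have "norm \<dots> \<le> (LINT y|lborel. e * \<eta> (y - s *\<^sub>R x))"
  proof (rule Bochner_Integration.integral_norm_bound_integral)
    show "norm (g y * \<eta> (y - s *\<^sub>R x) - g x * \<eta> (y - s *\<^sub>R x)) \<le> e * \<eta> (y - s *\<^sub>R x)" for y
    proof (cases "\<eta> (y - s *\<^sub>R x) = 0")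
      case False
      have "\<bar>g y - g x\<bar> * \<eta> (y - s *\<^sub>R x) \<le> e * \<eta> (y - s *\<^sub>R x)"
        using close [OF False] \<eta>(3) by (rule mult_right_mono)
      then show ?thesis
        using \<eta>(3) by (simp add: left_diff_distrib [symmetric] abs_mult)
    qed simp
  qed (use ints int\<eta> in auto)
  also have "\<dots> = e"
    using int\<eta> by simp
  finally show ?thesis
    by simp
qed

section \<open>Approximation in L^2 by continuous functions and by mollification\<close>

definition clip :: "real \<Rightarrow> real \<Rightarrow> real" where
  "clip k t = max (- k) (min k t)"

definition cutoff :: "real \<Rightarrow> real^2 \<Rightarrow> real" where
  "cutoff k x = max 0 (min 1 (k + 1 - norm x))"

lemma tendsto_0_eventually_less:
  fixes X :: "nat \<Rightarrow> real"
  assumes "X \<longlonglongrightarrow> 0" "0 < e"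
  obtains N where "\<And>n. n \<ge> N \<Longrightarrow> X n < e"
  using order_tendstoD(2) [OF assms] by (auto simp: eventually_sequentially)

lemma L2_tendsto_dominated:
  fixes f :: "'a \<Rightarrow> real" and F :: "nat \<Rightarrow> 'a \<Rightarrow> real"
  assumes f: "f \<in> borel_measurable M" and F: "\<And>n. F n \<in> borel_measurable M"
    and lim: "AE x in M. (\<lambda>n. F n x) \<longlonglongrightarrow> f x"
    and w: "w \<in> L2 M" and bound: "\<And>n x. \<bar>f x - F n x\<bar> \<le> w x"
  shows "(\<lambda>n. L2_norm M (\<lambda>x. f x - F n x)) \<longlonglongrightarrow> 0"
proof -
  have "(\<lambda>n. LINT x|M. (f x - F n x)\<^sup>2) \<longlonglongrightarrow> (LINT x|M. 0)"
  proof (rule integral_dominated_convergence [where w="\<lambda>x. (w x)\<^sup>2"])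
    show "integrable M (\<lambda>x. (w x)\<^sup>2)"
      using w by (simp add: L2_real_iff)
    show "AE x in M. (\<lambda>n. (f x - F n x)\<^sup>2) \<longlonglongrightarrow> 0"
      using lim by eventually_elim (auto intro!: tendsto_eq_intros)
    show "AE x in M. norm ((f x - F n x)\<^sup>2) \<le> (w x)\<^sup>2" for n
      using bound by (intro AE_I2) (metis abs_le_square_iff abs_of_nonneg abs_power2 abs_ge_zero order_trans real_norm_def)
  qed (use f F in measurable)
  then show ?thesis
    unfolding L2_norm_real by (auto intro!: tendsto_eq_intros)
qed

text \<open>Clipping the values and cutting off in space makes f bounded with bounded support. A
  measurable function is an almost everywhere limit of continuous functions; these undergo the same
  two truncations, so that dominated convergence gives convergence in L^2.\<close>

lemma L2_continuous_dense:
  fixes f :: "real^2 \<Rightarrow> real"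
  assumes f: "f \<in> L2 lborel" and e: "e > 0"
  obtains g R where "continuous_on UNIV g" "\<And>x. x \<notin> cball 0 R \<Longrightarrow> g x = 0"
    "L2_norm lborel (\<lambda>x. f x - g x) < e"
proof -
  have [measurable]: "f \<in> borel_measurable borel"
    using f by (simp add: L2_real_iff)
  define h where "h k x = clip k (f x) * cutoff k x" for k x
  have cont_cut: "continuous_on UNIV (cutoff k)" for k
    unfolding cutoff_def by (intro continuous_intros)
  have [measurable]: "cutoff k \<in> borel_measurable borel" for k
    using cont_cut by (rule borel_measurable_continuous_onI)
  have [measurable]: "h k \<in> borel_measurable borel" for k
    unfolding h_def clip_def by measurable
  have cut: "0 \<le> cutoff k x" "cutoff k x \<le> 1" for k x
    by (auto simp: cutoff_def)
  have "(\<lambda>k. L2_norm lborel (\<lambda>x. f x - h (real k) x)) \<longlonglongrightarrow> 0"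
  proof (rule L2_tendsto_dominated)
    show "AE x in lborel. (\<lambda>k. h (real k) x) \<longlonglongrightarrow> f x"
    proof (rule AE_I2)
      fix x
      have "\<forall>\<^sub>F k in sequentially. h (real k) x = f x"
        using eventually_ge_at_top [of "nat \<lceil>max \<bar>f x\<bar> (norm x)\<rceil>"]
        by eventually_elim (auto simp: h_def clip_def cutoff_def nat_le_iff ceiling_le_iff)
      then show "(\<lambda>k. h (real k) x) \<longlonglongrightarrow> f x"
        by (rule tendsto_eventually)
    qed
    show "(\<lambda>x. 1 * \<bar>f x\<bar>) \<in> L2 lborel"
      using f by (auto simp: L2_real_iff)
    show "\<bar>f x - h (real k) x\<bar> \<le> 1 * \<bar>f x\<bar>" for k x
    proof (cases "f x \<ge> 0")
      case True
      then have "0 \<le> clip k (f x)" "clip k (f x) \<le> f x"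
        by (auto simp: clip_def)
      then have "0 \<le> h k x" "h k x \<le> f x"
        using cut [of k x] mult_left_le [of "cutoff k x" "clip k (f x)"] by (auto simp: h_def)
      then show ?thesis
        by simp
    next
      case False
      then have "clip k (f x) \<le> 0" "f x \<le> clip k (f x)"
        by (auto simp: clip_def)
      then have "h k x \<le> 0" "f x \<le> h k x"
        using cut [of k x] mult_left_le [of "cutoff k x" "- clip k (f x)"] by (auto simp: h_def mult_le_0_iff)
      then show ?thesis
        by simp
    qed
  qed measurable
  from tendsto_0_eventually_less [OF this half_gt_zero [OF e]]
  obtain k :: nat where k: "L2_norm lborel (\<lambda>x. f x - h (real k) x) < e / 2"
    by blast
  have "f \<in> borel_measurable lebesgue"
    by (simp add: measurable_completion)
  then have "f measurable_on UNIV"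
    using lebesgue_measurable_imp_measurable_on [of f UNIV] by simp
  then obtain N g where N: "negligible N" and g: "\<And>n. continuous_on UNIV (g n)"
    and lim: "\<And>x. x \<notin> N \<Longrightarrow> (\<lambda>n. g n x) \<longlonglongrightarrow> f x"
    unfolding measurable_on_def by auto
  define G where "G n x = clip k (g n x) * cutoff k x" for n x
  have contG: "continuous_on UNIV (G n)" for n
    unfolding G_def clip_def using g cont_cut by (intro continuous_intros) auto
  have clipb: "\<bar>clip k t\<bar> \<le> k" for t
    by (auto simp: clip_def)
  have "(\<lambda>n. L2_norm lborel (\<lambda>x. h k x - G n x)) \<longlonglongrightarrow> 0"
  proof (rule L2_tendsto_dominated)
    show "G n \<in> borel_measurable lborel" for n
      using borel_measurable_continuous_onI [OF contG] by simp
    have "AE x in lebesgue. x \<notin> N"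
      using N by (simp add: AE_not_in negligible_iff_null_sets)
    then have "AE x in lborel. x \<notin> N"
      by (simp add: AE_completion_iff)
    then show "AE x in lborel. (\<lambda>n. G n x) \<longlonglongrightarrow> h k x"
      unfolding G_def h_def clip_def by eventually_elim (intro tendsto_intros lim)
    show "(\<lambda>x::real^2. 2 * real k * indicator (cball 0 (real k + 1)) x) \<in> L2 lborel"
    proof (rule L2_cmult)
      have "(\<lambda>x::real^2. (indicator (cball 0 (real k + 1)) x)\<^sup>2 :: real) = indicator (cball 0 (real k + 1))"
        by (auto simp: fun_eq_iff indicator_def)
      then show "(indicator (cball 0 (real k + 1)) :: real^2 \<Rightarrow> real) \<in> L2 lborel"
        using integrable_real_indicator [of "cball 0 (real k + 1)" "lborel :: (real^2) measure"]
          emeasure_bounded_finite [OF bounded_cball, of "0::real^2" "real k + 1"]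
        by (simp add: L2_real_iff borel_measurable_indicator)
    qed
    show "\<bar>h k x - G n x\<bar> \<le> 2 * real k * indicator (cball 0 (real k + 1)) x" for n x
    proof (cases "x \<in> cball 0 (real k + 1)")
      case True
      have "\<bar>clip k t\<bar> * \<bar>cutoff k x\<bar> \<le> real k * 1" for t
        using clipb cut [of k x] by (intro mult_mono) auto
      from this [of "f x"] this [of "g n x"] have "\<bar>h k x\<bar> \<le> real k" "\<bar>G n x\<bar> \<le> real k"
        by (simp_all add: h_def G_def abs_mult)
      with True show ?thesis
        by simp
    qed (simp add: h_def G_def cutoff_def)
  qed measurable
  from tendsto_0_eventually_less [OF this half_gt_zero [OF e]]
  obtain n where n: "L2_norm lborel (\<lambda>x. h k x - G n x) < e / 2"
    by blast
  have suppG: "x \<notin> cball 0 (real k + 1) \<Longrightarrow> G n x = 0" for x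
    by (simp add: G_def cutoff_def)
  have "G n \<in> L2 lborel"
    unfolding L2_real_iff
  proof
    show "integrable lborel (\<lambda>x. (G n x)\<^sup>2)"
      by (rule integrable_continuous_compact_support [of _ 0 "real k + 1"])
         (use contG suppG in \<open>auto intro!: continuous_intros\<close>)
  qed (use borel_measurable_continuous_onI [OF contG] in simp)
  moreover have "h k \<in> L2 lborel"
  proof -
    have "(h k x)\<^sup>2 \<le> (f x)\<^sup>2" for x
    proof -
      have "\<bar>clip k (f x)\<bar> * \<bar>cutoff k x\<bar> \<le> \<bar>f x\<bar> * 1"
        using cut [of k x] by (intro mult_mono) (auto simp: clip_def)
      then have "\<bar>h k x\<bar> \<le> \<bar>f x\<bar>"
        by (simp add: h_def abs_mult)
      then show ?thesis
        by (rule abs_le_square_iff [THEN iffD1])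
    qed
    then have "integrable lborel (\<lambda>x. (h k x)\<^sup>2)"
      using f by (rule_tac Bochner_Integration.integrable_bound [of lborel "\<lambda>x. (f x)\<^sup>2"]) (auto simp: L2_real_iff)
    then show ?thesis
      by (simp add: L2_real_iff)
  qed
  ultimately have "L2_norm lborel (\<lambda>x. f x - G n x) < e"
    using L2_norm_diff_triangle [OF f, of "h k" "G n"] k n by simp
  with contG suppG show thesis
    using that by blast
qed

lemma LINT_lebesgue_on_borel:
  fixes f :: "'a::euclidean_space \<Rightarrow> real"
  assumes "f \<in> borel_measurable borel" "S \<in> sets borel"
  shows "(LINT x|lebesgue_on S. f x) = (LINT x|lborel. indicator S x * f x)"
    "integrable (lebesgue_on S) f \<longleftrightarrow> integrable lborel (\<lambda>x. indicator S x * f x)"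
proof -
  have [measurable]: "f \<in> borel_measurable borel" "S \<in> sets borel"
    using assms by auto
  have S: "S \<in> sets lebesgue"
    using assms(2) by auto
  show "(LINT x|lebesgue_on S. f x) = (LINT x|lborel. indicator S x * f x)"
    using S by (simp add: integral_restrict_space integral_completion)
  show "integrable (lebesgue_on S) f \<longleftrightarrow> integrable lborel (\<lambda>x. indicator S x * f x)"
    using S by (simp add: integrable_restrict_space integrable_completion)
qed

lemma L2_lebesgue_on_borel:
  fixes f :: "real^2 \<Rightarrow> real"
  assumes f: "f \<in> L2 lborel" and S: "S \<in> sets borel"
  shows "f \<in> L2 (lebesgue_on S)" "L2_norm (lebesgue_on S) f \<le> L2_norm lborel f"
proof -
  have [measurable]: "f \<in> borel_measurable borel" "S \<in> sets borel"
    using f S by (auto simp: L2_real_iff)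
  have int: "integrable lborel (\<lambda>x. indicator S x * (f x)\<^sup>2)"
    using f by (rule_tac Bochner_Integration.integrable_bound [of lborel "\<lambda>x. (f x)\<^sup>2"])
      (auto simp: L2_real_iff indicator_def)
  have "f \<in> borel_measurable (lebesgue_on S)"
    by (simp add: measurable_completion measurable_restrict_space1)
  with int show "f \<in> L2 (lebesgue_on S)"
    by (simp add: L2_real_iff LINT_lebesgue_on_borel)
  have "(LINT x|lborel. indicator S x * (f x)\<^sup>2) \<le> (LINT x|lborel. (f x)\<^sup>2)"
    using f by (intro integral_mono int) (auto simp: L2_real_iff indicator_def)
  then show "L2_norm (lebesgue_on S) f \<le> L2_norm lborel f"
    by (simp add: L2_norm_real LINT_lebesgue_on_borel)
qed

lemma finite_measure_lebesgue_on:
  assumes "bounded S" "S \<in> sets lebesgue"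
  shows "finite_measure (lebesgue_on S)"
  by (simp add: assms bounded_set_imp_lmeasurable finite_measure_lebesgue_on)

lemma bounded_continuous_L2:
  fixes g :: "real^2 \<Rightarrow> real"
  assumes "bounded S" "S \<in> sets borel" "continuous_on UNIV g"
  shows "g \<in> L2 (lebesgue_on S)"
proof -
  have "compact (closure S)"
    using assms(1) by (simp add: compact_closure)
  then have "bounded (g ` closure S)"
    using assms(3) by (metis compact_continuous_image compact_imp_bounded continuous_on_subset top_greatest)
  then obtain B where "\<And>x. x \<in> closure S \<Longrightarrow> \<bar>g x\<bar> \<le> B"
    unfolding bounded_iff by auto
  moreover have "g \<in> borel_measurable (lebesgue_on S)"
    using borel_measurable_continuous_onI [OF assms(3)]
    by (simp add: measurable_completion measurable_restrict_space1)
  ultimately show ?thesis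
    using assms closure_subset finite_measure_lebesgue_on [of S]
    by (intro bounded_imp_L2 [of _ _ B]) auto
qed

text \<open>A three-epsilon argument. f is replaced by a continuous g of compact support; for g the
  convergence is uniform on the bounded set, and the mollified difference g - f is controlled by
  \<open>mollify_L2_bound\<close>, whose factor is at most 4 because the contraction is at least
  1/2.\<close>

lemma mollify_tendsto_L2:
  fixes f :: "real^2 \<Rightarrow> real" and \<epsilon> :: "nat \<Rightarrow> real"
  assumes f: "f \<in> L2 lborel" "integrable lborel f"
    and \<Omega>: "bounded \<Omega>" "open \<Omega>"
    and \<epsilon>: "\<And>n. 0 < \<epsilon> n" "\<And>n. \<epsilon> n \<le> 1/2" "\<epsilon> \<longlonglongrightarrow> 0"
    and \<eta>: "\<And>n. smooth (\<eta> n)" "\<And>n x. 0 \<le> \<eta> n x" "\<And>n x. \<eta> n x \<noteq> 0 \<Longrightarrow> norm x \<le> \<epsilon> n * c"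
      "\<And>n. (LINT x|lborel. \<eta> n x) = 1"
  shows "(\<lambda>n. L2_norm (lebesgue_on \<Omega>) (\<lambda>x. f x - mollify (1 - \<epsilon> n) (\<eta> n) f x)) \<longlonglongrightarrow> 0"
proof (rule LIMSEQ_I)
  fix e :: real assume e: "e > 0"
  let ?M = "lebesgue_on \<Omega>"
  have \<Omega>m: "\<Omega> \<in> sets borel" "\<Omega> \<in> sets lebesgue"
    using \<Omega> by auto
  have \<eta>supp: "x \<notin> cball 0 (\<epsilon> n * c) \<Longrightarrow> \<eta> n x = 0" for n x
    using \<eta>(3) by auto
  have \<eta>cont: "continuous_on UNIV (\<eta> n)" for n
    using \<eta>(1) C1_continuous smooth_imp_C1 by blast
  obtain g R where g: "continuous_on UNIV g" "\<And>x. x \<notin> cball 0 R \<Longrightarrow> g x = 0"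
    and fg: "L2_norm lborel (\<lambda>x. f x - g x) < e / 4"
    using L2_continuous_dense [OF f(1), of "e / 4"] e by auto
  have gi: "integrable lborel g"
    using integrable_continuous_compact_support [OF g] .
  have g2: "integrable lborel (\<lambda>x. (g x)\<^sup>2)"
    by (rule integrable_continuous_compact_support [of _ 0 R]) (use g in \<open>auto intro!: continuous_intros\<close>)
  have gL2: "g \<in> L2 lborel"
    using g2 borel_measurable_continuous_onI [OF g(1)] by (simp add: L2_real_iff)
  obtain B where B: "\<And>x. x \<in> \<Omega> \<Longrightarrow> norm x \<le> B" "B \<ge> 0"
    using \<Omega>(1) unfolding bounded_iff by (meson dual_order.trans linorder_le_cases)
  define m where "m = measure lebesgue \<Omega>"
  define e' where "e' = (e / 4) / (sqrt m + 1)"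
  have e': "e' > 0" "e' * sqrt m \<le> e / 4"
  proof -
    have m0: "sqrt m \<ge> 0"
      by (simp add: m_def)
    then show "e' > 0"
      using e by (simp add: e'_def add_nonneg_pos)
    have "e' * sqrt m \<le> e' * (sqrt m + 1)"
      using \<open>e' > 0\<close> by simp
    also have "\<dots> = e / 4"
    proof -
      have "sqrt m + 1 \<noteq> 0"
        using m0 by linarith
      then show ?thesis
        unfolding e'_def by (metis nonzero_eq_divide_eq)
    qed
    finally show "e' * sqrt m \<le> e / 4" .
  qed
  have "\<exists>d>0. \<forall>x y. dist y x < d \<longrightarrow> dist (g y) (g x) < e'"
    using uniformly_continuous_compact_support [of g 0 R] g e'(1) by (simp add: uniformly_continuous_on_def)
  then obtain d where d: "d > 0" "\<And>x y. dist y x < d \<Longrightarrow> dist (g y) (g x) < e'"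
    by blast
  have "(\<lambda>n. \<epsilon> n * (B + c)) \<longlonglongrightarrow> 0"
    using \<epsilon>(3) by (auto intro: tendsto_eq_intros)
  then obtain N where N: "\<And>n. n \<ge> N \<Longrightarrow> \<epsilon> n * (B + c) < d"
    using d(1) tendsto_0_eventually_less by blast
  have "L2_norm ?M (\<lambda>x. f x - mollify (1 - \<epsilon> n) (\<eta> n) f x) < e" if n: "n \<ge> N" for n
  proof -
    let ?s = "1 - \<epsilon> n"
    let ?m = "mollify ?s (\<eta> n)"
    have s: "?s \<ge> 1/2" using \<epsilon>(2) [of n] by simp
    have mc: "continuous_on UNIV (?m h)" if "integrable lborel h" for h
      using smooth_mollify [OF that \<eta>(1) \<eta>supp] C1_continuous smooth_imp_C1 by blast
    have mL2: "?m h \<in> L2 ?M" if "integrable lborel h" for h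
      using bounded_continuous_L2 [OF \<Omega>(1) \<Omega>m(1) mc [OF that]] .
    have 1: "L2_norm ?M (\<lambda>x. f x - g x) < e / 4"
      using L2_lebesgue_on_borel [OF L2_diff [OF f(1) gL2] \<Omega>m(1)] fg by simp
    have 2: "L2_norm ?M (\<lambda>x. g x - ?m g x) \<le> e / 4"
    proof -
      have close: "\<bar>?m g x - g x\<bar> \<le> e'" if x: "x \<in> \<Omega>" for x
      proof (rule mollify_close [OF gi \<eta>cont \<eta>supp \<eta>(2,4)])
        fix y assume "\<eta> n (y - ?s *\<^sub>R x) \<noteq> 0"
        then have "norm (y - ?s *\<^sub>R x) \<le> \<epsilon> n * c"
          by (rule \<eta>(3))
        \<comment> \<open>The displacement has two sources: the kernel, supported within \<epsilon>
          c of the origin, and the contraction, which moves x by \<epsilon> |x|.\<close>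
        moreover have "y - x = (y - ?s *\<^sub>R x) - \<epsilon> n *\<^sub>R x"
          by (simp add: algebra_simps)
        moreover have "norm (\<epsilon> n *\<^sub>R x) \<le> \<epsilon> n * B"
          using B(1) [OF x] \<epsilon>(1) [of n] by simp
        ultimately have "norm (y - x) \<le> \<epsilon> n * (B + c)"
          using norm_triangle_ineq4 [of "y - ?s *\<^sub>R x" "\<epsilon> n *\<^sub>R x"] by (simp add: algebra_simps)
        then have "dist y x < d"
          using N [OF n] by (simp add: dist_norm)
        then show "\<bar>g y - g x\<bar> \<le> e'"
          using d(2) by (force simp: dist_real_def)
      qed
      have "(LINT x|?M. (g x - ?m g x)\<^sup>2) \<le> (LINT x|?M. e'\<^sup>2)"
      proof (rule integral_mono)
        show "integrable ?M (\<lambda>x. (g x - ?m g x)\<^sup>2)"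
          using L2_diff [OF L2_lebesgue_on_borel(1) [OF gL2 \<Omega>m(1)] mL2 [OF gi]] by (simp add: L2_real_iff)
        show "integrable ?M (\<lambda>x. e'\<^sup>2)"
          using finite_measure_lebesgue_on [OF \<Omega>(1) \<Omega>m(2)] by (simp add: finite_measure.integrable_const)
        show "(g x - ?m g x)\<^sup>2 \<le> e'\<^sup>2" if "x \<in> space ?M" for x
          using close [of x] that e' by (simp add: abs_le_square_iff [symmetric] abs_minus_commute)
      qed
      also have "\<dots> = e'\<^sup>2 * m"
        using \<Omega>m by (simp add: m_def measure_restrict_space)
      finally have "L2_norm ?M (\<lambda>x. g x - ?m g x) \<le> sqrt (e'\<^sup>2 * m)"
        unfolding L2_norm_real by simp
      also have "\<dots> = e' * sqrt m"
        using e' by (simp add: real_sqrt_mult)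
      finally show ?thesis
        using e' by simp
    qed
    have 3: "L2_norm ?M (\<lambda>x. ?m g x - ?m f x) < e / 2"
    proof -
      define h where "h x = g x - f x" for x
      have h: "integrable lborel h" "h \<in> L2 lborel"
        using gi f L2_diff [OF gL2 f(1)] by (auto simp: h_def [abs_def])
      have nn: "(\<integral>\<^sup>+x. ennreal ((?m h x)\<^sup>2) \<partial>lborel) \<le> ennreal (4 * (LINT x|lborel. (h x)\<^sup>2))"
      proof -
        have "(\<integral>\<^sup>+x. ennreal ((?m h x)\<^sup>2) \<partial>lborel) \<le> ennreal (1 / ?s\<^sup>2) * (\<integral>\<^sup>+x. ennreal ((h x)\<^sup>2) \<partial>lborel)"
          using h s \<eta>supp by (intro mollify_L2_bound [where c=0 and R="\<epsilon> n * c"] \<eta>cont \<eta>(2,4)) (auto simp: L2_real_iff)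
        also have "\<dots> = ennreal (1 / ?s\<^sup>2) * ennreal (LINT x|lborel. (h x)\<^sup>2)"
          using h by (subst nn_integral_eq_integral) (auto simp: L2_real_iff)
        also have "\<dots> \<le> ennreal 4 * ennreal (LINT x|lborel. (h x)\<^sup>2)"
        proof -
          have "(1/2)\<^sup>2 \<le> ?s\<^sup>2"
            using s by (intro power_mono) auto
          then have "1 / ?s\<^sup>2 \<le> 4"
            using s by (simp add: field_simps power2_eq_square)
          then show ?thesis
            by (intro mult_right_mono ennreal_leI) auto
        qed
        finally show ?thesis
          by (simp add: ennreal_mult)
      qed
      have mm: "?m h \<in> borel_measurable borel"
        using borel_measurable_continuous_onI [OF mc [OF h(1)]] .
      have mi: "integrable lborel (\<lambda>x. (?m h x)\<^sup>2)"
        using nn mm by (intro integrableI_bounded) (auto simp: top_unique less_top [symmetric])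
      then have "(LINT x|lborel. (?m h x)\<^sup>2) \<le> 4 * (LINT x|lborel. (h x)\<^sup>2)"
        using nn by (subst (asm) nn_integral_eq_integral) auto
      then have "L2_norm lborel (?m h) \<le> sqrt (4 * (LINT x|lborel. (h x)\<^sup>2))"
        unfolding L2_norm_real by simp
      also have "\<dots> = 2 * L2_norm lborel h"
        by (simp add: real_sqrt_mult L2_norm_real)
      also have "\<dots> < e / 2"
        using fg by (simp add: h_def [abs_def] L2_norm_minus_commute [of lborel g f])
      finally have "L2_norm ?M (?m h) < e / 2"
        using L2_lebesgue_on_borel(2) [of "?m h" \<Omega>] mi mm \<Omega>m by (simp add: L2_real_iff)
      moreover have "?m h = (\<lambda>x. ?m g x - ?m f x)"
        unfolding h_def [abs_def]
        by (intro ext mollify_diff [OF gi f(2) \<eta>cont, where c=0 and R="\<epsilon> n * c"]) (rule \<eta>supp)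
      ultimately show ?thesis
        by (simp only:)
    qed
    have L: "f \<in> L2 ?M" "g \<in> L2 ?M"
      using L2_lebesgue_on_borel(1) f gL2 \<Omega>m by auto
    show ?thesis
      using L2_norm_diff_triangle [OF L mL2 [OF f(2)]]
        L2_norm_diff_triangle [OF L(2) mL2 [OF gi] mL2 [OF f(2)]] 1 2 3 by linarith
  qed
  then show "\<exists>N. \<forall>n\<ge>N. norm (L2_norm ?M (\<lambda>x. f x - mollify (1 - \<epsilon> n) (\<eta> n) f x) - 0) < e"
    by auto
qed

section \<open>Weak derivatives\<close>

lemma LINT_lebesgue_on_subset:
  fixes g :: "'a::euclidean_space \<Rightarrow> real"
  assumes "S \<subseteq> T" "S \<in> sets lebesgue" "T \<in> sets lebesgue" "\<And>x. x \<in> T - S \<Longrightarrow> g x = 0"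
  shows "(LINT x|lebesgue_on T. g x) = (LINT x|lebesgue_on S. g x)"
proof -
  have "(\<lambda>x. indicator T x *\<^sub>R g x) = (\<lambda>x. indicator S x *\<^sub>R g x)"
    using assms(1,4) by (auto simp: fun_eq_iff indicator_def)
  then show ?thesis
    using assms by (simp add: integral_restrict_space)
qed

lemma lebesgue_on_subset_eq:
  "S \<subseteq> T \<Longrightarrow> S \<in> sets lebesgue \<Longrightarrow> T \<in> sets lebesgue \<Longrightarrow> lebesgue_on S = restrict_space (lebesgue_on T) S"
  by (simp add: restrict_restrict_space Int_absorb1)

lemma measurable_lebesgue_on_mono:
  assumes "f \<in> borel_measurable (lebesgue_on T)" "S \<subseteq> T" "S \<in> sets lebesgue" "T \<in> sets lebesgue"
  shows "f \<in> borel_measurable (lebesgue_on S)"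
  using assms by (simp add: lebesgue_on_subset_eq [of S T] measurable_restrict_space1)

lemma integrable_lebesgue_on_mono:
  fixes f :: "'a::euclidean_space \<Rightarrow> real"
  assumes "integrable (lebesgue_on T) f" "S \<subseteq> T" "S \<in> sets lebesgue" "T \<in> sets lebesgue"
  shows "integrable (lebesgue_on S) f"
proof -
  have "S \<in> sets (lebesgue_on T)"
    using assms by (auto simp: sets_restrict_space)
  then show ?thesis
    using assms integrable_mult_indicator [of S "lebesgue_on T" f]
    by (simp add: lebesgue_on_subset_eq [of S T] integrable_restrict_space Int_absorb2)
qed

lemma LINT_lebesgue_on_mono:
  fixes f :: "'a::euclidean_space \<Rightarrow> real"
  assumes "integrable (lebesgue_on T) f" "S \<subseteq> T" "S \<in> sets lebesgue" "T \<in> sets lebesgue" "\<And>x. 0 \<le> f x"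
  shows "(LINT x|lebesgue_on S. f x) \<le> (LINT x|lebesgue_on T. f x)"
proof -
  have S: "S \<in> sets (lebesgue_on T)"
    using assms by (auto simp: sets_restrict_space)
  have "(LINT x|lebesgue_on S. f x) = (LINT x|lebesgue_on T. indicator S x *\<^sub>R f x)"
    using assms S by (simp add: lebesgue_on_subset_eq [of S T] integral_restrict_space Int_absorb2)
  also have "\<dots> \<le> (LINT x|lebesgue_on T. f x)"
    using assms S integrable_mult_indicator [OF S assms(1)]
    by (intro integral_mono) (auto simp: indicator_def)
  finally show ?thesis .
qed

lemma L2_lebesgue_on_mono:
  fixes f :: "'a::euclidean_space \<Rightarrow> real"
  assumes "f \<in> L2 (lebesgue_on T)" "S \<subseteq> T" "S \<in> sets lebesgue" "T \<in> sets lebesgue"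
  shows "f \<in> L2 (lebesgue_on S)" "L2_norm (lebesgue_on S) f \<le> L2_norm (lebesgue_on T) f"
proof -
  show "f \<in> L2 (lebesgue_on S)"
    using assms measurable_lebesgue_on_mono integrable_lebesgue_on_mono unfolding L2_real_iff by blast
  show "L2_norm (lebesgue_on S) f \<le> L2_norm (lebesgue_on T) f"
    unfolding L2_norm_real using assms by (intro real_sqrt_le_mono LINT_lebesgue_on_mono) (auto simp: L2_real_iff)
qed

lemma borel_measurable_lebesgue_on:
  assumes "f \<in> borel_measurable borel"
  shows "f \<in> borel_measurable (lebesgue_on S)"
  using assms by (intro measurable_restrict_space1 measurable_completion) simp

text \<open>Mollification integrates over the whole plane against \<open>lborel\<close>, whereas
  elements of L^2 of a domain are Lebesgue measurable and meaningful only there. Passing to a Borel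
  function that vanishes outside the domain connects the two settings.\<close>

lemma L2_borel_representative:
  fixes f :: "real^2 \<Rightarrow> real"
  assumes f: "f \<in> L2 (lebesgue_on \<Omega>)" and \<Omega>: "\<Omega> \<in> sets borel"
  obtains f' where "f' \<in> L2 lborel" "\<And>x. x \<notin> \<Omega> \<Longrightarrow> f' x = 0" "AE x in lebesgue_on \<Omega>. f x = f' x"
proof -
  have \<Omega>': "\<Omega> \<in> sets lebesgue"
    using \<Omega> by auto
  have "(\<lambda>x. if x \<in> \<Omega> then f x else 0) \<in> borel_measurable lebesgue"
    using f \<Omega>' by (intro borel_measurable_if_I) (auto simp: L2_real_iff)
  then obtain g where g [measurable]: "g \<in> borel_measurable lborel"
    and AE: "AE x in lborel. (if x \<in> \<Omega> then f x else 0) = g x"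
    using completion_ex_borel_measurable_real by blast
  note \<Omega> [measurable]
  define f' where "f' x = indicator \<Omega> x * g x" for x
  have f'm [measurable]: "f' \<in> borel_measurable borel"
    using g unfolding f'_def by measurable
  have "AE x in lebesgue. x \<in> \<Omega> \<longrightarrow> f x = f' x"
    using AE unfolding AE_completion_iff by eventually_elim (auto simp: f'_def)
  then have eq: "AE x in lebesgue_on \<Omega>. f x = f' x"
    using \<Omega>' by (simp add: AE_restrict_space_iff)
  have "f' \<in> L2 (lebesgue_on \<Omega>)"
    by (rule L2_cong_AE [OF f borel_measurable_lebesgue_on [OF f'm] eq])
  then have "integrable (lebesgue_on \<Omega>) (\<lambda>x. (f' x)\<^sup>2)"
    by (simp add: L2_real_iff)
  then have "integrable lborel (\<lambda>x. indicator \<Omega> x * (f' x)\<^sup>2)"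
    by (subst (asm) LINT_lebesgue_on_borel(2)) measurable
  moreover have "(\<lambda>x. indicator \<Omega> x * (f' x)\<^sup>2) = (\<lambda>x. (f' x)\<^sup>2)"
    by (auto simp: fun_eq_iff f'_def indicator_def)
  ultimately have "f' \<in> L2 lborel"
    by (simp add: L2_real_iff)
  then show thesis
    using that [of f'] eq by (simp add: f'_def)
qed

lemma L2_bounded_support_integrable:
  fixes f :: "real^2 \<Rightarrow> real"
  assumes f: "f \<in> L2 lborel" "\<And>x. x \<notin> \<Omega> \<Longrightarrow> f x = 0" and \<Omega>: "bounded \<Omega>" "\<Omega> \<in> sets borel"
  shows "integrable lborel f"
proof -
  have "integrable (lebesgue_on \<Omega>) f"
    using L2_integrable [OF finite_measure_lebesgue_on L2_lebesgue_on_borel(1)] f \<Omega> by auto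
  then have "integrable lborel (\<lambda>x. indicator \<Omega> x * f x)"
    using f \<Omega> by (simp add: LINT_lebesgue_on_borel L2_real_iff)
  moreover have "(\<lambda>x. indicator \<Omega> x * f x) = f"
    using f(2) by (auto simp: fun_eq_iff indicator_def)
  ultimately show ?thesis
    by simp
qed

lemma LINT_borel_representative:
  fixes f \<phi> :: "real^2 \<Rightarrow> real"
  assumes f: "f \<in> borel_measurable (lebesgue_on \<Omega>)" and f': "f' \<in> borel_measurable borel" "\<And>x. x \<notin> \<Omega> \<Longrightarrow> f' x = 0"
    and AE: "AE x in lebesgue_on \<Omega>. f x = f' x" and \<Omega>: "\<Omega> \<in> sets borel" and \<phi>: "\<phi> \<in> borel_measurable borel"
  shows "(LINT x|lebesgue_on \<Omega>. f x * \<phi> x) = (LINT x|lborel. f' x * \<phi> x)"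
proof -
  have meas: "h \<in> borel_measurable (lebesgue_on \<Omega>)" if "h \<in> borel_measurable borel" for h :: "real^2 \<Rightarrow> real"
    using that by (rule borel_measurable_lebesgue_on)
  have "(LINT x|lebesgue_on \<Omega>. f x * \<phi> x) = (LINT x|lebesgue_on \<Omega>. f' x * \<phi> x)"
    by (rule integral_cong_AE) (use f meas [OF f'(1)] meas [OF \<phi>] AE in auto)
  also have "\<dots> = (LINT x|lborel. indicator \<Omega> x * (f' x * \<phi> x))"
    using f' \<phi> \<Omega> by (intro LINT_lebesgue_on_borel) auto
  also have "\<dots> = (LINT x|lborel. f' x * \<phi> x)"
    using f'(2) by (intro Bochner_Integration.integral_cong) (auto simp: indicator_def)
  finally show ?thesis .
qed

section \<open>Test functions and the kernels of the mollification\<close>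

lemma partial_translate: "partial i (\<lambda>y. f (y - v)) = (\<lambda>y. partial i f (y - v))"
  if "\<And>x. f differentiable (at x)"
proof
  fix y
  have "((\<lambda>y. y - v) has_derivative (\<lambda>h. h)) (at y)"
    by (auto intro!: derivative_eq_intros)
  from has_derivative_compose [OF this frechet_derivative_worksI [OF that]]
  show "partial i (\<lambda>y. f (y - v)) y = partial i f (y - v)"
    by (simp add: partial_eqI) (simp add: partial_def)
qed

lemma smooth_translate: "smooth f \<Longrightarrow> smooth (\<lambda>y. f (y - v))"
proof -
  have "cont_diff k f \<Longrightarrow> cont_diff k (\<lambda>y. f (y - v))" for k
  proof (induction k arbitrary: f)
    case 0
    then show ?case
      by (auto intro!: continuous_on_compose2 [of UNIV f] continuous_intros)
  next
    case (Suc k)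
    then have "(\<lambda>y. f (y - v)) differentiable (at y)" for y
      by (auto intro!: differentiable_chain_at [of "\<lambda>y. y - v" y f, unfolded o_def])
    with Suc show ?case
      by (simp add: partial_translate)
  qed
  then show "smooth f \<Longrightarrow> smooth (\<lambda>y. f (y - v))"
    by (auto simp: smooth_def)
qed

lemma test_functionI:
  assumes "smooth \<phi>" "\<And>x. \<phi> x \<noteq> 0 \<Longrightarrow> x \<in> S" "compact S" "S \<subseteq> \<omega>"
  shows "\<phi> \<in> test_functions \<omega>"
proof -
  have "closure {x. \<phi> x \<noteq> 0} \<subseteq> S"
    using assms by (intro closure_minimal) (auto simp: compact_imp_closed)
  then show ?thesis
    using assms unfolding test_functions_def
    using compact_Int_closed [of S "closure {x. \<phi> x \<noteq> 0}"] by (auto simp: Int_absorb1)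
qed

lemma test_function_bounded_support:
  assumes "\<phi> \<in> test_functions \<omega>"
  obtains R where "\<And>x. x \<notin> cball 0 R \<Longrightarrow> \<phi> x = 0"
proof -
  have "bounded (closure {x. \<phi> x \<noteq> 0})"
    using assms by (auto simp: test_functions_def compact_imp_bounded)
  then obtain R where "\<And>x. x \<in> closure {x. \<phi> x \<noteq> 0} \<Longrightarrow> norm x \<le> R"
    unfolding bounded_iff by blast
  then show thesis
    using that [of R] closure_subset [of "{x. \<phi> x \<noteq> 0}"] by (force simp: subset_iff)
qed

lemma test_function_smooth: "\<phi> \<in> test_functions \<omega> \<Longrightarrow> smooth \<phi>"
  by (simp add: test_functions_def)

lemma test_function_outside: "\<phi> \<in> test_functions \<omega> \<Longrightarrow> x \<notin> \<omega> \<Longrightarrow> \<phi> x = 0"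
  using closure_subset [of "{x. \<phi> x \<noteq> 0}"] by (auto simp: test_functions_def)

lemma test_function_partial_outside: "\<phi> \<in> test_functions \<omega> \<Longrightarrow> x \<notin> \<omega> \<Longrightarrow> partial i \<phi> x = 0"
proof -
  assume \<phi>: "\<phi> \<in> test_functions \<omega>" and x: "x \<notin> \<omega>"
  have "(\<phi> has_derivative (\<lambda>h. 0)) (at x)"
    by (rule has_derivative_transform_within_open [of "\<lambda>x. 0" _ _ _ "- closure {x. \<phi> x \<noteq> 0}"])
       (use \<phi> x closure_subset [of "{x. \<phi> x \<noteq> 0}"] in \<open>auto simp: test_functions_def\<close>)
  then show ?thesis
    by (simp add: partial_eqI)
qed

lemma test_functions_mono: "\<omega> \<subseteq> \<omega>' \<Longrightarrow> test_functions \<omega> \<subseteq> test_functions \<omega>'"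
  by (auto simp: test_functions_def)

lemma smooth_compact_support_L2:
  fixes \<phi> :: "real^2 \<Rightarrow> real"
  assumes "continuous_on UNIV \<phi>" "\<And>x. x \<notin> cball 0 R \<Longrightarrow> \<phi> x = 0" "\<omega> \<in> sets borel"
  shows "\<phi> \<in> L2 (lebesgue_on \<omega>)"
proof (rule L2_lebesgue_on_borel(1))
  have "integrable lborel (\<lambda>x. (\<phi> x)\<^sup>2)"
    by (rule integrable_continuous_compact_support [of _ 0 R]) (use assms in \<open>auto intro!: continuous_intros\<close>)
  then show "\<phi> \<in> L2 lborel"
    using borel_measurable_continuous_onI [OF assms(1)] by (simp add: L2_real_iff)
qed (use assms in auto)

lemma test_function_L2:
  assumes \<phi>: "\<phi> \<in> test_functions \<omega>'" and \<omega>: "\<omega> \<in> sets borel"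
  shows "\<phi> \<in> L2 (lebesgue_on \<omega>)" "partial i \<phi> \<in> L2 (lebesgue_on \<omega>)"
proof -
  obtain R where R: "\<And>x. x \<notin> cball 0 R \<Longrightarrow> \<phi> x = 0"
    using test_function_bounded_support [OF \<phi>] by blast
  have C1: "cont_diff 1 \<phi>"
    using \<phi> test_function_smooth smooth_imp_C1 by blast
  show "\<phi> \<in> L2 (lebesgue_on \<omega>)"
    by (rule smooth_compact_support_L2 [OF C1_continuous [OF C1] R \<omega>])
  show "partial i \<phi> \<in> L2 (lebesgue_on \<omega>)"
    by (rule smooth_compact_support_L2 [OF C1_partial_continuous [OF C1] _ \<omega>, of R])
       (use R partial_compact_support [of 0 R \<phi>] in blast)
qed

text \<open>The kernel is centred at \<epsilon> x0 and not at 0: translated by (1 - \<epsilon>) x it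
  is centred at a convex combination of x and x0, hence pushed into the domain.\<close>

lemma mollifier_family:
  fixes x0 :: "real^2"
  assumes r: "r > 0"
  obtains \<epsilon> \<eta> where "\<And>n. 0 < \<epsilon> n" "\<And>n. \<epsilon> n \<le> 1/2" "\<epsilon> \<longlonglongrightarrow> 0"
    "\<And>n. smooth (\<eta> n)" "\<And>n x. 0 \<le> \<eta> n x" "\<And>n x. \<eta> n x \<noteq> 0 \<Longrightarrow> norm x \<le> \<epsilon> n * (norm x0 + r)"
    "\<And>n. (LINT x|lborel. \<eta> n x) = 1"
    "\<And>n x. \<eta> n x \<noteq> 0 \<Longrightarrow> x \<in> cball (\<epsilon> n *\<^sub>R x0) (\<epsilon> n * r)"
proof -
  define \<epsilon> where "\<epsilon> n = 1 / (real n + 2)" for n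
  have \<epsilon>: "0 < \<epsilon> n" "\<epsilon> n \<le> 1/2" for n
    by (simp_all add: \<epsilon>_def field_simps)
  have "\<exists>\<eta>. smooth \<eta> \<and> (\<forall>x. 0 \<le> \<eta> x) \<and> (\<forall>x. \<eta> x \<noteq> 0 \<longleftrightarrow> x \<in> ball (\<epsilon> n *\<^sub>R x0) (\<epsilon> n * r))
      \<and> (LINT x|lborel. \<eta> x) = 1" for n
    using normalized_bump [of "\<epsilon> n * r" "\<epsilon> n *\<^sub>R x0"] \<epsilon>(1) [of n] r by (metis mult_pos_pos)
  then obtain \<eta> where \<eta>: "\<And>n. smooth (\<eta> n)" "\<And>n x. 0 \<le> \<eta> n x"
    "\<And>n x. \<eta> n x \<noteq> 0 \<longleftrightarrow> x \<in> ball (\<epsilon> n *\<^sub>R x0) (\<epsilon> n * r)" "\<And>n. (LINT x|lborel. \<eta> n x) = 1"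
    by metis
  have lim: "\<epsilon> \<longlonglongrightarrow> 0"
    unfolding \<epsilon>_def using LIMSEQ_ignore_initial_segment [OF lim_1_over_n, of 2] by (simp add: add.commute)
  have "norm x \<le> \<epsilon> n * (norm x0 + r)" if "\<eta> n x \<noteq> 0" for n x
  proof -
    have "norm (x - \<epsilon> n *\<^sub>R x0) < \<epsilon> n * r"
      using that \<eta>(3) by (simp add: dist_norm norm_minus_commute)
    moreover have "norm (\<epsilon> n *\<^sub>R x0) = \<epsilon> n * norm x0"
      using abs_of_pos [OF \<epsilon>(1) [of n]] by (simp only: norm_scaleR)
    moreover have "norm x \<le> norm (x - \<epsilon> n *\<^sub>R x0) + norm (\<epsilon> n *\<^sub>R x0)"
      using norm_triangle_sub [of x "\<epsilon> n *\<^sub>R x0"] by linarith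
    ultimately have "norm x \<le> \<epsilon> n * r + \<epsilon> n * norm x0"
      by linarith
    then show ?thesis
      by (simp add: distrib_left)
  qed
  then show thesis
    using that [of \<epsilon> \<eta>] \<epsilon> lim \<eta> by auto
qed

text \<open>The support consists of points (1 - e) x + e z with z in the ball around x0. By
  convexity it is a compact subset of the domain, however close x is to the boundary.\<close>

lemma mollifier_test_function:
  assumes \<Omega>: "convex \<Omega>" "cball x0 r \<subseteq> \<Omega>" and r: "r > 0" and \<epsilon>: "0 < e" "e \<le> 1/2"
    and \<eta>: "smooth \<eta>" "\<And>x. \<eta> x \<noteq> 0 \<Longrightarrow> x \<in> cball (e *\<^sub>R x0) (e * r)" and x: "x \<in> \<Omega>"
  shows "(\<lambda>y. \<eta> (y - (1 - e) *\<^sub>R x)) \<in> test_functions \<Omega>"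
proof (rule test_functionI [OF smooth_translate [OF \<eta>(1)]])
  let ?S = "cball ((1 - e) *\<^sub>R x + e *\<^sub>R x0) (e * r)"
  show "y \<in> ?S" if "\<eta> (y - (1 - e) *\<^sub>R x) \<noteq> 0" for y
    using \<eta>(2) [OF that] by (simp add: dist_norm algebra_simps)
  show "compact ?S"
    by simp
  show "?S \<subseteq> \<Omega>"
  proof
    fix y assume y: "y \<in> ?S"
    define z where "z = (1 / e) *\<^sub>R (y - (1 - e) *\<^sub>R x)"
    have yz: "y = (1 - e) *\<^sub>R x + e *\<^sub>R z"
      using \<epsilon> by (simp add: z_def)
    have "dist ((1 - e) *\<^sub>R x + e *\<^sub>R x0) y = norm (e *\<^sub>R (x0 - z))"
      unfolding yz dist_norm by (simp add: algebra_simps)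
    then have "e * norm (x0 - z) \<le> e * r"
      using y \<epsilon> by simp
    then have "z \<in> cball x0 r"
      using \<epsilon> by (simp add: dist_norm)
    then have "z \<in> \<Omega>"
      using \<Omega>(2) by blast
    then show "y \<in> \<Omega>"
      unfolding yz using \<epsilon> x by (intro convexD [OF \<Omega>(1)]) auto
  qed
qed

section \<open>The fundamental lemma of the calculus of variations\<close>

text \<open>The mollification at a point of the domain is a pairing of f with a test function, so it
  vanishes identically there. It also converges to f in L^2, so f has norm 0.\<close>

lemma fundamental_lemma_convex:
  fixes f :: "real^2 \<Rightarrow> real"
  assumes \<Omega>: "open \<Omega>" "convex \<Omega>" "bounded \<Omega>" "\<Omega> \<noteq> {}" and f: "f \<in> L2 (lebesgue_on \<Omega>)"
    and zero: "\<And>\<phi>. \<phi> \<in> test_functions \<Omega> \<Longrightarrow> (LINT x|lebesgue_on \<Omega>. f x * \<phi> x) = 0"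
  shows "AE x in lebesgue_on \<Omega>. f x = 0"
proof -
  obtain x0 r where r: "r > 0" "cball x0 r \<subseteq> \<Omega>"
    using \<Omega> open_contains_cball by blast
  have \<Omega>m: "\<Omega> \<in> sets borel" "\<Omega> \<in> sets lebesgue"
    using \<Omega> by auto
  obtain f' where f': "f' \<in> L2 lborel" "\<And>x. x \<notin> \<Omega> \<Longrightarrow> f' x = 0" "AE x in lebesgue_on \<Omega>. f x = f' x"
    using L2_borel_representative [OF f \<Omega>m(1)] by blast
  have f'i: "integrable lborel f'"
    using L2_bounded_support_integrable f' \<Omega> \<Omega>m by blast
  obtain \<epsilon> \<eta> where \<epsilon>: "\<And>n. 0 < \<epsilon> n" "\<And>n. \<epsilon> n \<le> 1/2" "\<epsilon> \<longlonglongrightarrow> 0" and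
    \<eta>: "\<And>n. smooth (\<eta> n)" "\<And>n x. 0 \<le> \<eta> n x" "\<And>n x. \<eta> n x \<noteq> 0 \<Longrightarrow> norm x \<le> \<epsilon> n * (norm x0 + r)"
    "\<And>n. (LINT x|lborel. \<eta> n x) = 1" "\<And>n x. \<eta> n x \<noteq> 0 \<Longrightarrow> x \<in> cball (\<epsilon> n *\<^sub>R x0) (\<epsilon> n * r)"
    using mollifier_family [OF r(1), of x0] by blast
  have m0: "mollify (1 - \<epsilon> n) (\<eta> n) f' x = 0" if "x \<in> \<Omega>" for n x
  proof -
    let ?\<phi> = "\<lambda>y. \<eta> n (y - (1 - \<epsilon> n) *\<^sub>R x)"
    have \<phi>: "?\<phi> \<in> test_functions \<Omega>"
      using mollifier_test_function [OF \<Omega>(2) r(2,1) \<epsilon>(1,2) \<eta>(1) \<eta>(5) that] .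
    have "mollify (1 - \<epsilon> n) (\<eta> n) f' x = (LINT x|lebesgue_on \<Omega>. f x * ?\<phi> x)"
      unfolding mollify_def
      by (rule LINT_borel_representative [symmetric])
         (use f f' \<Omega>m C1_measurable [OF smooth_imp_C1 [OF test_function_smooth [OF \<phi>]]] in \<open>simp_all add: L2_real_iff\<close>)
    then show ?thesis
      using zero [OF \<phi>] by simp
  qed
  have "(\<lambda>n. L2_norm (lebesgue_on \<Omega>) (\<lambda>x. f' x - mollify (1 - \<epsilon> n) (\<eta> n) f' x)) \<longlonglongrightarrow> 0"
    by (rule mollify_tendsto_L2 [OF f'(1) f'i \<Omega>(3,1) \<epsilon> \<eta>(1-4)])
  moreover have "L2_norm (lebesgue_on \<Omega>) (\<lambda>x. f' x - mollify (1 - \<epsilon> n) (\<eta> n) f' x) = L2_norm (lebesgue_on \<Omega>) f'" for n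
  proof -
    have "(LINT x|lebesgue_on \<Omega>. (f' x - mollify (1 - \<epsilon> n) (\<eta> n) f' x)\<^sup>2) = (LINT x|lebesgue_on \<Omega>. (f' x)\<^sup>2)"
      by (rule Bochner_Integration.integral_cong) (simp_all add: m0)
    then show ?thesis
      by (simp add: L2_norm_real)
  qed
  ultimately have "L2_norm (lebesgue_on \<Omega>) f' = 0"
    by (simp add: LIMSEQ_const_iff)
  then have "(LINT x|lebesgue_on \<Omega>. (f' x)\<^sup>2) = 0"
    by (simp add: L2_norm_real)
  moreover have "integrable (lebesgue_on \<Omega>) (\<lambda>x. (f' x)\<^sup>2)"
    using L2_lebesgue_on_borel [OF f'(1) \<Omega>m(1)] by (simp add: L2_real_iff)
  ultimately have "AE x in lebesgue_on \<Omega>. (f' x)\<^sup>2 = 0"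
    using integral_nonneg_eq_0_iff_AE [of "lebesgue_on \<Omega>" "\<lambda>x. (f' x)\<^sup>2"] by simp
  with f'(3) show ?thesis
    by eventually_elim simp
qed

lemma AE_lebesgue_on_negligible:
  assumes "\<omega> \<in> sets lebesgue"
  shows "(AE x in lebesgue_on \<omega>. P x) \<longleftrightarrow> negligible {x \<in> \<omega>. \<not> P x}"
proof -
  have "(AE x in lebesgue_on \<omega>. P x) \<longleftrightarrow> (AE x in lebesgue. x \<in> \<omega> \<longrightarrow> P x)"
    using assms by (simp add: AE_restrict_space_iff)
  also have "\<dots> \<longleftrightarrow> negligible {x. \<not> (x \<in> \<omega> \<longrightarrow> P x)}"
    unfolding eventually_ae_filter_negligible using negligible_subset by blast
  also have "{x. \<not> (x \<in> \<omega> \<longrightarrow> P x)} = {x \<in> \<omega>. \<not> P x}"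
    by blast
  finally show ?thesis .
qed

text \<open>Negligibility is a local property and balls are convex, so the convex case
  suffices.\<close>

lemma fundamental_lemma:
  fixes f :: "real^2 \<Rightarrow> real"
  assumes \<omega>: "open \<omega>" and f: "f \<in> L2 (lebesgue_on \<omega>)"
    and zero: "\<And>\<phi>. \<phi> \<in> test_functions \<omega> \<Longrightarrow> (LINT x|lebesgue_on \<omega>. f x * \<phi> x) = 0"
  shows "AE x in lebesgue_on \<omega>. f x = 0"
proof -
  have \<omega>m: "\<omega> \<in> sets lebesgue"
    using \<omega> by auto
  have "negligible {x \<in> \<omega>. f x \<noteq> 0}"
  proof (subst locally_negligible_alt, rule ballI)
    fix x assume x: "x \<in> {x \<in> \<omega>. f x \<noteq> 0}"
    then obtain r where r: "r > 0" "ball x r \<subseteq> \<omega>"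
      using \<omega> open_contains_ball by blast
    have bm: "ball x r \<in> sets lebesgue"
      by simp
    have "AE x in lebesgue_on (ball x r). f x = 0"
    proof (rule fundamental_lemma_convex)
      show "f \<in> L2 (lebesgue_on (ball x r))"
        using L2_lebesgue_on_mono(1) [OF f r(2) bm \<omega>m] .
      fix \<phi> assume \<phi>: "\<phi> \<in> test_functions (ball x r)"
      then have "(LINT x|lebesgue_on (ball x r). f x * \<phi> x) = (LINT x|lebesgue_on \<omega>. f x * \<phi> x)"
        using test_function_outside [OF \<phi>] by (intro LINT_lebesgue_on_subset [symmetric] r \<omega>m bm) auto
      also have "\<dots> = 0"
        using zero \<phi> test_functions_mono [OF r(2)] by blast
      finally show "(LINT x|lebesgue_on (ball x r). f x * \<phi> x) = 0" .
    qed (use r in auto)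
    then have "negligible {y \<in> ball x r. f y \<noteq> 0}"
      by (simp add: AE_lebesgue_on_negligible)
    moreover have "{x \<in> \<omega>. f x \<noteq> 0} \<inter> ball x r = {y \<in> ball x r. f y \<noteq> 0}"
      using r(2) by auto
    moreover have "openin (top_of_set {x \<in> \<omega>. f x \<noteq> 0}) ({x \<in> \<omega>. f x \<noteq> 0} \<inter> ball x r)"
      by (rule openin_open_Int) simp
    moreover have "x \<in> {x \<in> \<omega>. f x \<noteq> 0} \<inter> ball x r"
      using x r(1) by simp
    ultimately show "\<exists>U. openin (top_of_set {x \<in> \<omega>. f x \<noteq> 0}) U \<and> x \<in> U \<and> negligible U"
      by (intro exI [of _ "{x \<in> \<omega>. f x \<noteq> 0} \<inter> ball x r"] conjI) (simp_all only:)
  qed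
  then show ?thesis
    using \<omega>m by (simp add: AE_lebesgue_on_negligible)
qed

section \<open>Weak gradients\<close>

text \<open>The gradient is an explicit argument because \<open>weak_partial\<close> is an arbitrary
  choice, determined only almost everywhere and depending on the domain; an explicit gradient can be
  restricted to subdomains.\<close>

definition weak_grad :: "(real^2) set \<Rightarrow> (real^2 \<Rightarrow> real) \<Rightarrow> (2 \<Rightarrow> real^2 \<Rightarrow> real) \<Rightarrow> bool" where
  "weak_grad \<omega> f G \<longleftrightarrow> f \<in> L2 (lebesgue_on \<omega>) \<and>
     (\<forall>i. G i \<in> L2 (lebesgue_on \<omega>) \<and> is_weak_partial \<omega> i f (G i))"

lemma weak_gradD:
  assumes "weak_grad \<omega> f G"
  shows "f \<in> L2 (lebesgue_on \<omega>)" "G i \<in> L2 (lebesgue_on \<omega>)" "is_weak_partial \<omega> i f (G i)"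
  using assms by (auto simp: weak_grad_def)

lemma H1_iff: "f \<in> H1 \<omega> \<longleftrightarrow> (\<exists>G. weak_grad \<omega> f G)"
  unfolding H1_def weak_grad_def by (simp add: Bex_def) metis

lemma weak_grad_weak_partial:
  assumes "f \<in> H1 \<omega>"
  shows "weak_grad \<omega> f (\<lambda>i. weak_partial \<omega> i f)"
proof -
  have "\<exists>g. g \<in> L2 (lebesgue_on \<omega>) \<and> is_weak_partial \<omega> i f g" for i
    using assms by (auto simp: H1_def)
  from someI_ex [OF this] show ?thesis
    using assms unfolding weak_grad_def weak_partial_def H1_def by blast
qed

lemma weak_grad_unique:
  assumes \<omega>: "open \<omega>" and G: "weak_grad \<omega> f G" and G': "weak_grad \<omega> f G'"
  shows "AE x in lebesgue_on \<omega>. G i x = G' i x"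
proof -
  have "AE x in lebesgue_on \<omega>. G i x - G' i x = 0"
  proof (rule fundamental_lemma [OF \<omega> L2_diff [OF weak_gradD(2) [OF G] weak_gradD(2) [OF G']]])
    fix \<phi> assume \<phi>: "\<phi> \<in> test_functions \<omega>"
    have \<phi>L2: "\<phi> \<in> L2 (lebesgue_on \<omega>)"
      using test_function_L2 [OF \<phi>] \<omega> by auto
    have "(LINT x|lebesgue_on \<omega>. G i x * \<phi> x) = (LINT x|lebesgue_on \<omega>. G' i x * \<phi> x)"
      using weak_gradD(3) [OF G, of i] weak_gradD(3) [OF G', of i] \<phi> by (auto simp: is_weak_partial_def)
    then show "(LINT x|lebesgue_on \<omega>. (G i x - G' i x) * \<phi> x) = 0"
      using L2_mult_integrable [OF weak_gradD(2) [OF G] \<phi>L2] L2_mult_integrable [OF weak_gradD(2) [OF G'] \<phi>L2]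
      by (simp add: left_diff_distrib)
  qed
  then show ?thesis
    by eventually_elim simp
qed

text \<open>Weak derivatives are unique almost everywhere, so the choice hidden in
  \<open>H1_norm\<close> may be replaced by any gradient at hand.\<close>

lemma H1_norm_sq:
  assumes \<omega>: "open \<omega>" and G: "weak_grad \<omega> f G"
  shows "(H1_norm \<omega> f)\<^sup>2 = (L2_norm (lebesgue_on \<omega>) f)\<^sup>2 + (L2_norm (lebesgue_on \<omega>) (G 1))\<^sup>2
    + (L2_norm (lebesgue_on \<omega>) (G 2))\<^sup>2"
proof -
  have W: "weak_grad \<omega> f (\<lambda>i. weak_partial \<omega> i f)"
    using weak_grad_weak_partial G H1_iff by blast
  have "L2_norm (lebesgue_on \<omega>) (weak_partial \<omega> i f) = L2_norm (lebesgue_on \<omega>) (G i)" for i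
    using weak_gradD(2) [OF W] weak_gradD(2) [OF G] weak_grad_unique [OF \<omega> W G]
    by (intro L2_norm_cong_AE) (auto simp: L2_real_iff)
  then show ?thesis
    by (simp add: H1_norm_def sum_2 real_sqrt_pow2 add_nonneg_nonneg)
qed

lemma weak_grad_mono:
  assumes G: "weak_grad \<omega> f G" and sub: "\<omega>' \<subseteq> \<omega>" and op: "open \<omega>" "open \<omega>'"
  shows "weak_grad \<omega>' f G"
proof -
  have m: "\<omega>' \<in> sets lebesgue" "\<omega> \<in> sets lebesgue"
    using op by auto
  have "is_weak_partial \<omega>' i f (G i)" for i
    unfolding is_weak_partial_def
  proof
    fix \<phi> assume \<phi>: "\<phi> \<in> test_functions \<omega>'"
    then have "(LINT x|lebesgue_on \<omega>. f x * partial i \<phi> x) = - (LINT x|lebesgue_on \<omega>. G i x * \<phi> x)"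
      using weak_gradD(3) [OF G, of i] test_functions_mono [OF sub] by (auto simp: is_weak_partial_def)
    moreover have "(LINT x|lebesgue_on \<omega>. f x * partial i \<phi> x) = (LINT x|lebesgue_on \<omega>'. f x * partial i \<phi> x)"
      using test_function_partial_outside [OF \<phi>] by (intro LINT_lebesgue_on_subset sub m) auto
    moreover have "(LINT x|lebesgue_on \<omega>. G i x * \<phi> x) = (LINT x|lebesgue_on \<omega>'. G i x * \<phi> x)"
      using test_function_outside [OF \<phi>] by (intro LINT_lebesgue_on_subset sub m) auto
    ultimately show "(LINT x|lebesgue_on \<omega>'. f x * partial i \<phi> x) = - (LINT x|lebesgue_on \<omega>'. G i x * \<phi> x)"
      by simp
  qed
  then show ?thesis
    using L2_lebesgue_on_mono(1) [OF _ sub m] weak_gradD [OF G] by (auto simp: weak_grad_def)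
qed

lemma weak_grad_cong_AE:
  assumes G: "weak_grad \<omega> f G" and \<omega>: "open \<omega>"
    and f': "f' \<in> borel_measurable (lebesgue_on \<omega>)" "AE x in lebesgue_on \<omega>. f x = f' x"
  shows "weak_grad \<omega> f' G"
proof -
  have "(LINT x|lebesgue_on \<omega>. f x * partial i \<phi> x) = (LINT x|lebesgue_on \<omega>. f' x * partial i \<phi> x)"
    if \<phi>: "\<phi> \<in> test_functions \<omega>" for i \<phi>
  proof (rule integral_cong_AE)
    have "partial i \<phi> \<in> borel_measurable (lebesgue_on \<omega>)"
      using test_function_L2(2) [OF \<phi>] \<omega> by (auto simp: L2_real_iff)
    then show "(\<lambda>x. f x * partial i \<phi> x) \<in> borel_measurable (lebesgue_on \<omega>)"
      "(\<lambda>x. f' x * partial i \<phi> x) \<in> borel_measurable (lebesgue_on \<omega>)"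
      using f'(1) weak_gradD(1) [OF G] by (auto simp: L2_real_iff)
    show "AE x in lebesgue_on \<omega>. f x * partial i \<phi> x = f' x * partial i \<phi> x"
      using f'(2) by eventually_elim simp
  qed
  then show ?thesis
    using G L2_cong_AE [OF weak_gradD(1) [OF G] f'] unfolding weak_grad_def is_weak_partial_def by auto
qed

lemma weak_grad_lincomb:
  assumes F: "weak_grad \<omega> f F" and G: "weak_grad \<omega> g G" and \<omega>: "open \<omega>"
  shows "weak_grad \<omega> (\<lambda>x. a * f x + b * g x) (\<lambda>i x. a * F i x + b * G i x)"
proof -
  have lin: "(LINT x|lebesgue_on \<omega>. (a * p x + b * q x) * \<phi> x)
      = a * (LINT x|lebesgue_on \<omega>. p x * \<phi> x) + b * (LINT x|lebesgue_on \<omega>. q x * \<phi> x)"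
    if "p \<in> L2 (lebesgue_on \<omega>)" "q \<in> L2 (lebesgue_on \<omega>)" "\<phi> \<in> L2 (lebesgue_on \<omega>)" for p q \<phi>
    using L2_mult_integrable [OF that(1,3)] L2_mult_integrable [OF that(2,3)]
    by (simp add: distrib_right mult.assoc)
  have "is_weak_partial \<omega> i (\<lambda>x. a * f x + b * g x) (\<lambda>x. a * F i x + b * G i x)" for i
    unfolding is_weak_partial_def
  proof
    fix \<phi> assume \<phi>: "\<phi> \<in> test_functions \<omega>"
    have \<omega>m: "\<omega> \<in> sets borel"
      using \<omega> by auto
    show "(LINT x|lebesgue_on \<omega>. (a * f x + b * g x) * partial i \<phi> x)
        = - (LINT x|lebesgue_on \<omega>. (a * F i x + b * G i x) * \<phi> x)"
      using weak_gradD(3) [OF F, of i] weak_gradD(3) [OF G, of i] \<phi>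
      by (simp add: lin weak_gradD(1,2) [OF F] weak_gradD(1,2) [OF G] test_function_L2 [OF \<phi> \<omega>m] is_weak_partial_def)
  qed
  then show ?thesis
    using weak_gradD(1,2) [OF F] weak_gradD(1,2) [OF G] by (simp add: weak_grad_def L2_add L2_cmult)
qed

lemma weak_grad_diff:
  assumes F: "weak_grad \<omega> f F" and G: "weak_grad \<omega> g G" and \<omega>: "open \<omega>"
  shows "weak_grad \<omega> (\<lambda>x. f x - g x) (\<lambda>i x. F i x - G i x)"
  using weak_grad_lincomb [OF assms, of 1 "-1"] by simp

text \<open>Translating a compactly supported \<open>\<psi>\<close> does not change its integral; differentiating in the
  translation gives the claim. The translates are written as a mollification of an indicator.\<close>

lemma integral_partial_zero:
  assumes \<psi>: "cont_diff 1 \<psi>" "\<And>x. x \<notin> cball 0 R \<Longrightarrow> \<psi> x = 0"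
  shows "(LINT x|lborel. partial i \<psi> x) = 0"
proof -
  \<comment> \<open>The radius R + 1 makes the indicator equal to 1 on the support of every
    translate of \<psi> by a vector of norm below 1.\<close>
  define f :: "real^2 \<Rightarrow> real" where "f = indicator (cball 0 (R + 1))"
  have f: "integrable lborel f"
    using integrable_real_indicator [of "cball 0 (R + 1)" "lborel :: (real^2) measure"]
      emeasure_bounded_finite [OF bounded_cball, of "0::real^2" "R + 1"] by (simp add: f_def)
  have "mollify (-1) \<psi> f x = (LINT y|lborel. \<psi> y)" if x: "x \<in> ball 0 1" for x
  proof -
    have "mollify (-1) \<psi> f x = (LINT y|lborel. \<psi> (y - (- x)))"
      unfolding mollify_def
    proof (rule Bochner_Integration.integral_cong [OF refl])
      fix y
      show "f y * \<psi> (y - (-1) *\<^sub>R x) = \<psi> (y - (- x))"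
      proof (cases "\<psi> (y + x) = 0")
        case False
        then have "norm (y + x) \<le> R"
          using \<psi>(2) [of "y + x"] by auto
        then have "norm y \<le> R + 1"
          using x norm_triangle_ineq4 [of "y + x" x] by simp
        then show ?thesis
          by (simp add: f_def)
      qed simp
    qed
    also have "\<dots> = (LINT y|lborel. \<psi> y)"
      by (rule integral_lborel_shift(2)) (rule integrable_continuous_compact_support [OF C1_continuous [OF \<psi>(1)] \<psi>(2)])
    finally show ?thesis .
  qed
  then have "(mollify (-1) \<psi> f has_derivative (\<lambda>h. 0)) (at 0)"
    by (rule_tac has_derivative_transform_within_open [of "\<lambda>x. LINT y|lborel. \<psi> y" _ _ _ "ball 0 1"]) auto
  then have "partial i (mollify (-1) \<psi> f) 0 = 0"
    by (simp add: partial_eqI)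
  moreover have "partial i (mollify (-1) \<psi> f) 0 = mollify (-1) (partial i \<psi>) f 0"
    using fun_cong [OF partial_mollify [OF f \<psi>, where i=i and s="-1"], of 0] by simp
  ultimately have "(LINT y|lborel. f y * partial i \<psi> y) = 0"
    by (simp add: mollify_def)
  moreover have "f y * partial i \<psi> y = partial i \<psi> y" for y
    using partial_compact_support [of 0 R \<psi> y i] \<psi>(2) by (cases "y \<in> cball 0 R") (auto simp: f_def indicator_def)
  ultimately show ?thesis
    by simp
qed

text \<open>The product of f with a test function has compact support, so the integral of its
  partial derivative vanishes; the product rule then gives integration by parts without any boundary
  term.\<close>

lemma weak_grad_C1:
  assumes f: "cont_diff 1 f" and \<omega>: "open \<omega>" "bounded \<omega>"
  shows "weak_grad \<omega> f (\<lambda>i. partial i f)"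
proof -
  have \<omega>m: "\<omega> \<in> sets borel" "\<omega> \<in> sets lebesgue"
    using \<omega> by auto
  have L2: "f \<in> L2 (lebesgue_on \<omega>)" "partial i f \<in> L2 (lebesgue_on \<omega>)" for i
    using bounded_continuous_L2 [OF \<omega>(2) \<omega>m(1)] C1_continuous [OF f] C1_partial_continuous [OF f] by blast+
  have "is_weak_partial \<omega> i f (partial i f)" for i
    unfolding is_weak_partial_def
  proof
    fix \<phi> assume \<phi>: "\<phi> \<in> test_functions \<omega>"
    have C1: "cont_diff 1 \<phi>"
      using \<phi> test_function_smooth smooth_imp_C1 by blast
    obtain R where R: "\<And>x. x \<notin> cball 0 R \<Longrightarrow> \<phi> x = 0"
      using test_function_bounded_support [OF \<phi>] by blast
    have C1': "cont_diff 1 (\<lambda>x. f x * \<phi> x)"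
      by (rule cont_diff_mult [OF f C1])
    have eq: "partial i (\<lambda>x. f x * \<phi> x) x = f x * partial i \<phi> x + partial i f x * \<phi> x" for x
      by (rule partial_mult [OF C1_differentiable [OF f] C1_differentiable [OF C1]])
    have "0 = (LINT x|lborel. partial i (\<lambda>x. f x * \<phi> x) x)"
      by (rule integral_partial_zero [OF C1', of R, symmetric]) (simp add: R)
    also have "\<dots> = (LINT x|lborel. indicator \<omega> x * partial i (\<lambda>x. f x * \<phi> x) x)"
      using test_function_outside [OF \<phi>] test_function_partial_outside [OF \<phi>]
      by (intro Bochner_Integration.integral_cong) (auto simp: eq indicator_def)
    also have "\<dots> = (LINT x|lebesgue_on \<omega>. partial i (\<lambda>x. f x * \<phi> x) x)"
      by (rule LINT_lebesgue_on_borel(1) [symmetric]) (use \<omega>m C1_partial_measurable [OF C1'] in auto)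
    also have "\<dots> = (LINT x|lebesgue_on \<omega>. f x * partial i \<phi> x) + (LINT x|lebesgue_on \<omega>. partial i f x * \<phi> x)"
      unfolding eq
      by (intro Bochner_Integration.integral_add L2_mult_integrable L2 test_function_L2 [OF \<phi> \<omega>m(1)])
    finally show "(LINT x|lebesgue_on \<omega>. f x * partial i \<phi> x) = - (LINT x|lebesgue_on \<omega>. partial i f x * \<phi> x)"
      by linarith
  qed
  with L2 show ?thesis
    by (simp add: weak_grad_def)
qed

section \<open>Density of smooth functions and weak curls\<close>

text \<open>At a point of the domain the kernel is a test function, so the derivative can be moved
  from it to f: the gradient of the mollified f is 1 - \<epsilon> times the mollified gradient, the
  factor coming from the contraction. Both f and its gradient therefore converge by
  \<open>mollify_tendsto_L2\<close>, on the whole domain and not only on compact subsets.\<close>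

lemma smooth_dense_weak_grad:
  assumes \<Omega>: "open \<Omega>" "convex \<Omega>" "bounded \<Omega>" and G: "weak_grad \<Omega> f G"
  obtains \<phi> :: "nat \<Rightarrow> real^2 \<Rightarrow> real" where "\<And>n. smooth (\<phi> n)"
    "(\<lambda>n. L2_norm (lebesgue_on \<Omega>) (\<lambda>x. f x - \<phi> n x)) \<longlonglongrightarrow> 0"
    "\<And>i. (\<lambda>n. L2_norm (lebesgue_on \<Omega>) (\<lambda>x. G i x - partial i (\<phi> n) x)) \<longlonglongrightarrow> 0"
proof (cases "\<Omega> = {}")
  case True
  have "L2_norm (lebesgue_on \<Omega>) g = 0" for g :: "real^2 \<Rightarrow> real"
    using True by (simp add: L2_norm_real integral_restrict_space)
  then show thesis
    by (intro that [of "\<lambda>n x. 0"]) (simp_all add: smooth_const)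
next
  case False
  then obtain x0 r where r: "r > 0" "cball x0 r \<subseteq> \<Omega>"
    using \<Omega> open_contains_cball by blast
  let ?M = "lebesgue_on \<Omega>"
  have \<Omega>m: "\<Omega> \<in> sets borel" "\<Omega> \<in> sets lebesgue"
    using \<Omega> by auto
  obtain f' where f': "f' \<in> L2 lborel" "\<And>x. x \<notin> \<Omega> \<Longrightarrow> f' x = 0" "AE x in ?M. f x = f' x"
    using L2_borel_representative [OF weak_gradD(1) [OF G] \<Omega>m(1)] by blast
  have f'i: "integrable lborel f'"
    using L2_bounded_support_integrable f' \<Omega> \<Omega>m by blast
  have "\<exists>g'. g' \<in> L2 lborel \<and> (\<forall>x. x \<notin> \<Omega> \<longrightarrow> g' x = 0) \<and> (AE x in ?M. G i x = g' x)" for i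
    using L2_borel_representative [OF weak_gradD(2) [OF G, of i] \<Omega>m(1)] by metis
  then obtain g' where g': "\<And>i. g' i \<in> L2 lborel" "\<And>i x. x \<notin> \<Omega> \<Longrightarrow> g' i x = 0" "\<And>i. AE x in ?M. G i x = g' i x"
    by metis
  have g'i: "integrable lborel (g' i)" for i
    using L2_bounded_support_integrable [OF g'(1,2)] \<Omega> \<Omega>m by blast
  obtain \<epsilon> \<eta> where \<epsilon>: "\<And>n. 0 < \<epsilon> n" "\<And>n. \<epsilon> n \<le> 1/2" "\<epsilon> \<longlonglongrightarrow> 0" and
    \<eta>: "\<And>n. smooth (\<eta> n)" "\<And>n x. 0 \<le> \<eta> n x" "\<And>n x. \<eta> n x \<noteq> 0 \<Longrightarrow> norm x \<le> \<epsilon> n * (norm x0 + r)"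
    "\<And>n. (LINT x|lborel. \<eta> n x) = 1" "\<And>n x. \<eta> n x \<noteq> 0 \<Longrightarrow> x \<in> cball (\<epsilon> n *\<^sub>R x0) (\<epsilon> n * r)"
    using mollifier_family [OF r(1), of x0] by blast
  have \<eta>supp: "x \<notin> cball (\<epsilon> n *\<^sub>R x0) (\<epsilon> n * r) \<Longrightarrow> \<eta> n x = 0" for x n
    using \<eta>(5) by blast
  define \<phi> where "\<phi> n = mollify (1 - \<epsilon> n) (\<eta> n) f'" for n
  have sm: "smooth (mollify (1 - \<epsilon> n) (\<eta> n) h)" if "integrable lborel h" for h n
    by (rule smooth_mollify [OF that \<eta>(1) \<eta>supp])
  have meas: "h \<in> borel_measurable ?M" if "smooth h" for h
    using borel_measurable_lebesgue_on C1_measurable smooth_imp_C1 that by blast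
  have partial_\<phi>: "partial i (\<phi> n) x = (1 - \<epsilon> n) * mollify (1 - \<epsilon> n) (\<eta> n) (g' i) x" if x: "x \<in> \<Omega>" for i n x
  proof -
    let ?\<psi> = "\<lambda>y. \<eta> n (y - (1 - \<epsilon> n) *\<^sub>R x)"
    have \<psi>: "?\<psi> \<in> test_functions \<Omega>"
      using mollifier_test_function [OF \<Omega>(2) r(2,1) \<epsilon>(1,2) \<eta>(1) \<eta>(5) x] .
    have C1: "cont_diff 1 ?\<psi>"
      using test_function_smooth [OF \<psi>] smooth_imp_C1 by blast
    have p\<psi>: "partial i ?\<psi> = (\<lambda>y. partial i (\<eta> n) (y - (1 - \<epsilon> n) *\<^sub>R x))"
      by (rule partial_translate) (rule C1_differentiable [OF smooth_imp_C1 [OF \<eta>(1)]])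
    have "mollify (1 - \<epsilon> n) (partial i (\<eta> n)) f' x = (LINT y|lborel. f' y * partial i ?\<psi> y)"
      by (simp add: mollify_def p\<psi>)
    also have "\<dots> = (LINT y|?M. f y * partial i ?\<psi> y)"
      by (rule LINT_borel_representative [symmetric])
         (use f' weak_gradD(1) [OF G] \<Omega>m C1_partial_measurable [OF C1] in \<open>simp_all add: L2_real_iff\<close>)
    also have "\<dots> = - (LINT y|?M. G i y * ?\<psi> y)"
      using weak_gradD(3) [OF G, of i] \<psi> by (simp add: is_weak_partial_def)
    also have "(LINT y|?M. G i y * ?\<psi> y) = mollify (1 - \<epsilon> n) (\<eta> n) (g' i) x"
      unfolding mollify_def
      by (rule LINT_borel_representative)
         (use g' weak_gradD(2) [OF G] \<Omega>m C1_measurable [OF C1] in \<open>simp_all add: L2_real_iff\<close>)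
    finally have "mollify (1 - \<epsilon> n) (partial i (\<eta> n)) f' x = - mollify (1 - \<epsilon> n) (\<eta> n) (g' i) x" .
    moreover have "partial i (mollify (1 - \<epsilon> n) (\<eta> n) f')
        = (\<lambda>x. - (1 - \<epsilon> n) * mollify (1 - \<epsilon> n) (partial i (\<eta> n)) f' x)"
      by (rule partial_mollify [OF f'i smooth_imp_C1 [OF \<eta>(1)] \<eta>supp])
    ultimately show ?thesis
      unfolding \<phi>_def by (simp add: left_diff_distrib)
  qed
  show thesis
  proof (rule that)
    show "smooth (\<phi> n)" for n
      unfolding \<phi>_def by (rule sm [OF f'i])
    have "(\<lambda>n. L2_norm ?M (\<lambda>x. f' x - \<phi> n x)) \<longlonglongrightarrow> 0"
      unfolding \<phi>_def by (rule mollify_tendsto_L2 [OF f'(1) f'i \<Omega>(3,1) \<epsilon> \<eta>(1-4)])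
    moreover have "L2_norm ?M (\<lambda>x. f x - \<phi> n x) = L2_norm ?M (\<lambda>x. f' x - \<phi> n x)" for n
      using f' weak_gradD(1) [OF G] meas [OF sm [OF f'i]] L2_lebesgue_on_borel(1) [OF f'(1) \<Omega>m(1)]
      by (intro L2_norm_cong_AE) (auto simp: L2_real_iff \<phi>_def)
    ultimately show "(\<lambda>n. L2_norm ?M (\<lambda>x. f x - \<phi> n x)) \<longlonglongrightarrow> 0"
      by simp
    fix i
    let ?m = "\<lambda>n. mollify (1 - \<epsilon> n) (\<eta> n) (g' i)"
    have g'L: "g' i \<in> L2 ?M"
      using L2_lebesgue_on_borel(1) [OF g'(1) \<Omega>m(1)] .
    have mL: "?m n \<in> L2 ?M" for n
      using bounded_continuous_L2 [OF \<Omega>(3) \<Omega>m(1) C1_continuous [OF smooth_imp_C1 [OF sm [OF g'i]]]] .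
    have lim: "(\<lambda>n. L2_norm ?M (\<lambda>x. g' i x - ?m n x)) \<longlonglongrightarrow> 0"
      by (rule mollify_tendsto_L2 [OF g'(1) g'i \<Omega>(3,1) \<epsilon> \<eta>(1-4)])
    show "(\<lambda>n. L2_norm ?M (\<lambda>x. G i x - partial i (\<phi> n) x)) \<longlonglongrightarrow> 0"
    proof (rule tendsto_sandwich [OF _ _ tendsto_const])
      have "(\<lambda>n. L2_norm ?M (\<lambda>x. g' i x - ?m n x) + \<epsilon> n * L2_norm ?M (g' i)) \<longlonglongrightarrow> 0 + 0 * L2_norm ?M (g' i)"
        by (intro tendsto_intros lim \<epsilon>)
      then show "(\<lambda>n. L2_norm ?M (\<lambda>x. g' i x - ?m n x) + \<epsilon> n * L2_norm ?M (g' i)) \<longlonglongrightarrow> 0"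
        by simp
      have "L2_norm ?M (\<lambda>x. G i x - partial i (\<phi> n) x)
          \<le> L2_norm ?M (\<lambda>x. g' i x - ?m n x) + \<epsilon> n * L2_norm ?M (g' i)" for n
      proof -
        have p: "partial i (\<phi> n) \<in> borel_measurable ?M"
          using meas [OF smooth_partial [OF sm [OF f'i]]] by (simp add: \<phi>_def)
        have "L2_norm ?M (\<lambda>x. G i x - partial i (\<phi> n) x) = L2_norm ?M (\<lambda>x. g' i x - partial i (\<phi> n) x)"
        proof (rule L2_norm_cong_AE)
          show "(\<lambda>x. G i x - partial i (\<phi> n) x) \<in> borel_measurable ?M" "(\<lambda>x. g' i x - partial i (\<phi> n) x) \<in> borel_measurable ?M"
            using L2_measurable [OF weak_gradD(2) [OF G]] L2_measurable [OF g'L] p by (intro borel_measurable_diff; simp)+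
          show "AE x in ?M. G i x - partial i (\<phi> n) x = g' i x - partial i (\<phi> n) x"
            using g'(3) [of i] by eventually_elim simp
        qed
        also have "\<dots> = L2_norm ?M (\<lambda>x. (1 - \<epsilon> n) * (g' i x - ?m n x) + \<epsilon> n * g' i x)"
        proof -
          have "(LINT x|?M. (g' i x - partial i (\<phi> n) x)\<^sup>2) = (LINT x|?M. ((1 - \<epsilon> n) * (g' i x - ?m n x) + \<epsilon> n * g' i x)\<^sup>2)"
            by (rule Bochner_Integration.integral_cong) (simp_all add: partial_\<phi> algebra_simps)
          then show ?thesis
            by (simp add: L2_norm_real)
        qed
        also have "\<dots> \<le> L2_norm ?M (\<lambda>x. (1 - \<epsilon> n) * (g' i x - ?m n x)) + L2_norm ?M (\<lambda>x. \<epsilon> n * g' i x)"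
          by (rule L2_norm_triangle [OF L2_cmult [OF L2_diff [OF g'L mL]] L2_cmult [OF g'L]])
        also have "\<dots> = \<bar>1 - \<epsilon> n\<bar> * L2_norm ?M (\<lambda>x. g' i x - ?m n x) + \<bar>\<epsilon> n\<bar> * L2_norm ?M (g' i)"
          by (simp add: L2_norm_cmult)
        also have "\<dots> \<le> 1 * L2_norm ?M (\<lambda>x. g' i x - ?m n x) + \<epsilon> n * L2_norm ?M (g' i)"
          using \<epsilon>(1,2) [of n] by (intro add_mono mult_right_mono) auto
        finally show ?thesis
          by simp
      qed
      then show "\<forall>\<^sub>F n in sequentially. L2_norm ?M (\<lambda>x. G i x - partial i (\<phi> n) x)
          \<le> L2_norm ?M (\<lambda>x. g' i x - ?m n x) + \<epsilon> n * L2_norm ?M (g' i)"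
        by simp
    qed simp
  qed
qed

lemma weak_curl_unique:
  assumes \<omega>: "open \<omega>" and w: "w \<in> L2 (lebesgue_on \<omega>)" "w' \<in> L2 (lebesgue_on \<omega>)"
    and "is_weak_curl \<omega> v w" "is_weak_curl \<omega> v w'"
  shows "AE x in lebesgue_on \<omega>. w x = w' x"
proof -
  have "AE x in lebesgue_on \<omega>. w x - w' x = 0"
  proof (rule fundamental_lemma [OF \<omega> L2_diff [OF w]])
    fix \<phi> assume \<phi>: "\<phi> \<in> test_functions \<omega>"
    have \<phi>L2: "\<phi> \<in> L2 (lebesgue_on \<omega>)"
      using test_function_L2 [OF \<phi>] \<omega> by auto
    show "(LINT x|lebesgue_on \<omega>. (w x - w' x) * \<phi> x) = 0"
      using L2_mult_integrable [OF w(1) \<phi>L2] L2_mult_integrable [OF w(2) \<phi>L2] assms(4,5) \<phi>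
      by (simp add: left_diff_distrib is_weak_curl_def)
  qed
  then show ?thesis
    by eventually_elim simp
qed

lemma is_weak_curl_weak_grad:
  assumes \<omega>: "open \<omega>" and G: "\<And>i. weak_grad \<omega> (\<lambda>x. v x $ i) (G i)"
  shows "is_weak_curl \<omega> v (\<lambda>x. G 2 1 x - G 1 2 x)"
  unfolding is_weak_curl_def
proof
  fix \<phi> assume \<phi>: "\<phi> \<in> test_functions \<omega>"
  have \<omega>m: "\<omega> \<in> sets borel"
    using \<omega> by auto
  note int = L2_mult_integrable [OF weak_gradD(1) [OF G] test_function_L2(2) [OF \<phi> \<omega>m]]
    L2_mult_integrable [OF weak_gradD(2) [OF G] test_function_L2(1) [OF \<phi> \<omega>m]]
  have "(LINT x|lebesgue_on \<omega>. v x $ 1 * partial 2 \<phi> x - v x $ 2 * partial 1 \<phi> x)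
      = - (LINT x|lebesgue_on \<omega>. G 1 2 x * \<phi> x) + (LINT x|lebesgue_on \<omega>. G 2 1 x * \<phi> x)"
    using weak_gradD(3) [OF G, of 1 2] weak_gradD(3) [OF G, of 2 1] \<phi>
    by (simp add: int is_weak_partial_def)
  then show "(LINT x|lebesgue_on \<omega>. (G 2 1 x - G 1 2 x) * \<phi> x)
      = (LINT x|lebesgue_on \<omega>. v x $ 1 * partial 2 \<phi> x - v x $ 2 * partial 1 \<phi> x)"
    by (simp add: int left_diff_distrib)
qed

section \<open>The mean over an edge of a triangle\<close>

text \<open>Twice the signed area of the triangle a b c, positive if the vertices are in
  counterclockwise order. Replacing one vertex by x gives the corresponding barycentric coordinate
  of x, up to the factor \<open>orient a b c\<close>.\<close>

definition orient :: "real^2 \<Rightarrow> real^2 \<Rightarrow> real^2 \<Rightarrow> real" where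
  "orient a b c = (b $ 1 - a $ 1) * (c $ 2 - a $ 2) - (b $ 2 - a $ 2) * (c $ 1 - a $ 1)"

lemma orient_cycle: "orient b c a = orient a b c" "orient c a b = orient a b c"
  and orient_swap: "orient b a c = - orient a b c" "orient a c b = - orient a b c"
  by (simp_all add: orient_def algebra_simps)

lemma orient_degenerate [simp]: "orient a a b = 0" "orient a b a = 0" "orient b a a = 0"
  by (simp_all add: orient_def)

lemma orient_barycentric_sum: "orient x b c + orient a x c + orient a b x = orient a b c"
  by (simp add: orient_def algebra_simps)

lemma orient_barycentric:
  "orient x b c *\<^sub>R a + orient a x c *\<^sub>R b + orient a b x *\<^sub>R c = orient a b c *\<^sub>R x"
  by (simp add: orient_def vec_eq_iff forall_2 algebra_simps)

lemma orient_convex_combination: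
  assumes "u + v + w = 1"
  shows "orient (u *\<^sub>R a + v *\<^sub>R b + w *\<^sub>R c) b c = u * orient a b c"
    "orient a (u *\<^sub>R a + v *\<^sub>R b + w *\<^sub>R c) c = v * orient a b c"
    "orient a b (u *\<^sub>R a + v *\<^sub>R b + w *\<^sub>R c) = w * orient a b c"
proof -
  have u: "u = 1 - v - w"
    using assms by simp
  show "orient (u *\<^sub>R a + v *\<^sub>R b + w *\<^sub>R c) b c = u * orient a b c"
    "orient a (u *\<^sub>R a + v *\<^sub>R b + w *\<^sub>R c) c = v * orient a b c"
    "orient a b (u *\<^sub>R a + v *\<^sub>R b + w *\<^sub>R c) = w * orient a b c"
    unfolding u orient_def by (simp_all add: algebra_simps)
qed

definition triangle :: "real^2 \<Rightarrow> real^2 \<Rightarrow> real^2 \<Rightarrow> (real^2) set" where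
  "triangle a b c = interior (convex hull {a, b, c})"

lemma collinear_imp_orient_0: "collinear {a, b, c} \<Longrightarrow> orient a b c = 0"
proof -
  assume "collinear {a, b, c}"
  then obtain u where u: "\<And>x y. x \<in> {a, b, c} \<Longrightarrow> y \<in> {a, b, c} \<Longrightarrow> \<exists>t. x - y = t *\<^sub>R u"
    unfolding collinear_def by blast
  obtain s t where "b - a = s *\<^sub>R u" "c - a = t *\<^sub>R u"
    using u [of b a] u [of c a] by auto
  then have "b $ i - a $ i = s * u $ i" "c $ i - a $ i = t * u $ i" for i
    by (simp_all add: vec_eq_iff)
  then show "orient a b c = 0"
    by (simp add: orient_def)
qed

lemma triangle_eq:
  assumes "orient a b c \<noteq> 0"
  shows "triangle a b c = {x. \<exists>u v w. 0 < u \<and> 0 < v \<and> 0 < w \<and> u + v + w = 1 \<and> u *\<^sub>R a + v *\<^sub>R b + w *\<^sub>R c = x}"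
  unfolding triangle_def using assms collinear_imp_orient_0
  by (intro interior_convex_hull_3_minimal) auto

lemma mem_triangleI:
  assumes "orient a b c \<noteq> 0" "0 < u" "0 < v" "0 < w" "u + v + w = 1" "u *\<^sub>R a + v *\<^sub>R b + w *\<^sub>R c = x"
  shows "x \<in> triangle a b c"
  using assms unfolding triangle_eq [OF assms(1)] by blast

lemma mem_triangle_iff:
  assumes "orient a b c > 0"
  shows "x \<in> triangle a b c \<longleftrightarrow> 0 < orient x b c \<and> 0 < orient a x c \<and> 0 < orient a b x"
proof
  assume "x \<in> triangle a b c"
  then show "0 < orient x b c \<and> 0 < orient a x c \<and> 0 < orient a b x"
    using assms by (auto simp: triangle_eq orient_convex_combination)
next
  let ?D = "orient a b c"
  assume "0 < orient x b c \<and> 0 < orient a x c \<and> 0 < orient a b x"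
  moreover have "orient x b c / ?D + orient a x c / ?D + orient a b x / ?D = 1"
    using assms orient_barycentric_sum [of x b c a] by (simp flip: add_divide_distrib)
  moreover have "(orient x b c / ?D) *\<^sub>R a + (orient a x c / ?D) *\<^sub>R b + (orient a b x / ?D) *\<^sub>R c = x"
  proof -
    have "(1 / ?D) *\<^sub>R (orient x b c *\<^sub>R a + orient a x c *\<^sub>R b + orient a b x *\<^sub>R c) = x"
      using assms by (simp add: orient_barycentric)
    then show ?thesis
      by (simp add: scaleR_add_right)
  qed
  ultimately show "x \<in> triangle a b c"
    using assms by (intro mem_triangleI [of a b c "orient x b c / ?D" "orient a x c / ?D" "orient a b x / ?D"]) auto
qed

lemma mem_hull_iff:
  assumes "orient a b c > 0"
  shows "x \<in> convex hull {a, b, c} \<longleftrightarrow> 0 \<le> orient x b c \<and> 0 \<le> orient a x c \<and> 0 \<le> orient a b x"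
proof
  assume "x \<in> convex hull {a, b, c}"
  then show "0 \<le> orient x b c \<and> 0 \<le> orient a x c \<and> 0 \<le> orient a b x"
    using assms by (auto simp: convex_hull_3 orient_convex_combination)
next
  let ?D = "orient a b c"
  assume "0 \<le> orient x b c \<and> 0 \<le> orient a x c \<and> 0 \<le> orient a b x"
  moreover have "orient x b c / ?D + orient a x c / ?D + orient a b x / ?D = 1"
    using assms orient_barycentric_sum [of x b c a] by (simp flip: add_divide_distrib)
  moreover have "x = (orient x b c / ?D) *\<^sub>R a + (orient a x c / ?D) *\<^sub>R b + (orient a b x / ?D) *\<^sub>R c"
  proof -
    have "(1 / ?D) *\<^sub>R (orient x b c *\<^sub>R a + orient a x c *\<^sub>R b + orient a b x *\<^sub>R c) = x"
      using assms by (simp add: orient_barycentric)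
    then show ?thesis
      by (simp add: scaleR_add_right)
  qed
  ultimately show "x \<in> convex hull {a, b, c}"
    using assms unfolding convex_hull_3
    by (intro CollectI exI [of _ "orient x b c / ?D"] exI [of _ "orient a x c / ?D"]
        exI [of _ "orient a b x / ?D"]) simp
qed

lemma triangle_perm: "triangle a b c = triangle b c a" "triangle a b c = triangle b a c"
  "triangle a b c = triangle a c b"
  by (simp_all add: triangle_def insert_commute)

lemma open_triangle [simp]: "open (triangle a b c)"
  and convex_triangle [simp]: "convex (triangle a b c)"
  and bounded_triangle [simp]: "bounded (triangle a b c)"
  by (simp_all add: triangle_def convex_interior bounded_subset [OF _ interior_subset] bounded_convex_hull)

lemma triangle_measurable [simp]: "triangle a b c \<in> sets borel" "triangle a b c \<in> sets lebesgue"
  using open_triangle [of a b c] by (auto simp del: open_triangle)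

section \<open>Integration over a triangle along rays from a vertex\<close>

text \<open>Lebesgue measure is determined by its values on boxes. Writing it as the image of a
  product measure makes Fubini's theorem applicable to the two coordinates.\<close>

lemma lborel_vec2:
  "distr (lborel \<Otimes>\<^sub>M lborel) borel (\<lambda>p. vector [fst p, snd p] :: real^2) = lborel"
proof (rule lborel_eqI [symmetric])
  have meas: "(\<lambda>p :: real \<times> real. vector [fst p, snd p] :: real^2) \<in> borel_measurable (lborel \<Otimes>\<^sub>M lborel)"
  proof (subst borel_measurable_vec2_iff, rule allI)
    fix i :: 2
    show "(\<lambda>p :: real \<times> real. (vector [fst p, snd p] :: real^2) $ i) \<in> borel_measurable (lborel \<Otimes>\<^sub>M lborel)"
      using exhaust_2 [of i] by auto
  qed
  show "sets (distr (lborel \<Otimes>\<^sub>M lborel) borel (\<lambda>p. vector [fst p, snd p] :: real^2)) = sets borel"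
    by simp
  fix l u :: "real^2"
  assume "\<And>b. b \<in> Basis \<Longrightarrow> l \<bullet> b \<le> u \<bullet> b"
  then have le: "l $ i \<le> u $ i" for i
    by (force simp: Basis_vec_def inner_axis)
  have Basis: "(Basis :: (real^2) set) = {axis 1 1, axis 2 1}"
    using exhaust_2 by (auto simp: Basis_vec_def) metis
  have "(axis 1 1 :: real^2) \<noteq> axis 2 1"
    by (simp add: axis_eq_axis)
  then have prod: "(\<Prod>b\<in>Basis. (u - l) \<bullet> b) = (u $ 1 - l $ 1) * (u $ 2 - l $ 2)"
    by (simp add: Basis inner_axis)
  have "(\<lambda>p. vector [fst p, snd p] :: real^2) -` box l u \<inter> space (lborel \<Otimes>\<^sub>M lborel)
      = {l $ 1<..<u $ 1} \<times> {l $ 2<..<u $ 2}"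
    by (auto simp: mem_box_cart forall_2 space_pair_measure)
  then have "emeasure (distr (lborel \<Otimes>\<^sub>M lborel) borel (\<lambda>p. vector [fst p, snd p] :: real^2)) (box l u)
      = emeasure (lborel \<Otimes>\<^sub>M lborel) ({l $ 1<..<u $ 1} \<times> {l $ 2<..<u $ 2})"
    using meas by (subst emeasure_distr) auto
  also have "\<dots> = ennreal ((u $ 1 - l $ 1) * (u $ 2 - l $ 2))"
    using le by (subst lborel.emeasure_pair_measure_Times) (auto simp: ennreal_mult)
  finally show "emeasure (distr (lborel \<Otimes>\<^sub>M lborel) borel (\<lambda>p. vector [fst p, snd p] :: real^2)) (box l u)
      = ennreal (\<Prod>b\<in>Basis. (u - l) \<bullet> b)"
    unfolding prod .
qed

lemma LINT_Icc_Ioo: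
  fixes f :: "real \<Rightarrow> real"
  assumes "f \<in> borel_measurable borel"
  shows "(LINT t|lborel. indicator {0<..<1} t * f t) = (LINT t|lborel. indicator {0..1} t * f t)"
proof (rule integral_cong_AE)
  have "AE t in lborel. t \<noteq> (0::real)" "AE t in lborel. t \<noteq> (1::real)"
    by (rule AE_lborel_singleton)+
  then show "AE t in lborel. indicator {0<..<1} t * f t = indicator {0..1} t * f t"
    by eventually_elim (auto simp: indicator_def)
qed (use assms in measurable)

lemma integral_unit_box:
  fixes h :: "real^2 \<Rightarrow> real"
  assumes h: "continuous_on UNIV h"
  shows "(LINT p|lebesgue_on (box 0 1). h p)
    = (LINT s|lborel. indicator {0..1} s * (LINT t|lborel. indicator {0..1} t * h (vector [t, s])))"
proof -
  have [measurable]: "h \<in> borel_measurable borel"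
    by (rule borel_measurable_continuous_onI [OF h])
  let ?v = "\<lambda>p :: real \<times> real. vector [fst p, snd p] :: real^2"
  have [measurable]: "?v \<in> borel_measurable (lborel \<Otimes>\<^sub>M lborel)"
  proof (subst borel_measurable_vec2_iff, rule allI)
    fix i :: 2
    show "(\<lambda>p. ?v p $ i) \<in> borel_measurable (lborel \<Otimes>\<^sub>M lborel)"
      using exhaust_2 [of i] by auto
  qed
  define k where "k x = indicator (box 0 1) x * h x" for x
  have [measurable]: "k \<in> borel_measurable borel"
    unfolding k_def by measurable
  have "integrable (lebesgue_on (box 0 1)) h"
    using L2_integrable [OF finite_measure_lebesgue_on bounded_continuous_L2 [OF _ _ h]] by simp
  then have ki: "integrable lborel k"
    unfolding k_def using LINT_lebesgue_on_borel(2) [of h "box 0 1"] by simp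
  then have ki': "integrable (lborel \<Otimes>\<^sub>M lborel) (\<lambda>p. k (?v p))"
    by (subst (asm) lborel_vec2 [symmetric], subst (asm) integrable_distr_eq) auto
  have kv: "k (vector [t, s]) = indicator {0<..<1} s * (indicator {0<..<1} t * h (vector [t, s]))" for t s
    by (auto simp: k_def indicator_def mem_box_cart forall_2)
  have "(LINT p|lebesgue_on (box 0 1). h p) = (LINT x|lborel. k x)"
    unfolding k_def by (rule LINT_lebesgue_on_borel) auto
  also have "\<dots> = (LINT p|(lborel \<Otimes>\<^sub>M lborel). k (?v p))"
    by (subst lborel_vec2 [symmetric], subst integral_distr) auto
  also have "\<dots> = (LINT s|lborel. LINT t|lborel. k (vector [t, s]))"
    using lborel_pair.integral_snd [of "\<lambda>t s. k (vector [t, s])"] ki' by (simp add: case_prod_unfold)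
  also have "\<dots> = (LINT s|lborel. indicator {0<..<1} s * (LINT t|lborel. indicator {0..1} t * h (vector [t, s])))"
  proof (rule Bochner_Integration.integral_cong [OF refl])
    fix s :: real
    have "(\<lambda>t. h (vector [t, s])) \<in> borel_measurable borel"
    proof -
      have "(\<lambda>t. vector [t, s] :: real^2) \<in> borel_measurable borel"
      proof (subst borel_measurable_vec2_iff, rule allI)
        fix i :: 2
        show "(\<lambda>t. (vector [t, s] :: real^2) $ i) \<in> borel_measurable borel"
          using exhaust_2 [of i] by auto
      qed
      then show ?thesis
        by measurable
    qed
    then show "(LINT t|lborel. k (vector [t, s])) = indicator {0<..<1} s * (LINT t|lborel. indicator {0..1} t * h (vector [t, s]))"
      by (simp add: kv LINT_Icc_Ioo)
  qed
  also have "\<dots> = (LINT s|lborel. indicator {0..1} s * (LINT t|lborel. indicator {0..1} t * h (vector [t, s])))"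
  proof (rule LINT_Icc_Ioo)
    have "(\<lambda>p. indicator {0..1} (snd p) * h (vector [snd p, fst p])) \<in> borel_measurable (lborel \<Otimes>\<^sub>M lborel)"
    proof -
      have "(\<lambda>p :: real \<times> real. vector [snd p, fst p] :: real^2) \<in> borel_measurable (lborel \<Otimes>\<^sub>M lborel)"
      proof (subst borel_measurable_vec2_iff, rule allI)
        fix i :: 2
        show "(\<lambda>p :: real \<times> real. (vector [snd p, fst p] :: real^2) $ i) \<in> borel_measurable (lborel \<Otimes>\<^sub>M lborel)"
          using exhaust_2 [of i] by auto
      qed
      then show ?thesis
        by measurable
    qed
    then have "(\<lambda>(s, t). indicator {0..1} t * h (vector [t, s])) \<in> borel_measurable (lborel \<Otimes>\<^sub>M lborel)"
      by (simp add: case_prod_unfold)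
    from lborel.borel_measurable_lebesgue_integral [OF this]
    show "(\<lambda>s. LINT t|lborel. indicator {0..1} t * h (vector [t, s])) \<in> borel_measurable borel"
      by simp
  qed
  finally show ?thesis .
qed

text \<open>The coordinates are s, the position of a point on the edge a b, and t, the fraction of
  the ray from d to that point. They map the open unit square bijectively onto the open triangle,
  with Jacobian t times \<open>orient d a b\<close>.\<close>

lemma integral_triangle:
  fixes g :: "real^2 \<Rightarrow> real"
  assumes D: "orient d a b \<noteq> 0" and g: "continuous_on UNIV g"
  shows "(LINT x|lebesgue_on (triangle d a b). g x) = \<bar>orient d a b\<bar> *
    (LINT s|lborel. indicator {0..1} s * (LINT t|lborel. indicator {0..1} t * (t * g (d + t *\<^sub>R (linepath a b s - d)))))"
proof -
  define \<Phi> :: "real^2 \<Rightarrow> real^2" where "\<Phi> p = d + (p $ 1) *\<^sub>R (a - d) + (p $ 1 * p $ 2) *\<^sub>R (b - a)" for p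
  define \<Phi>' where "\<Phi>' p h = (h $ 1) *\<^sub>R (a - d) + (h $ 1 * p $ 2 + p $ 1 * h $ 2) *\<^sub>R (b - a)" for p h :: "real^2"
  have der: "(\<Phi> has_derivative \<Phi>' p) (at p within S)" for p S
    unfolding \<Phi>_def \<Phi>'_def
    by (rule derivative_eq_intros bounded_linear.has_derivative [OF bounded_linear_vec_nth] refl)+
       (auto simp: fun_eq_iff algebra_simps)
  have det: "det (matrix (\<Phi>' p)) = p $ 1 * orient d a b" for p
    by (simp add: det_2 matrix_def \<Phi>'_def axis_def orient_def algebra_simps)
  have bary: "\<Phi> p = (1 - p $ 1) *\<^sub>R d + (p $ 1 * (1 - p $ 2)) *\<^sub>R a + (p $ 1 * p $ 2) *\<^sub>R b" for p
    by (simp add: \<Phi>_def algebra_simps)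
  have unbary: "orient (\<Phi> p) a b = (1 - p $ 1) * orient d a b" "orient d a (\<Phi> p) = (p $ 1 * p $ 2) * orient d a b" for p
    unfolding bary by (rule orient_convex_combination, simp add: algebra_simps)+
  have inj: "inj_on \<Phi> (box 0 1)"
  proof (rule inj_onI)
    fix p q assume p: "p \<in> box 0 1" and q: "q \<in> box 0 1" and eq: "\<Phi> p = \<Phi> q"
    have "p $ 1 = q $ 1"
      using unbary(1) [of p] unbary(1) [of q] eq D by simp
    moreover have "p $ 1 * p $ 2 = q $ 1 * q $ 2"
      using unbary(2) [of p] unbary(2) [of q] eq D by simp
    ultimately show "p = q"
      using p by (auto simp: vec_eq_iff forall_2 mem_box_cart)
  qed
  have img: "\<Phi> ` box 0 1 = triangle d a b"
  proof (intro equalityI subsetI)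
    fix x assume "x \<in> \<Phi> ` box 0 1"
    then obtain p where "p \<in> box 0 1" "x = \<Phi> p"
      by blast
    then show "x \<in> triangle d a b"
      by (intro mem_triangleI [OF D, of "1 - p $ 1" "p $ 1 * (1 - p $ 2)" "p $ 1 * p $ 2"])
         (simp_all add: bary mem_box_cart forall_2 algebra_simps)
  next
    fix x assume "x \<in> triangle d a b"
    then obtain u v w where uvw: "0 < u" "0 < v" "0 < w" "u + v + w = 1" "x = u *\<^sub>R d + v *\<^sub>R a + w *\<^sub>R b"
      unfolding triangle_eq [OF D] by blast
    \<comment> \<open>The inverse map: the barycentric weights of a and b add up to t, and s is the
      share of b in that sum.\<close>
    let ?p = "vector [v + w, w / (v + w)] :: real^2"
    have u: "u = 1 - (v + w)"
      using uvw by simp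
    have "(v + w) * (1 - w / (v + w)) = v" "(v + w) * (w / (v + w)) = w"
      using uvw by (simp_all add: field_simps)
    then have "\<Phi> ?p = x"
      unfolding bary uvw(5) u by simp
    moreover have "?p \<in> box 0 1"
      using uvw by (simp add: mem_box_cart forall_2)
    ultimately show "x \<in> \<Phi> ` box 0 1"
      by blast
  qed
  \<comment> \<open>The change of variables is applied to a vector-valued integrand; g is repeated
    in both components and the first one is read off afterwards.\<close>
  define f :: "real^2 \<Rightarrow> real^2" where "f x = (\<chi> i. g x)" for x
  have cont\<Phi>: "continuous_on UNIV \<Phi>"
    unfolding \<Phi>_def by (intro continuous_intros)
  define h where "h p = \<bar>det (matrix (\<Phi>' p))\<bar> * g (\<Phi> p)" for p
  have conth: "continuous_on UNIV h"
    unfolding h_def det by (intro continuous_intros continuous_on_compose2 [OF g cont\<Phi>]) auto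
  have hint: "integrable (lebesgue_on (box 0 1)) h"
    using L2_integrable [OF finite_measure_lebesgue_on bounded_continuous_L2 [OF _ _ conth]] by simp
  have gint: "integrable (lebesgue_on (triangle d a b)) g"
    using L2_integrable [OF finite_measure_lebesgue_on bounded_continuous_L2 [OF _ _ g]] by simp
  have abs: "k absolutely_integrable_on S" if "integrable (lebesgue_on S) k" "S \<in> sets lebesgue" for k :: "real^2 \<Rightarrow> real" and S
    using that by (simp add: set_integrable_def integrable_restrict_space)
  have "f absolutely_integrable_on triangle d a b"
    using abs [OF gint] by (simp add: absolutely_integrable_on_iff_component f_def)
  with has_absolute_integral_change_of_variables [of "box 0 1" \<Phi> \<Phi>' f "integral (triangle d a b) f"] der inj
  have cov: "(\<lambda>x. \<bar>det (matrix (\<Phi>' x))\<bar> *\<^sub>R f (\<Phi> x)) absolutely_integrable_on box 0 1"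
    "integral (box 0 1) (\<lambda>x. \<bar>det (matrix (\<Phi>' x))\<bar> *\<^sub>R f (\<Phi> x)) = integral (triangle d a b) f"
    by (simp_all add: img)
  have "integral (box 0 1) h = integral (box 0 1) (\<lambda>x. \<bar>det (matrix (\<Phi>' x))\<bar> *\<^sub>R f (\<Phi> x)) $ 1"
    using integral_component_eq_cart [of "\<lambda>x. \<bar>det (matrix (\<Phi>' x))\<bar> *\<^sub>R f (\<Phi> x)" "box 0 1" 1]
      set_lebesgue_integral_eq_integral(1) [OF cov(1)] by (simp add: h_def [abs_def] f_def)
  also have "\<dots> = integral (triangle d a b) g"
    using integral_component_eq_cart [of f "triangle d a b" 1]
      set_lebesgue_integral_eq_integral(1) [OF \<open>f absolutely_integrable_on triangle d a b\<close>]
    by (simp only: cov(2)) (simp add: f_def)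
  finally have "(LINT x|lebesgue_on (triangle d a b). g x) = (LINT p|lebesgue_on (box 0 1). h p)"
    using hint gint by (simp add: lebesgue_integral_eq_integral)
  also have "\<dots> = (LINT s|lborel. indicator {0..1} s * (LINT t|lborel. indicator {0..1} t * h (vector [t, s])))"
    by (rule integral_unit_box [OF conth])
  also have "\<dots> = (LINT s|lborel. \<bar>orient d a b\<bar> * (indicator {0..1} s *
      (LINT t|lborel. indicator {0..1} t * (t * g (d + t *\<^sub>R (linepath a b s - d))))))"
  proof (rule Bochner_Integration.integral_cong [OF refl])
    fix s :: real
    have eq: "(\<lambda>t. indicator {0..1} t * h (vector [t, s]))
        = (\<lambda>t. \<bar>orient d a b\<bar> * (indicator {0..1} t * (t * g (d + t *\<^sub>R (linepath a b s - d)))))"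
    proof
      fix t :: real
      have "\<Phi> (vector [t, s]) = d + t *\<^sub>R (linepath a b s - d)"
        by (simp add: \<Phi>_def linepath_def algebra_simps)
      then show "indicator {0..1} t * h (vector [t, s])
          = \<bar>orient d a b\<bar> * (indicator {0..1} t * (t * g (d + t *\<^sub>R (linepath a b s - d))))"
        by (simp add: h_def det abs_mult indicator_def)
    qed
    show "indicator {0..1} s * (LINT t|lborel. indicator {0..1} t * h (vector [t, s]))
        = \<bar>orient d a b\<bar> * (indicator {0..1} s *
      (LINT t|lborel. indicator {0..1} t * (t * g (d + t *\<^sub>R (linepath a b s - d)))))"
      unfolding eq by simp
  qed
  finally show ?thesis
    by simp
qed

text \<open>Integration is over the parameter in [0, 1], so this is the mean over the segment and
  not the integral with respect to arc length.\<close>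

definition segint :: "(real^2 \<Rightarrow> real) \<Rightarrow> real^2 \<Rightarrow> real^2 \<Rightarrow> real" where
  "segint g a b = (LINT s|lborel. indicator {0..1} s * g (linepath a b s))"

text \<open>This is the divergence theorem for the field g(x) (x - d): the integrand is its
  divergence, and on the two edges through d the field is tangential, so only the edge a b
  contributes. In the ray coordinates it is the fundamental theorem of calculus for t^2 g on each
  ray.\<close>

lemma edge_formula:
  assumes D: "orient d a b \<noteq> 0" and g: "cont_diff 1 g"
  shows "(LINT x|lebesgue_on (triangle d a b). 2 * g x + (x $ 1 - d $ 1) * partial 1 g x + (x $ 2 - d $ 2) * partial 2 g x)
    = \<bar>orient d a b\<bar> * segint g a b"
proof -
  let ?G = "\<lambda>x. 2 * g x + (x $ 1 - d $ 1) * partial 1 g x + (x $ 2 - d $ 2) * partial 2 g x"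
  have cont: "continuous_on UNIV ?G"
    by (intro continuous_intros C1_continuous [OF g] C1_partial_continuous [OF g])
  have radial: "(LINT t|lborel. indicator {0..1} t * (t * ?G (d + t *\<^sub>R (y - d)))) = g y" for y
  proof -
    define k where "k = y - d"
    let ?F = "\<lambda>t. t\<^sup>2 * g (d + t *\<^sub>R k)"
    let ?f = "\<lambda>t. t * ?G (d + t *\<^sub>R k)"
    have "(LINT t|lborel. ?f t * indicator {0..1} t) = ?F 1 - ?F 0"
    proof (rule integral_FTC_Icc_real)
      fix t :: real
      show "(?F has_real_derivative ?f t) (at t)"
        by (rule derivative_eq_intros C1_line_derivative [OF g] refl)+ (simp add: power2_eq_square algebra_simps)
      have "continuous_on UNIV ?f"
        by (intro continuous_intros continuous_on_compose2 [OF cont]) auto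
      then show "isCont ?f t"
        by (simp add: continuous_on_eq_continuous_at)
    qed simp
    then show ?thesis
      by (simp add: mult.commute k_def)
  qed
  show ?thesis
    unfolding integral_triangle [OF D cont] radial segint_def ..
qed

lemma segint_const: "segint (\<lambda>x. c) a b = c"
  by (simp add: segint_def)

text \<open>\<open>edge_formula\<close> for the constant function 1.\<close>

lemma measure_triangle: "measure lebesgue (triangle d a b) = \<bar>orient d a b\<bar> / 2" if "orient d a b \<noteq> 0"
proof -
  have "(LINT x|lebesgue_on (triangle d a b). 2 * (1::real)) = \<bar>orient d a b\<bar>"
    using edge_formula [OF that, of "\<lambda>x. 1"] by (simp add: cont_diff_const segint_const)
  then show ?thesis
    by (simp add: measure_restrict_space)
qed

section \<open>Traces\<close>

text \<open>Riesz-Fischer. Along a subsequence with rapidly decreasing increments the sum of the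
  absolute increments is integrable, so the subsequence converges almost everywhere; Fatou's lemma
  transfers the Cauchy estimates to its limit.\<close>

lemma L2_complete:
  fixes f :: "nat \<Rightarrow> 'a \<Rightarrow> real"
  assumes M: "finite_measure M" and f: "\<And>n. f n \<in> L2 M"
    and Cauchy: "\<And>e. e > 0 \<Longrightarrow> \<exists>N. \<forall>m\<ge>N. \<forall>n\<ge>N. L2_norm M (\<lambda>x. f m x - f n x) < e"
  obtains g where "g \<in> L2 M" "(\<lambda>n. L2_norm M (\<lambda>x. g x - f n x)) \<longlonglongrightarrow> 0"
proof -
  have [measurable]: "f n \<in> borel_measurable M" for n
    using f by (simp add: L2_real_iff)
  have "\<exists>N. \<forall>m\<ge>N. \<forall>n\<ge>N. L2_norm M (\<lambda>x. f m x - f n x) < (1/2) ^ k" for k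
    using Cauchy by simp
  then obtain N where N: "\<And>k m n. m \<ge> N k \<Longrightarrow> n \<ge> N k \<Longrightarrow> L2_norm M (\<lambda>x. f m x - f n x) < (1/2) ^ k"
    by metis
  \<comment> \<open>The partial sum of the \<open>N j\<close> makes r m at least N k for all k up to
    m; the summand k makes r m at least m, so that late members of the subsequence are late members
    of the sequence.\<close>
  define r where "r k = k + (\<Sum>j\<le>k. N j)" for k
  have rN: "r m \<ge> N k" if "m \<ge> k" for k m
  proof -
    have "N k \<le> (\<Sum>j\<le>m. N j)"
      using that by (intro member_le_sum) auto
    then show ?thesis
      by (simp add: r_def)
  qed
  define h where "h k x = \<bar>f (r (Suc k)) x - f (r k) x\<bar>" for k x
  have [measurable]: "h k \<in> borel_measurable M" for k
    unfolding h_def by measurable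
  define c where "c = sqrt (measure M (space M))"
  have h_int: "(\<integral>\<^sup>+x. ennreal (h k x) \<partial>M) \<le> ennreal (c * (1/2) ^ k)" for k
  proof -
    have hL2: "h k \<in> L2 M"
      using L2_diff [OF f f] by (simp add: L2_real_iff h_def)
    have "(\<integral>\<^sup>+x. ennreal (h k x) \<partial>M) = ennreal (LINT x|M. h k x)"
      by (rule nn_integral_eq_integral [OF L2_integrable [OF M hL2]]) (simp add: h_def)
    also have "(LINT x|M. h k x) \<le> L2_norm M (h k) * L2_norm M (\<lambda>x. 1 :: real)"
      using L2_cauchy_schwarz [OF hL2 L2_const [OF M, of 1]] by simp
    also have "\<dots> = L2_norm M (\<lambda>x. f (r (Suc k)) x - f (r k) x) * c"
      by (simp add: L2_norm_real h_def c_def)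
    also have "\<dots> \<le> (1/2) ^ k * c"
      using N [OF rN [of k "Suc k"] rN [of k k]] by (intro mult_right_mono) (auto simp: c_def)
    finally show ?thesis
      by (simp add: mult.commute ennreal_leI)
  qed
  have "(\<integral>\<^sup>+x. (\<Sum>k. ennreal (h k x)) \<partial>M) = (\<Sum>k. \<integral>\<^sup>+x. ennreal (h k x) \<partial>M)"
    by (rule nn_integral_suminf) measurable
  also have "\<dots> \<le> (\<Sum>k. ennreal (c * (1/2) ^ k))"
    by (intro suminf_le h_int) auto
  also have "\<dots> = ennreal (\<Sum>k. c * (1/2) ^ k)"
    by (rule suminf_ennreal2) (auto simp: c_def intro!: summable_mult summable_geometric)
  finally have "(\<integral>\<^sup>+x. (\<Sum>k. ennreal (h k x)) \<partial>M) \<noteq> \<infinity>"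
    by (auto simp: top_unique)
  then have "AE x in M. (\<Sum>k. ennreal (h k x)) \<noteq> \<infinity>"
    by (rule nn_integral_PInf_AE [rotated]) measurable
  then have conv: "AE x in M. convergent (\<lambda>k. f (r k) x)"
  proof eventually_elim
    case (elim x)
    then have "summable (\<lambda>k. h k x)"
      by (intro summable_suminf_not_top) (auto simp: h_def)
    then have "summable (\<lambda>k. f (r (Suc k)) x - f (r k) x)"
      unfolding h_def by (rule summable_rabs_cancel)
    then have "convergent (\<lambda>n. \<Sum>k<n. f (r (Suc k)) x - f (r k) x)"
      by (simp add: summable_iff_convergent)
    then have "convergent (\<lambda>n. f (r n) x - f (r 0) x)"
      by (simp add: sum_lessThan_telescope [of "\<lambda>n. f (r n) x"])
    then show ?case
      using convergent_add_const_right_iff [of "\<lambda>n. f (r n) x" "- f (r 0) x"] by simp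
  qed
  define g where "g x = lim (\<lambda>k. f (r k) x)" for x
  have [measurable]: "g \<in> borel_measurable M"
    unfolding g_def by measurable
  have lim: "AE x in M. (\<lambda>k. f (r k) x) \<longlonglongrightarrow> g x"
    using conv by eventually_elim (simp add: g_def convergent_LIMSEQ_iff)
  have bound: "(\<integral>\<^sup>+x. ennreal ((g x - f n x)\<^sup>2) \<partial>M) \<le> ennreal (e\<^sup>2)"
    if n: "\<And>m. m \<ge> K \<Longrightarrow> L2_norm M (\<lambda>x. f (r m) x - f n x) \<le> e" for n e K
  proof -
    have "(\<integral>\<^sup>+x. ennreal ((g x - f n x)\<^sup>2) \<partial>M) = (\<integral>\<^sup>+x. liminf (\<lambda>m. ennreal ((f (r m) x - f n x)\<^sup>2)) \<partial>M)"
    proof (rule nn_integral_cong_AE)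
      show "AE x in M. ennreal ((g x - f n x)\<^sup>2) = liminf (\<lambda>m. ennreal ((f (r m) x - f n x)\<^sup>2))"
        using lim by eventually_elim (auto intro!: lim_imp_Liminf [symmetric] tendsto_ennrealI tendsto_intros)
    qed
    also have "\<dots> \<le> liminf (\<lambda>m. \<integral>\<^sup>+x. ennreal ((f (r m) x - f n x)\<^sup>2) \<partial>M)"
      by (rule nn_integral_liminf) measurable
    also have "\<dots> \<le> limsup (\<lambda>m. \<integral>\<^sup>+x. ennreal ((f (r m) x - f n x)\<^sup>2) \<partial>M)"
      by (rule Liminf_le_Limsup) simp
    also have "\<dots> \<le> ennreal (e\<^sup>2)"
    proof (rule Limsup_bounded)
      show "\<forall>\<^sub>F m in sequentially. (\<integral>\<^sup>+x. ennreal ((f (r m) x - f n x)\<^sup>2) \<partial>M) \<le> ennreal (e\<^sup>2)"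
        using eventually_ge_at_top [of K]
      proof eventually_elim
        case (elim m)
        have "(\<integral>\<^sup>+x. ennreal ((f (r m) x - f n x)\<^sup>2) \<partial>M) = ennreal ((L2_norm M (\<lambda>x. f (r m) x - f n x))\<^sup>2)"
          unfolding L2_norm_sq using L2_diff [OF f f] by (intro nn_integral_eq_integral) (auto simp: L2_real_iff)
        also have "\<dots> \<le> ennreal (e\<^sup>2)"
          using n [OF elim] by (intro ennreal_leI power_mono) auto
        finally show ?case .
      qed
    qed
    finally show ?thesis .
  qed
  have diffL2: "(\<lambda>x. g x - f n x) \<in> L2 M \<and> L2_norm M (\<lambda>x. g x - f n x) \<le> e"
    if n: "\<And>m. m \<ge> K \<Longrightarrow> L2_norm M (\<lambda>x. f (r m) x - f n x) \<le> e" and e: "e \<ge> 0" for n e K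
  proof -
    have b: "(\<integral>\<^sup>+x. ennreal ((g x - f n x)\<^sup>2) \<partial>M) \<le> ennreal (e\<^sup>2)"
      using n by (rule bound)
    then have int: "integrable M (\<lambda>x. (g x - f n x)\<^sup>2)"
      by (intro integrableI_bounded) (auto simp: less_top [symmetric] top_unique)
    then have "(LINT x|M. (g x - f n x)\<^sup>2) \<le> e\<^sup>2"
      using b by (subst (asm) nn_integral_eq_integral) auto
    then have "L2_norm M (\<lambda>x. g x - f n x) \<le> e"
      unfolding L2_norm_real using e real_sqrt_le_mono by fastforce
    with int show ?thesis
      by (simp add: L2_real_iff)
  qed
  have "\<exists>N. \<forall>n\<ge>N. (\<lambda>x. g x - f n x) \<in> L2 M \<and> L2_norm M (\<lambda>x. g x - f n x) < e" if e: "e > 0" for e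
  proof -
    obtain N' where N': "\<And>m n. m \<ge> N' \<Longrightarrow> n \<ge> N' \<Longrightarrow> L2_norm M (\<lambda>x. f m x - f n x) < e / 2"
      using Cauchy [of "e / 2"] e by auto
    have rm: "r m \<ge> m" for m
      by (simp add: r_def)
    have "(\<lambda>x. g x - f n x) \<in> L2 M \<and> L2_norm M (\<lambda>x. g x - f n x) \<le> e / 2" if "n \<ge> N'" for n
      by (rule diffL2 [of N']) (use N' [OF order_trans [OF _ rm] that] e in \<open>auto intro: less_imp_le\<close>)
    with e show ?thesis
      by (intro exI [of _ N']) force
  qed
  note * = this
  obtain n where "(\<lambda>x. g x - f n x) \<in> L2 M"
    using * [of 1] by auto
  from L2_add [OF this f [of n]] have "g \<in> L2 M"
    by simp
  moreover have "(\<lambda>n. L2_norm M (\<lambda>x. g x - f n x)) \<longlonglongrightarrow> 0"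
  proof (rule LIMSEQ_I)
    fix e :: real assume "e > 0"
    then show "\<exists>N. \<forall>n\<ge>N. norm (L2_norm M (\<lambda>x. g x - f n x) - 0) < e"
      using * [of e] by auto
  qed
  ultimately show thesis
    by (rule that)
qed

section \<open>Arc length on a segment\<close>

lemma arc_length_density:
  "arc_length a b = density (distr (restrict_space lborel {0..1}) borel (linepath a b)) (\<lambda>_. ennreal (dist a b))"
  unfolding arc_length_def
  by (rule measure_eqI) (auto simp: emeasure_density nn_integral_cmult_indicator)

lemma sets_arc_length [measurable_cong, simp]: "sets (arc_length a b) = sets borel"
  and space_arc_length [simp]: "space (arc_length a b) = UNIV"
  by (auto simp: arc_length_def space_scale_measure)

lemma linepath_measurable: "linepath a b \<in> restrict_space lborel {0..1} \<rightarrow>\<^sub>M borel"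
  for a b :: "real^2"
proof -
  have "linepath a b \<in> borel_measurable borel"
    unfolding linepath_def by measurable
  then show ?thesis
    by (intro measurable_restrict_space1) simp
qed

lemma integral_arc_length:
  fixes g :: "real^2 \<Rightarrow> real"
  assumes [measurable]: "g \<in> borel_measurable borel"
  shows "(LINT x|arc_length a b. g x) = dist a b * segint g a b"
    "integrable (arc_length a b) g \<longleftrightarrow> a = b \<or> integrable lborel (\<lambda>s. indicator {0..1} s * g (linepath a b s))"
proof -
  note linepath_measurable [measurable]
  show "(LINT x|arc_length a b. g x) = dist a b * segint g a b"
    unfolding arc_length_density segint_def
    by (subst integral_density) (auto simp: integral_distr integral_restrict_space)
  show "integrable (arc_length a b) g \<longleftrightarrow> a = b \<or> integrable lborel (\<lambda>s. indicator {0..1} s * g (linepath a b s))"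
    unfolding arc_length_density
    by (subst integrable_density) (auto simp: integrable_distr_eq integrable_restrict_space)
qed

lemma finite_measure_arc_length [simp]: "finite_measure (arc_length a b)"
proof
  have "emeasure (arc_length a b) UNIV = ennreal (dist a b) * emeasure lborel {0..1::real}"
    unfolding arc_length_def emeasure_scale_measure
    by (subst emeasure_distr [OF linepath_measurable]) (auto simp: emeasure_restrict_space space_restrict_space)
  then show "emeasure (arc_length a b) (space (arc_length a b)) \<noteq> \<infinity>"
    by (simp add: ennreal_mult_eq_top_iff)
qed

lemma continuous_segment_integrable:
  fixes g :: "real^2 \<Rightarrow> real"
  assumes "continuous_on UNIV g"
  shows "integrable lborel (\<lambda>s. indicator {0..1} s * g (linepath a b s))"
proof -
  have "continuous_on {0..1} (\<lambda>s. g (linepath a b s))"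
    by (rule continuous_on_compose2 [OF assms]) (auto intro: continuous_intros)
  from borel_integrable_compact [OF _ this] show ?thesis
    by simp
qed

lemma continuous_L2_arc_length:
  fixes g :: "real^2 \<Rightarrow> real"
  assumes "continuous_on UNIV g"
  shows "g \<in> L2 (arc_length a b)"
proof -
  have m: "g \<in> borel_measurable borel"
    by (rule borel_measurable_continuous_onI [OF assms])
  have "continuous_on UNIV (\<lambda>x. (g x)\<^sup>2)"
    using assms by (intro continuous_intros)
  then have "integrable (arc_length a b) (\<lambda>x. (g x)\<^sup>2)"
    using continuous_segment_integrable by (subst integral_arc_length(2)) (use m in auto)
  with m show ?thesis
    by (simp add: L2_real_iff)
qed

section \<open>Edge means as volume integrals, and traces\<close>

text \<open>The left-hand side of \<open>edge_formula\<close> divided by twice the area: for smooth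
  f the mean over the edge a b. Since it involves only f and its weak gradient in L^2, it is
  continuous in H^1 and so is the mean of the trace. The vertex d is auxiliary
  (\<open>edge_mean_opposite_vertex\<close>).\<close>

definition edge_mean :: "real^2 \<Rightarrow> real^2 \<Rightarrow> real^2 \<Rightarrow> (real^2 \<Rightarrow> real) \<Rightarrow> (2 \<Rightarrow> real^2 \<Rightarrow> real) \<Rightarrow> real" where
  "edge_mean d a b f G = (2 * (LINT x|lebesgue_on (triangle d a b). f x)
     + (LINT x|lebesgue_on (triangle d a b). G 1 x * (x $ 1 - d $ 1))
     + (LINT x|lebesgue_on (triangle d a b). G 2 x * (x $ 2 - d $ 2))) / \<bar>orient d a b\<bar>"

lemma continuous_L2_triangle:
  fixes g :: "real^2 \<Rightarrow> real"
  assumes "continuous_on UNIV g"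
  shows "g \<in> L2 (lebesgue_on (triangle a b c))"
  using assms by (intro bounded_continuous_L2) auto

lemma L2_triangle_coord: "(\<lambda>x. x $ i - d $ i) \<in> L2 (lebesgue_on (triangle a b c))"
  by (intro continuous_L2_triangle continuous_intros)

lemma finite_measure_triangle [simp]: "finite_measure (lebesgue_on (triangle a b c))"
  by (intro finite_measure_lebesgue_on) auto

lemma edge_mean_C1:
  assumes D: "orient d a b \<noteq> 0" and g: "cont_diff 1 g"
  shows "edge_mean d a b g (\<lambda>i. partial i g) = segint g a b"
proof -
  let ?M = "lebesgue_on (triangle d a b)"
  have i: "integrable ?M g"
    by (rule L2_integrable [OF finite_measure_triangle continuous_L2_triangle [OF C1_continuous [OF g]]])
  have p: "integrable ?M (\<lambda>x. partial i g x * (x $ i - d $ i))" for i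
    by (rule L2_mult_integrable [OF continuous_L2_triangle [OF C1_partial_continuous [OF g]] L2_triangle_coord])
  have "(LINT x|?M. 2 * g x + (x $ 1 - d $ 1) * partial 1 g x + (x $ 2 - d $ 2) * partial 2 g x)
      = 2 * (LINT x|?M. g x) + (LINT x|?M. partial 1 g x * (x $ 1 - d $ 1)) + (LINT x|?M. partial 2 g x * (x $ 2 - d $ 2))"
    using i p [of 1] p [of 2] by (simp add: mult.commute)
  with edge_formula [OF D g] D show ?thesis
    by (simp add: edge_mean_def)
qed

lemma edge_mean_tendsto:
  assumes f: "f \<in> L2 (lebesgue_on (triangle d a b))" and G: "\<And>i. G i \<in> L2 (lebesgue_on (triangle d a b))"
    and \<phi>: "\<And>n. \<phi> n \<in> L2 (lebesgue_on (triangle d a b))" and \<Gamma>: "\<And>n i. \<Gamma> n i \<in> L2 (lebesgue_on (triangle d a b))"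
    and "(\<lambda>n. L2_norm (lebesgue_on (triangle d a b)) (\<lambda>x. f x - \<phi> n x)) \<longlonglongrightarrow> 0"
    and "\<And>i. (\<lambda>n. L2_norm (lebesgue_on (triangle d a b)) (\<lambda>x. G i x - \<Gamma> n i x)) \<longlonglongrightarrow> 0"
  shows "(\<lambda>n. edge_mean d a b (\<phi> n) (\<Gamma> n)) \<longlonglongrightarrow> edge_mean d a b f G"
  unfolding edge_mean_def divide_inverse
  by (intro tendsto_intros L2_integral_tendsto [OF finite_measure_triangle f \<phi>]
      L2_inner_tendsto [OF G \<Gamma> L2_triangle_coord] assms)

text \<open>\<open>edge_formula\<close> for the square of \<phi>, together with 2 |\<phi> \<phi>'|
  <= \<phi>^2 + \<phi>'^2. The constant depends on the shape of the triangle, which is harmless: it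
  serves only to show that traces exist and does not enter the error estimate.\<close>

lemma trace_inequality:
  assumes D: "orient d a b \<noteq> 0"
  obtains C where "C \<ge> 0" "\<And>\<phi>. cont_diff 1 \<phi> \<Longrightarrow>
    (L2_norm (arc_length a b) \<phi>)\<^sup>2 \<le> C * ((L2_norm (lebesgue_on (triangle d a b)) \<phi>)\<^sup>2
      + (L2_norm (lebesgue_on (triangle d a b)) (partial 1 \<phi>))\<^sup>2 + (L2_norm (lebesgue_on (triangle d a b)) (partial 2 \<phi>))\<^sup>2)"
proof -
  let ?M = "lebesgue_on (triangle d a b)"
  obtain R where R: "\<And>x. x \<in> triangle d a b \<Longrightarrow> norm (x - d) \<le> R" "R \<ge> 0"
  proof -
    have "bounded ((\<lambda>x. x - d) ` triangle d a b)"
      by (simp add: bounded_translation_minus)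
    then obtain R where "\<And>x. x \<in> triangle d a b \<Longrightarrow> norm (x - d) \<le> R"
      unfolding bounded_iff by blast
    then show thesis
      using that [of "max R 0"] by (auto simp: le_max_iff_disj)
  qed
  define C where "C = dist a b * (2 + 2 * R) / \<bar>orient d a b\<bar>"
  have "(L2_norm (arc_length a b) \<phi>)\<^sup>2 \<le> C * ((L2_norm ?M \<phi>)\<^sup>2 + (L2_norm ?M (partial 1 \<phi>))\<^sup>2 + (L2_norm ?M (partial 2 \<phi>))\<^sup>2)"
    if \<phi>: "cont_diff 1 \<phi>" for \<phi>
  proof -
    let ?g = "\<lambda>x. \<phi> x * \<phi> x"
    have g: "cont_diff 1 ?g"
      by (rule cont_diff_mult [OF \<phi> \<phi>])
    have pg: "partial i ?g x = 2 * \<phi> x * partial i \<phi> x" for i x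
      using partial_mult [OF C1_differentiable [OF \<phi>] C1_differentiable [OF \<phi>]] by simp
    have int: "integrable ?M (\<lambda>x. (\<phi> x)\<^sup>2)" "integrable ?M (\<lambda>x. (partial i \<phi> x)\<^sup>2)" for i
      using continuous_L2_triangle [OF C1_continuous [OF \<phi>]] continuous_L2_triangle [OF C1_partial_continuous [OF \<phi>]]
      by (auto simp: L2_real_iff)
    let ?G = "\<lambda>x. 2 * ?g x + (x $ 1 - d $ 1) * partial 1 ?g x + (x $ 2 - d $ 2) * partial 2 ?g x"
    have "\<bar>orient d a b\<bar> * segint ?g a b = (LINT x|?M. ?G x)"
      using edge_formula [OF D g] by simp
    also have "\<dots> \<le> (LINT x|?M. (2 + 2 * R) * ((\<phi> x)\<^sup>2 + (partial 1 \<phi> x)\<^sup>2 + (partial 2 \<phi> x)\<^sup>2))"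
    proof (rule integral_mono)
      have "continuous_on UNIV ?G"
        by (intro continuous_intros C1_continuous [OF g] C1_continuous [OF \<phi>] C1_partial_continuous [OF g])
      then show "integrable ?M ?G"
        by (rule L2_integrable [OF finite_measure_triangle continuous_L2_triangle])
      show "integrable ?M (\<lambda>x. (2 + 2 * R) * ((\<phi> x)\<^sup>2 + (partial 1 \<phi> x)\<^sup>2 + (partial 2 \<phi> x)\<^sup>2))"
        using int by simp
      fix x assume "x \<in> space ?M"
      then have "norm (x - d) \<le> R"
        using R(1) by simp
      then have "\<bar>x $ i - d $ i\<bar> \<le> R" for i
        using component_le_norm_cart [of "x - d" i] by simp
      then have "\<bar>x $ i - d $ i\<bar> * \<bar>2 * \<phi> x * partial i \<phi> x\<bar> \<le> R * ((\<phi> x)\<^sup>2 + (partial i \<phi> x)\<^sup>2)" for i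
        using sum_squares_bound [of "\<bar>\<phi> x\<bar>" "\<bar>partial i \<phi> x\<bar>"] R(2) by (intro mult_mono) (auto simp: abs_mult)
      then have "(x $ i - d $ i) * partial i ?g x \<le> R * ((\<phi> x)\<^sup>2 + (partial i \<phi> x)\<^sup>2)" for i
        unfolding pg abs_mult [symmetric] using abs_ge_self order_trans by blast
      from this [of 1] this [of 2]
      have "?G x \<le> 2 * (\<phi> x)\<^sup>2 + (R * ((\<phi> x)\<^sup>2 + (partial 1 \<phi> x)\<^sup>2) + R * ((\<phi> x)\<^sup>2 + (partial 2 \<phi> x)\<^sup>2))"
        by (simp add: power2_eq_square)
      also have "\<dots> \<le> (2 + 2 * R) * ((\<phi> x)\<^sup>2 + (partial 1 \<phi> x)\<^sup>2 + (partial 2 \<phi> x)\<^sup>2)"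
        using R(2) by (simp add: algebra_simps add_nonneg_nonneg mult_nonneg_nonneg)
      finally show "?G x \<le> (2 + 2 * R) * ((\<phi> x)\<^sup>2 + (partial 1 \<phi> x)\<^sup>2 + (partial 2 \<phi> x)\<^sup>2)" .
    qed
    also have "\<dots> = (2 + 2 * R) * ((L2_norm ?M \<phi>)\<^sup>2 + (L2_norm ?M (partial 1 \<phi>))\<^sup>2 + (L2_norm ?M (partial 2 \<phi>))\<^sup>2)"
      using int by (simp add: L2_norm_sq)
    finally have *: "segint ?g a b \<le> (2 + 2 * R) * ((L2_norm ?M \<phi>)\<^sup>2 + (L2_norm ?M (partial 1 \<phi>))\<^sup>2 + (L2_norm ?M (partial 2 \<phi>))\<^sup>2) / \<bar>orient d a b\<bar>"
      using D by (simp add: field_simps)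
    have "(L2_norm (arc_length a b) \<phi>)\<^sup>2 = dist a b * segint ?g a b"
      using integral_arc_length(1) [OF C1_measurable [OF g], of a b]
      by (simp only: L2_norm_sq power2_eq_square [of "\<phi> _"])
    also have "\<dots> \<le> dist a b * ((2 + 2 * R) * ((L2_norm ?M \<phi>)\<^sup>2 + (L2_norm ?M (partial 1 \<phi>))\<^sup>2 + (L2_norm ?M (partial 2 \<phi>))\<^sup>2) / \<bar>orient d a b\<bar>)"
      by (intro mult_left_mono *) simp
    finally show ?thesis
      by (simp add: C_def)
  qed
  then show thesis
    using that [of C] R(2) by (simp add: C_def)
qed

lemma L2_norm_le_H1_norm:
  assumes "open \<omega>" "weak_grad \<omega> f G"
  shows "L2_norm (lebesgue_on \<omega>) f \<le> H1_norm \<omega> f" "L2_norm (lebesgue_on \<omega>) (G i) \<le> H1_norm \<omega> f"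
proof -
  have H: "0 \<le> H1_norm \<omega> f"
    by (simp add: H1_norm_def sum_nonneg)
  show "L2_norm (lebesgue_on \<omega>) f \<le> H1_norm \<omega> f"
    by (rule power2_le_imp_le [OF _ H]) (simp add: H1_norm_sq [OF assms])
  show "L2_norm (lebesgue_on \<omega>) (G i) \<le> H1_norm \<omega> f"
    by (rule power2_le_imp_le [OF _ H]) (use exhaust_2 [of i] in \<open>auto simp: H1_norm_sq [OF assms]\<close>)
qed

lemma H1_tendsto_triangle:
  assumes \<omega>: "open \<omega>" "triangle d a b \<subseteq> \<omega>" and G: "weak_grad \<omega> f G"
    and \<phi>: "\<And>n. smooth (\<phi> n)" "\<And>n. (\<lambda>x. f x - \<phi> n x) \<in> H1 \<omega>" "(\<lambda>n. H1_norm \<omega> (\<lambda>x. f x - \<phi> n x)) \<longlonglongrightarrow> 0"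
  shows "(\<lambda>n. L2_norm (lebesgue_on (triangle d a b)) (\<lambda>x. f x - \<phi> n x)) \<longlonglongrightarrow> 0"
    "(\<lambda>n. L2_norm (lebesgue_on (triangle d a b)) (\<lambda>x. G i x - partial i (\<phi> n) x)) \<longlonglongrightarrow> 0"
proof -
  let ?M = "lebesgue_on (triangle d a b)"
  have m: "triangle d a b \<in> sets lebesgue" "\<omega> \<in> sets lebesgue"
    using \<omega> by auto
  have GT: "weak_grad (triangle d a b) f G"
    by (rule weak_grad_mono [OF G \<omega>(2,1) open_triangle])
  have bound: "L2_norm ?M (\<lambda>x. f x - \<phi> n x) \<le> H1_norm \<omega> (\<lambda>x. f x - \<phi> n x)"
    "L2_norm ?M (\<lambda>x. G i x - partial i (\<phi> n) x) \<le> H1_norm \<omega> (\<lambda>x. f x - \<phi> n x)" for n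
  proof -
    obtain W where W: "weak_grad \<omega> (\<lambda>x. f x - \<phi> n x) W"
      using \<phi>(2) H1_iff by blast
    have WT: "weak_grad (triangle d a b) (\<lambda>x. f x - \<phi> n x) W"
      by (rule weak_grad_mono [OF W \<omega>(2,1) open_triangle])
    have DT: "weak_grad (triangle d a b) (\<lambda>x. f x - \<phi> n x) (\<lambda>i x. G i x - partial i (\<phi> n) x)"
      by (rule weak_grad_diff [OF GT weak_grad_C1 [OF smooth_imp_C1 [OF \<phi>(1)]]]) auto
    show "L2_norm ?M (\<lambda>x. f x - \<phi> n x) \<le> H1_norm \<omega> (\<lambda>x. f x - \<phi> n x)"
      using L2_lebesgue_on_mono(2) [OF weak_gradD(1) [OF W] \<omega>(2) m] L2_norm_le_H1_norm(1) [OF \<omega>(1) W] by simp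
    have "L2_norm ?M (\<lambda>x. G i x - partial i (\<phi> n) x) = L2_norm ?M (W i)"
      by (rule L2_norm_cong_AE [OF L2_measurable [OF weak_gradD(2) [OF DT]] L2_measurable [OF weak_gradD(2) [OF WT]]
            weak_grad_unique [OF open_triangle DT WT]])
    also have "\<dots> \<le> H1_norm \<omega> (\<lambda>x. f x - \<phi> n x)"
      using L2_lebesgue_on_mono(2) [OF weak_gradD(2) [OF W] \<omega>(2) m] L2_norm_le_H1_norm(2) [OF \<omega>(1) W]
      by (meson order_trans)
    finally show "L2_norm ?M (\<lambda>x. G i x - partial i (\<phi> n) x) \<le> H1_norm \<omega> (\<lambda>x. f x - \<phi> n x)" .
  qed
  show "(\<lambda>n. L2_norm ?M (\<lambda>x. f x - \<phi> n x)) \<longlonglongrightarrow> 0"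
    "(\<lambda>n. L2_norm ?M (\<lambda>x. G i x - partial i (\<phi> n) x)) \<longlonglongrightarrow> 0"
    by (rule tendsto_sandwich [OF _ _ tendsto_const \<phi>(3)];
        intro always_eventually allI bound L2_norm_nonneg)+
qed

text \<open>Both sides are limits along the smooth functions that define the trace: their edge means
  converge in L^2 of the segment and, as volume integrals, by convergence in H^1. Consequently all
  traces have the same mean, whichever one \<open>trace_on\<close> selects.\<close>

lemma trace_segint:
  assumes \<omega>: "open \<omega>" "triangle d a b \<subseteq> \<omega>" and D: "orient d a b \<noteq> 0" and G: "weak_grad \<omega> f G"
    and g: "is_trace \<omega> a b f g"
  shows "segint g a b = edge_mean d a b f G"
proof -
  obtain \<phi> where gL: "g \<in> L2 (arc_length a b)" and
    \<phi>: "\<And>n. smooth (\<phi> n)" "\<And>n. (\<lambda>x. f x - \<phi> n x) \<in> H1 \<omega>" "(\<lambda>n. H1_norm \<omega> (\<lambda>x. f x - \<phi> n x)) \<longlonglongrightarrow> 0"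
    "(\<lambda>n. L2_norm (arc_length a b) (\<lambda>x. g x - \<phi> n x)) \<longlonglongrightarrow> 0"
    using g unfolding is_trace_def by blast
  have C1: "cont_diff 1 (\<phi> n)" for n
    using \<phi>(1) smooth_imp_C1 by blast
  have "a \<noteq> b"
    using D by auto
  have "(\<lambda>n. LINT x|arc_length a b. \<phi> n x) \<longlonglongrightarrow> (LINT x|arc_length a b. g x)"
    by (rule L2_integral_tendsto [OF finite_measure_arc_length gL continuous_L2_arc_length [OF C1_continuous [OF C1]] \<phi>(4)])
  moreover have "g \<in> borel_measurable borel"
    using L2_measurable [OF gL] by (simp add: measurable_def)
  ultimately have "(\<lambda>n. dist a b * segint (\<phi> n) a b) \<longlonglongrightarrow> dist a b * segint g a b"
    by (simp add: integral_arc_length C1_measurable [OF C1])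
  then have "(\<lambda>n. dist a b * segint (\<phi> n) a b / dist a b) \<longlonglongrightarrow> dist a b * segint g a b / dist a b"
    using \<open>a \<noteq> b\<close> by (intro tendsto_intros) auto
  then have "(\<lambda>n. segint (\<phi> n) a b) \<longlonglongrightarrow> segint g a b"
    using \<open>a \<noteq> b\<close> by simp
  moreover have "(\<lambda>n. edge_mean d a b (\<phi> n) (\<lambda>i. partial i (\<phi> n))) \<longlonglongrightarrow> edge_mean d a b f G"
    by (rule edge_mean_tendsto [OF weak_gradD(1,2) [OF weak_grad_mono [OF G \<omega>(2,1) open_triangle]]
          continuous_L2_triangle [OF C1_continuous [OF C1]] continuous_L2_triangle [OF C1_partial_continuous [OF C1]]
          H1_tendsto_triangle [OF \<omega> G \<phi>(1-3)]])
  ultimately show ?thesis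
    using edge_mean_C1 [OF D C1] LIMSEQ_unique by simp
qed

text \<open>Smooth approximations of f are Cauchy in H^1 of a triangle having a b as an edge. By the
  trace inequality their restrictions are Cauchy in L^2 of the segment, whose limit is a
  trace.\<close>

lemma trace_exists:
  assumes \<omega>: "open \<omega>" "triangle d a b \<subseteq> \<omega>" and D: "orient d a b \<noteq> 0" and G: "weak_grad \<omega> f G"
    and \<phi>: "\<And>n. smooth (\<phi> n)" "\<And>n. (\<lambda>x. f x - \<phi> n x) \<in> H1 \<omega>" "(\<lambda>n. H1_norm \<omega> (\<lambda>x. f x - \<phi> n x)) \<longlonglongrightarrow> 0"
  shows "is_trace \<omega> a b f (trace_on \<omega> a b f)"
proof -
  let ?M = "lebesgue_on (triangle d a b)"
  have C1: "cont_diff 1 (\<phi> n)" for n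
    using \<phi>(1) smooth_imp_C1 by blast
  obtain C where C: "C \<ge> 0" "\<And>\<psi>. cont_diff 1 \<psi> \<Longrightarrow> (L2_norm (arc_length a b) \<psi>)\<^sup>2 \<le> C * ((L2_norm ?M \<psi>)\<^sup>2
      + (L2_norm ?M (partial 1 \<psi>))\<^sup>2 + (L2_norm ?M (partial 2 \<psi>))\<^sup>2)"
    using trace_inequality [OF D] by blast
  define E where "E n = L2_norm ?M (\<lambda>x. f x - \<phi> n x) + L2_norm ?M (\<lambda>x. G 1 x - partial 1 (\<phi> n) x)
      + L2_norm ?M (\<lambda>x. G 2 x - partial 2 (\<phi> n) x)" for n
  have "E \<longlonglongrightarrow> 0 + 0 + 0"
    unfolding E_def by (intro tendsto_add H1_tendsto_triangle [OF \<omega> G \<phi>])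
  then have E0: "E \<longlonglongrightarrow> 0"
    by simp
  note GT = weak_gradD(1,2) [OF weak_grad_mono [OF G \<omega>(2,1) open_triangle]]
  have Cauchy: "(L2_norm (arc_length a b) (\<lambda>x. \<phi> m x - \<phi> n x))\<^sup>2 \<le> 3 * C * (E m + E n)\<^sup>2" for m n
  proof -
    have dC1: "cont_diff 1 (\<lambda>x. \<phi> m x - \<phi> n x)"
      using smooth_diff [OF \<phi>(1) \<phi>(1)] smooth_imp_C1 by blast
    have tri: "L2_norm ?M (\<lambda>x. p x - q x) \<le> L2_norm ?M (\<lambda>x. k x - p x) + L2_norm ?M (\<lambda>x. k x - q x)"
      if "p \<in> L2 ?M" "q \<in> L2 ?M" "k \<in> L2 ?M" for p q k :: "real^2 \<Rightarrow> real"
      using L2_norm_diff_triangle [OF that(1,3,2)] L2_norm_minus_commute [of ?M p k] by simp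
    note cl = continuous_L2_triangle [OF C1_continuous [OF C1]] continuous_L2_triangle [OF C1_partial_continuous [OF C1]]
    have Eb: "L2_norm ?M (\<lambda>x. f x - \<phi> k x) \<le> E k" "L2_norm ?M (\<lambda>x. G i x - partial i (\<phi> k) x) \<le> E k" for k i
      using exhaust_2 [of i] by (auto simp: E_def add_nonneg_nonneg)
    have "L2_norm ?M (\<lambda>x. \<phi> m x - \<phi> n x) \<le> E m + E n"
      using tri [OF cl(1) cl(1) GT(1), of m n] Eb(1) [of m] Eb(1) [of n] by linarith
    moreover have "L2_norm ?M (partial i (\<lambda>x. \<phi> m x - \<phi> n x)) \<le> E m + E n" for i
    proof -
      have "partial i (\<lambda>x. \<phi> m x - \<phi> n x) = (\<lambda>x. partial i (\<phi> m) x - partial i (\<phi> n) x)"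
        by (rule ext) (rule partial_diff [OF C1_differentiable [OF C1] C1_differentiable [OF C1]])
      then show ?thesis
        using tri [OF cl(2) cl(2) GT(2), of i m i n i] Eb(2) [of i m] Eb(2) [of i n] by simp
    qed
    ultimately have "(L2_norm ?M (\<lambda>x. \<phi> m x - \<phi> n x))\<^sup>2 + (L2_norm ?M (partial 1 (\<lambda>x. \<phi> m x - \<phi> n x)))\<^sup>2
        + (L2_norm ?M (partial 2 (\<lambda>x. \<phi> m x - \<phi> n x)))\<^sup>2 \<le> (E m + E n)\<^sup>2 + (E m + E n)\<^sup>2 + (E m + E n)\<^sup>2"
      by (intro add_mono power_mono) auto
    then have "C * ((L2_norm ?M (\<lambda>x. \<phi> m x - \<phi> n x))\<^sup>2 + (L2_norm ?M (partial 1 (\<lambda>x. \<phi> m x - \<phi> n x)))\<^sup>2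
        + (L2_norm ?M (partial 2 (\<lambda>x. \<phi> m x - \<phi> n x)))\<^sup>2) \<le> C * ((E m + E n)\<^sup>2 + (E m + E n)\<^sup>2 + (E m + E n)\<^sup>2)"
      using C(1) by (intro mult_left_mono)
    with C(2) [OF dC1] show ?thesis
      by simp
  qed
  obtain g where g: "g \<in> L2 (arc_length a b)" "(\<lambda>n. L2_norm (arc_length a b) (\<lambda>x. g x - \<phi> n x)) \<longlonglongrightarrow> 0"
  proof (rule L2_complete [of "arc_length a b" \<phi>])
    show "\<phi> n \<in> L2 (arc_length a b)" for n
      by (rule continuous_L2_arc_length [OF C1_continuous [OF C1]])
    fix e :: real assume e: "e > 0"
    define k where "k = sqrt (3 * C) + 1"
    have k: "k > 0"
      using C(1) by (simp add: k_def add_nonneg_pos)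
    obtain N where N: "\<And>n. n \<ge> N \<Longrightarrow> E n < e / (2 * k)"
      using tendsto_0_eventually_less [OF E0, of "e / (2 * k)"] e k by (metis divide_pos_pos mult_pos_pos zero_less_numeral)
    have "L2_norm (arc_length a b) (\<lambda>x. \<phi> m x - \<phi> n x) < e" if "m \<ge> N" "n \<ge> N" for m n
    proof -
      have En: "0 \<le> E n" for n
        by (simp add: E_def)
      have "L2_norm (arc_length a b) (\<lambda>x. \<phi> m x - \<phi> n x) \<le> sqrt (3 * C * (E m + E n)\<^sup>2)"
        using real_sqrt_le_mono [OF Cauchy [of m n]] by simp
      also have "\<dots> = sqrt (3 * C) * (E m + E n)"
        using En [of m] En [of n] by (simp add: real_sqrt_mult)
      also have "\<dots> \<le> k * (E m + E n)"
        using En [of m] En [of n] by (intro mult_right_mono) (auto simp: k_def)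
      also have "\<dots> < k * (e / (2 * k) + e / (2 * k))"
        using N [OF that(1)] N [OF that(2)] k by (intro mult_strict_left_mono) auto
      also have "\<dots> = e"
        using k by simp
      finally show ?thesis .
    qed
    then show "\<exists>N. \<forall>m\<ge>N. \<forall>n\<ge>N. L2_norm (arc_length a b) (\<lambda>x. \<phi> m x - \<phi> n x) < e"
      by blast
  qed auto
  then have "is_trace \<omega> a b f g"
    unfolding is_trace_def using \<phi> by blast
  then show ?thesis
    unfolding trace_on_def by (rule someI [of "is_trace \<omega> a b f"])
qed

section \<open>The Poincare inequality on convex domains\<close>

lemma C1_FTC:
  fixes x y :: "real^2"
  assumes \<phi>: "cont_diff 1 \<phi>"
  shows "\<phi> x - \<phi> y = (LINT t|lborel. ((x - y) $ 1 * partial 1 \<phi> (y + t *\<^sub>R (x - y))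
    + (x - y) $ 2 * partial 2 \<phi> (y + t *\<^sub>R (x - y))) * indicator {0..1} t)" (is "_ = (LINT t|lborel. ?f t * _)")
proof -
  have "(LINT t|lborel. ?f t * indicator {0..1} t) = \<phi> (y + 1 *\<^sub>R (x - y)) - \<phi> (y + 0 *\<^sub>R (x - y))"
  proof (rule integral_FTC_Icc_real)
    show "((\<lambda>t. \<phi> (y + t *\<^sub>R (x - y))) has_real_derivative ?f t) (at t)" for t
      by (rule C1_line_derivative [OF \<phi>])
    have "continuous_on UNIV ?f"
      by (intro continuous_intros continuous_on_compose2 [OF C1_partial_continuous [OF \<phi>, of UNIV]]) auto
    then show "isCont ?f t" for t
      by (simp add: continuous_on_eq_continuous_at)
  qed simp
  then show ?thesis
    by simp
qed

text \<open>The fundamental theorem of calculus along the segment from y to x, followed by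
  Cauchy-Schwarz in t and in the plane. The bound is a nonnegative extended real, ready for
  Tonelli's theorem.\<close>

lemma C1_difference_sq_le:
  fixes x y :: "real^2"
  assumes \<phi>: "cont_diff 1 \<phi>"
  shows "ennreal ((\<phi> x - \<phi> y)\<^sup>2) \<le> ennreal ((dist x y)\<^sup>2) *
    (\<integral>\<^sup>+t. indicator {0..1} t * ennreal ((partial 1 \<phi> (y + t *\<^sub>R (x - y)))\<^sup>2 + (partial 2 \<phi> (y + t *\<^sub>R (x - y)))\<^sup>2) \<partial>lborel)"
proof -
  let ?k = "x - y"
  let ?p = "\<lambda>i t. partial i \<phi> (y + t *\<^sub>R ?k)"
  let ?f = "\<lambda>t. ?k $ 1 * ?p 1 t + ?k $ 2 * ?p 2 t"
  let ?I = "indicator {0..1} :: real \<Rightarrow> real"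
  have cp: "continuous_on UNIV (?p i)" for i
    by (intro continuous_on_compose2 [OF C1_partial_continuous [OF \<phi>, of UNIV]] continuous_intros) auto
  have int: "integrable lborel (\<lambda>t. ?I t *\<^sub>R h t)" if "continuous_on UNIV h" for h :: "real \<Rightarrow> real"
    using that by (intro borel_integrable_compact) (auto intro: continuous_on_subset)
  have cf: "continuous_on UNIV ?f"
    by (intro continuous_intros cp)
  have L: "?I \<in> L2 lborel" "(\<lambda>t. ?I t * ?f t) \<in> L2 lborel"
  proof -
    have "(\<lambda>t. (?I t)\<^sup>2) = ?I"
      by (auto simp: fun_eq_iff indicator_def)
    then show "?I \<in> L2 lborel"
      by (simp add: L2_real_iff)
    have "(\<lambda>t. (?I t * ?f t)\<^sup>2) = (\<lambda>t. ?I t *\<^sub>R (?f t)\<^sup>2)"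
      by (auto simp: fun_eq_iff indicator_def)
    moreover have "integrable lborel (\<lambda>t. ?I t *\<^sub>R (?f t)\<^sup>2)"
      by (intro int continuous_intros cp)
    moreover have "?f \<in> borel_measurable borel"
      by (rule borel_measurable_continuous_onI [OF cf])
    ultimately show "(\<lambda>t. ?I t * ?f t) \<in> L2 lborel"
      by (auto simp: L2_real_iff)
  qed
  have "\<phi> x - \<phi> y = (LINT t|lborel. ?I t * (?I t * ?f t))"
    unfolding C1_FTC [OF \<phi>, of x y] by (intro Bochner_Integration.integral_cong) (auto simp: indicator_def)
  then have "(\<phi> x - \<phi> y)\<^sup>2 \<le> (LINT t|lborel. (?I t)\<^sup>2) * (LINT t|lborel. (?I t * ?f t)\<^sup>2)"
    using L2_cauchy_schwarz_sq [OF L] by simp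
  also have "(LINT t|lborel. (?I t)\<^sup>2) = 1"
  proof -
    have "(\<lambda>t. (?I t)\<^sup>2) = ?I"
      by (auto simp: fun_eq_iff indicator_def)
    then show ?thesis
      by simp
  qed
  also have "1 * (LINT t|lborel. (?I t * ?f t)\<^sup>2) \<le> (LINT t|lborel. (dist x y)\<^sup>2 * (?I t *\<^sub>R ((?p 1 t)\<^sup>2 + (?p 2 t)\<^sup>2)))"
    unfolding mult_1
  proof (rule integral_mono)
    show "integrable lborel (\<lambda>t. (?I t * ?f t)\<^sup>2)"
      using L(2) by (simp add: L2_real_iff)
    show "integrable lborel (\<lambda>t. (dist x y)\<^sup>2 * (?I t *\<^sub>R ((?p 1 t)\<^sup>2 + (?p 2 t)\<^sup>2)))"
      by (intro integrable_mult_right int continuous_intros cp)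
    fix t
    have "(?f t)\<^sup>2 \<le> ((?k $ 1)\<^sup>2 + (?k $ 2)\<^sup>2) * ((?p 1 t)\<^sup>2 + (?p 2 t)\<^sup>2)"
    proof -
      have "((?k $ 1)\<^sup>2 + (?k $ 2)\<^sup>2) * ((?p 1 t)\<^sup>2 + (?p 2 t)\<^sup>2) - (?f t)\<^sup>2 = (?k $ 1 * ?p 2 t - ?k $ 2 * ?p 1 t)\<^sup>2"
        by (simp add: power2_eq_square algebra_simps)
      then show ?thesis
        by (metis diff_ge_0_iff_ge zero_le_power2)
    qed
    moreover have "(?k $ 1)\<^sup>2 + (?k $ 2)\<^sup>2 = (dist x y)\<^sup>2"
      by (simp add: dist_norm norm_vec_def L2_set_def sum_2)
    ultimately show "(?I t * ?f t)\<^sup>2 \<le> (dist x y)\<^sup>2 * (?I t *\<^sub>R ((?p 1 t)\<^sup>2 + (?p 2 t)\<^sup>2))"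
      by (simp add: indicator_def)
  qed
  also have "\<dots> = (dist x y)\<^sup>2 * (LINT t|lborel. ?I t *\<^sub>R ((?p 1 t)\<^sup>2 + (?p 2 t)\<^sup>2))"
    by simp
  finally have "ennreal ((\<phi> x - \<phi> y)\<^sup>2) \<le> ennreal ((dist x y)\<^sup>2) * ennreal (LINT t|lborel. ?I t *\<^sub>R ((?p 1 t)\<^sup>2 + (?p 2 t)\<^sup>2))"
    by (subst ennreal_mult [symmetric]) (auto intro: ennreal_leI)
  also have "ennreal (LINT t|lborel. ?I t *\<^sub>R ((?p 1 t)\<^sup>2 + (?p 2 t)\<^sup>2)) = (\<integral>\<^sup>+t. ennreal (?I t *\<^sub>R ((?p 1 t)\<^sup>2 + (?p 2 t)\<^sup>2)) \<partial>lborel)"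
  proof (rule nn_integral_eq_integral [symmetric])
    show "integrable lborel (\<lambda>t. ?I t *\<^sub>R ((?p 1 t)\<^sup>2 + (?p 2 t)\<^sup>2))"
      by (intro int continuous_intros cp)
  qed simp
  also have "\<dots> = (\<integral>\<^sup>+t. indicator {0..1} t * ennreal ((?p 1 t)\<^sup>2 + (?p 2 t)\<^sup>2) \<partial>lborel)"
    by (rule nn_integral_cong) (auto simp: indicator_def)
  finally show ?thesis .
qed

text \<open>For fixed t the point y + t (x - y) is an affine function of x with factor t and of y
  with factor 1 - t. One of the two factors is at least 1/2; substituting in that variable costs at
  most 4, and the other variable contributes the area.\<close>

lemma nn_integral_segment_le:
  fixes F :: "real^2 \<Rightarrow> ennreal"
  assumes [measurable]: "F \<in> borel_measurable borel" "\<Omega> \<in> sets borel" and t: "0 \<le> t" "t \<le> 1"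
  shows "(\<integral>\<^sup>+x. \<integral>\<^sup>+y. indicator \<Omega> x * indicator \<Omega> y * F (y + t *\<^sub>R (x - y)) \<partial>lborel \<partial>lborel)
    \<le> 4 * emeasure lborel \<Omega> * (\<integral>\<^sup>+z. F z \<partial>lborel)"
proof -
  have aff: "(\<integral>\<^sup>+z. F (v + c *\<^sub>R z) \<partial>lborel) \<le> 4 * (\<integral>\<^sup>+z. F z \<partial>lborel)" if "c \<ge> 1/2" for v c
  proof -
    have "(\<integral>\<^sup>+z. F (v + c *\<^sub>R z) \<partial>lborel) = ennreal (1 / c\<^sup>2) * (ennreal (c\<^sup>2) * (\<integral>\<^sup>+z. F (v + c *\<^sub>R z) \<partial>lborel))"
      using that by (simp add: mult.assoc [symmetric] ennreal_mult' [symmetric])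
    also have "\<dots> = ennreal (1 / c\<^sup>2) * (\<integral>\<^sup>+z. F z \<partial>lborel)"
      using that by (subst nn_integral_affine_lborel [of F c v]) auto
    also have "\<dots> \<le> ennreal 4 * (\<integral>\<^sup>+z. F z \<partial>lborel)"
    proof (intro mult_right_mono ennreal_leI)
      have "(1/2)\<^sup>2 \<le> c\<^sup>2"
        using that by (intro power_mono) auto
      then show "1 / c\<^sup>2 \<le> 4"
        using that by (simp add: field_simps power2_eq_square)
    qed simp
    finally show ?thesis
      by simp
  qed
  show ?thesis
  proof (cases "t \<ge> 1/2")
    case True
    have "(\<integral>\<^sup>+x. \<integral>\<^sup>+y. indicator \<Omega> x * indicator \<Omega> y * F (y + t *\<^sub>R (x - y)) \<partial>lborel \<partial>lborel)
        = (\<integral>\<^sup>+y. \<integral>\<^sup>+x. indicator \<Omega> x * indicator \<Omega> y * F (y + t *\<^sub>R (x - y)) \<partial>lborel \<partial>lborel)"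
      by (rule lborel_pair.Fubini') measurable
    also have "\<dots> \<le> (\<integral>\<^sup>+y. indicator \<Omega> y * (4 * (\<integral>\<^sup>+z. F z \<partial>lborel)) \<partial>lborel)"
    proof (rule nn_integral_mono)
      fix y
      have "(\<integral>\<^sup>+x. indicator \<Omega> x * indicator \<Omega> y * F (y + t *\<^sub>R (x - y)) \<partial>lborel)
          \<le> (\<integral>\<^sup>+x. indicator \<Omega> y * F ((1 - t) *\<^sub>R y + t *\<^sub>R x) \<partial>lborel)"
        by (rule nn_integral_mono) (auto simp: indicator_def algebra_simps)
      also have "\<dots> = indicator \<Omega> y * (\<integral>\<^sup>+x. F ((1 - t) *\<^sub>R y + t *\<^sub>R x) \<partial>lborel)"
        by (rule nn_integral_cmult) measurable
      also have "\<dots> \<le> indicator \<Omega> y * (4 * (\<integral>\<^sup>+z. F z \<partial>lborel))"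
        using aff [OF True] by (rule mult_left_mono) simp
      finally show "(\<integral>\<^sup>+x. indicator \<Omega> x * indicator \<Omega> y * F (y + t *\<^sub>R (x - y)) \<partial>lborel)
          \<le> indicator \<Omega> y * (4 * (\<integral>\<^sup>+z. F z \<partial>lborel))" .
    qed
    also have "\<dots> = 4 * emeasure lborel \<Omega> * (\<integral>\<^sup>+z. F z \<partial>lborel)"
      by (subst nn_integral_multc) (auto simp: ac_simps)
    finally show ?thesis .
  next
    case False
    have "(\<integral>\<^sup>+x. \<integral>\<^sup>+y. indicator \<Omega> x * indicator \<Omega> y * F (y + t *\<^sub>R (x - y)) \<partial>lborel \<partial>lborel)
        \<le> (\<integral>\<^sup>+x. indicator \<Omega> x * (4 * (\<integral>\<^sup>+z. F z \<partial>lborel)) \<partial>lborel)"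
    proof (rule nn_integral_mono)
      fix x
      have "(\<integral>\<^sup>+y. indicator \<Omega> x * indicator \<Omega> y * F (y + t *\<^sub>R (x - y)) \<partial>lborel)
          \<le> (\<integral>\<^sup>+y. indicator \<Omega> x * F (t *\<^sub>R x + (1 - t) *\<^sub>R y) \<partial>lborel)"
        by (rule nn_integral_mono) (auto simp: indicator_def algebra_simps)
      also have "\<dots> = indicator \<Omega> x * (\<integral>\<^sup>+y. F (t *\<^sub>R x + (1 - t) *\<^sub>R y) \<partial>lborel)"
        by (rule nn_integral_cmult) measurable
      also have "\<dots> \<le> indicator \<Omega> x * (4 * (\<integral>\<^sup>+z. F z \<partial>lborel))"
        using aff [of "1 - t"] False by (intro mult_left_mono) auto
      finally show "(\<integral>\<^sup>+y. indicator \<Omega> x * indicator \<Omega> y * F (y + t *\<^sub>R (x - y)) \<partial>lborel)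
          \<le> indicator \<Omega> x * (4 * (\<integral>\<^sup>+z. F z \<partial>lborel))" .
    qed
    also have "\<dots> = 4 * emeasure lborel \<Omega> * (\<integral>\<^sup>+z. F z \<partial>lborel)"
      by (subst nn_integral_multc) (auto simp: ac_simps)
    finally show ?thesis .
  qed
qed

text \<open>By convexity the segment from y to x stays inside the domain, so the gradient may be
  multiplied by the indicator. The order of integration is then changed so that t is outermost and
  \<open>nn_integral_segment_le\<close> applies for each t.\<close>

lemma poincare_double:
  assumes \<phi>: "cont_diff 1 \<phi>" and \<Omega>: "open \<Omega>" "convex \<Omega>"
    and h: "\<And>x y. x \<in> \<Omega> \<Longrightarrow> y \<in> \<Omega> \<Longrightarrow> dist x y \<le> h"
  shows "(\<integral>\<^sup>+x. \<integral>\<^sup>+y. indicator \<Omega> x * indicator \<Omega> y * ennreal ((\<phi> x - \<phi> y)\<^sup>2) \<partial>lborel \<partial>lborel)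
    \<le> ennreal (h\<^sup>2) * (4 * emeasure lborel \<Omega> * (\<integral>\<^sup>+z. indicator \<Omega> z * ennreal ((partial 1 \<phi> z)\<^sup>2 + (partial 2 \<phi> z)\<^sup>2) \<partial>lborel))"
proof -
  have \<Omega>m [measurable]: "\<Omega> \<in> sets borel"
    using \<Omega> by auto
  note [measurable] = C1_measurable [OF \<phi>] C1_partial_measurable [OF \<phi>]
  define F where "F z = indicator \<Omega> z * ennreal ((partial 1 \<phi> z)\<^sup>2 + (partial 2 \<phi> z)\<^sup>2)" for z
  have [measurable]: "F \<in> borel_measurable borel"
    unfolding F_def by measurable
  let ?K = "\<lambda>t x y. indicator \<Omega> x * indicator \<Omega> y * F (y + t *\<^sub>R (x - y))"
  have "(\<integral>\<^sup>+x. \<integral>\<^sup>+y. indicator \<Omega> x * indicator \<Omega> y * ennreal ((\<phi> x - \<phi> y)\<^sup>2) \<partial>lborel \<partial>lborel)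
      \<le> (\<integral>\<^sup>+x. \<integral>\<^sup>+y. ennreal (h\<^sup>2) * (\<integral>\<^sup>+t. indicator {0..1} t * ?K t x y \<partial>lborel) \<partial>lborel \<partial>lborel)"
  proof (intro nn_integral_mono)
    fix x y
    show "indicator \<Omega> x * indicator \<Omega> y * ennreal ((\<phi> x - \<phi> y)\<^sup>2)
        \<le> ennreal (h\<^sup>2) * (\<integral>\<^sup>+t. indicator {0..1} t * ?K t x y \<partial>lborel)"
    proof (cases "x \<in> \<Omega> \<and> y \<in> \<Omega>")
      case True
      have "y + t *\<^sub>R (x - y) \<in> \<Omega>" if "0 \<le> t" "t \<le> 1" for t
      proof -
        have "y + t *\<^sub>R (x - y) = (1 - t) *\<^sub>R y + t *\<^sub>R x"
          by (simp add: algebra_simps)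
        then show ?thesis
          using convexD [OF \<Omega>(2), of y x "1 - t" t] True that by simp
      qed
      then have "(\<integral>\<^sup>+t. indicator {0..1} t * ?K t x y \<partial>lborel) = (\<integral>\<^sup>+t. indicator {0..1} t
          * ennreal ((partial 1 \<phi> (y + t *\<^sub>R (x - y)))\<^sup>2 + (partial 2 \<phi> (y + t *\<^sub>R (x - y)))\<^sup>2) \<partial>lborel)"
        using True by (intro nn_integral_cong) (auto simp: F_def indicator_def)
      moreover have "(dist x y)\<^sup>2 \<le> h\<^sup>2"
        using h True by (intro power_mono) auto
      ultimately show ?thesis
        using order_trans [OF C1_difference_sq_le [OF \<phi>, of x y] mult_right_mono [OF ennreal_leI]] True
        by simp
    qed (auto simp: indicator_def)
  qed
  also have "\<dots> = ennreal (h\<^sup>2) * (\<integral>\<^sup>+x. \<integral>\<^sup>+y. (\<integral>\<^sup>+t. indicator {0..1} t * ?K t x y \<partial>lborel) \<partial>lborel \<partial>lborel)"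
    by (subst nn_integral_cmult, measurable)+
  also have "(\<integral>\<^sup>+x. \<integral>\<^sup>+y. (\<integral>\<^sup>+t. indicator {0..1} t * ?K t x y \<partial>lborel) \<partial>lborel \<partial>lborel)
      = (\<integral>\<^sup>+x. \<integral>\<^sup>+t. (\<integral>\<^sup>+y. indicator {0..1} t * ?K t x y \<partial>lborel) \<partial>lborel \<partial>lborel)"
    by (intro nn_integral_cong lborel_pair.Fubini') measurable
  also have "\<dots> = (\<integral>\<^sup>+t. \<integral>\<^sup>+x. (\<integral>\<^sup>+y. indicator {0..1} t * ?K t x y \<partial>lborel) \<partial>lborel \<partial>lborel)"
    by (rule lborel_pair.Fubini') measurable
  also have "\<dots> \<le> (\<integral>\<^sup>+t. indicator {0..1} t * (4 * emeasure lborel \<Omega> * (\<integral>\<^sup>+z. F z \<partial>lborel)) \<partial>(lborel :: real measure))"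
  proof (rule nn_integral_mono)
    fix t :: real
    show "(\<integral>\<^sup>+x. (\<integral>\<^sup>+y. indicator {0..1} t * ?K t x y \<partial>lborel) \<partial>lborel)
        \<le> indicator {0..1} t * (4 * emeasure lborel \<Omega> * (\<integral>\<^sup>+z. F z \<partial>lborel))"
    proof (cases "t \<in> {0..1}")
      case True
      then show ?thesis
        using nn_integral_segment_le [of F \<Omega> t] by simp
    qed simp
  qed
  also have "\<dots> = 4 * emeasure lborel \<Omega> * (\<integral>\<^sup>+z. F z \<partial>lborel)"
    by (subst nn_integral_multc) auto
  finally show ?thesis
    unfolding F_def by (simp add: mult_left_mono)
qed

text \<open>The double integral of (\<phi>(x) - \<phi>(y))^2 equals twice the area times the squared
  distance of \<phi> from its mean. Comparison with \<open>poincare_double\<close> cancels the area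
  and leaves 2 h^2, whatever the shape of the domain.\<close>

lemma poincare_C1:
  assumes \<phi>: "cont_diff 1 \<phi>" and \<Omega>: "open \<Omega>" "convex \<Omega>" "bounded \<Omega>"
    and h: "\<And>x y. x \<in> \<Omega> \<Longrightarrow> y \<in> \<Omega> \<Longrightarrow> dist x y \<le> h"
    and m: "m * measure lebesgue \<Omega> = (LINT x|lebesgue_on \<Omega>. \<phi> x)" and ne: "\<Omega> \<noteq> {}"
  shows "(L2_norm (lebesgue_on \<Omega>) (\<lambda>x. \<phi> x - m))\<^sup>2
    \<le> 2 * h\<^sup>2 * ((L2_norm (lebesgue_on \<Omega>) (partial 1 \<phi>))\<^sup>2 + (L2_norm (lebesgue_on \<Omega>) (partial 2 \<phi>))\<^sup>2)"
proof -
  let ?M = "lebesgue_on \<Omega>"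
  have \<Omega>m [measurable]: "\<Omega> \<in> sets borel"
    using \<Omega> by auto
  define A where "A = measure lebesgue \<Omega>"
  have A: "A > 0"
    using open_not_negligible [OF \<Omega>(1) ne] \<Omega>
    by (simp add: A_def zero_less_measure_iff bounded_set_imp_lmeasurable negligible_iff_measure less_le)
  have emA: "emeasure lborel \<Omega> = ennreal A"
  proof -
    have "emeasure lebesgue \<Omega> = ennreal A"
      using \<Omega> by (simp add: A_def emeasure_eq_measure2 bounded_set_imp_lmeasurable)
    then show ?thesis
      by simp
  qed
  have fin: "finite_measure ?M"
    using finite_measure_lebesgue_on [OF \<Omega>(3)] \<Omega>(1) by simp
  have L2c: "g \<in> L2 ?M" if "continuous_on UNIV g" for g :: "real^2 \<Rightarrow> real"
    using bounded_continuous_L2 [OF \<Omega>(3) \<Omega>m that] .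
  have conv: "(\<integral>\<^sup>+x. indicator \<Omega> x * ennreal (g x) \<partial>lborel) = ennreal (LINT x|?M. g x)"
    if g: "continuous_on UNIV g" "\<And>x. x \<in> \<Omega> \<Longrightarrow> 0 \<le> g x" for g :: "real^2 \<Rightarrow> real"
  proof -
    have gm: "g \<in> borel_measurable borel"
      by (rule borel_measurable_continuous_onI [OF g(1)])
    have "integrable ?M g"
      by (rule L2_integrable [OF fin L2c [OF g(1)]])
    then have i: "integrable lborel (\<lambda>x. indicator \<Omega> x * g x)"
      using LINT_lebesgue_on_borel(2) [OF gm \<Omega>m] by simp
    have "(\<integral>\<^sup>+x. indicator \<Omega> x * ennreal (g x) \<partial>lborel) = (\<integral>\<^sup>+x. ennreal (indicator \<Omega> x * g x) \<partial>lborel)"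
      by (rule nn_integral_cong) (auto simp: indicator_def)
    also have "\<dots> = ennreal (LINT x|lborel. indicator \<Omega> x * g x)"
      by (rule nn_integral_eq_integral [OF i]) (auto simp: g indicator_def)
    also have "\<dots> = ennreal (LINT x|?M. g x)"
      using LINT_lebesgue_on_borel(1) [OF gm \<Omega>m] by simp
    finally show ?thesis .
  qed
  have c\<phi>: "continuous_on UNIV \<phi>"
    by (rule C1_continuous [OF \<phi>])
  define I1 I2 where "I1 = (LINT x|?M. \<phi> x)" and "I2 = (LINT x|?M. (\<phi> x)\<^sup>2)"
  have int: "integrable ?M \<phi>" "integrable ?M (\<lambda>x. (\<phi> x)\<^sup>2)" "integrable ?M (\<lambda>x. c)" for c :: real
    using L2_integrable [OF fin L2c [OF c\<phi>]] L2c [OF c\<phi>] finite_measure.integrable_const [OF fin]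
    by (auto simp: L2_real_iff)
  have MA: "measure ?M \<Omega> = A"
    using \<Omega> by (simp add: A_def measure_restrict_space)
  have inner: "(LINT y|?M. (v - \<phi> y)\<^sup>2) = v\<^sup>2 * A - 2 * v * I1 + I2" for v
  proof -
    have "(LINT y|?M. (v - \<phi> y)\<^sup>2) = (LINT y|?M. v\<^sup>2 - 2 * v * \<phi> y + (\<phi> y)\<^sup>2)"
      by (rule Bochner_Integration.integral_cong) (auto simp: power2_diff algebra_simps)
    also have "\<dots> = v\<^sup>2 * A - 2 * v * I1 + I2"
      using int by (simp add: MA I1_def I2_def)
    finally show ?thesis .
  qed
  have "(\<integral>\<^sup>+x. \<integral>\<^sup>+y. indicator \<Omega> x * indicator \<Omega> y * ennreal ((\<phi> x - \<phi> y)\<^sup>2) \<partial>lborel \<partial>lborel)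
      = (\<integral>\<^sup>+x. indicator \<Omega> x * ennreal ((\<phi> x)\<^sup>2 * A - 2 * \<phi> x * I1 + I2) \<partial>lborel)"
  proof (rule nn_integral_cong)
    fix x
    have [measurable]: "\<phi> \<in> borel_measurable borel"
      by (rule C1_measurable [OF \<phi>])
    have "(\<integral>\<^sup>+y. indicator \<Omega> x * indicator \<Omega> y * ennreal ((\<phi> x - \<phi> y)\<^sup>2) \<partial>lborel)
        = indicator \<Omega> x * (\<integral>\<^sup>+y. indicator \<Omega> y * ennreal ((\<phi> x - \<phi> y)\<^sup>2) \<partial>lborel)"
      by (simp add: mult.assoc nn_integral_cmult)
    also have "(\<integral>\<^sup>+y. indicator \<Omega> y * ennreal ((\<phi> x - \<phi> y)\<^sup>2) \<partial>lborel) = ennreal (LINT y|?M. (\<phi> x - \<phi> y)\<^sup>2)"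
      by (intro conv continuous_intros c\<phi>) auto
    finally show "(\<integral>\<^sup>+y. indicator \<Omega> x * indicator \<Omega> y * ennreal ((\<phi> x - \<phi> y)\<^sup>2) \<partial>lborel)
        = indicator \<Omega> x * ennreal ((\<phi> x)\<^sup>2 * A - 2 * \<phi> x * I1 + I2)"
      by (simp add: inner)
  qed
  also have "\<dots> = ennreal (LINT x|?M. (\<phi> x)\<^sup>2 * A - 2 * \<phi> x * I1 + I2)"
  proof (intro conv continuous_intros c\<phi>)
    show "0 \<le> (\<phi> x)\<^sup>2 * A - 2 * \<phi> x * I1 + I2" for x
      unfolding inner [symmetric] by simp
  qed
  also have "(LINT x|?M. (\<phi> x)\<^sup>2 * A - 2 * \<phi> x * I1 + I2) = 2 * A * I2 - 2 * I1\<^sup>2"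
    using int by (simp add: MA I1_def [symmetric] I2_def [symmetric] power2_eq_square [of I1])
  finally have LHS: "(\<integral>\<^sup>+x. \<integral>\<^sup>+y. indicator \<Omega> x * indicator \<Omega> y * ennreal ((\<phi> x - \<phi> y)\<^sup>2) \<partial>lborel \<partial>lborel)
      = ennreal (2 * A * I2 - 2 * I1\<^sup>2)" .
  define S where "S = (L2_norm ?M (partial 1 \<phi>))\<^sup>2 + (L2_norm ?M (partial 2 \<phi>))\<^sup>2"
  have S: "S \<ge> 0"
    by (simp add: S_def)
  have "(\<integral>\<^sup>+z. indicator \<Omega> z * ennreal ((partial 1 \<phi> z)\<^sup>2 + (partial 2 \<phi> z)\<^sup>2) \<partial>lborel)
      = ennreal (LINT z|?M. (partial 1 \<phi> z)\<^sup>2 + (partial 2 \<phi> z)\<^sup>2)"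
    by (intro conv continuous_intros C1_partial_continuous [OF \<phi>]) auto
  also have "(LINT z|?M. (partial 1 \<phi> z)\<^sup>2 + (partial 2 \<phi> z)\<^sup>2) = S"
    using L2c [OF C1_partial_continuous [OF \<phi>]] by (simp add: S_def L2_norm_sq L2_real_iff)
  finally have RHS: "(\<integral>\<^sup>+z. indicator \<Omega> z * ennreal ((partial 1 \<phi> z)\<^sup>2 + (partial 2 \<phi> z)\<^sup>2) \<partial>lborel) = ennreal S" .
  have "ennreal (2 * A * I2 - 2 * I1\<^sup>2) \<le> ennreal (h\<^sup>2) * (4 * ennreal A * ennreal S)"
    using poincare_double [OF \<phi> \<Omega>(1,2) h] unfolding LHS RHS emA .
  also have "\<dots> = ennreal (h\<^sup>2 * (4 * A * S))"
    using A S by (simp add: ennreal_mult)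
  finally have "2 * A * I2 - 2 * I1\<^sup>2 \<le> h\<^sup>2 * (4 * A * S)"
    using A S by (subst (asm) ennreal_le_iff) auto
  moreover have "I1 = m * A"
    using m by (simp add: I1_def A_def)
  ultimately have "(2 * A) * (I2 - m * I1) \<le> (2 * A) * (2 * h\<^sup>2 * S)"
    by (simp add: power2_eq_square algebra_simps)
  then have "I2 - m * I1 \<le> 2 * h\<^sup>2 * S"
    using A by simp
  moreover have "(L2_norm ?M (\<lambda>x. \<phi> x - m))\<^sup>2 = I2 - m * I1"
    using inner [of m] \<open>I1 = m * A\<close>
    by (simp add: L2_norm_sq power2_commute [of "\<phi> _" m] power2_eq_square [of m] algebra_simps)
  ultimately show ?thesis
    by (simp add: S_def)
qed

text \<open>Passage to the limit along smooth approximations, whose means converge to m as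
  well.\<close>

lemma poincare:
  assumes \<Omega>: "open \<Omega>" "convex \<Omega>" "bounded \<Omega>" "\<Omega> \<noteq> {}"
    and h: "\<And>x y. x \<in> \<Omega> \<Longrightarrow> y \<in> \<Omega> \<Longrightarrow> dist x y \<le> h"
    and G: "weak_grad \<Omega> f G"
    and m: "m * measure lebesgue \<Omega> = (LINT x|lebesgue_on \<Omega>. f x)"
  shows "(L2_norm (lebesgue_on \<Omega>) (\<lambda>x. f x - m))\<^sup>2
    \<le> 2 * h\<^sup>2 * ((L2_norm (lebesgue_on \<Omega>) (G 1))\<^sup>2 + (L2_norm (lebesgue_on \<Omega>) (G 2))\<^sup>2)"
proof -
  let ?M = "lebesgue_on \<Omega>"
  have fin: "finite_measure ?M"
    using finite_measure_lebesgue_on [OF \<Omega>(3)] \<Omega>(1) by simp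
  define A where "A = measure lebesgue \<Omega>"
  have A: "A > 0"
    using open_not_negligible [OF \<Omega>(1,4)] \<Omega>
    by (simp add: A_def zero_less_measure_iff bounded_set_imp_lmeasurable negligible_iff_measure less_le)
  obtain \<phi> where \<phi>: "\<And>n. smooth (\<phi> n)" "(\<lambda>n. L2_norm ?M (\<lambda>x. f x - \<phi> n x)) \<longlonglongrightarrow> 0"
    "\<And>i. (\<lambda>n. L2_norm ?M (\<lambda>x. G i x - partial i (\<phi> n) x)) \<longlonglongrightarrow> 0"
    using smooth_dense_weak_grad [OF \<Omega>(1-3) G] by blast
  have C1: "cont_diff 1 (\<phi> n)" for n
    using \<phi>(1) smooth_imp_C1 by blast
  have L2c: "g \<in> L2 ?M" if "continuous_on UNIV g" for g :: "real^2 \<Rightarrow> real"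
    using bounded_continuous_L2 [OF \<Omega>(3) _ that] \<Omega>(1) by auto
  note \<phi>L = L2c [OF C1_continuous [OF C1]] L2c [OF C1_partial_continuous [OF C1]]
  note GL = weak_gradD(1,2) [OF G]
  define mn where "mn n = (LINT x|?M. \<phi> n x) / A" for n
  have "mn \<longlonglongrightarrow> (LINT x|?M. f x) / A"
    unfolding mn_def using A by (intro tendsto_intros L2_integral_tendsto [OF fin GL(1) \<phi>L(1) \<phi>(2)]) auto
  moreover have "(LINT x|?M. f x) / A = m"
    using m A by (simp add: A_def [symmetric] divide_eq_eq)
  ultimately have mn: "mn \<longlonglongrightarrow> m"
    by simp
  have c: "(\<lambda>x. c) \<in> L2 ?M" for c :: real
    using L2_const [OF fin] .
  have "(\<lambda>n. L2_norm ?M (\<lambda>x. (f x - m) - (\<phi> n x - mn n))) \<longlonglongrightarrow> 0"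
  proof (rule tendsto_sandwich [OF _ _ tendsto_const])
    have "(\<lambda>n. L2_norm ?M (\<lambda>x. f x - \<phi> n x) + \<bar>mn n - m\<bar> * L2_norm ?M (\<lambda>x. 1 :: real)) \<longlonglongrightarrow> 0 + \<bar>m - m\<bar> * L2_norm ?M (\<lambda>x. 1 :: real)"
      by (intro tendsto_intros \<phi> mn)
    then show "(\<lambda>n. L2_norm ?M (\<lambda>x. f x - \<phi> n x) + \<bar>mn n - m\<bar> * L2_norm ?M (\<lambda>x. 1 :: real)) \<longlonglongrightarrow> 0"
      by simp
    have "L2_norm ?M (\<lambda>x. (f x - m) - (\<phi> n x - mn n)) \<le> L2_norm ?M (\<lambda>x. f x - \<phi> n x) + \<bar>mn n - m\<bar> * L2_norm ?M (\<lambda>x. 1 :: real)" for n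
    proof -
      have "(\<lambda>x. (f x - m) - (\<phi> n x - mn n)) = (\<lambda>x. (f x - \<phi> n x) + (mn n - m) * 1)"
        by (simp add: fun_eq_iff)
      then show ?thesis
        using L2_norm_triangle [OF L2_diff [OF GL(1) \<phi>L(1)] L2_cmult [OF c, of "mn n - m" 1], of n]
        by (simp only: L2_norm_cmult)
    qed
    then show "\<forall>\<^sub>F n in sequentially. L2_norm ?M (\<lambda>x. (f x - m) - (\<phi> n x - mn n))
        \<le> L2_norm ?M (\<lambda>x. f x - \<phi> n x) + \<bar>mn n - m\<bar> * L2_norm ?M (\<lambda>x. 1 :: real)"
      by (intro always_eventually allI)
  qed simp
  then have lim1: "(\<lambda>n. L2_norm ?M (\<lambda>x. \<phi> n x - mn n)) \<longlonglongrightarrow> L2_norm ?M (\<lambda>x. f x - m)"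
    by (rule L2_norm_tendsto [OF L2_diff [OF GL(1) c] L2_diff [OF \<phi>L(1) c]])
  have lim2: "(\<lambda>n. L2_norm ?M (partial i (\<phi> n))) \<longlonglongrightarrow> L2_norm ?M (G i)" for i
    by (rule L2_norm_tendsto [OF GL(2) \<phi>L(2) \<phi>(3)])
  show ?thesis
  proof (rule LIMSEQ_le)
    show "(\<lambda>n. (L2_norm ?M (\<lambda>x. \<phi> n x - mn n))\<^sup>2) \<longlonglongrightarrow> (L2_norm ?M (\<lambda>x. f x - m))\<^sup>2"
      by (intro tendsto_intros lim1)
    show "(\<lambda>n. 2 * h\<^sup>2 * ((L2_norm ?M (partial 1 (\<phi> n)))\<^sup>2 + (L2_norm ?M (partial 2 (\<phi> n)))\<^sup>2))
        \<longlonglongrightarrow> 2 * h\<^sup>2 * ((L2_norm ?M (G 1))\<^sup>2 + (L2_norm ?M (G 2))\<^sup>2)"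
      by (intro tendsto_intros lim2)
    have "mn n * measure lebesgue \<Omega> = (LINT x|?M. \<phi> n x)" for n
      using A by (simp add: mn_def A_def)
    then show "\<exists>N. \<forall>n\<ge>N. (L2_norm ?M (\<lambda>x. \<phi> n x - mn n))\<^sup>2
        \<le> 2 * h\<^sup>2 * ((L2_norm ?M (partial 1 (\<phi> n)))\<^sup>2 + (L2_norm ?M (partial 2 (\<phi> n)))\<^sup>2)"
      using poincare_C1 [OF C1 \<Omega>(1-3) h _ \<Omega>(4)] by blast
  qed
qed

text \<open>By the definition of \<open>edge_mean\<close>, the edge mean minus the mean m is the
  integral of the gradient against x - d, divided by twice the area A. Cauchy-Schwarz and |x - d| <=
  h give 2 k^2 A <= h^2 S for the difference k, again without any shape factor. With 2 h^2 S from
  \<open>poincare\<close>, doubled by the square of a sum, the total is 5 h^2 S.\<close>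

lemma edge_poincare:
  assumes D: "orient d a b \<noteq> 0" and h: "\<And>x y. x \<in> triangle d a b \<Longrightarrow> y \<in> triangle d a b \<Longrightarrow> dist x y \<le> h"
    and hd: "\<And>x. x \<in> triangle d a b \<Longrightarrow> dist x d \<le> h"
    and G: "weak_grad (triangle d a b) f G"
  shows "(L2_norm (lebesgue_on (triangle d a b)) (\<lambda>x. f x - edge_mean d a b f G))\<^sup>2
    \<le> 5 * h\<^sup>2 * ((L2_norm (lebesgue_on (triangle d a b)) (G 1))\<^sup>2 + (L2_norm (lebesgue_on (triangle d a b)) (G 2))\<^sup>2)"
proof -
  let ?T = "triangle d a b"
  let ?M = "lebesgue_on ?T"
  define A where "A = measure lebesgue ?T"
  have A: "A = \<bar>orient d a b\<bar> / 2"
    using measure_triangle [OF D] by (simp add: A_def)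
  have A0: "A > 0"
    using D by (simp add: A)
  have ne: "?T \<noteq> {}"
  proof
    assume "?T = {}"
    then show False
      using A0 by (simp add: A_def)
  qed
  note GL = weak_gradD(1,2) [OF G]
  define m where "m = (LINT x|?M. f x) / A"
  define S where "S = (L2_norm ?M (G 1))\<^sup>2 + (L2_norm ?M (G 2))\<^sup>2"
  have P: "(L2_norm ?M (\<lambda>x. f x - m))\<^sup>2 \<le> 2 * h\<^sup>2 * S"
    unfolding S_def using A0 by (intro poincare [OF _ _ _ ne h G]) (auto simp: m_def A_def)
  have MA: "measure ?M ?T = A"
    by (simp add: A_def measure_restrict_space)
  have bound: "\<bar>LINT x|?M. G i x * (x $ i - d $ i)\<bar> \<le> L2_norm ?M (G i) * (h * sqrt A)" for i
  proof -
    have "\<bar>LINT x|?M. G i x * (x $ i - d $ i)\<bar> \<le> L2_norm ?M (G i) * L2_norm ?M (\<lambda>x. x $ i - d $ i)"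
      by (rule L2_cauchy_schwarz [OF GL(2) L2_triangle_coord])
    also have "L2_norm ?M (\<lambda>x. x $ i - d $ i) \<le> h * sqrt A"
    proof -
      obtain x where "x \<in> ?T"
        using ne by blast
      then have h0: "0 \<le> h"
        using hd zero_le_dist order_trans by blast
      have "(LINT x|?M. (x $ i - d $ i)\<^sup>2) \<le> (LINT x|?M. h\<^sup>2)"
      proof (rule integral_mono)
        show "integrable ?M (\<lambda>x. (x $ i - d $ i)\<^sup>2)"
          using L2_triangle_coord [of i d d a b] by (simp add: L2_real_iff)
        show "integrable ?M (\<lambda>x. h\<^sup>2)"
          by (simp add: finite_measure.integrable_const)
        fix x assume "x \<in> space ?M"
        then have "norm (x - d) \<le> h"
          using hd by (simp add: dist_norm)
        then have "\<bar>x $ i - d $ i\<bar> \<le> h"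
          using component_le_norm_cart [of "x - d" i] by simp
        then show "(x $ i - d $ i)\<^sup>2 \<le> h\<^sup>2"
          using h0 by (simp add: abs_le_square_iff [symmetric])
      qed
      also have "\<dots> = h\<^sup>2 * A"
        by (simp add: MA)
      finally have "L2_norm ?M (\<lambda>x. x $ i - d $ i) \<le> sqrt (h\<^sup>2 * A)"
        unfolding L2_norm_real by simp
      then show ?thesis
        using h0 by (simp add: real_sqrt_mult)
    qed
    finally show ?thesis
      by (simp add: mult_left_mono)
  qed
  define k where "k = m - edge_mean d a b f G"
  have "k = - ((LINT x|?M. G 1 x * (x $ 1 - d $ 1)) + (LINT x|?M. G 2 x * (x $ 2 - d $ 2))) / (2 * A)"
    using A0 by (simp add: k_def m_def edge_mean_def A field_simps)
  then have "\<bar>k\<bar> * (2 * A) = \<bar>(LINT x|?M. G 1 x * (x $ 1 - d $ 1)) + (LINT x|?M. G 2 x * (x $ 2 - d $ 2))\<bar>"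
    using A0 by (simp add: abs_divide)
  also have "\<dots> \<le> (L2_norm ?M (G 1) + L2_norm ?M (G 2)) * (h * sqrt A)"
    using bound [of 1] bound [of 2] by (simp add: distrib_right)
  finally have "(\<bar>k\<bar> * (2 * A))\<^sup>2 \<le> ((L2_norm ?M (G 1) + L2_norm ?M (G 2)) * (h * sqrt A))\<^sup>2"
    using A0 by (intro power_mono) auto
  also have "\<dots> = (L2_norm ?M (G 1) + L2_norm ?M (G 2))\<^sup>2 * (h\<^sup>2 * A)"
    using A0 by (simp add: power_mult_distrib)
  also have "\<dots> \<le> (2 * S) * (h\<^sup>2 * A)"
    using sum_squares_bound [of "L2_norm ?M (G 1)" "L2_norm ?M (G 2)"] A0
    by (intro mult_right_mono) (auto simp: S_def power2_sum)
  finally have "(2 * A) * (2 * (k\<^sup>2 * A)) \<le> (2 * A) * (h\<^sup>2 * S)"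
    by (simp add: power2_eq_square algebra_simps)
  then have k: "2 * (k\<^sup>2 * A) \<le> h\<^sup>2 * S"
    by (rule mult_left_le_imp_le) (use A0 in simp)
  have "(L2_norm ?M (\<lambda>x. f x - edge_mean d a b f G))\<^sup>2 = (LINT x|?M. (f x - m + k)\<^sup>2)"
    by (simp add: L2_norm_sq k_def)
  also have "\<dots> \<le> (LINT x|?M. 2 * (f x - m)\<^sup>2 + 2 * k\<^sup>2)"
  proof (rule integral_mono)
    have c: "(\<lambda>x. c) \<in> L2 ?M" for c :: real
      by simp
    have L: "(\<lambda>x. f x - m) \<in> L2 ?M"
      by (rule L2_diff [OF GL(1) c])
    show "integrable ?M (\<lambda>x. (f x - m + k)\<^sup>2)"
      using L2_add [OF L c [of k]] by (simp add: L2_real_iff)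
    show "integrable ?M (\<lambda>x. 2 * (f x - m)\<^sup>2 + 2 * k\<^sup>2)"
      using L by (simp add: L2_real_iff finite_measure.integrable_const)
    show "(f x - m + k)\<^sup>2 \<le> 2 * (f x - m)\<^sup>2 + 2 * k\<^sup>2" for x
      using sum_squares_bound [of "f x - m" k] by (simp add: power2_sum)
  qed
  also have "\<dots> = 2 * (L2_norm ?M (\<lambda>x. f x - m))\<^sup>2 + 2 * (k\<^sup>2 * A)"
    using L2_diff [OF GL(1) L2_const [OF finite_measure_triangle, of m]]
    by (simp add: L2_real_iff L2_norm_sq MA finite_measure.integrable_const)
  also have "\<dots> \<le> 2 * (2 * h\<^sup>2 * S) + h\<^sup>2 * S"
    using P k by linarith
  finally show ?thesis
    by (simp add: S_def algebra_simps)
qed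

section \<open>Edge fluxes of vector fields\<close>

text \<open>\<open>G i j\<close> is the derivative of component i in direction j.\<close>

definition weak_jacobian :: "(real^2) set \<Rightarrow> (real^2 \<Rightarrow> real^2) \<Rightarrow> (2 \<Rightarrow> 2 \<Rightarrow> real^2 \<Rightarrow> real) \<Rightarrow> bool" where
  "weak_jacobian \<omega> v G \<longleftrightarrow> (\<forall>i. weak_grad \<omega> (\<lambda>x. v x $ i) (G i))"

text \<open>The line integral of the tangential component of v from a to b, expressed by volume
  integrals over a triangle with apex d. The vector b - a carries the unit tangent and the length of
  the edge.\<close>

definition edge_flux ::
  "real^2 \<Rightarrow> real^2 \<Rightarrow> real^2 \<Rightarrow> (real^2 \<Rightarrow> real^2) \<Rightarrow> (2 \<Rightarrow> 2 \<Rightarrow> real^2 \<Rightarrow> real) \<Rightarrow> real" where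
  "edge_flux d a b v G = (b $ 1 - a $ 1) * edge_mean d a b (\<lambda>x. v x $ 1) (G 1)
     + (b $ 2 - a $ 2) * edge_mean d a b (\<lambda>x. v x $ 2) (G 2)"

lemma edge_mean_swap: "edge_mean d b a f G = edge_mean d a b f G"
  by (simp add: edge_mean_def triangle_perm(3) [of d a b] orient_swap(2) [of d a b])

lemma edge_flux_swap: "edge_flux d b a v G = - edge_flux d a b v G"
  by (simp add: edge_flux_def edge_mean_swap algebra_simps)

lemma edge_mean_cong_AE:
  assumes "f \<in> borel_measurable (lebesgue_on (triangle d a b))" "f' \<in> borel_measurable (lebesgue_on (triangle d a b))"
    and "AE x in lebesgue_on (triangle d a b). f x = f' x"
  shows "edge_mean d a b f G = edge_mean d a b f' G"
  unfolding edge_mean_def using integral_cong_AE [OF assms] by simp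

text \<open>One sequence serves the convex set and all its open subsets. This is how a trace of u
  taken from P is reached: density is known on the convex hull, and P is only a subset of
  it.\<close>

lemma smooth_approximation:
  assumes \<Omega>: "open \<Omega>" "convex \<Omega>" "bounded \<Omega>" and G: "weak_grad \<Omega> f G"
  obtains \<phi> :: "nat \<Rightarrow> real^2 \<Rightarrow> real" where "\<And>n. smooth (\<phi> n)"
    "\<And>\<omega> n. open \<omega> \<Longrightarrow> \<omega> \<subseteq> \<Omega> \<Longrightarrow> (\<lambda>x. f x - \<phi> n x) \<in> H1 \<omega>"
    "\<And>\<omega>. open \<omega> \<Longrightarrow> \<omega> \<subseteq> \<Omega> \<Longrightarrow> (\<lambda>n. H1_norm \<omega> (\<lambda>x. f x - \<phi> n x)) \<longlonglongrightarrow> 0"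
proof -
  obtain \<phi> where \<phi>: "\<And>n. smooth (\<phi> n)" "(\<lambda>n. L2_norm (lebesgue_on \<Omega>) (\<lambda>x. f x - \<phi> n x)) \<longlonglongrightarrow> 0"
    "\<And>i. (\<lambda>n. L2_norm (lebesgue_on \<Omega>) (\<lambda>x. G i x - partial i (\<phi> n) x)) \<longlonglongrightarrow> 0"
    using smooth_dense_weak_grad [OF \<Omega> G] by blast
  have DG: "weak_grad \<omega> (\<lambda>x. f x - \<phi> n x) (\<lambda>i x. G i x - partial i (\<phi> n) x)" if "open \<omega>" "\<omega> \<subseteq> \<Omega>" for \<omega> n
    by (rule weak_grad_mono [OF weak_grad_diff [OF G weak_grad_C1 [OF smooth_imp_C1 [OF \<phi>(1)] \<Omega>(1,3)] \<Omega>(1)]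
          that(2) \<Omega>(1) that(1)])
  show thesis
  proof (rule that)
    show "smooth (\<phi> n)" for n
      by (rule \<phi>)
    show "(\<lambda>x. f x - \<phi> n x) \<in> H1 \<omega>" if "open \<omega>" "\<omega> \<subseteq> \<Omega>" for \<omega> n
      using DG [OF that] H1_iff by blast
    fix \<omega> assume \<omega>: "open \<omega>" "\<omega> \<subseteq> \<Omega>"
    have m: "\<omega> \<in> sets lebesgue" "\<Omega> \<in> sets lebesgue"
      using \<omega> \<Omega> by auto
    let ?E = "\<lambda>n. sqrt ((L2_norm (lebesgue_on \<Omega>) (\<lambda>x. f x - \<phi> n x))\<^sup>2
      + (L2_norm (lebesgue_on \<Omega>) (\<lambda>x. G 1 x - partial 1 (\<phi> n) x))\<^sup>2
      + (L2_norm (lebesgue_on \<Omega>) (\<lambda>x. G 2 x - partial 2 (\<phi> n) x))\<^sup>2)"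
    have "?E \<longlonglongrightarrow> sqrt (0\<^sup>2 + 0\<^sup>2 + 0\<^sup>2)"
      by (intro tendsto_intros \<phi>)
    then have E: "?E \<longlonglongrightarrow> 0"
      by simp
    have bound: "H1_norm \<omega> (\<lambda>x. f x - \<phi> n x) \<le> ?E n" for n
    proof (rule real_le_rsqrt)
      note D\<Omega> = DG [OF \<Omega>(1) subset_refl, of n]
      show "(H1_norm \<omega> (\<lambda>x. f x - \<phi> n x))\<^sup>2 \<le> (L2_norm (lebesgue_on \<Omega>) (\<lambda>x. f x - \<phi> n x))\<^sup>2
          + (L2_norm (lebesgue_on \<Omega>) (\<lambda>x. G 1 x - partial 1 (\<phi> n) x))\<^sup>2
          + (L2_norm (lebesgue_on \<Omega>) (\<lambda>x. G 2 x - partial 2 (\<phi> n) x))\<^sup>2"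
        unfolding H1_norm_sq [OF \<omega>(1) DG [OF \<omega>]]
        by (intro add_mono power_mono L2_norm_nonneg L2_lebesgue_on_mono(2) [OF weak_gradD(1) [OF D\<Omega>] \<omega>(2) m]
            L2_lebesgue_on_mono(2) [OF weak_gradD(2) [OF D\<Omega>] \<omega>(2) m])
    qed
    have "0 \<le> H1_norm \<omega> g" for g
      by (simp add: H1_norm_def sum_nonneg)
    then show "(\<lambda>n. H1_norm \<omega> (\<lambda>x. f x - \<phi> n x)) \<longlonglongrightarrow> 0"
      by (intro tendsto_sandwich [OF _ _ tendsto_const E] always_eventually allI bound)
  qed
qed

text \<open>For smooth functions both sides are the mean over the segment, which knows nothing about
  the apex; both are continuous in H^1.\<close>

lemma edge_mean_opposite_vertex:
  assumes \<Omega>: "open \<Omega>" "convex \<Omega>" "bounded \<Omega>" and G: "weak_grad \<Omega> f G"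
    and T: "triangle d a b \<subseteq> \<Omega>" "orient d a b \<noteq> 0" "triangle d' a b \<subseteq> \<Omega>" "orient d' a b \<noteq> 0"
  shows "edge_mean d a b f G = edge_mean d' a b f G"
proof -
  obtain \<phi> where \<phi>: "\<And>n. smooth (\<phi> n)"
    "\<And>\<omega> n. open \<omega> \<Longrightarrow> \<omega> \<subseteq> \<Omega> \<Longrightarrow> (\<lambda>x. f x - \<phi> n x) \<in> H1 \<omega>"
    "\<And>\<omega>. open \<omega> \<Longrightarrow> \<omega> \<subseteq> \<Omega> \<Longrightarrow> (\<lambda>n. H1_norm \<omega> (\<lambda>x. f x - \<phi> n x)) \<longlonglongrightarrow> 0"
    using smooth_approximation [OF \<Omega> G] by blast
  have C1: "cont_diff 1 (\<phi> n)" for n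
    using \<phi>(1) smooth_imp_C1 by blast
  have "(\<lambda>n. segint (\<phi> n) a b) \<longlonglongrightarrow> edge_mean d a b f G" if T: "triangle d a b \<subseteq> \<Omega>" "orient d a b \<noteq> 0" for d
  proof -
    have "(\<lambda>n. edge_mean d a b (\<phi> n) (\<lambda>i. partial i (\<phi> n))) \<longlonglongrightarrow> edge_mean d a b f G"
      by (rule edge_mean_tendsto [OF weak_gradD(1,2) [OF weak_grad_mono [OF G T(1) \<Omega>(1) open_triangle]]
          continuous_L2_triangle [OF C1_continuous [OF C1]] continuous_L2_triangle [OF C1_partial_continuous [OF C1]]
          H1_tendsto_triangle [OF \<Omega>(1) T(1) G \<phi>(1) \<phi>(2) [OF \<Omega>(1) subset_refl] \<phi>(3) [OF \<Omega>(1) subset_refl]]])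
    then show ?thesis
      by (simp add: edge_mean_C1 [OF T(2) C1])
  qed
  from this [OF T(1,2)] this [OF T(3,4)] show ?thesis
    by (rule LIMSEQ_unique)
qed

lemma edge_flux_opposite_vertex:
  assumes "open \<Omega>" "convex \<Omega>" "bounded \<Omega>" "weak_jacobian \<Omega> v G"
    and "triangle d a b \<subseteq> \<Omega>" "orient d a b \<noteq> 0" "triangle d' a b \<subseteq> \<Omega>" "orient d' a b \<noteq> 0"
  shows "edge_flux d a b v G = edge_flux d' a b v G"
proof -
  have "edge_mean d a b (\<lambda>x. v x $ i) (G i) = edge_mean d' a b (\<lambda>x. v x $ i) (G i)" for i
    by (rule edge_mean_opposite_vertex [OF assms(1-3) _ assms(5-8)]) (use assms(4) in \<open>simp add: weak_jacobian_def\<close>)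
  then show ?thesis
    by (simp add: edge_flux_def)
qed

text \<open>Once smooth approximations exist, the value chosen by \<open>trace_on\<close> really is
  a trace, and by \<open>trace_segint\<close> its mean is given by volume integrals. The length in
  the arc-length measure cancels the normalisation of the tangent.\<close>

lemma edge_integral_eq_flux:
  assumes \<omega>: "open \<omega>" "triangle d a b \<subseteq> \<omega>" and D: "orient d a b \<noteq> 0" and G: "weak_jacobian \<omega> v G"
    and appr: "\<And>i. \<exists>\<phi> :: nat \<Rightarrow> real^2 \<Rightarrow> real. (\<forall>n. smooth (\<phi> n)) \<and> (\<forall>n. (\<lambda>x. v x $ i - \<phi> n x) \<in> H1 \<omega>) \<and>
      (\<lambda>n. H1_norm \<omega> (\<lambda>x. v x $ i - \<phi> n x)) \<longlonglongrightarrow> 0"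
  shows "edge_integral \<omega> v a b = edge_flux d a b v G"
proof -
  let ?N = "arc_length a b"
  have Gi: "weak_grad \<omega> (\<lambda>x. v x $ i) (G i)" for i
    using G by (simp add: weak_jacobian_def)
  define tr where "tr i = trace_on \<omega> a b (\<lambda>y. v y $ i)" for i
  have tr: "is_trace \<omega> a b (\<lambda>y. v y $ i) (tr i)" for i
    using appr [of i] trace_exists [OF \<omega> D Gi [of i]] unfolding tr_def by blast
  have seg: "segint (tr i) a b = edge_mean d a b (\<lambda>x. v x $ i) (G i)" for i
    by (rule trace_segint [OF \<omega> D Gi tr])
  have trL: "tr i \<in> L2 ?N" for i
    using tr by (simp add: is_trace_def)
  have trm: "tr i \<in> borel_measurable borel" for i
    using L2_measurable [OF trL] by (simp add: measurable_def)
  have int: "integrable ?N (tr i)" for i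
    by (rule L2_integrable [OF finite_measure_arc_length trL])
  have "a \<noteq> b"
    using D by auto
  have "edge_integral \<omega> v a b = (LINT x|?N. tr 1 x * ((b $ 1 - a $ 1) / dist a b) + tr 2 x * ((b $ 2 - a $ 2) / dist a b))"
    by (simp add: edge_integral_def tr_def inner_vec_def sum_2 dist_norm norm_minus_commute divide_inverse mult.commute)
  also have "\<dots> = (LINT x|?N. tr 1 x) * ((b $ 1 - a $ 1) / dist a b) + (LINT x|?N. tr 2 x) * ((b $ 2 - a $ 2) / dist a b)"
    using int by simp
  also have "\<dots> = edge_flux d a b v G"
    using \<open>a \<noteq> b\<close> by (simp add: integral_arc_length(1) [OF trm] seg edge_flux_def)
  finally show ?thesis .
qed

lemma edge_integral_convex:
  assumes \<Omega>: "open \<Omega>" "convex \<Omega>" "bounded \<Omega>" and G: "weak_jacobian \<Omega> v G"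
    and \<omega>: "open \<omega>" "\<omega> \<subseteq> \<Omega>" "triangle d a b \<subseteq> \<omega>" and D: "orient d a b \<noteq> 0"
  shows "edge_integral \<omega> v a b = edge_flux d a b v G"
proof (rule edge_integral_eq_flux [OF \<omega>(1,3) D])
  have Gi: "weak_grad \<Omega> (\<lambda>x. v x $ i) (G i)" for i
    using G by (simp add: weak_jacobian_def)
  show "weak_jacobian \<omega> v G"
    unfolding weak_jacobian_def using weak_grad_mono [OF Gi \<omega>(2) \<Omega>(1) \<omega>(1)] by blast
  fix i
  show "\<exists>\<phi> :: nat \<Rightarrow> real^2 \<Rightarrow> real. (\<forall>n. smooth (\<phi> n)) \<and> (\<forall>n. (\<lambda>x. v x $ i - \<phi> n x) \<in> H1 \<omega>) \<and>
      (\<lambda>n. H1_norm \<omega> (\<lambda>x. v x $ i - \<phi> n x)) \<longlonglongrightarrow> 0"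
  proof -
    obtain \<phi> where "\<And>n. smooth (\<phi> n)"
      "\<And>\<omega> n. open \<omega> \<Longrightarrow> \<omega> \<subseteq> \<Omega> \<Longrightarrow> (\<lambda>x. v x $ i - \<phi> n x) \<in> H1 \<omega>"
      "\<And>\<omega>. open \<omega> \<Longrightarrow> \<omega> \<subseteq> \<Omega> \<Longrightarrow> (\<lambda>n. H1_norm \<omega> (\<lambda>x. v x $ i - \<phi> n x)) \<longlonglongrightarrow> 0"
      using smooth_approximation [OF \<Omega> Gi [of i]] by blast
    with \<omega>(1,2) show ?thesis
      by blast
  qed
qed

definition C1_field :: "(real^2 \<Rightarrow> real^2) \<Rightarrow> bool" where
  "C1_field p \<longleftrightarrow> (\<forall>i. cont_diff 1 (\<lambda>x. p x $ i))"

definition jacobian :: "(real^2 \<Rightarrow> real^2) \<Rightarrow> 2 \<Rightarrow> 2 \<Rightarrow> real^2 \<Rightarrow> real" where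
  "jacobian p i j = partial j (\<lambda>x. p x $ i)"

lemma edge_flux_C1:
  assumes D: "orient d a b \<noteq> 0" and p: "C1_field p"
  shows "edge_flux d a b p (jacobian p) = segint (\<lambda>x. p x \<bullet> (b - a)) a b"
proof -
  have C1: "cont_diff 1 (\<lambda>x. p x $ i)" for i
    using p by (simp add: C1_field_def)
  have int: "integrable lborel (\<lambda>s. indicator {0..1} s * (p (linepath a b s) $ i))" for i
    by (rule continuous_segment_integrable [OF C1_continuous [OF C1]])
  have "segint (\<lambda>x. p x \<bullet> (b - a)) a b = (LINT s|lborel.
      (b $ 1 - a $ 1) * (indicator {0..1} s * (p (linepath a b s) $ 1)) + (b $ 2 - a $ 2) * (indicator {0..1} s * (p (linepath a b s) $ 2)))"
    unfolding segint_def by (rule Bochner_Integration.integral_cong) (auto simp: inner_vec_def sum_2 algebra_simps)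
  also have "\<dots> = (b $ 1 - a $ 1) * segint (\<lambda>x. p x $ 1) a b + (b $ 2 - a $ 2) * segint (\<lambda>x. p x $ 2) a b"
    using int by (simp add: segint_def)
  also have "\<dots> = edge_flux d a b p (jacobian p)"
    unfolding edge_flux_def jacobian_def by (simp only: edge_mean_C1 [OF D C1])
  finally show ?thesis ..
qed

text \<open>Meant for the pieces of the interpolant, which agree with an edge element only almost
  everywhere. The constant sequence p approximates v in H^1, the distance being 0.\<close>

lemma edge_integral_cong_smooth:
  assumes D: "orient d a b \<noteq> 0" and v: "v \<in> borel_measurable (lebesgue_on (triangle d a b))"
    and p: "\<And>i. smooth (\<lambda>x. p x $ i)" and AE: "AE x in lebesgue_on (triangle d a b). v x = p x"
  shows "edge_integral (triangle d a b) v a b = segint (\<lambda>x. p x \<bullet> (b - a)) a b"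
proof -
  let ?T = "triangle d a b"
  have C1: "cont_diff 1 (\<lambda>x. p x $ i)" for i
    using p smooth_imp_C1 by blast
  have vm: "(\<lambda>x. v x $ i) \<in> borel_measurable (lebesgue_on ?T)" for i
    using v borel_measurable_vec2_iff by blast
  have pm: "(\<lambda>x. p x $ i) \<in> borel_measurable (lebesgue_on ?T)" for i
    by (rule borel_measurable_lebesgue_on [OF C1_measurable [OF C1]])
  have AEi: "AE x in lebesgue_on ?T. p x $ i = v x $ i" for i
    using AE by eventually_elim simp
  have pG: "weak_grad ?T (\<lambda>x. p x $ i) (jacobian p i)" for i
    unfolding jacobian_def by (rule weak_grad_C1 [OF C1]) auto
  have vG: "weak_grad ?T (\<lambda>x. v x $ i) (jacobian p i)" for i
    by (rule weak_grad_cong_AE [OF pG open_triangle vm AEi])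
  have "edge_integral ?T v a b = edge_flux d a b v (jacobian p)"
  proof (rule edge_integral_eq_flux [OF open_triangle subset_refl D])
    show "weak_jacobian ?T v (jacobian p)"
      by (simp add: weak_jacobian_def vG)
    fix i
    have dG: "weak_grad ?T (\<lambda>x. v x $ i - p x $ i) (\<lambda>j x. jacobian p i j x - jacobian p i j x)"
      by (rule weak_grad_diff [OF vG pG open_triangle])
    have "L2_norm (lebesgue_on ?T) (\<lambda>x. v x $ i - p x $ i) = L2_norm (lebesgue_on ?T) (\<lambda>x. 0 :: real)"
      by (rule L2_norm_cong_AE) (use vm pm AEi [of i] in auto)
    then have "(H1_norm ?T (\<lambda>x. v x $ i - p x $ i))\<^sup>2 = 0"
      unfolding H1_norm_sq [OF open_triangle dG] by (simp add: L2_norm_real)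
    then show "\<exists>\<phi> :: nat \<Rightarrow> real^2 \<Rightarrow> real. (\<forall>n. smooth (\<phi> n)) \<and> (\<forall>n. (\<lambda>x. v x $ i - \<phi> n x) \<in> H1 ?T) \<and>
      (\<lambda>n. H1_norm ?T (\<lambda>x. v x $ i - \<phi> n x)) \<longlonglongrightarrow> 0"
      using p dG H1_iff by (intro exI [of _ "\<lambda>n x. p x $ i"]) auto
  qed
  also have "\<dots> = edge_flux d a b p (jacobian p)"
    unfolding edge_flux_def using edge_mean_cong_AE [OF pm vm AEi] by simp
  also have "\<dots> = segint (\<lambda>x. p x \<bullet> (b - a)) a b"
    by (rule edge_flux_C1 [OF D]) (unfold C1_field_def, rule allI, rule C1)
  finally show ?thesis .
qed

text \<open>Summing the edge formula over the three edges, everything but the curl cancels: the edge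
  vectors add up to zero.\<close>

lemma stokes_triangle:
  assumes D: "orient a b c \<noteq> 0" and G: "weak_jacobian (triangle a b c) v G"
  shows "edge_flux c a b v G + edge_flux a b c v G + edge_flux b c a v G
    = sgn (orient a b c) * (LINT x|lebesgue_on (triangle a b c). G 2 1 x - G 1 2 x)"
proof -
  let ?M = "lebesgue_on (triangle a b c)"
  have Gi: "weak_grad (triangle a b c) (\<lambda>x. v x $ i) (G i)" for i
    using G by (simp add: weak_jacobian_def)
  note GL = weak_gradD(1,2) [OF Gi]
  have Ti: "triangle c a b = triangle a b c" "triangle b c a = triangle a b c"
    using triangle_perm(1) by metis+
  have Di: "orient c a b = orient a b c" "orient b c a = orient a b c"
    by (simp_all add: orient_cycle)
  define I where "I i j = (LINT x|?M. G i j x)" for i j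
  define X where "X i j = (LINT x|?M. G i j x * x $ j)" for i j
  define V where "V i = (LINT x|?M. v x $ i)" for i
  have int: "integrable ?M (G i j)" "integrable ?M (\<lambda>x. G i j x * x $ j)" for i j
    using L2_integrable [OF finite_measure_triangle GL(2)]
      L2_mult_integrable [OF GL(2) L2_triangle_coord [of _ 0, simplified]] by auto
  have lin: "(LINT x|?M. G i j x * (x $ j - t)) = X i j - t * I i j" for i j t
    using int [of i j] by (simp add: right_diff_distrib X_def I_def mult.commute [of _ t])
  have curl: "(LINT x|?M. G 2 1 x - G 1 2 x) = I 2 1 - I 1 2"
    using int by (simp add: I_def)
  define R where "R = \<bar>orient a b c\<bar>"
  have R: "R \<noteq> 0"
    using D by (simp add: R_def)
  have "R * (edge_flux c a b v G + edge_flux a b c v G + edge_flux b c a v G) = orient a b c * (I 2 1 - I 1 2)"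
  proof -
    \<comment> \<open>The numerator of the edge mean of component i for the apex o'. It is affine in
      the apex, which makes the final cancellation an algebraic identity.\<close>
    define Y where "Y i o' = 2 * V i + (X i 1 - o' $ 1 * I i 1) + (X i 2 - o' $ 2 * I i 2)" for i and o' :: "real^2"
    have aux: "R * (p * (y / R) + q * (z / R)) = p * y + q * z" for p q y z
      using R by (simp add: field_simps)
    have "R * edge_flux c a b v G = (b $ 1 - a $ 1) * Y 1 c + (b $ 2 - a $ 2) * Y 2 c"
      "R * edge_flux a b c v G = (c $ 1 - b $ 1) * Y 1 a + (c $ 2 - b $ 2) * Y 2 a"
      "R * edge_flux b c a v G = (a $ 1 - c $ 1) * Y 1 b + (a $ 2 - c $ 2) * Y 2 b"
      unfolding edge_flux_def edge_mean_def Ti Di lin V_def [symmetric] R_def [symmetric] Y_def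
      by (rule aux)+
    then have "R * (edge_flux c a b v G + edge_flux a b c v G + edge_flux b c a v G)
      = ((b $ 1 - a $ 1) * Y 1 c + (b $ 2 - a $ 2) * Y 2 c) + ((c $ 1 - b $ 1) * Y 1 a + (c $ 2 - b $ 2) * Y 2 a)
        + ((a $ 1 - c $ 1) * Y 1 b + (a $ 2 - c $ 2) * Y 2 b)"
      by (simp add: distrib_left)
    also have "\<dots> = orient a b c * (I 2 1 - I 1 2)"
      by (simp add: Y_def orient_def algebra_simps)
    finally show ?thesis .
  qed
  moreover have "orient a b c = R * sgn (orient a b c)"
    by (simp add: R_def abs_mult_sgn)
  ultimately have "R * (edge_flux c a b v G + edge_flux a b c v G + edge_flux b c a v G)
      = R * (sgn (orient a b c) * (I 2 1 - I 1 2))"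
    by (metis mult.assoc)
  then show ?thesis
    using R curl by simp
qed

section \<open>Simple polygons are Jordan curves\<close>

text \<open>A component of the complement cannot meet both open pieces. Those in I are bounded, and
  the connected piece J lies in a single unbounded component.\<close>

lemma inside_eqI:
  assumes "I \<inter> J = {}" "I \<union> J = - S" "open I" "open J" "connected J" "bounded I" "\<not> bounded J"
  shows "inside S = I"
proof (intro equalityI subsetI)
  fix x assume x: "x \<in> inside S"
  then have xS: "x \<notin> S" "bounded (connected_component_set (- S) x)"
    by (auto simp: inside_def)
  show "x \<in> I"
  proof (rule ccontr)
    assume "x \<notin> I"
    then have "x \<in> J"
      using xS assms(2) by blast
    then have "J \<subseteq> connected_component_set (- S) x"
      using assms by (intro connected_component_maximal) auto
    then show False
      using xS assms(7) bounded_subset by blast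
  qed
next
  fix x assume x: "x \<in> I"
  let ?C = "connected_component_set (- S) x"
  have "?C \<subseteq> - S" "connected ?C" "x \<in> ?C"
    using x assms(2) connected_component_subset connected_component_refl_eq [of "- S" x] by auto
  then have "J \<inter> ?C = {}"
    using connectedD [of ?C I J] assms(1-4) x by blast
  then have "?C \<subseteq> I"
    using assms(2) \<open>?C \<subseteq> - S\<close> by blast
  then show "x \<in> inside S"
    using assms(2,6) x bounded_subset by (auto simp: inside_def)
qed

text \<open>Transport of the Jordan curve theorem from the complex plane by the linear isomorphism k
  and its inverse f. The images of the two components are recognised as inside and outside by
  \<open>inside_eqI\<close>.\<close>

lemma Jordan_inside_outside_real2:
  fixes g :: "real \<Rightarrow> real^2"
  assumes g: "simple_path g" "pathfinish g = pathstart g"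
  defines "S \<equiv> path_image g"
  shows "inside S \<noteq> {}" "open (inside S)" "connected (inside S)" "bounded (inside S)"
    "open (outside S)" "inside S \<inter> outside S = {}" "inside S \<union> outside S = - S"
    "frontier (inside S) = S" "frontier (outside S) = S"
proof -
  define f :: "real^2 \<Rightarrow> complex" where "f v = Complex (v $ 1) (v $ 2)" for v
  define k :: "complex \<Rightarrow> real^2" where "k z = vector [Re z, Im z]" for z
  have fk: "f (k z) = z" "k (f v) = v" for z v
    by (simp_all add: f_def k_def complex_eq_iff vec_eq_iff forall_2)
  have lin: "linear f" "linear k"
    by (auto intro!: linearI simp: f_def k_def complex_eq_iff vec_eq_iff forall_2)
  have cont: "continuous_on A f" "continuous_on C k" for A C
    using lin linear_continuous_on linear_linear by blast+
  have kim: "k ` A = f -` A" for A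
  proof (rule set_eqI)
    show "v \<in> k ` A \<longleftrightarrow> v \<in> f -` A" for v
      using fk by (metis imageE imageI vimageE vimageI)
  qed
  have injk: "inj k" and surjk: "surj k"
    using fk by (metis injI, metis surjI)
  have injf: "inj f"
    using fk by (metis injI)
  let ?c = "f \<circ> g"
  have "simple_path ?c"
    using g(1) cont(1) inj_on_subset [OF injf subset_UNIV] by (intro simple_path_continuous_image) auto
  moreover have "pathfinish ?c = pathstart ?c"
    using g(2) by (simp add: pathfinish_compose pathstart_compose)
  ultimately have J: "inside (path_image ?c) \<noteq> {}" "open (inside (path_image ?c))" "connected (inside (path_image ?c))"
    "open (outside (path_image ?c))" "connected (outside (path_image ?c))"
    "bounded (inside (path_image ?c))" "\<not> bounded (outside (path_image ?c))"
    "inside (path_image ?c) \<inter> outside (path_image ?c) = {}"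
    "inside (path_image ?c) \<union> outside (path_image ?c) = - path_image ?c"
    "frontier (inside (path_image ?c)) = path_image ?c" "frontier (outside (path_image ?c)) = path_image ?c"
    using Jordan_inside_outside [of ?c] by auto
  have pc: "path_image ?c = f ` S"
    by (simp add: S_def path_image_compose)
  define I U where "I = k ` inside (path_image ?c)" and "U = k ` outside (path_image ?c)"
  have op: "open (k ` A)" if "open A" for A
    unfolding kim
    by (rule continuous_open_vimage [OF that]) (use cont(1) [of UNIV] in \<open>simp add: continuous_on_eq_continuous_at\<close>)
  have kfS: "k ` (f ` S) = S"
    by (simp add: image_image fk)
  have 1: "I \<inter> U = {}" "I \<union> U = - S"
  proof -
    show "I \<inter> U = {}"
      unfolding I_def U_def using J(8) injk by (metis image_Int image_empty)
    have "I \<union> U = k ` (- path_image ?c)"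
      unfolding I_def U_def by (simp add: image_Un [symmetric] J(9))
    also have "\<dots> = - k ` path_image ?c"
      using injk surjk by (simp add: bij_image_Compl_eq bij_def)
    finally show "I \<union> U = - S"
      by (simp add: pc kfS)
  qed
  have 2: "open I" "open U" "connected I" "connected U" "bounded I" "I \<noteq> {}"
    using J op cont(2) lin(2) by (auto simp: I_def U_def connected_continuous_image bounded_linear_image linear_linear)
  have 3: "\<not> bounded U"
  proof
    assume "bounded U"
    then have "bounded (f ` U)"
      using lin(1) by (simp add: bounded_linear_image linear_linear)
    then show False
      using J(7) by (simp add: U_def image_image fk)
  qed
  have ins: "inside S = I"
    by (rule inside_eqI [OF 1 2(1,2,4,5) 3])
  have outs: "outside S = U"
    using inside_Un_outside [of S] inside_Int_outside [of S] 1 ins by blast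
  have cl: "closure (k ` A) = k ` closure A" for A
  proof
    have "closed (k ` closure A)"
      unfolding kim
      by (rule continuous_closed_vimage [OF closed_closure]) (use cont(1) [of UNIV] in \<open>simp add: continuous_on_eq_continuous_at\<close>)
    then show "closure (k ` A) \<subseteq> k ` closure A"
      using closure_subset by (intro closure_minimal) auto
    show "k ` closure A \<subseteq> closure (k ` A)"
      by (intro image_closure_subset cont(2) closed_closure closure_subset)
  qed
  have fr: "frontier (k ` A) = k ` frontier A" if "open A" for A
    using op [OF that] that injk by (simp add: frontier_def interior_open cl image_set_diff)
  show "inside S \<noteq> {}" "open (inside S)" "connected (inside S)" "bounded (inside S)"
    "open (outside S)" "inside S \<inter> outside S = {}" "inside S \<union> outside S = - S"
    using 1 2 by (auto simp: ins outs)
  show "frontier (inside S) = S" "frontier (outside S) = S"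
    unfolding ins outs I_def U_def using J(2,4,10,11) by (simp_all add: fr pc kfS)
qed

section \<open>The boundary of a simple polygon as a closed path\<close>

lemma next_vertex_simps:
  "Suc i < length vs \<Longrightarrow> next_vertex vs i = vs ! Suc i"
  "Suc i = length vs \<Longrightarrow> next_vertex vs i = vs ! 0"
  by (simp_all add: next_vertex_def)

lemma simple_polygonD:
  assumes "simple_polygon vs"
  shows "3 \<le> length vs" "distinct vs"
    "\<And>i j. i < length vs \<Longrightarrow> j < length vs \<Longrightarrow> i \<noteq> j \<Longrightarrow>
      polygon_edge vs i \<inter> polygon_edge vs j = {vs ! i, next_vertex vs i} \<inter> {vs ! j, next_vertex vs j}"
  using assms by (auto simp: simple_polygon_def)

lemma polygon_arc:
  assumes vs: "simple_polygon vs" and k: "1 \<le> k" "k < length vs"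
  shows "\<exists>g. arc g \<and> pathstart g = vs ! 0 \<and> pathfinish g = vs ! k \<and> path_image g = (\<Union>i<k. polygon_edge vs i)"
  using k
proof (induction k rule: dec_induct)
  case base
  have "vs ! 0 \<noteq> vs ! 1"
  proof -
    have "0 < length vs" "1 < length vs"
      using simple_polygonD(1) [OF vs] by linarith+
    then show ?thesis
      using simple_polygonD(2) [OF vs] by (metis nth_eq_iff_index_eq zero_neq_one)
  qed
  then show ?case
    using base by (intro exI [of _ "linepath (vs ! 0) (vs ! 1)"])
      (auto simp: polygon_edge_def next_vertex_simps arc_linepath)
next
  case (step k)
  then obtain g where g: "arc g" "pathstart g = vs ! 0" "pathfinish g = vs ! k" "path_image g = (\<Union>i<k. polygon_edge vs i)"
    by auto
  note d = simple_polygonD(2) [OF vs]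
  have nv: "next_vertex vs k = vs ! Suc k"
    using step by (simp add: next_vertex_simps)
  have "vs ! k \<noteq> vs ! Suc k"
    using step d by (simp add: nth_eq_iff_index_eq)
  then have "arc (g +++ linepath (vs ! k) (vs ! Suc k))"
  proof (intro arc_join g(1) arc_linepath)
    show "path_image g \<inter> path_image (linepath (vs ! k) (vs ! Suc k)) \<subseteq> {pathstart (linepath (vs ! k) (vs ! Suc k))}"
    proof
      fix x assume x: "x \<in> path_image g \<inter> path_image (linepath (vs ! k) (vs ! Suc k))"
      then obtain i where i: "i < k" "x \<in> polygon_edge vs i"
        using g(4) by auto
      have "x \<in> polygon_edge vs k"
        using x by (simp add: polygon_edge_def nv)
      moreover have "polygon_edge vs i \<inter> polygon_edge vs k = {vs ! i, vs ! Suc i} \<inter> {vs ! k, vs ! Suc k}"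
        using simple_polygonD(3) [OF vs, of i k] i step nv by (simp add: next_vertex_simps)
      ultimately have "x \<in> {vs ! i, vs ! Suc i} \<inter> {vs ! k, vs ! Suc k}"
        using i(2) by blast
      moreover have "vs ! i \<noteq> vs ! Suc k" "vs ! Suc i \<noteq> vs ! Suc k"
        using d i step by (simp_all add: nth_eq_iff_index_eq)
      ultimately show "x \<in> {pathstart (linepath (vs ! k) (vs ! Suc k))}"
        by auto
    qed
  qed (use g in auto)
  moreover have "path_image (g +++ linepath (vs ! k) (vs ! Suc k)) = (\<Union>i<Suc k. polygon_edge vs i)"
    using g by (subst path_image_join) (auto simp: polygon_edge_def nv lessThan_Suc)
  ultimately show ?case
    using g by (intro exI [of _ "g +++ linepath (vs ! k) (vs ! Suc k)"]) simp
qed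

lemma polygon_simple_closed_path:
  assumes vs: "simple_polygon vs"
  obtains g where "simple_path g" "pathfinish g = pathstart g" "path_image g = polygon_boundary vs"
proof -
  define n where "n = length vs - 1"
  have n: "2 \<le> n" "n < length vs" "Suc n = length vs"
    using simple_polygonD(1) [OF vs] by (auto simp: n_def)
  obtain g where g: "arc g" "pathstart g = vs ! 0" "pathfinish g = vs ! n" "path_image g = (\<Union>i<n. polygon_edge vs i)"
    using polygon_arc [OF vs, of n] n by auto
  note d = simple_polygonD(2) [OF vs]
  have nv: "next_vertex vs n = vs ! 0"
    using n by (simp add: next_vertex_simps)
  let ?l = "linepath (vs ! n) (vs ! 0)"
  have "vs ! n \<noteq> vs ! 0"
    using n nth_eq_iff_index_eq [OF d, of n 0] by (cases vs) auto
  then have "simple_path (g +++ ?l)"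
  proof (intro simple_path_join_loop g(1) arc_linepath)
    show "path_image g \<inter> path_image ?l \<subseteq> {pathstart g, pathstart ?l}"
    proof
      fix x assume x: "x \<in> path_image g \<inter> path_image ?l"
      then obtain i where i: "i < n" "x \<in> polygon_edge vs i"
        using g(4) by auto
      have "x \<in> polygon_edge vs n"
        using x by (simp add: polygon_edge_def nv)
      then have "x \<in> {vs ! n, vs ! 0}"
        using simple_polygonD(3) [OF vs, of i n] i n nv by auto
      then show "x \<in> {pathstart g, pathstart ?l}"
        using g by auto
    qed
  qed (use g in auto)
  moreover have "{..<length vs} = insert n {..<n}"
    using n by auto
  then have "path_image (g +++ ?l) = polygon_boundary vs"
    using g by (subst path_image_join) (auto simp: polygon_boundary_def polygon_edge_def nv)
  moreover have "pathfinish (g +++ ?l) = pathstart (g +++ ?l)"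
    using g by simp
  ultimately show thesis
    using that by blast
qed

text \<open>The curve is the frontier of the outside too, so every boundary point is a limit of
  points outside. Hence no boundary point is interior to the closure; this regularity later decides
  whether a covered neighbourhood belongs to the open region.\<close>

lemma polygon_jordan:
  assumes vs: "simple_polygon vs"
  shows "polygon_region vs \<noteq> {}" "open (polygon_region vs)" "connected (polygon_region vs)" "bounded (polygon_region vs)"
    "polygon_region vs \<inter> polygon_boundary vs = {}"
    "closure (polygon_region vs) = polygon_region vs \<union> polygon_boundary vs"
    "frontier (polygon_region vs) = polygon_boundary vs"
    "interior (closure (polygon_region vs)) = polygon_region vs"
    "\<And>x. x \<in> polygon_boundary vs \<Longrightarrow> x \<in> closure (- closure (polygon_region vs))"
proof -
  obtain g where g: "simple_path g" "pathfinish g = pathstart g" "path_image g = polygon_boundary vs"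
    using polygon_simple_closed_path [OF vs] by blast
  let ?B = "polygon_boundary vs"
  note J = Jordan_inside_outside_real2 [OF g(1,2), unfolded g(3)]
  show ne: "polygon_region vs \<noteq> {}" and op: "open (polygon_region vs)" and "connected (polygon_region vs)" "bounded (polygon_region vs)"
    and fr: "frontier (polygon_region vs) = ?B"
    using J by (auto simp: polygon_region_def)
  show disj: "polygon_region vs \<inter> ?B = {}"
    using J by (auto simp: polygon_region_def)
  show cl: "closure (polygon_region vs) = polygon_region vs \<union> ?B"
    using closure_Un_frontier [of "polygon_region vs"] fr by simp
  have out: "- closure (polygon_region vs) = outside ?B"
    using cl by (simp add: polygon_region_def outside_inside Un_commute)
  show far: "x \<in> closure (- closure (polygon_region vs))" if "x \<in> ?B" for x
    using J(9) that unfolding out by (auto simp: frontier_def)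
  show "interior (closure (polygon_region vs)) = polygon_region vs"
  proof
    show "polygon_region vs \<subseteq> interior (closure (polygon_region vs))"
      using op closure_subset by (intro interior_maximal) auto
    show "interior (closure (polygon_region vs)) \<subseteq> polygon_region vs"
    proof
      fix x assume x: "x \<in> interior (closure (polygon_region vs))"
      then have "x \<notin> closure (- closure (polygon_region vs))"
        by (simp add: closure_complement)
      then have "x \<notin> ?B"
        using far by blast
      then show "x \<in> polygon_region vs"
        using x interior_subset cl by blast
    qed
  qed
qed

section \<open>Triangulated polygons\<close>

lemma orient_0_imp_collinear:
  assumes "orient a b c = 0"
  shows "collinear {a, b, c}"
proof (cases "a = b")
  case False
  have "\<exists>t. c - a = t *\<^sub>R (b - a)"
  proof (cases "b $ 1 = a $ 1")
    case True
    with False have "b $ 2 - a $ 2 \<noteq> 0"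
      by (auto simp: vec_eq_iff forall_2)
    with assms True show ?thesis
      by (intro exI [of _ "(c $ 2 - a $ 2) / (b $ 2 - a $ 2)"]) (auto simp: vec_eq_iff forall_2 orient_def)
  next
    case False
    then have nz: "b $ 1 - a $ 1 \<noteq> 0"
      by simp
    let ?t = "(c $ 1 - a $ 1) / (b $ 1 - a $ 1)"
    have "c $ 1 - a $ 1 = ?t * (b $ 1 - a $ 1)"
      using nz by simp
    moreover have "(c $ 2 - a $ 2) * (b $ 1 - a $ 1) = (c $ 1 - a $ 1) * (b $ 2 - a $ 2)"
      using assms by (simp add: orient_def mult.commute)
    then have "c $ 2 - a $ 2 = ?t * (b $ 2 - a $ 2)"
      using nz by (simp add: eq_divide_eq)
    ultimately show ?thesis
      by (intro exI [of _ ?t]) (simp add: vec_eq_iff forall_2)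
  qed
  then obtain t where "c - a = t *\<^sub>R (b - a)" ..
  then have c: "c = (1 - t) *\<^sub>R a + t *\<^sub>R b"
    by (simp add: algebra_simps)
  have "c \<in> affine hull {a, b}"
    unfolding affine_hull_2 c by (intro CollectI exI [of _ "1 - t"] exI [of _ t]) simp
  then show ?thesis
    using collinear_3_affine_hull [OF False, of c] by (simp add: insert_commute)
qed simp

lemma affine_independent_orient:
  assumes "orient a b c \<noteq> 0"
  shows "\<not> affine_dependent {a, b, c}"
  using assms collinear_imp_orient_0 affine_dependent_imp_collinear_3 by blast

lemma extreme_points_hull:
  assumes "orient a b c \<noteq> 0"
  shows "{x. x extreme_point_of (convex hull {a, b, c})} = {a, b, c}"
  using extreme_point_of_convex_hull_affine_independent [OF affine_independent_orient [OF assms]] by blast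

lemma two_simplex_cases:
  assumes "2 simplex K"
  obtains a b c where "orient a b c > 0" "K = convex hull {a, b, c}"
proof -
  obtain C where C: "\<not> affine_dependent C" "int (card C) = 2 + 1" "K = convex hull C"
    using assms by (auto simp: simplex_def)
  then have "card C = 3"
    by simp
  then obtain a b c where abc: "C = {a, b, c}" "a \<noteq> b" "b \<noteq> c" "a \<noteq> c"
    by (auto simp: card_3_iff)
  have "orient a b c \<noteq> 0"
    using orient_0_imp_collinear abc C(1) collinear_3_eq_affine_dependent by blast
  then consider "orient a b c > 0" | "orient a c b > 0"
    using orient_swap(2) [of a b c] by linarith
  then show thesis
    using that abc(1) C(3) by cases (auto simp: insert_commute)
qed

text \<open>Edges are taken in counterclockwise order, so that the triangle lies to the left of each
  of them and two triangles sharing an edge carry it in opposite directions. Interior edges thus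
  cancel in sums of circulations.\<close>

definition dir_edges :: "(real^2) set \<Rightarrow> ((real^2) \<times> (real^2)) set" where
  "dir_edges K = {(a, b). \<exists>c. orient a b c > 0 \<and> K = convex hull {a, b, c}}"

lemma dir_edges_hull:
  assumes D: "orient a b c > 0"
  shows "dir_edges (convex hull {a, b, c}) = {(a, b), (b, c), (c, a)}"
proof
  show "{(a, b), (b, c), (c, a)} \<subseteq> dir_edges (convex hull {a, b, c})"
  proof -
    have "convex hull {a, b, c} = convex hull {b, c, a}" "convex hull {a, b, c} = convex hull {c, a, b}"
      by (simp_all add: insert_commute)
    moreover have "orient b c a > 0" "orient c a b > 0"
      using D by (simp_all add: orient_cycle)
    ultimately show ?thesis
      using D unfolding dir_edges_def by (simp only: insert_subset empty_subsetI mem_Collect_eq prod.case) metis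
  qed
  show "dir_edges (convex hull {a, b, c}) \<subseteq> {(a, b), (b, c), (c, a)}"
  proof (rule subrelI)
    fix p q assume "(p, q) \<in> dir_edges (convex hull {a, b, c})"
    then have "\<exists>r. orient p q r > 0 \<and> convex hull {a, b, c} = convex hull {p, q, r}"
      by (simp only: dir_edges_def mem_Collect_eq prod.case)
    then obtain r where r': "orient p q r > 0 \<and> convex hull {a, b, c} = convex hull {p, q, r}" ..
    note r = conjunct1 [OF r'] conjunct2 [OF r']
    have eq: "{p, q, r} = {a, b, c}"
    proof -
      have "{p, q, r} = {x. x extreme_point_of (convex hull {p, q, r})}"
        by (rule extreme_points_hull [symmetric]) (use r(1) in linarith)
      also have "\<dots> = {x. x extreme_point_of (convex hull {a, b, c})}"
        by (rule arg_cong [OF r(2) [symmetric]])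
      also have "\<dots> = {a, b, c}"
        by (rule extreme_points_hull) (use D in linarith)
      finally show ?thesis .
    qed
    have ne: "p \<noteq> q" "p \<noteq> r" "q \<noteq> r" "a \<noteq> b" "a \<noteq> c" "b \<noteq> c"
      using r(1) D by auto
    have "p \<in> {a, b, c}" "q \<in> {a, b, c}" "r \<in> {a, b, c}"
      using eq by auto
    then consider "p = a" "q = b" | "p = b" "q = c" | "p = c" "q = a"
      | "p = b" "q = a" "r = c" | "p = a" "q = c" "r = b" | "p = c" "q = b" "r = a"
      using ne by auto
    then show "(p, q) \<in> {(a, b), (b, c), (c, a)}"
    proof cases
      case 4 then show ?thesis using r(1) D orient_swap(1) [of a b c] by simp
    next
      case 5 then show ?thesis using r(1) D orient_swap(2) [of a b c] by simp
    next
      case 6 then show ?thesis using r(1) D by (simp add: orient_def algebra_simps)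
    qed auto
  qed
qed

lemma dir_edgesE:
  assumes "(a, b) \<in> dir_edges K"
  obtains c where "orient a b c > 0" "K = convex hull {a, b, c}" "dir_edges K = {(a, b), (b, c), (c, a)}"
proof -
  have "\<exists>c. orient a b c > 0 \<and> K = convex hull {a, b, c}"
    using assms by (simp only: dir_edges_def mem_Collect_eq prod.case)
  then obtain c where c: "orient a b c > 0 \<and> K = convex hull {a, b, c}" ..
  then have "dir_edges K = {(a, b), (b, c), (c, a)}"
    using dir_edges_hull by simp
  then show thesis
    by (rule that [OF conjunct1 [OF c] conjunct2 [OF c]])
qed

text \<open>At a point of the open edge two barycentric coordinates are positive, and they remain so
  nearby. Only the third, \<open>orient a b y\<close>, decides on which side of the edge y
  lies.\<close>

lemma near_edge:
  assumes D: "orient a b c > 0" and x: "x \<in> open_segment a b"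
  obtains r where "r > 0" "\<And>y. y \<in> ball x r \<Longrightarrow> 0 \<le> orient a b y \<Longrightarrow> y \<in> convex hull {a, b, c}"
    "\<And>y. y \<in> ball x r \<Longrightarrow> 0 < orient a b y \<Longrightarrow> y \<in> interior (convex hull {a, b, c})"
proof -
  obtain u where u: "0 < u" "u < 1" "x = (1 - u) *\<^sub>R a + u *\<^sub>R b + 0 *\<^sub>R c"
    using x by (auto simp: in_segment)
  have pos: "orient x b c > 0" "orient a x c > 0"
    unfolding u(3) using u D by (subst orient_convex_combination; simp)+
  have "open {y. 0 < orient y b c}" "open {y. 0 < orient a y c}"
    unfolding orient_def by (intro open_Collect_less continuous_intros)+
  then have "open ({y. 0 < orient y b c} \<inter> {y. 0 < orient a y c})"
    by (rule open_Int)
  then obtain r where r: "r > 0" "ball x r \<subseteq> {y. 0 < orient y b c} \<inter> {y. 0 < orient a y c}"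
    using pos open_contains_ball by blast
  show thesis
  proof (rule that [OF r(1)])
    fix y assume y: "y \<in> ball x r"
    then have y': "0 < orient y b c" "0 < orient a y c"
      using r(2) by auto
    show "0 \<le> orient a b y \<Longrightarrow> y \<in> convex hull {a, b, c}"
      using y' by (simp add: mem_hull_iff [OF D])
    show "0 < orient a b y \<Longrightarrow> y \<in> interior (convex hull {a, b, c})"
      using y' by (simp add: mem_triangle_iff [OF D] triangle_def [symmetric])
  qed
qed

lemma orient_open_segment:
  assumes "x \<in> open_segment a b"
  shows "orient a b x = 0"
proof -
  obtain u where x: "x = (1 - u) *\<^sub>R a + u *\<^sub>R b"
    using assms by (auto simp: in_segment)
  show ?thesis
    unfolding x orient_def by (simp add: algebra_simps)
qed

lemma orient_perturb:
  assumes "a \<noteq> b" "x \<in> open_segment a b" "r > 0" "\<sigma> = 1 \<or> \<sigma> = -1"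
  obtains y where "y \<in> ball x r" "\<sigma> * orient a b y > 0"
proof -
  define n :: "real^2" where "n = vector [- (b $ 2 - a $ 2), b $ 1 - a $ 1]"
  have n: "n \<noteq> 0"
    using assms(1) by (auto simp: n_def vec_eq_iff forall_2)
  define e where "e = r / (2 * norm n)"
  have e: "e > 0"
    using n assms(3) by (simp add: e_def)
  define y where "y = x + (\<sigma> * e) *\<^sub>R n"
  have "norm ((\<sigma> * e) *\<^sub>R n) = r / 2"
    using n assms(3,4) e by (auto simp: e_def abs_mult)
  then have "y \<in> ball x r"
    using assms(3) by (simp add: y_def dist_norm)
  moreover have "orient a b x = 0"
    using assms(2) by (rule orient_open_segment)
  then have "orient a b y = (\<sigma> * e) * ((b $ 1 - a $ 1)\<^sup>2 + (b $ 2 - a $ 2)\<^sup>2)"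
    by (simp add: y_def n_def orient_def power2_eq_square algebra_simps)
  moreover have "(b $ 1 - a $ 1)\<^sup>2 + (b $ 2 - a $ 2)\<^sup>2 > 0"
    using assms(1) by (auto simp: vec_eq_iff forall_2 sum_power2_gt_zero_iff)
  ultimately show thesis
    using that [of y] assms(4) e by (auto simp: mult_pos_pos)
qed

section \<open>Local structure of the triangulation\<close>

locale triangulated_polygon =
  fixes vs :: "(real^2) list" and T :: "(real^2) set set"
  assumes poly: "simple_polygon vs" and tri: "polygon_triangulation vs T"
begin

abbreviation "P \<equiv> polygon_region vs"
abbreviation "B \<equiv> polygon_boundary vs"

lemmas jordan = polygon_jordan [OF poly]

lemma finite_T: "finite T"
  using tri by (simp add: polygon_triangulation_def triangulation_def)

lemma face: "K \<in> T \<Longrightarrow> K' \<in> T \<Longrightarrow> (K \<inter> K') face_of K" "K \<in> T \<Longrightarrow> K' \<in> T \<Longrightarrow> (K \<inter> K') face_of K'"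
proof -
  have "\<forall>K K'. K \<in> T \<and> K' \<in> T \<longrightarrow> (K \<inter> K') face_of K"
    using tri unfolding polygon_triangulation_def triangulation_def by blast
  then show "K \<in> T \<Longrightarrow> K' \<in> T \<Longrightarrow> (K \<inter> K') face_of K" "K \<in> T \<Longrightarrow> K' \<in> T \<Longrightarrow> (K \<inter> K') face_of K'"
    by (blast, metis Int_commute)
qed

lemma union_T: "\<Union>T = P \<union> B"
  using tri jordan(6) by (simp add: polygon_triangulation_def)

lemma triangleE:
  assumes "K \<in> T"
  obtains a b c where "orient a b c > 0" "K = convex hull {a, b, c}" "dir_edges K = {(a, b), (b, c), (c, a)}"
  using assms tri two_simplex_cases dir_edges_hull unfolding polygon_triangulation_def by metis

lemma closed_K: "K \<in> T \<Longrightarrow> closed K" and convex_K: "K \<in> T \<Longrightarrow> convex K"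
  and compact_K: "K \<in> T \<Longrightarrow> compact K"
  by (metis triangleE compact_convex_hull compact_imp_closed finite.emptyI finite_imp_compact finite_insert,
      metis triangleE convex_convex_hull,
      metis triangleE compact_convex_hull finite.emptyI finite_imp_compact finite_insert)

lemma interior_nonempty: "K \<in> T \<Longrightarrow> interior K \<noteq> {}"
proof -
  assume "K \<in> T"
  then obtain a b c where D: "orient a b c > 0" and K: "K = convex hull {a, b, c}"
    by (rule triangleE)
  have "(1/3) *\<^sub>R a + (1/3) *\<^sub>R b + (1/3) *\<^sub>R c \<in> triangle a b c"
    using D by (intro mem_triangleI [of a b c "1/3" "1/3" "1/3"]) auto
  then show ?thesis
    by (auto simp: K triangle_def)
qed

lemma closure_interior_K: "K \<in> T \<Longrightarrow> closure (interior K) = K"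
  using convex_closure_interior [OF convex_K interior_nonempty] closed_K by (simp add: closure_closed)

lemma interior_K_subset: "K \<in> T \<Longrightarrow> interior K \<subseteq> P"
proof -
  assume "K \<in> T"
  then have "K \<subseteq> closure P"
    using union_T jordan(6) by blast
  then show ?thesis
    using interior_mono [of K "closure P"] jordan(8) by simp
qed

text \<open>A face that meets the interior of a convex set is the whole set. Applied to both
  triangles this makes them equal.\<close>

lemma interior_Int_K: "K \<in> T \<Longrightarrow> K' \<in> T \<Longrightarrow> K \<noteq> K' \<Longrightarrow> interior K \<inter> K' = {}"
proof (rule ccontr)
  assume K: "K \<in> T" "K' \<in> T" "K \<noteq> K'" and ne: "interior K \<inter> K' \<noteq> {}"
  have "(K \<inter> K') \<inter> interior K \<noteq> {}"
    using ne interior_subset by blast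
  then have "K \<inter> K' = K"
    using face_of_disjoint_interior [OF face(1) [OF K(1,2)]] by blast
  then have sub: "K \<subseteq> K'"
    by blast
  then have "(K \<inter> K') \<inter> interior K' \<noteq> {}"
    using interior_mono [OF sub] interior_nonempty [OF K(1)] interior_subset [of K] by blast
  then have "K \<inter> K' = K'"
    using face_of_disjoint_interior [OF face(2) [OF K(1,2)]] by blast
  with sub K(3) show False
    by blast
qed

text \<open>There are no hanging vertices: v is a vertex of some triangle K', hence of the common
  face of K and K', hence of K.\<close>

lemma vertex_extreme:
  assumes v: "v \<in> set vs" and K: "K \<in> T" "v \<in> K"
  shows "v extreme_point_of K"
proof -
  obtain K' where K': "K' \<in> T" "v extreme_point_of K'"
    using v tri unfolding polygon_triangulation_def by blast
  then have "v \<in> K \<inter> K'"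
    using K by (auto simp: extreme_point_of_def)
  moreover have "v extreme_point_of (K \<inter> K')"
    using extreme_point_of_face [OF face(2) [OF K(1) K'(1)]] K'(2) calculation by blast
  ultimately show ?thesis
    using extreme_point_of_face [OF face(1) [OF K(1) K'(1)]] by blast
qed

lemma dir_edge_vertices:
  assumes "K \<in> T" "(a, b) \<in> dir_edges K"
  shows "a \<in> set vs" "b \<in> set vs" "a \<noteq> b" "closed_segment a b \<subseteq> K"
proof -
  obtain c where c: "orient a b c > 0" "K = convex hull {a, b, c}"
    using assms(2) by (rule dir_edgesE)
  then have "{x. x extreme_point_of K} = {a, b, c}"
    using extreme_points_hull [of a b c] by simp
  then show "a \<in> set vs" "b \<in> set vs"
    using assms(1) tri unfolding polygon_triangulation_def by blast+
  show "a \<noteq> b"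
    using c(1) by auto
  show "closed_segment a b \<subseteq> K"
    unfolding c(2) segment_convex_hull by (rule hull_mono) auto
qed

lemma vertex_in_K:
  assumes "K \<in> T" "(a, b) \<in> dir_edges K" "v \<in> set vs" "v \<in> closed_segment a b"
  shows "v = a \<or> v = b"
proof -
  have "v extreme_point_of K"
    using vertex_extreme assms dir_edge_vertices(4) by blast
  then have "v \<notin> open_segment a b"
    using dir_edge_vertices(4) [OF assms(1,2)] ends_in_segment unfolding extreme_point_of_def by blast
  then show ?thesis
    using assms(4) by (auto simp: open_segment_def)
qed

text \<open>Two triangles to the left of the same directed edge both contain, in their interiors,
  all points slightly to the left of its midpoint; interiors of different triangles are
  disjoint.\<close>

lemma dir_edge_unique:
  assumes "K \<in> T" "K' \<in> T" "e \<in> dir_edges K" "e \<in> dir_edges K'"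
  shows "K = K'"
proof (rule ccontr)
  assume ne: "K \<noteq> K'"
  obtain a b where e: "e = (a, b)"
    by (cases e)
  obtain c where c: "orient a b c > 0" "K = convex hull {a, b, c}"
    using assms(3) unfolding e by (rule dir_edgesE)
  obtain c' where c': "orient a b c' > 0" "K' = convex hull {a, b, c'}"
    using assms(4) unfolding e by (rule dir_edgesE)
  have ab: "a \<noteq> b"
    using c(1) by auto
  have mid: "midpoint a b \<in> open_segment a b"
    using ab by simp
  obtain r where r: "r > 0" "\<And>y. y \<in> ball (midpoint a b) r \<Longrightarrow> 0 < orient a b y \<Longrightarrow> y \<in> interior K"
    using near_edge [OF c(1) mid] c(2) by metis
  obtain r' where r': "r' > 0" "\<And>y. y \<in> ball (midpoint a b) r' \<Longrightarrow> 0 < orient a b y \<Longrightarrow> y \<in> interior K'"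
    using near_edge [OF c'(1) mid] c'(2) by metis
  obtain y where "y \<in> ball (midpoint a b) (min r r')" "1 * orient a b y > 0"
    using orient_perturb [OF ab mid, of "min r r'" 1] r(1) r'(1) by auto
  then have "y \<in> interior K" "y \<in> interior K'"
    using r(2) r'(2) by auto
  then show False
    using interior_Int_K [OF assms(1,2) ne] interior_subset by blast
qed

lemma boundary_cases:
  assumes "K \<in> T" "x \<in> K" "x \<notin> interior K" "x \<notin> set vs"
  obtains a b where "(a, b) \<in> dir_edges K" "x \<in> open_segment a b"
proof -
  obtain a b c where D: "orient a b c > 0" and K: "K = convex hull {a, b, c}" and E: "dir_edges K = {(a, b), (b, c), (c, a)}"
    using assms(1) by (rule triangleE)
  have vs: "a \<in> set vs" "b \<in> set vs" "c \<in> set vs"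
    using dir_edge_vertices(1) [OF assms(1)] E by blast+
  obtain u v w where uvw: "0 \<le> u" "0 \<le> v" "0 \<le> w" "u + v + w = 1" "x = u *\<^sub>R a + v *\<^sub>R b + w *\<^sub>R c"
    using assms(2) unfolding K convex_hull_3 by blast
  have seg: "y \<in> open_segment p q" if "y = (1 - t) *\<^sub>R p + t *\<^sub>R q" "p \<in> set vs" "q \<in> set vs" "0 \<le> t" "t \<le> 1" "y \<notin> set vs" for y p q t
  proof -
    have "y \<in> closed_segment p q"
      using that by (auto simp: in_segment)
    then show ?thesis
      using that by (auto simp: open_segment_def)
  qed
  consider "u = 0" | "v = 0" | "w = 0" | "0 < u" "0 < v" "0 < w"
    using uvw by linarith
  then show thesis
  proof cases
    case 1
    then have "x \<in> open_segment b c"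
      using uvw vs assms(4) by (intro seg [where t=w]) auto
    then show thesis using that E by blast
  next
    case 2
    have "u = 1 - w" using 2 uvw by simp
    then have "x \<in> open_segment c a"
      using 2 uvw vs assms(4) by (intro seg [where t=u]) auto
    then show thesis using that E by blast
  next
    case 3
    then have "x \<in> open_segment a b"
      using uvw vs assms(4) by (intro seg [where t=v]) auto
    then show thesis using that E by blast
  next
    case 4
    then have "x \<in> triangle a b c"
      using D uvw by (intro mem_triangleI [of a b c u v w]) auto
    then show thesis
      using assms(3) by (simp add: K triangle_def)
  qed
qed

text \<open>The common face contains a point of the open edge, hence both of its endpoints, and
  these are vertices of K'. So K' has the edge in one of the two directions, and the direction used
  by K is excluded by \<open>dir_edge_unique\<close>.\<close>

lemma opposite_triangle:
  assumes K: "K \<in> T" "K' \<in> T" "K \<noteq> K'" and e: "(a, b) \<in> dir_edges K" "x \<in> open_segment a b" "x \<in> K'"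
  shows "(b, a) \<in> dir_edges K'"
proof -
  note ab = dir_edge_vertices [OF K(1) e(1)]
  have "a \<in> K" "b \<in> K" "x \<in> K"
    using ab(4) e(2) by (auto simp: open_segment_def)
  then have "a \<in> K \<inter> K'" "b \<in> K \<inter> K'"
    using face_ofD [OF face(1) [OF K(1,2)] e(2)] e(3) by blast+
  then have ex: "a extreme_point_of K'" "b extreme_point_of K'"
    using vertex_extreme [OF ab(1) K(2)] vertex_extreme [OF ab(2) K(2)] by auto
  obtain p q r where D: "orient p q r > 0" and K': "K' = convex hull {p, q, r}" and E: "dir_edges K' = {(p, q), (q, r), (r, p)}"
    using K(2) by (rule triangleE)
  have "a \<in> {p, q, r}" "b \<in> {p, q, r}"
    using ex extreme_points_hull [of p q r] D unfolding K' by auto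
  then have "(a, b) \<in> dir_edges K' \<or> (b, a) \<in> dir_edges K'"
    using ab(3) unfolding E by auto
  then show ?thesis
    using dir_edge_unique [OF K(1,2) e(1)] K(3) by blast
qed

lemma boundary_vertices: "set vs \<subseteq> B"
proof
  fix v assume "v \<in> set vs"
  then obtain i where "i < length vs" "v = vs ! i"
    by (auto simp: in_set_conv_nth)
  then show "v \<in> B"
    by (auto simp: polygon_boundary_def polygon_edge_def)
qed

text \<open>In a small disc around x only triangles containing x occur. A point of the disc to the
  right of the edge is covered by one of them, and this cannot be K.\<close>

lemma interior_edge_opposite:
  assumes K: "K \<in> T" and e: "(a, b) \<in> dir_edges K" and x: "x \<in> open_segment a b" "x \<in> P"
  obtains K' where "K' \<in> T" "(b, a) \<in> dir_edges K'"
proof -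
  let ?F = "{K' \<in> T. x \<notin> K'}"
  have "open (P - \<Union>?F)"
    using jordan(2) finite_T closed_K by (intro open_Diff closed_Union) auto
  then obtain r where r: "r > 0" "ball x r \<subseteq> P - \<Union>?F"
    using x(2) open_contains_ball by blast
  have ab: "a \<noteq> b"
    using dir_edge_vertices(3) [OF K e] .
  obtain y where y: "y \<in> ball x r" "(-1) * orient a b y > 0"
    using orient_perturb [OF ab x(1) r(1), of "-1"] by auto
  then obtain K' where K': "K' \<in> T" "y \<in> K'" "x \<in> K'"
    using r(2) union_T by blast
  obtain c where c: "orient a b c > 0" "K = convex hull {a, b, c}"
    using e by (rule dir_edgesE)
  have "y \<notin> K"
    using y(2) unfolding c(2) mem_hull_iff [OF c(1)] by simp
  then have "K \<noteq> K'"
    using K' by blast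
  then show thesis
    using that opposite_triangle [OF K K'(1) _ e x(1) K'(3)] K'(1) by blast
qed

text \<open>The two triangles contain the two halves of a small disc around x. The disc is open and
  contained in the closure of P, whose interior is P.\<close>

lemma paired_edge_ball:
  assumes K: "K \<in> T" "K' \<in> T" and e: "(a, b) \<in> dir_edges K" "(b, a) \<in> dir_edges K'" and x: "x \<in> open_segment a b"
  obtains r where "r > 0" "ball x r \<subseteq> K \<union> K'" "ball x r \<subseteq> P"
proof -
  obtain c where c: "orient a b c > 0" "K = convex hull {a, b, c}"
    using e(1) by (rule dir_edgesE)
  obtain c' where c': "orient b a c' > 0" "K' = convex hull {b, a, c'}"
    using e(2) by (rule dir_edgesE)
  obtain r where r: "r > 0" "\<And>y. y \<in> ball x r \<Longrightarrow> 0 \<le> orient a b y \<Longrightarrow> y \<in> K"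
    using near_edge [OF c(1) x] c(2) by metis
  have x': "x \<in> open_segment b a"
    using x by (simp add: open_segment_commute)
  obtain r' where r': "r' > 0" "\<And>y. y \<in> ball x r' \<Longrightarrow> 0 \<le> orient b a y \<Longrightarrow> y \<in> K'"
    using near_edge [OF c'(1) x'] c'(2) by metis
  have sub: "ball x (min r r') \<subseteq> K \<union> K'"
  proof
    fix y assume "y \<in> ball x (min r r')"
    then show "y \<in> K \<union> K'"
      using r(2) [of y] r'(2) [of y] orient_swap(1) [of a b y] by (cases "orient a b y \<ge> 0") auto
  qed
  also have "K \<union> K' \<subseteq> closure P"
    using K union_T jordan(6) by blast
  finally have "ball x (min r r') \<subseteq> interior (closure P)"
    by (intro interior_maximal) auto
  with sub r(1) r'(1) that show thesis
    unfolding jordan(8) by (metis min_less_iff_conj)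
qed

lemma paired_edge_interior:
  assumes "K \<in> T" "K' \<in> T" "(a, b) \<in> dir_edges K" "(b, a) \<in> dir_edges K'"
  shows "open_segment a b \<subseteq> P"
proof
  fix x assume "x \<in> open_segment a b"
  then obtain r where "r > 0" "ball x r \<subseteq> P"
    using paired_edge_ball [OF assms] by metis
  then show "x \<in> P"
    by (auto simp: subset_iff)
qed

lemma vertex_on_polygon_edge:
  assumes "v \<in> set vs" "i < length vs" "v \<in> polygon_edge vs i"
  shows "v = vs ! i \<or> v = next_vertex vs i"
proof -
  obtain j where j: "j < length vs" "v = vs ! j"
    using assms(1) by (auto simp: in_set_conv_nth)
  show ?thesis
  proof (cases "j = i")
    case False
    have "v \<in> polygon_edge vs j"
      using j by (simp add: polygon_edge_def)
    then show ?thesis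
      using simple_polygonD(3) [OF poly assms(2) j(1)] False assms(3) by blast
  qed (use j in auto)
qed

text \<open>The open segments of a polygon without its vertices are the connected pieces of the boundary,
  so an unpaired edge, which lies in the boundary and contains no vertex, is inside one of them.\<close>

lemma unpaired_edge:
  assumes K: "K \<in> T" and e: "(a, b) \<in> dir_edges K" and un: "\<And>K'. K' \<in> T \<Longrightarrow> (b, a) \<notin> dir_edges K'"
  obtains i where "i < length vs" "{a, b} = {vs ! i, next_vertex vs i}"
proof -
  note ab = dir_edge_vertices [OF K e]
  have seg_B: "open_segment a b \<subseteq> B"
  proof
    fix x assume x: "x \<in> open_segment a b"
    then have "x \<in> K"
      using ab(4) by (auto simp: open_segment_def)
    then have "x \<in> P \<union> B"
      using K union_T by blast
    moreover have "x \<notin> P"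
      using interior_edge_opposite [OF K e x] un by blast
    ultimately show "x \<in> B"
      by blast
  qed
  have novert: "open_segment a b \<inter> set vs = {}"
    using vertex_in_K [OF K e] by (auto simp: open_segment_def)
  have mid: "midpoint a b \<in> open_segment a b"
    using ab(3) by simp
  then obtain i where i: "i < length vs" "midpoint a b \<in> polygon_edge vs i"
    using seg_B unfolding polygon_boundary_def by blast
  define U where "U = (\<Union>j\<in>{..<length vs} - {i}. polygon_edge vs j)"
  have "closed U"
    unfolding U_def polygon_edge_def by (intro closed_UN) auto
  moreover have "closed (polygon_edge vs i)"
    by (simp add: polygon_edge_def)
  moreover have "open_segment a b \<subseteq> polygon_edge vs i \<union> U"
    using seg_B by (auto simp: polygon_boundary_def U_def)
  moreover have "polygon_edge vs i \<inter> U \<inter> open_segment a b = {}"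
  proof (rule ccontr)
    assume "\<not> ?thesis"
    then obtain x j where x: "x \<in> open_segment a b" "x \<in> polygon_edge vs i" "x \<in> polygon_edge vs j" "j < length vs" "j \<noteq> i"
      by (auto simp: U_def)
    then have "x \<in> {vs ! i, next_vertex vs i}"
      using simple_polygonD(3) [OF poly i(1), of j] by blast
    moreover have "Suc i mod length vs < length vs"
      using i(1) by (intro mod_less_divisor) auto
    ultimately have "x \<in> set vs"
      using i(1) unfolding next_vertex_def by (metis insert_iff nth_mem singletonD)
    with x(1) novert show False
      by blast
  qed
  ultimately have "open_segment a b \<inter> polygon_edge vs i = {} \<or> open_segment a b \<inter> U = {}"
    using connected_closedD [of "open_segment a b" "polygon_edge vs i" U] convex_connected [OF convex_open_segment, of a b]
    by blast
  then have "open_segment a b \<subseteq> polygon_edge vs i"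
    using mid i(2) \<open>open_segment a b \<subseteq> polygon_edge vs i \<union> U\<close> by blast
  then have "closure (open_segment a b) \<subseteq> polygon_edge vs i"
    by (intro closure_minimal) (auto simp: polygon_edge_def)
  then have "closed_segment a b \<subseteq> polygon_edge vs i"
    using ab(3) by simp
  then have ab_i: "a \<in> polygon_edge vs i" "b \<in> polygon_edge vs i"
    by auto
  have "{a, b} = {vs ! i, next_vertex vs i}"
    using vertex_on_polygon_edge [OF ab(1) i(1) ab_i(1)] vertex_on_polygon_edge [OF ab(2) i(1) ab_i(2)] ab(3) by auto
  with i(1) that show thesis
    by blast
qed

lemma polygon_edge_dir_edge:
  assumes K: "K \<in> T" and i: "i < length vs" "polygon_edge vs i \<subseteq> K"
  shows "(vs ! i, next_vertex vs i) \<in> dir_edges K \<or> (next_vertex vs i, vs ! i) \<in> dir_edges K"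
proof -
  have l: "Suc i mod length vs < length vs"
    using i(1) by (intro mod_less_divisor) auto
  have v: "vs ! i \<in> set vs" "next_vertex vs i \<in> set vs"
    using i(1) l by (auto simp: next_vertex_def)
  have "Suc i mod length vs \<noteq> i"
    using simple_polygonD(1) [OF poly] i(1) by (cases "Suc i = length vs") auto
  then have ne: "vs ! i \<noteq> next_vertex vs i"
    using simple_polygonD(2) [OF poly] i(1) l by (simp add: next_vertex_def nth_eq_iff_index_eq)
  have ex: "vs ! i extreme_point_of K" "next_vertex vs i extreme_point_of K"
    using vertex_extreme [OF v(1) K] vertex_extreme [OF v(2) K] i(2) by (auto simp: polygon_edge_def)
  obtain p q r where D: "orient p q r > 0" and K': "K = convex hull {p, q, r}" and E: "dir_edges K = {(p, q), (q, r), (r, p)}"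
    using K by (rule triangleE)
  have "vs ! i \<in> {p, q, r}" "next_vertex vs i \<in> {p, q, r}"
    using ex extreme_points_hull [of p q r] D unfolding K' by auto
  with ne show ?thesis
    unfolding E by auto
qed

lemma polygon_edge_not_paired:
  assumes "K \<in> T" "K' \<in> T" "(a, b) \<in> dir_edges K" "(b, a) \<in> dir_edges K'" "i < length vs"
  shows "closed_segment a b \<noteq> polygon_edge vs i"
proof
  assume eq: "closed_segment a b = polygon_edge vs i"
  have "midpoint a b \<in> P"
    using paired_edge_interior [OF assms(1-4)] dir_edge_vertices(3) [OF assms(1,3)] by auto
  moreover have "midpoint a b \<in> B"
    using eq assms(5) midpoint_in_closed_segment by (auto simp: polygon_boundary_def)
  ultimately show False
    using jordan(5) by blast
qed

end

section \<open>Sums over directed edges and flows on the dual graph\<close>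

lemma sum_antisymmetric:
  fixes f :: "'a \<times> 'a \<Rightarrow> real"
  assumes A: "finite A" and f: "\<And>e. e \<in> A \<Longrightarrow> prod.swap e \<in> A \<Longrightarrow> f (prod.swap e) = - f e"
  shows "sum f A = sum f {e \<in> A. prod.swap e \<notin> A}"
proof -
  let ?I = "{e \<in> A. prod.swap e \<in> A}"
  have "sum f ?I = sum (\<lambda>e. f (prod.swap e)) ?I"
    by (rule sum.reindex_bij_witness [of _ prod.swap prod.swap]) auto
  also have "\<dots> = - sum f ?I"
    unfolding sum_negf [symmetric] by (rule sum.cong) (use f in auto)
  finally have "sum f ?I = 0"
    by simp
  moreover have "sum f A = sum f ?I + sum f {e \<in> A. prod.swap e \<notin> A}"
    using A by (subst sum.union_disjoint [symmetric]) (auto intro!: sum.cong)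
  ultimately show ?thesis
    by simp
qed

lemma negligible_frontier_interior_K:
  "convex K \<Longrightarrow> negligible (K - interior K)" for K :: "(real^2) set"
  by (rule negligible_subset [OF negligible_convex_frontier])
     (auto simp: frontier_def closure_subset [THEN subsetD])

context triangulated_polygon
begin

definition edges :: "(real^2) set set \<Rightarrow> ((real^2) \<times> (real^2)) set" where
  "edges S = (\<Union>K\<in>S. dir_edges K)"

lemma finite_dir_edges: "K \<in> T \<Longrightarrow> finite (dir_edges K)"
  by (metis triangleE finite.emptyI finite_insert)

lemma finite_edges: "S \<subseteq> T \<Longrightarrow> finite (edges S)"
  unfolding edges_def using finite_T finite_dir_edges by (intro finite_UN_I) (auto intro: finite_subset)

lemma dir_edge_swap_ne: "K \<in> T \<Longrightarrow> e \<in> dir_edges K \<Longrightarrow> prod.swap e \<noteq> e"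
  using dir_edge_vertices(3) by (cases e) auto

lemma swap_not_same: "K \<in> T \<Longrightarrow> e \<in> dir_edges K \<Longrightarrow> prod.swap e \<notin> dir_edges K"
proof -
  assume K: "K \<in> T" "e \<in> dir_edges K"
  obtain a b where e: "e = (a, b)"
    by (cases e)
  obtain c where "orient a b c > 0" "dir_edges K = {(a, b), (b, c), (c, a)}"
    using K(2) unfolding e by (rule dir_edgesE)
  moreover from this have "a \<noteq> b" "b \<noteq> c" "a \<noteq> c"
    by auto
  ultimately show ?thesis
    by (auto simp: e)
qed

text \<open>Discrete Stokes theorem: by \<open>dir_edge_unique\<close> each directed edge occurs
  once, and an edge shared by two triangles of S occurs in both directions and cancels. The boundary
  of the union of S remains.\<close>

lemma sum_dir_edges:
  fixes f :: "(real^2) \<times> (real^2) \<Rightarrow> real"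
  assumes S: "S \<subseteq> T" and f: "\<And>e. e \<in> edges S \<Longrightarrow> prod.swap e \<in> edges S \<Longrightarrow> f (prod.swap e) = - f e"
  shows "(\<Sum>K\<in>S. sum f (dir_edges K)) = sum f {e \<in> edges S. prod.swap e \<notin> edges S}"
proof -
  have "sum f (edges S) = (\<Sum>K\<in>S. sum f (dir_edges K))"
    unfolding edges_def
  proof (rule sum.UNION_disjoint)
    show "finite S"
      using S finite_T finite_subset by blast
    show "\<forall>K\<in>S. finite (dir_edges K)"
      using S finite_dir_edges by blast
    show "\<forall>K\<in>S. \<forall>K'\<in>S. K \<noteq> K' \<longrightarrow> dir_edges K \<inter> dir_edges K' = {}"
      using S dir_edge_unique by blast
  qed
  moreover have "sum f (edges S) = sum f {e \<in> edges S. prod.swap e \<notin> edges S}"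
  proof (rule sum_antisymmetric)
    show "finite (edges S)"
      by (rule finite_edges [OF S])
    show "f (prod.swap e) = - f e" if "e \<in> edges S" "prod.swap e \<in> edges S" for e
      by (rule f [OF that])
  qed
  ultimately show ?thesis
    by simp
qed

definition adjacent :: "((real^2) set \<times> (real^2) set) set" where
  "adjacent = {(K, K'). K \<in> T \<and> K' \<in> T \<and> (\<exists>e. e \<in> dir_edges K \<and> prod.swap e \<in> dir_edges K')}"

text \<open>The triangles reachable from K0 and the others form two closed unions covering the
  connected set P. A common point in P is not a vertex, since vertices lie on the boundary; so it
  lies on an open edge, across which the two triangles are adjacent, a contradiction.\<close>

lemma adjacent_connected:
  assumes K0: "K0 \<in> T" and K: "K \<in> T"
  shows "(K0, K) \<in> adjacent\<^sup>*"
proof (rule ccontr)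
  assume nK: "(K0, K) \<notin> adjacent\<^sup>*"
  define S where "S = {L \<in> T. (K0, L) \<in> adjacent\<^sup>*}"
  have cl: "closed (\<Union>S)" "closed (\<Union>(T - S))"
    using finite_T closed_K by (auto simp: S_def intro!: closed_Union)
  have "P \<subseteq> \<Union>S \<union> \<Union>(T - S)"
    using union_T by (auto simp: S_def)
  moreover have "\<Union>S \<inter> \<Union>(T - S) \<inter> P = {}"
  proof (rule ccontr)
    assume "\<not> ?thesis"
    then obtain x L L' where x: "x \<in> P" "x \<in> L" "x \<in> L'" and L: "L \<in> S" and L': "L' \<in> T" "L' \<notin> S"
      by blast
    have LT: "L \<in> T"
      using L by (simp add: S_def)
    have ne: "L \<noteq> L'"
      using L L' by blast
    have "x \<notin> interior L"
      using interior_Int_K [OF LT L'(1) ne] x by blast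
    moreover have "x \<notin> set vs"
      using boundary_vertices jordan(5) x(1) by blast
    ultimately obtain a b where ab: "(a, b) \<in> dir_edges L" "x \<in> open_segment a b"
      using boundary_cases [OF LT x(2)] by blast
    then have "(b, a) \<in> dir_edges L'"
      using opposite_triangle [OF LT L'(1) ne ab x(3)] by blast
    then have "(L, L') \<in> adjacent"
      using LT L'(1) ab(1) unfolding adjacent_def by force
    then have "L' \<in> S"
      using L L'(1) by (auto simp: S_def)
    then show False
      using L' by blast
  qed
  ultimately have "\<Union>S \<inter> P = {} \<or> \<Union>(T - S) \<inter> P = {}"
    using connected_closedD [OF jordan(3) _ _ cl] by blast
  moreover have "K0 \<in> S" "K \<in> T - S"
    using K0 K nK by (auto simp: S_def)
  moreover have "interior K0 \<subseteq> P" "interior K0 \<noteq> {}" "interior K \<subseteq> P" "interior K \<noteq> {}"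
    using interior_K_subset interior_nonempty K0 K by auto
  ultimately show False
    using interior_subset [of K0] interior_subset [of K] by blast
qed

text \<open>A unit of flow is sent along a path in the dual graph: an antisymmetric function on
  edges, zero on the boundary, whose sum over the edges of a triangle is the net inflow. The path is
  lengthened by one crossing at a time.\<close>

lemma unit_flow:
  assumes K0: "K0 \<in> T" and K: "K \<in> T"
  shows "\<exists>\<delta> :: (real^2) \<times> (real^2) \<Rightarrow> real. (\<forall>e. \<delta> (prod.swap e) = - \<delta> e) \<and>
    (\<forall>e\<in>edges T. prod.swap e \<notin> edges T \<longrightarrow> \<delta> e = 0) \<and>
    (\<forall>L\<in>T. sum \<delta> (dir_edges L) = of_bool (L = K) - of_bool (L = K0))"
  using adjacent_connected [OF K0 K]
proof induction
  case base
  show ?case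
    by (intro exI [of _ "\<lambda>e. 0"]) auto
next
  case (step K K')
  then obtain \<delta> :: "(real^2) \<times> (real^2) \<Rightarrow> real" where \<delta>: "\<And>e. \<delta> (prod.swap e) = - \<delta> e"
    "\<And>e. e \<in> edges T \<Longrightarrow> prod.swap e \<notin> edges T \<Longrightarrow> \<delta> e = 0"
    "\<And>L. L \<in> T \<Longrightarrow> sum \<delta> (dir_edges L) = of_bool (L = K) - of_bool (L = K0)"
    by blast
  obtain e0 where K: "K \<in> T" "K' \<in> T" and e0: "e0 \<in> dir_edges K" "prod.swap e0 \<in> dir_edges K'"
    using step(2) by (auto simp: adjacent_def)
  \<comment> \<open>One unit crosses e0 from K to K': it is counted negatively on the edge as seen
    from K and positively on the reversed edge as seen from K'.\<close>
  define \<eta> :: "(real^2) \<times> (real^2) \<Rightarrow> real" where "\<eta> e = of_bool (e = prod.swap e0) - of_bool (e = e0)" for e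
  have ne: "prod.swap e0 \<noteq> e0"
    using dir_edge_swap_ne K(1) e0(1) by blast
  have sw: "prod.swap e = e0 \<longleftrightarrow> e = prod.swap e0" for e :: "(real^2) \<times> (real^2)"
    by (metis swap_swap)
  have 1: "\<eta> (prod.swap e) = - \<eta> e" for e
  proof -
    have "prod.swap e = prod.swap e0 \<longleftrightarrow> e = e0"
      by (metis swap_swap)
    then show ?thesis
      using sw [of e] by (simp add: \<eta>_def)
  qed
  have 2: "\<eta> e = 0" if "e \<in> edges T" "prod.swap e \<notin> edges T" for e
    using that K e0 by (auto simp: \<eta>_def edges_def)
  have 3: "sum \<eta> (dir_edges L) = of_bool (L = K') - of_bool (L = K)" if L: "L \<in> T" for L
  proof -
    have iff: "prod.swap e0 \<in> dir_edges L \<longleftrightarrow> L = K'" "e0 \<in> dir_edges L \<longleftrightarrow> L = K"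
      using dir_edge_unique [OF L] K e0 by blast+
    have "sum \<eta> (dir_edges L) = (\<Sum>e\<in>dir_edges L. of_bool (e = prod.swap e0)) - (\<Sum>e\<in>dir_edges L. of_bool (e = e0))"
      by (simp add: \<eta>_def sum_subtractf)
    also have "\<dots> = of_bool (L = K') - of_bool (L = K)"
      using finite_dir_edges [OF L] by (simp add: of_bool_def iff)
    finally show ?thesis .
  qed
  show ?case
    by (intro exI [of _ "\<lambda>e. \<delta> e + \<eta> e"]) (auto simp: 1 2 3 \<delta> sum.distrib)
qed

text \<open>Unit flows from a fixed root K0 to each K are superposed with the weights \<beta> K. The
  balance at the root is correct because the weights sum to zero.\<close>

lemma exists_flow:
  fixes \<beta> :: "(real^2) set \<Rightarrow> real"
  assumes \<beta>: "(\<Sum>K\<in>T. \<beta> K) = 0"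
  obtains \<delta> :: "(real^2) \<times> (real^2) \<Rightarrow> real" where "\<And>e. \<delta> (prod.swap e) = - \<delta> e"
    "\<And>e. e \<in> edges T \<Longrightarrow> prod.swap e \<notin> edges T \<Longrightarrow> \<delta> e = 0"
    "\<And>K. K \<in> T \<Longrightarrow> sum \<delta> (dir_edges K) = \<beta> K"
proof -
  have "T \<noteq> {}"
    using union_T jordan(1) by blast
  then obtain K0 where K0: "K0 \<in> T"
    by blast
  obtain D :: "(real^2) set \<Rightarrow> (real^2) \<times> (real^2) \<Rightarrow> real" where D: "\<And>K e. K \<in> T \<Longrightarrow> D K (prod.swap e) = - D K e"
    "\<And>K e. K \<in> T \<Longrightarrow> e \<in> edges T \<Longrightarrow> prod.swap e \<notin> edges T \<Longrightarrow> D K e = 0"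
    "\<And>K L. K \<in> T \<Longrightarrow> L \<in> T \<Longrightarrow> sum (D K) (dir_edges L) = of_bool (L = K) - of_bool (L = K0)"
    using unit_flow [OF K0] by metis
  define \<delta> where "\<delta> e = (\<Sum>K\<in>T. \<beta> K * D K e)" for e
  show thesis
  proof (rule that)
    show "\<delta> (prod.swap e) = - \<delta> e" for e
      by (simp add: \<delta>_def D(1) sum_negf [symmetric])
    show "\<delta> e = 0" if "e \<in> edges T" "prod.swap e \<notin> edges T" for e
      using that by (simp add: \<delta>_def D(2))
    fix L assume L: "L \<in> T"
    have "sum \<delta> (dir_edges L) = (\<Sum>K\<in>T. \<beta> K * sum (D K) (dir_edges L))"
      unfolding \<delta>_def by (subst sum.swap) (simp add: sum_distrib_left)
    also have "\<dots> = (\<Sum>K\<in>T. \<beta> K * of_bool (L = K)) - (\<Sum>K\<in>T. \<beta> K) * of_bool (L = K0)"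
      by (simp add: D(3) L right_diff_distrib sum_subtractf sum_distrib_right)
    also have "\<dots> = \<beta> L"
      using \<beta> finite_T L by (simp add: of_bool_def if_distrib cong: if_cong)
    finally show "sum \<delta> (dir_edges L) = \<beta> L" .
  qed
qed

section \<open>Cutting the polygon along a chord\<close>

lemma dir_edges_open_disjoint:
  assumes K: "K \<in> T" "(a, b) \<in> dir_edges K" "(p, q) \<in> dir_edges K" and x: "x \<in> open_segment a b" "x \<in> open_segment p q"
  shows "p = a \<and> q = b"
proof -
  obtain c where D: "orient a b c > 0" and E: "dir_edges K = {(a, b), (b, c), (c, a)}"
    using K(2) by (rule dir_edgesE)
  obtain u where u: "0 < u" "u < 1" "x = (1 - u) *\<^sub>R a + u *\<^sub>R b + 0 *\<^sub>R c"
    using x(1) by (auto simp: in_segment)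
  have "orient x b c > 0" "orient a x c > 0"
    unfolding u(3) using u D by (subst orient_convex_combination; simp)+
  then have "orient b c x \<noteq> 0" "orient c a x \<noteq> 0"
    using orient_cycle(1) [of b c x] orient_cycle(2) [of c a x] by simp_all
  moreover have "orient p q x = 0"
    using x(2) by (rule orient_open_segment)
  ultimately show ?thesis
    using K(3) unfolding E by auto
qed

text \<open>A paired edge is a chord of the polygon. Together with one of the two boundary arcs between its
  endpoints it bounds a subpolygon, and \<open>S\<close> consists of the triangles in this subpolygon.\<close>

lemma chord_split:
  assumes K0: "K0 \<in> T" "(a, b) \<in> dir_edges K0" and K0': "K0' \<in> T" "(b, a) \<in> dir_edges K0'"
  obtains S e0 where "S \<subseteq> T" "e0 = (a, b) \<or> e0 = (b, a)" "e0 \<in> edges S" "prod.swap e0 \<notin> edges S"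
    "\<And>e. e \<in> edges S \<Longrightarrow> prod.swap e \<notin> edges S \<Longrightarrow> prod.swap e \<in> edges T \<Longrightarrow> e = e0"
proof -
  have main: "\<exists>S\<subseteq>T. \<exists>e0. (e0 = (a, b) \<or> e0 = (b, a)) \<and> e0 \<in> edges S \<and> prod.swap e0 \<notin> edges S \<and>
    (\<forall>e. e \<in> edges S \<longrightarrow> prod.swap e \<notin> edges S \<longrightarrow> prod.swap e \<in> edges T \<longrightarrow> e = e0)"
    if K0: "K0 \<in> T" "(a, b) \<in> dir_edges K0" and K0': "K0' \<in> T" "(b, a) \<in> dir_edges K0'"
      and ij: "i < j" "j < length vs" "a = vs ! i" "b = vs ! j" for K0 K0' a b i j
  proof -
    have ab: "a \<noteq> b"
      using dir_edge_vertices(3) [OF K0] .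
    have ne0: "K0 \<noteq> K0'"
      using swap_not_same [OF K0] K0'(2) by auto
    note inP = paired_edge_interior [OF K0(1) K0'(1) K0(2) K0'(2)]
    have "j \<noteq> Suc i"
    proof
      assume "j = Suc i"
      then have "closed_segment a b = polygon_edge vs i"
        using ij by (simp add: polygon_edge_def next_vertex_simps)
      then show False
        using polygon_edge_not_paired [OF K0(1) K0'(1) K0(2) K0'(2), of i] ij by simp
    qed
    with ij have ij2: "i + 2 \<le> j"
      by simp
    \<comment> \<open>The vertices from a to b in the order of the polygon; the edge that closes
      this list is the chord.\<close>
    define ws where "ws = drop i (take (Suc j) vs)"
    define m where "m = j - i"
    have len: "length ws = Suc m"
      using ij by (simp add: ws_def m_def)
    have nth: "ws ! k = vs ! (i + k)" if "k \<le> m" for k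
      using that ij by (simp add: ws_def m_def)
    have ws0: "ws ! 0 = a" "ws ! m = b"
      using nth [of 0] nth [of m] ij by (simp_all add: m_def)
    have edge: "polygon_edge ws k = polygon_edge vs (i + k)" "next_vertex ws k = next_vertex vs (i + k)" if "k < m" for k
    proof -
      show "next_vertex ws k = next_vertex vs (i + k)"
        using that nth [of "Suc k"] ij len by (simp add: next_vertex_simps m_def)
      then show "polygon_edge ws k = polygon_edge vs (i + k)"
        using that nth [of k] by (simp add: polygon_edge_def)
    qed
    have last: "next_vertex ws m = a" "polygon_edge ws m = closed_segment a b"
      using len ws0 by (simp_all add: next_vertex_simps polygon_edge_def closed_segment_commute)
    \<comment> \<open>The open chord runs inside P, so it meets the boundary of P only at its
      endpoints. This is what makes the cut-off polygon simple.\<close>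
    have seg_B: "closed_segment a b \<inter> B = {a, b}"
    proof -
      have "a \<in> B" "b \<in> B"
        using boundary_vertices dir_edge_vertices(1,2) [OF K0] by auto
      then show ?thesis
        using inP jordan(5) by (auto simp: open_segment_def)
    qed
    have chord: "polygon_edge vs l \<inter> closed_segment a b = {vs ! l, next_vertex vs l} \<inter> {a, b}" if l: "l < length vs" for l
    proof -
      have "polygon_edge vs l \<subseteq> B"
        using l by (auto simp: polygon_boundary_def)
      then have eq: "polygon_edge vs l \<inter> closed_segment a b = polygon_edge vs l \<inter> {a, b}"
        using seg_B by auto
      have ends: "vs ! l \<in> polygon_edge vs l" "next_vertex vs l \<in> polygon_edge vs l"
        by (auto simp: polygon_edge_def)
      have "x \<in> {vs ! l, next_vertex vs l}" if "x \<in> polygon_edge vs l" "x = a \<or> x = b" for x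
        using vertex_on_polygon_edge [OF _ l that(1)] dir_edge_vertices(1,2) [OF K0] that(2) by auto
      with ends show ?thesis
        unfolding eq by auto
    qed
    have ws: "simple_polygon ws"
      unfolding simple_polygon_def
    proof (intro conjI allI impI)
      show "3 \<le> length ws"
        using len ij2 by (simp add: m_def)
      show "distinct ws"
        using simple_polygonD(2) [OF poly] by (simp add: ws_def)
      fix k l assume kl: "k < length ws" "l < length ws" "k \<noteq> l"
      consider "k < m" "l < m" | "k < m" "l = m" | "k = m" "l < m"
        using kl len by linarith
      then show "polygon_edge ws k \<inter> polygon_edge ws l = {ws ! k, next_vertex ws k} \<inter> {ws ! l, next_vertex ws l}"
      proof cases
        case 1
        then have "i + k < length vs" "i + l < length vs" "i + k \<noteq> i + l"
          using ij kl by (auto simp: m_def)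
        from simple_polygonD(3) [OF poly this] show ?thesis
          using 1 by (simp add: edge nth)
      next
        case 2
        then have "i + k < length vs"
          using ij by (auto simp: m_def)
        from chord [OF this] show ?thesis
          using 2 by (simp add: edge nth last ws0 insert_commute)
      next
        case 3
        then have "i + l < length vs"
          using ij by (auto simp: m_def)
        from chord [OF this] show ?thesis
          using 3 by (simp add: edge nth last ws0 insert_commute Int_commute)
      qed
    qed
    let ?J = "polygon_boundary ws" and ?Q = "polygon_region ws"
    note jw = polygon_jordan [OF ws]
    have J_sub: "?J \<subseteq> B \<union> closed_segment a b"
    proof
      fix x assume "x \<in> ?J"
      then obtain k where k: "k < Suc m" "x \<in> polygon_edge ws k"
        by (auto simp: polygon_boundary_def len)
      show "x \<in> B \<union> closed_segment a b"
      proof (cases "k = m")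
        case False
        then have "k < m" "i + k < length vs"
          using k ij by (auto simp: m_def)
        then show ?thesis
          using k(2) by (auto simp: edge polygon_boundary_def)
      qed (use k last in auto)
    qed
    have seg_J: "closed_segment a b \<subseteq> ?J"
      unfolding polygon_boundary_def len using last(2) by blast
    have seg_K: "closed_segment a b \<subseteq> K0" "closed_segment a b \<subseteq> K0'"
      using dir_edge_vertices(4) [OF K0] dir_edge_vertices(4) [OF K0'] by (simp_all add: closed_segment_commute)
    have int_J: "interior K \<inter> ?J = {}" if K: "K \<in> T" for K
    proof -
      have "interior K \<inter> closed_segment a b = {}"
        using interior_Int_K [OF K K0(1)] interior_Int_K [OF K K0'(1)] seg_K ne0 by (cases "K = K0") blast+
      moreover have "interior K \<inter> B = {}"
        using interior_K_subset [OF K] jordan(5) by blast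
      ultimately show ?thesis
        using J_sub by blast
    qed
    define S where "S = {K \<in> T. interior K \<subseteq> ?Q}"
    \<comment> \<open>The interior of a triangle is connected and avoids the boundary of the
      subpolygon, so it lies inside as soon as the triangle meets the inside.\<close>
    have dich: "K \<in> S" if K: "K \<in> T" "K \<inter> ?Q \<noteq> {}" for K
    proof -
      have "closure (interior K) \<inter> ?Q \<noteq> {}"
        using K closure_interior_K by simp
      then have "interior K \<inter> ?Q \<noteq> {}"
        using open_Int_closure_eq_empty [OF jw(2)] by blast
      moreover have "connected (interior K)"
        by (intro convex_connected convex_interior convex_K K(1))
      ultimately have "interior K \<subseteq> ?Q"
        using connected_Int_frontier [of "interior K" ?Q] int_J [OF K(1)] jw(7) by blast
      with K(1) show ?thesis
        by (simp add: S_def)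
    qed
    have S_closure: "K \<subseteq> closure ?Q" if "K \<in> S" for K
      using that closure_mono [of "interior K" ?Q] closure_interior_K by (auto simp: S_def)
    let ?m = "midpoint a b"
    have mid: "?m \<in> open_segment a b" "?m \<in> ?J"
      using ab subsetD [OF seg_J midpoint_in_closed_segment] by simp_all
    obtain r where r: "r > 0" "ball ?m r \<subseteq> K0 \<union> K0'"
      by (rule paired_edge_ball [OF K0(1) K0'(1) K0(2) K0'(2) mid(1)])
    \<comment> \<open>Otherwise a whole disc around the midpoint of the chord would lie in the
      closure of the subpolygon, although the midpoint is on its boundary.\<close>
    have not_both: "\<not> (K0 \<in> S \<and> K0' \<in> S)"
    proof
      assume "K0 \<in> S \<and> K0' \<in> S"
      then have "ball ?m r \<subseteq> closure ?Q"
        using S_closure r(2) by blast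
      then have "ball ?m r \<subseteq> interior (closure ?Q)"
        by (intro interior_maximal) auto
      then have "?m \<in> ?Q"
        unfolding jw(8) using r(1) by (auto simp: subset_iff)
      then show False
        using mid(2) jw(5) by blast
    qed
    \<comment> \<open>As a boundary point, the midpoint is a limit of points of the subpolygon;
      these lie in the disc covered by the two triangles at the chord.\<close>
    have one: "K0 \<in> S \<or> K0' \<in> S"
    proof -
      have "?m \<in> closure ?Q"
        using mid(2) jw(6) by blast
      moreover have "?m \<in> ball ?m r"
        using r(1) by simp
      ultimately have "ball ?m r \<inter> ?Q \<noteq> {}"
        using open_Int_closure_eq_empty [OF open_ball, of ?m r ?Q] by blast
      then show ?thesis
        using r(2) dich [OF K0(1)] dich [OF K0'(1)] by blast
    qed
    \<comment> \<open>The midpoint of any other interior edge avoids the chord and the boundary of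
      P, hence the boundary of the subpolygon. Lying in its closure, it lies inside, and so the
      triangle on the other side belongs to S as well.\<close>
    have cross: "K' \<in> S" if K: "K \<in> S" "(p, q) \<in> dir_edges K" and K': "K' \<in> T" "(q, p) \<in> dir_edges K'"
      and pq: "(p, q) \<noteq> (a, b)" "(p, q) \<noteq> (b, a)" for K K' p q
    proof -
      have KT: "K \<in> T"
        using K(1) by (simp add: S_def)
      have "p \<noteq> q"
        using dir_edge_vertices(3) [OF KT K(2)] .
      let ?n = "midpoint p q"
      have n: "?n \<in> open_segment p q"
        using \<open>p \<noteq> q\<close> by simp
      have nP: "?n \<in> P"
        using paired_edge_interior [OF KT K'(1) K(2) K'(2)] n by blast
      have "?n \<notin> closed_segment a b"
      proof
        assume seg: "?n \<in> closed_segment a b"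
        have "?n \<notin> set vs"
          using nP boundary_vertices jordan(5) by blast
        then have o: "?n \<in> open_segment a b"
          using seg dir_edge_vertices(1,2) [OF K0] by (auto simp: open_segment_def)
        show False
        proof (cases "K = K0")
          case True
          have "(q, p) \<in> dir_edges K0'"
            using opposite_triangle [OF KT K0'(1) _ K(2) n] True ne0 seg seg_K by blast
          then show False
            using dir_edges_open_disjoint [OF K0'(1) K0'(2), of q p ?n] o n pq by (auto simp: open_segment_commute)
        next
          case False
          have "(q, p) \<in> dir_edges K0"
            using opposite_triangle [OF KT K0(1) False K(2) n] seg seg_K by blast
          then show False
            using dir_edges_open_disjoint [OF K0(1) K0(2), of q p ?n] o n pq by (auto simp: open_segment_commute)
        qed
      qed
      moreover have "?n \<notin> B"
        using nP jordan(5) by blast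
      ultimately have "?n \<notin> ?J"
        using J_sub by blast
      moreover have "?n \<in> K" "?n \<in> K'"
        using n dir_edge_vertices(4) [OF KT K(2)] dir_edge_vertices(4) [OF K']
        by (auto simp: open_segment_def closed_segment_commute)
      ultimately have "?n \<in> ?Q"
        using S_closure [OF K(1)] jw(6) by blast
      then show ?thesis
        using dich [OF K'(1)] \<open>?n \<in> K'\<close> by blast
    qed
    \<comment> \<open>The chord in the direction that has the triangle of S on its left.\<close>
    define e0 where "e0 = (if K0 \<in> S then (a, b) else (b, a))"
    have ST: "S \<subseteq> T"
      by (auto simp: S_def)
    have K0_iff: "K = K0" if "K \<in> T" "(a, b) \<in> dir_edges K" for K
      using dir_edge_unique [OF that(1) K0(1) that(2) K0(2)] .
    have K0'_iff: "K = K0'" if "K \<in> T" "(b, a) \<in> dir_edges K" for K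
      using dir_edge_unique [OF that(1) K0'(1) that(2) K0'(2)] .
    show ?thesis
    proof (intro exI [of _ S] exI [of _ e0] conjI allI impI ST)
      show "e0 = (a, b) \<or> e0 = (b, a)"
        by (simp add: e0_def)
      show "e0 \<in> edges S"
        using one K0 K0' by (auto simp: e0_def edges_def)
      show "prod.swap e0 \<notin> edges S"
        using not_both one ST K0_iff K0'_iff by (auto simp: e0_def edges_def split: if_splits)
      fix e assume e: "e \<in> edges S" "prod.swap e \<notin> edges S" "prod.swap e \<in> edges T"
      obtain p q where pq: "e = (p, q)"
        by (cases e)
      obtain K where K: "K \<in> S" "(p, q) \<in> dir_edges K"
        using e(1) by (auto simp: pq edges_def)
      obtain K' where K': "K' \<in> T" "(q, p) \<in> dir_edges K'"
        using e(3) by (auto simp: pq edges_def)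
      have "K' \<notin> S"
        using e(2) K'(2) by (auto simp: pq edges_def)
      then have "(p, q) = (a, b) \<or> (p, q) = (b, a)"
        using cross [OF K K'] by blast
      then show "e = e0"
      proof
        assume "(p, q) = (a, b)"
        then show ?thesis
          using K K0_iff ST by (auto simp: pq e0_def)
      next
        assume "(p, q) = (b, a)"
        then have "K0' \<in> S"
          using K K0'_iff ST by auto
        then show ?thesis
          using \<open>(p, q) = (b, a)\<close> not_both by (auto simp: pq e0_def)
      qed
    qed
  qed
  obtain i j where ij: "i < length vs" "j < length vs" "a = vs ! i" "b = vs ! j"
    using dir_edge_vertices(1,2) [OF K0] by (auto simp: in_set_conv_nth)
  have "i \<noteq> j"
    using dir_edge_vertices(3) [OF K0] ij by auto
  then consider "i < j" | "j < i"
    by linarith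
  then show thesis
  proof cases
    case 1
    from main [OF K0 K0' 1 ij(2,3,4)] that show thesis
      by metis
  next
    case 2
    from main [OF K0' K0 2 ij(1,4,3)] that show thesis
      by metis
  qed
qed

text \<open>The interiors of the triangles are disjoint, and what they miss of P is contained in
  finitely many frontiers of convex sets, which are negligible.\<close>

lemma integral_P:
  fixes f :: "real^2 \<Rightarrow> real"
  assumes f: "integrable (lebesgue_on P) f"
  shows "(LINT x|lebesgue_on P. f x) = (\<Sum>K\<in>T. LINT x|lebesgue_on (interior K). f x)"
proof -
  have Pm: "P \<in> sets lebesgue"
    using jordan(2) by auto
  have Km: "interior K \<in> sets lebesgue" for K
    by (simp add: borel_open)
  have fK: "integrable (lebesgue_on (interior K)) f" if "K \<in> T" for K
    by (rule integrable_lebesgue_on_mono [OF f interior_K_subset [OF that] Km Pm])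
  have "negligible (P - (\<Union>K\<in>T. interior K))"
  proof (rule negligible_subset)
    show "negligible (\<Union>K\<in>T. K - interior K)"
      using finite_T negligible_frontier_interior_K [OF convex_K] by (intro negligible_Union) auto
    show "P - (\<Union>K\<in>T. interior K) \<subseteq> (\<Union>K\<in>T. K - interior K)"
      using union_T by blast
  qed
  then have N: "AE x in lebesgue. x \<notin> P - (\<Union>K\<in>T. interior K)"
    by (intro AE_not_in) (simp only: negligible_iff_null_sets)
  have eq: "indicator P x *\<^sub>R f x = (\<Sum>K\<in>T. indicator (interior K) x *\<^sub>R f x)"
    if nx: "x \<notin> P - (\<Union>K\<in>T. interior K)" for x
  proof (cases "x \<in> P")
    case True
    then obtain K where K: "K \<in> T" "x \<in> interior K"
      using nx by blast
    have "(\<Sum>L\<in>T. indicator (interior L) x *\<^sub>R f x) = (\<Sum>L\<in>{K}. indicator (interior L) x *\<^sub>R f x)"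
    proof (rule sum.mono_neutral_right [OF finite_T])
      show "\<forall>L\<in>T - {K}. indicator (interior L) x *\<^sub>R f x = 0"
        using interior_Int_K [OF K(1)] K(2) interior_subset by (fastforce simp: indicator_def)
    qed (use K in auto)
    with True K show ?thesis
      by simp
  next
    case False
    then have "x \<notin> interior K" if "K \<in> T" for K
      using interior_K_subset [OF that] by blast
    with False show ?thesis
      by simp
  qed
  have ints: "integrable lebesgue (\<lambda>x. indicator (interior K) x *\<^sub>R f x)" if "K \<in> T" for K
    using fK [OF that] Km by (simp add: integrable_restrict_space)
  have intP: "integrable lebesgue (\<lambda>x. indicator P x *\<^sub>R f x)"
    using f Pm by (simp add: integrable_restrict_space)
  have "(LINT x|lebesgue_on P. f x) = (LINT x|lebesgue. indicator P x *\<^sub>R f x)"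
    using Pm by (simp add: integral_restrict_space)
  also have "\<dots> = (LINT x|lebesgue. (\<Sum>K\<in>T. indicator (interior K) x *\<^sub>R f x))"
  proof (rule integral_cong_AE)
    show "AE x in lebesgue. indicator P x *\<^sub>R f x = (\<Sum>K\<in>T. indicator (interior K) x *\<^sub>R f x)"
      using N by eventually_elim (rule eq)
    show "(\<lambda>x. indicator P x *\<^sub>R f x) \<in> borel_measurable lebesgue"
      using intP by (rule borel_measurable_integrable)
    show "(\<lambda>x. \<Sum>K\<in>T. indicator (interior K) x *\<^sub>R f x) \<in> borel_measurable lebesgue"
      using ints by (intro borel_measurable_sum borel_measurable_integrable)
  qed
  also have "\<dots> = (\<Sum>K\<in>T. LINT x|lebesgue. indicator (interior K) x *\<^sub>R f x)"
    using ints by (rule Bochner_Integration.integral_sum)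
  also have "\<dots> = (\<Sum>K\<in>T. LINT x|lebesgue_on (interior K). f x)"
    using Km by (simp add: integral_restrict_space)
  finally show ?thesis .
qed

end

section \<open>Piecewise edge elements\<close>

text \<open>An element of \<open>ND\<close> by its parameters. The field (x_2, -x_1) has curl -2, so
  \<open>nd a b\<close> has curl -2 b.\<close>

definition nd :: "real^2 \<Rightarrow> real \<Rightarrow> real^2 \<Rightarrow> real^2" where
  "nd a b x = a + b *\<^sub>R vector [x $ 2, - (x $ 1)]"

lemma nd_nth [simp]: "nd a b x $ 1 = a $ 1 + b * x $ 2" "nd a b x $ 2 = a $ 2 - b * x $ 1"
  by (simp_all add: nd_def)

lemma ND_iff: "p \<in> ND \<longleftrightarrow> (\<exists>a b. p = nd a b)"
  by (simp add: ND_def nd_def [abs_def])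

lemma smooth_nd: "smooth (\<lambda>x. nd a b x $ i)"
proof -
  have "smooth (\<lambda>x. a $ 1 + b * x $ 2)" "smooth (\<lambda>x. a $ 2 - b * x $ 1)"
    by (intro smooth_add smooth_diff smooth_mult smooth_const smooth_coord)+
  then show ?thesis
    using exhaust_2 [of i] by auto
qed

lemma C1_nd: "cont_diff 1 (\<lambda>x. nd a b x $ i)"
  using smooth_nd smooth_imp_C1 by blast

lemma continuous_nd: "continuous_on A (nd a b)"
proof -
  have "nd a b = (\<lambda>x. \<chi> i. nd a b x $ i)"
    by (simp add: fun_eq_iff)
  then show ?thesis
    using continuous_on_vec_lambda [of A "\<lambda>i x. nd a b x $ i"] C1_continuous [OF C1_nd] by simp
qed

lemma partial_nd: "partial 1 (\<lambda>x. nd a b x $ 2) x = - b" "partial 2 (\<lambda>x. nd a b x $ 1) x = b"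
proof -
  have d: "(\<lambda>x::real^2. x $ i) differentiable (at x)" for i
    by (intro bounded_linear_imp_differentiable bounded_linear_vec_nth)
  have d': "(\<lambda>x::real^2. b * x $ i) differentiable (at x)" for i
    by (intro differentiable_mult d differentiable_const)
  show "partial 1 (\<lambda>x. nd a b x $ 2) x = - b" "partial 2 (\<lambda>x. nd a b x $ 1) x = b"
    by (simp_all add: partial_diff [OF differentiable_const d'] partial_add [OF differentiable_const d'] partial_cmult [OF d] partial_coord)
qed

text \<open>Moving along b - a changes the field by a multiple of the rotated vector, which is
  perpendicular to b - a.\<close>

lemma nd_tangential_const: "nd \<alpha> \<beta> (linepath a b s) \<bullet> (b - a) = nd \<alpha> \<beta> a \<bullet> (b - a)"
  by (simp add: inner_vec_def sum_2 linepath_def algebra_simps)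

lemma segint_nd: "segint (\<lambda>x. nd \<alpha> \<beta> x \<bullet> (b - a)) a b = nd \<alpha> \<beta> a \<bullet> (b - a)"
  by (simp add: segint_def nd_tangential_const)

lemma nd_tangential_swap: "nd \<alpha> \<beta> b \<bullet> (a - b) = - (nd \<alpha> \<beta> a \<bullet> (b - a))"
  by (simp add: inner_vec_def sum_2 algebra_simps)

lemma nd_circulation:
  "nd \<alpha> \<beta> a \<bullet> (b - a) + nd \<alpha> \<beta> b \<bullet> (c - b) + nd \<alpha> \<beta> c \<bullet> (a - c) = - \<beta> * orient a b c"
  by (simp add: inner_vec_def sum_2 orient_def algebra_simps)

text \<open>By \<open>nd_circulation\<close> the sum of the three values fixes \<beta>. The two
  values on the edges at a then form a linear system for the value of the field at a, solved by
  Cramer's rule, and \<alpha> is read off from that value.\<close>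

lemma nd_exists:
  assumes D: "orient a b c \<noteq> 0"
  obtains \<alpha> \<beta> where "nd \<alpha> \<beta> a \<bullet> (b - a) = x1" "nd \<alpha> \<beta> b \<bullet> (c - b) = x2" "nd \<alpha> \<beta> c \<bullet> (a - c) = x3"
proof -
  let ?D = "orient a b c"
  define \<beta> where "\<beta> = - (x1 + x2 + x3) / ?D"
  define N1 N2 where N: "N1 = x1 * (c $ 2 - a $ 2) + x3 * (b $ 2 - a $ 2)"
    "N2 = x1 * (c $ 1 - a $ 1) + x3 * (b $ 1 - a $ 1)"
  define k1 k2 where k: "k1 = N1 / ?D" "k2 = - N2 / ?D"
  define \<alpha> :: "real^2" where "\<alpha> = vector [k1 - \<beta> * a $ 2, k2 + \<beta> * a $ 1]"
  have p: "nd \<alpha> \<beta> a \<bullet> v = (N1 * v $ 1 - N2 * v $ 2) / ?D" for v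
    by (simp add: inner_vec_def sum_2 \<alpha>_def k diff_divide_distrib)
  have 1: "nd \<alpha> \<beta> a \<bullet> (b - a) = x1"
  proof -
    have "N1 * (b - a) $ 1 - N2 * (b - a) $ 2 = x1 * ?D"
      by (simp add: N orient_def algebra_simps)
    then show ?thesis
      using D by (simp only: p nonzero_mult_div_cancel_right not_False_eq_True)
  qed
  have 3: "nd \<alpha> \<beta> c \<bullet> (a - c) = x3"
  proof -
    have "N1 * (c - a) $ 1 - N2 * (c - a) $ 2 = - x3 * ?D"
      by (simp add: N orient_def algebra_simps)
    then have "nd \<alpha> \<beta> a \<bullet> (c - a) = - x3"
      using D by (simp only: p nonzero_mult_div_cancel_right not_False_eq_True)
    then show ?thesis
      using nd_tangential_swap [of \<alpha> \<beta> a c] by simp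
  qed
  have "- \<beta> * ?D = x1 + x2 + x3"
    using D by (simp add: \<beta>_def)
  then have "nd \<alpha> \<beta> b \<bullet> (c - b) = x2"
    using nd_circulation [of \<alpha> \<beta> a b c] 1 3 by simp
  with 1 3 that show thesis
    by blast
qed

text \<open>Stokes' theorem for the field \<phi> times \<open>nd \<alpha> \<beta>\<close>, whose
  curl is the integrand by the product rule. On each edge the tangential component of the second
  factor is constant and comes out of the integral.\<close>

lemma stokes_nd:
  assumes D: "orient a b c > 0" and \<phi>: "cont_diff 1 \<phi>"
  shows "(LINT x|lebesgue_on (triangle a b c). - 2 * \<beta> * \<phi> x - (nd \<alpha> \<beta> x $ 1 * partial 2 \<phi> x - nd \<alpha> \<beta> x $ 2 * partial 1 \<phi> x))
    = (nd \<alpha> \<beta> a \<bullet> (b - a)) * segint \<phi> a b + (nd \<alpha> \<beta> b \<bullet> (c - b)) * segint \<phi> b c + (nd \<alpha> \<beta> c \<bullet> (a - c)) * segint \<phi> c a"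
proof -
  let ?p = "\<lambda>x. \<phi> x *\<^sub>R nd \<alpha> \<beta> x"
  have C1: "C1_field ?p"
    unfolding C1_field_def vector_scaleR_component real_scaleR_def by (intro allI cont_diff_mult \<phi> C1_nd)
  have J: "weak_jacobian (triangle a b c) ?p (jacobian ?p)"
    unfolding weak_jacobian_def jacobian_def using C1 by (auto simp: C1_field_def intro!: weak_grad_C1)
  have pp: "partial j (\<lambda>x. ?p x $ i) x = \<phi> x * partial j (\<lambda>x. nd \<alpha> \<beta> x $ i) x + partial j \<phi> x * nd \<alpha> \<beta> x $ i" for i j x
    unfolding vector_scaleR_component real_scaleR_def
    by (rule partial_mult [OF C1_differentiable [OF \<phi>] C1_differentiable [OF C1_nd]])
  have curl: "jacobian ?p 2 1 x - jacobian ?p 1 2 x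
      = - 2 * \<beta> * \<phi> x - (nd \<alpha> \<beta> x $ 1 * partial 2 \<phi> x - nd \<alpha> \<beta> x $ 2 * partial 1 \<phi> x)" for x
    unfolding jacobian_def pp partial_nd by (simp add: algebra_simps)
  have flux: "edge_flux d p q ?p (jacobian ?p) = (nd \<alpha> \<beta> p \<bullet> (q - p)) * segint \<phi> p q" if "orient d p q \<noteq> 0" for d p q
  proof -
    have "edge_flux d p q ?p (jacobian ?p) = segint (\<lambda>x. ?p x \<bullet> (q - p)) p q"
      by (rule edge_flux_C1 [OF that C1])
    also have "\<dots> = (nd \<alpha> \<beta> p \<bullet> (q - p)) * segint \<phi> p q"
      unfolding segint_def Bochner_Integration.integral_mult_right_zero [symmetric]
      by (rule Bochner_Integration.integral_cong) (simp_all add: nd_tangential_const)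
    finally show ?thesis .
  qed
  have "edge_flux c a b ?p (jacobian ?p) + edge_flux a b c ?p (jacobian ?p) + edge_flux b c a ?p (jacobian ?p)
      = (LINT x|lebesgue_on (triangle a b c). jacobian ?p 2 1 x - jacobian ?p 1 2 x)"
    using stokes_triangle [OF _ J] D by simp
  moreover have "orient c a b \<noteq> 0" "orient a b c \<noteq> 0" "orient b c a \<noteq> 0"
    using D by (simp_all add: orient_cycle)
  ultimately show ?thesis
    by (simp only: curl flux not_False_eq_True)
qed

text \<open>Evaluation at the starting point suffices for the fields \<open>nd\<close>, whose
  tangential component is constant along the edge; for them this is the line integral along
  e.\<close>

definition tangential :: "(real^2 \<Rightarrow> real^2) \<Rightarrow> (real^2) \<times> (real^2) \<Rightarrow> real" where
  "tangential p e = p (fst e) \<bullet> (snd e - fst e)"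

lemma tangential_nd_swap: "tangential (nd \<alpha> \<beta>) (prod.swap e) = - tangential (nd \<alpha> \<beta>) e"
  using nd_tangential_swap [of \<alpha> \<beta> "snd e" "fst e"] by (simp add: tangential_def)

lemma segint_swap: "segint \<phi> b a = segint \<phi> a b" if "continuous_on UNIV \<phi>"
proof -
  have m: "\<phi> \<in> borel_measurable borel"
    by (rule borel_measurable_continuous_onI [OF that])
  have [measurable]: "(\<lambda>s. \<phi> (linepath a b s)) \<in> borel_measurable borel"
    by (rule borel_measurable_continuous_onI) (intro continuous_on_compose2 [OF that] continuous_intros; simp)
  have "segint \<phi> a b = (LINT s|lborel. indicator {0..1} (1 + (-1) * s) * \<phi> (linepath a b (1 + (-1) * s)))"
    unfolding segint_def by (subst lborel_integral_real_affine [of "-1" _ 1]) auto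
  also have "\<dots> = segint \<phi> b a"
    unfolding segint_def
    by (rule Bochner_Integration.integral_cong) (auto simp: indicator_def linepath_def algebra_simps)
  finally show ?thesis ..
qed

section \<open>Tangential continuity and the weak curl of piecewise fields\<close>

context triangulated_polygon
begin

lemma interior_eq_triangle: "K = convex hull {a, b, c} \<Longrightarrow> interior K = triangle a b c"
  by (simp add: triangle_def)

lemma dir_edges_sum3:
  fixes f :: "(real^2) \<times> (real^2) \<Rightarrow> real"
  assumes "orient a b c > 0" "dir_edges K = {(a, b), (b, c), (c, a)}"
  shows "sum f (dir_edges K) = f (a, b) + f (b, c) + f (c, a)"
proof -
  have "a \<noteq> b" "b \<noteq> c" "a \<noteq> c"
    using assms(1) by auto
  then show ?thesis
    by (simp add: assms(2))
qed

lemma measure_interior_K: "K \<in> T \<Longrightarrow> orient a b c > 0 \<Longrightarrow> K = convex hull {a, b, c} \<Longrightarrow>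
  measure lebesgue (interior K) = orient a b c / 2"
  using measure_triangle [of a b c] by (simp add: triangle_def)

lemma sum_tangential_nd:
  assumes K: "K \<in> T"
  shows "sum (tangential (nd \<alpha> \<beta>)) (dir_edges K) = - 2 * \<beta> * measure lebesgue (interior K)"
proof -
  obtain a b c where D: "orient a b c > 0" "K = convex hull {a, b, c}" "dir_edges K = {(a, b), (b, c), (c, a)}"
    using K by (rule triangleE)
  show ?thesis
    unfolding dir_edges_sum3 [OF D(1,3)] measure_interior_K [OF K D(1,2)]
    using nd_circulation [of \<alpha> \<beta> a b c] by (simp add: tangential_def)
qed

text \<open>\<open>stokes_nd\<close> on every triangle. The result says that only edge terms stand
  between w and the property of having weak curl c; it is used in both directions below.\<close>

lemma integral_piecewise_nd:
  fixes w :: "real^2 \<Rightarrow> real^2"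
  assumes w: "w \<in> L2 (lebesgue_on P)" and \<phi>: "\<phi> \<in> test_functions P"
    and p: "\<And>K. K \<in> T \<Longrightarrow> AE x in lebesgue_on (interior K). w x = nd (\<alpha> K) (\<beta> K) x"
    and c: "\<And>K. K \<in> T \<Longrightarrow> - 2 * \<beta> K = c"
  shows "(LINT x|lebesgue_on P. c * \<phi> x) - (LINT x|lebesgue_on P. w x $ 1 * partial 2 \<phi> x - w x $ 2 * partial 1 \<phi> x)
    = (\<Sum>K\<in>T. \<Sum>e\<in>dir_edges K. tangential (nd (\<alpha> K) (\<beta> K)) e * segint \<phi> (fst e) (snd e))"
proof -
  have Pm: "P \<in> sets borel" "P \<in> sets lebesgue"
    using jordan(2) by auto
  have C1: "cont_diff 1 \<phi>"
    using \<phi> test_function_smooth smooth_imp_C1 by blast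
  note \<phi>L = test_function_L2 [OF \<phi> Pm(1)]
  have wi: "(\<lambda>x. w x $ i) \<in> L2 (lebesgue_on P)" for i
    using w L2_vec_iff by blast
  have fin: "finite_measure (lebesgue_on P)"
    by (rule finite_measure_lebesgue_on [OF jordan(4) Pm(2)])
  let ?f = "\<lambda>x. c * \<phi> x - (w x $ 1 * partial 2 \<phi> x - w x $ 2 * partial 1 \<phi> x)"
  have i1: "integrable (lebesgue_on P) (\<lambda>x. c * \<phi> x)"
    using L2_integrable [OF fin \<phi>L(1)] by simp
  have i2: "integrable (lebesgue_on P) (\<lambda>x. w x $ 1 * partial 2 \<phi> x - w x $ 2 * partial 1 \<phi> x)"
    by (intro Bochner_Integration.integrable_diff L2_mult_integrable wi \<phi>L)
  have fi: "integrable (lebesgue_on P) ?f"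
    using i1 i2 by (rule Bochner_Integration.integrable_diff)
  have "(LINT x|lebesgue_on P. c * \<phi> x) - (LINT x|lebesgue_on P. w x $ 1 * partial 2 \<phi> x - w x $ 2 * partial 1 \<phi> x)
      = (LINT x|lebesgue_on P. ?f x)"
    using i1 i2 by simp
  also have "\<dots> = (\<Sum>K\<in>T. LINT x|lebesgue_on (interior K). ?f x)"
    by (rule integral_P [OF fi])
  also have "\<dots> = (\<Sum>K\<in>T. \<Sum>e\<in>dir_edges K. tangential (nd (\<alpha> K) (\<beta> K)) e * segint \<phi> (fst e) (snd e))"
  proof (rule sum.cong [OF refl])
    fix K assume K: "K \<in> T"
    obtain a b d where D: "orient a b d > 0" "K = convex hull {a, b, d}" "dir_edges K = {(a, b), (b, d), (d, a)}"
      using K by (rule triangleE)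
    have Ki: "interior K = triangle a b d"
      by (rule interior_eq_triangle [OF D(2)])
    let ?g = "\<lambda>x. - 2 * \<beta> K * \<phi> x - (nd (\<alpha> K) (\<beta> K) x $ 1 * partial 2 \<phi> x - nd (\<alpha> K) (\<beta> K) x $ 2 * partial 1 \<phi> x)"
    have "(LINT x|lebesgue_on (interior K). ?f x) = (LINT x|lebesgue_on (interior K). ?g x)"
    proof (rule integral_cong_AE)
      show "?f \<in> borel_measurable (lebesgue_on (interior K))"
        by (rule measurable_lebesgue_on_mono [OF borel_measurable_integrable [OF fi] interior_K_subset [OF K] _ Pm(2)])
           (simp add: borel_open)
      have "continuous_on UNIV ?g"
        by (intro continuous_intros C1_continuous [OF C1] C1_partial_continuous [OF C1] C1_continuous [OF C1_nd])
      then show "?g \<in> borel_measurable (lebesgue_on (interior K))"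
        by (intro borel_measurable_lebesgue_on borel_measurable_continuous_onI)
      show "AE x in lebesgue_on (interior K). ?f x = ?g x"
        using p [OF K] by eventually_elim (simp add: c [OF K, symmetric])
    qed
    also have "\<dots> = (\<Sum>e\<in>dir_edges K. tangential (nd (\<alpha> K) (\<beta> K)) e * segint \<phi> (fst e) (snd e))"
      unfolding Ki dir_edges_sum3 [OF D(1,3)] using stokes_nd [OF D(1) C1, of "\<beta> K" "\<alpha> K"]
      by (simp add: tangential_def)
    finally show "(LINT x|lebesgue_on (interior K). ?f x)
        = (\<Sum>e\<in>dir_edges K. tangential (nd (\<alpha> K) (\<beta> K)) e * segint \<phi> (fst e) (snd e))" .
  qed
  finally show ?thesis .
qed

lemma unpaired_edge_polygon:
  assumes "K \<in> T" "(a, b) \<in> dir_edges K" "(b, a) \<notin> edges T"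
  obtains i where "i < length vs" "(a, b) = (vs ! i, next_vertex vs i) \<or> (b, a) = (vs ! i, next_vertex vs i)"
    "polygon_edge vs i \<subseteq> K" "closed_segment a b \<subseteq> B"
proof -
  have un: "\<And>K'. K' \<in> T \<Longrightarrow> (b, a) \<notin> dir_edges K'"
    using assms(3) by (auto simp: edges_def)
  obtain i where i: "i < length vs" "{a, b} = {vs ! i, next_vertex vs i}"
    by (rule unpaired_edge [OF assms(1,2) un])
  then have cases: "(a, b) = (vs ! i, next_vertex vs i) \<or> (b, a) = (vs ! i, next_vertex vs i)"
    by (auto simp: doubleton_eq_iff)
  then have "polygon_edge vs i = closed_segment a b"
    by (auto simp: polygon_edge_def closed_segment_commute)
  moreover have "polygon_edge vs i \<subseteq> B"
    using i(1) by (auto simp: polygon_boundary_def)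
  ultimately show thesis
    using that [OF i(1) cases] dir_edge_vertices(4) [OF assms(1,2)] by simp
qed

text \<open>The edge terms cancel in pairs on interior edges because the tangential components
  match, and vanish on boundary edges because a test function is zero there.\<close>

lemma piecewise_nd_weak_curl:
  fixes w :: "real^2 \<Rightarrow> real^2"
  assumes w: "w \<in> L2 (lebesgue_on P)"
    and p: "\<And>K. K \<in> T \<Longrightarrow> AE x in lebesgue_on (interior K). w x = nd (\<alpha> K) (\<beta> K) x"
    and c: "\<And>K. K \<in> T \<Longrightarrow> - 2 * \<beta> K = c"
    and X: "\<And>K e. K \<in> T \<Longrightarrow> e \<in> dir_edges K \<Longrightarrow> tangential (nd (\<alpha> K) (\<beta> K)) e = X e"
    and anti: "\<And>e. e \<in> edges T \<Longrightarrow> prod.swap e \<in> edges T \<Longrightarrow> X (prod.swap e) = - X e"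
  shows "is_weak_curl P w (\<lambda>x. c)"
  unfolding is_weak_curl_def
proof
  fix \<phi> assume \<phi>: "\<phi> \<in> test_functions P"
  have cont: "continuous_on UNIV \<phi>"
    using \<phi> test_function_smooth smooth_imp_C1 C1_continuous by blast
  let ?Y = "\<lambda>e. X e * segint \<phi> (fst e) (snd e)"
  have "(\<Sum>K\<in>T. \<Sum>e\<in>dir_edges K. tangential (nd (\<alpha> K) (\<beta> K)) e * segint \<phi> (fst e) (snd e)) = (\<Sum>K\<in>T. sum ?Y (dir_edges K))"
    by (intro sum.cong refl) (simp add: X)
  also have "\<dots> = sum ?Y {e \<in> edges T. prod.swap e \<notin> edges T}"
    by (rule sum_dir_edges) (simp_all add: anti segint_swap [OF cont])
  also have "\<dots> = 0"
  proof (rule sum.neutral, rule ballI)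
    fix e assume e: "e \<in> {e \<in> edges T. prod.swap e \<notin> edges T}"
    obtain a b where ab: "e = (a, b)"
      by (cases e)
    obtain K where K: "K \<in> T" "(a, b) \<in> dir_edges K"
      using e by (auto simp: ab edges_def)
    have "(b, a) \<notin> edges T"
      using e by (simp add: ab)
    then obtain i where "closed_segment a b \<subseteq> B"
      using unpaired_edge_polygon [OF K] by metis
    then have "linepath a b s \<notin> P" if "s \<in> {0..1}" for s
      using that linepath_in_path [of s a b] jordan(5) by auto
    then have "indicator {0..1} s * \<phi> (linepath a b s) = 0" for s :: real
      using test_function_outside [OF \<phi>] by (cases "s \<in> {0..1}") auto
    then have "segint \<phi> a b = 0"
      unfolding segint_def by (simp only: Bochner_Integration.integral_zero)
    then show "?Y e = 0"
      by (simp add: ab)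
  qed
  finally show "(LINT x|lebesgue_on P. c * \<phi> x) = (LINT x|lebesgue_on P. w x $ 1 * partial 2 \<phi> x - w x $ 2 * partial 1 \<phi> x)"
    using integral_piecewise_nd [OF w \<phi> p c] by simp
qed

text \<open>The converse: a bump around the midpoint of the edge isolates this edge in the sum of
  edge terms, leaving the jump of the tangential component times the mean of the bump over the edge,
  which is positive.\<close>

lemma piecewise_nd_tangential_continuous:
  fixes w :: "real^2 \<Rightarrow> real^2"
  assumes w: "w \<in> L2 (lebesgue_on P)"
    and p: "\<And>K. K \<in> T \<Longrightarrow> AE x in lebesgue_on (interior K). w x = nd (\<alpha> K) (\<beta> K) x"
    and c: "\<And>K. K \<in> T \<Longrightarrow> - 2 * \<beta> K = c"
    and curl: "is_weak_curl P w (\<lambda>x. c)"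
    and K: "K \<in> T" "(a, b) \<in> dir_edges K" "K' \<in> T" "(b, a) \<in> dir_edges K'"
  shows "tangential (nd (\<alpha> K') (\<beta> K')) (b, a) = - tangential (nd (\<alpha> K) (\<beta> K)) (a, b)"
proof -
  let ?m = "midpoint a b"
  have ab: "a \<noteq> b"
    using dir_edge_vertices(3) [OF K(1,2)] .
  have mid: "?m \<in> open_segment a b"
    using ab by simp
  have mP: "?m \<in> P"
    using paired_edge_interior [OF K(1,3,2,4)] mid by blast
  have other: "?m \<notin> closed_segment (fst e) (snd e)"
    if L: "L \<in> T" "e \<in> dir_edges L" and e: "e \<noteq> (a, b)" "e \<noteq> (b, a)" for L e
  proof
    assume seg: "?m \<in> closed_segment (fst e) (snd e)"
    obtain p q where pq: "e = (p, q)"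
      by (cases e)
    note v = dir_edge_vertices [OF L(1), of p q]
    have "?m \<notin> set vs"
      using mP boundary_vertices jordan(5) by blast
    then have o: "?m \<in> open_segment p q"
      using seg v L(2) by (auto simp: pq open_segment_def)
    have mK: "?m \<in> K"
      using mid dir_edge_vertices(4) [OF K(1,2)] by (auto simp: open_segment_def)
    have pqL: "(p, q) \<in> dir_edges L"
      using L(2) by (simp add: pq)
    show False
    proof (cases "L = K")
      case True
      then show False
        using dir_edges_open_disjoint [OF K(1,2) _ mid o] pqL e pq by blast
    next
      case False
      have "(q, p) \<in> dir_edges K"
        by (rule opposite_triangle [OF L(1) K(1) False pqL o mK])
      then have "(q, p) = (a, b)"
        using dir_edges_open_disjoint [OF K(1,2) _ mid, of q p] o by (simp add: open_segment_commute)
      then show False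
        using e pq by auto
    qed
  qed
  \<comment> \<open>All other edges form a closed set that misses the midpoint, so a small disc
    around it in P meets no other edge.\<close>
  let ?F = "\<Union>e\<in>edges T - {(a, b), (b, a)}. closed_segment (fst e) (snd e)"
  have "closed ?F"
    using finite_edges [OF subset_refl] by (intro closed_UN) auto
  moreover have "?m \<notin> ?F"
    using other by (auto simp: edges_def)
  ultimately have "open (P - ?F)" "?m \<in> P - ?F"
    using jordan(2) mP by auto
  then obtain r where r: "r > 0" "cball ?m r \<subseteq> P - ?F"
    using open_contains_cball by blast
  obtain \<phi> where \<phi>: "smooth \<phi>" "\<And>x. 0 \<le> \<phi> x" "\<And>x. \<phi> x \<noteq> 0 \<longleftrightarrow> x \<in> ball ?m r"
    using exists_bump [OF r(1)] by blast
  have test: "\<phi> \<in> test_functions P"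
    by (rule test_functionI [OF \<phi>(1), of "cball ?m r"]) (use \<phi>(3) r(2) ball_subset_cball in auto)
  have cont: "continuous_on UNIV \<phi>"
    using \<phi>(1) smooth_imp_C1 C1_continuous by blast
  have zero: "segint \<phi> (fst e) (snd e) = 0" if "L \<in> T" "e \<in> dir_edges L" "e \<noteq> (a, b)" "e \<noteq> (b, a)" for L e
  proof -
    have "indicator {0..1} s * \<phi> (linepath (fst e) (snd e) s) = 0" for s :: real
    proof (cases "s \<in> {0..1}")
      case True
      then have "linepath (fst e) (snd e) s \<in> closed_segment (fst e) (snd e)"
        by (metis linepath_in_path)
      then have "linepath (fst e) (snd e) s \<in> ?F"
        using that by (auto simp: edges_def)
      then have "linepath (fst e) (snd e) s \<notin> ball ?m r"
        using r(2) ball_subset_cball by blast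
      then show ?thesis
        using \<phi>(3) by auto
    qed simp
    then show ?thesis
      unfolding segint_def by (simp only: Bochner_Integration.integral_zero)
  qed
  let ?t = "\<lambda>L e. tangential (nd (\<alpha> L) (\<beta> L)) e * segint \<phi> (fst e) (snd e)"
  have KK': "K \<noteq> K'"
    using swap_not_same [OF K(1,2)] K(4) by auto
  have inner: "sum (?t L) (dir_edges L) = (if L = K then ?t K (a, b) else 0) + (if L = K' then ?t K' (b, a) else 0)"
    if L: "L \<in> T" for L
  proof -
    have iff: "(a, b) \<in> dir_edges L \<longleftrightarrow> L = K" "(b, a) \<in> dir_edges L \<longleftrightarrow> L = K'"
      using dir_edge_unique [OF L] K by blast+
    have "sum (?t L) (dir_edges L) = sum (?t L) (dir_edges L \<inter> {(a, b), (b, a)})"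
      using zero [OF L] finite_dir_edges [OF L] by (intro sum.mono_neutral_right) auto
    also have "\<dots> = (if L = K then ?t K (a, b) else 0) + (if L = K' then ?t K' (b, a) else 0)"
      using iff KK' ab by (auto simp: Int_insert_right)
    finally show ?thesis .
  qed
  have "0 = (\<Sum>L\<in>T. sum (?t L) (dir_edges L))"
    using integral_piecewise_nd [OF w test p c] curl test by (simp add: is_weak_curl_def)
  also have "\<dots> = ?t K (a, b) + ?t K' (b, a)"
    using finite_T K by (simp add: inner sum.distrib)
  also have "\<dots> = (tangential (nd (\<alpha> K) (\<beta> K)) (a, b) + tangential (nd (\<alpha> K') (\<beta> K')) (b, a)) * segint \<phi> a b"
    by (simp add: segint_swap [OF cont, of b a] distrib_right)
  finally have prod: "(tangential (nd (\<alpha> K) (\<beta> K)) (a, b) + tangential (nd (\<alpha> K') (\<beta> K')) (b, a)) * segint \<phi> a b = 0"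
    by simp
  have "segint \<phi> a b \<noteq> 0"
  proof
    assume "segint \<phi> a b = 0"
    then have "AE s in lborel. indicator {0..1} s * \<phi> (linepath a b s) = 0"
      using integral_nonneg_eq_0_iff_AE [OF continuous_segment_integrable [OF cont]] \<phi>(2)
      by (simp add: segint_def)
    then have "AE s in lebesgue. indicator {0..1} s * \<phi> (linepath a b s) = 0"
      by (rule AE_completion)
    then have N: "negligible {s. \<not> (indicator {0..1} s * \<phi> (linepath a b s) = 0)}"
      unfolding eventually_ae_filter_negligible using negligible_subset by blast
    define V where "V = {s. dist ?m (linepath a b s) < r} \<inter> {0<..<1::real}"
    have "open V"
      unfolding V_def by (intro open_Int open_Collect_less continuous_intros)
    moreover have "1/2 \<in> V"
      using r(1) by (simp add: V_def linepath_def midpoint_def scaleR_add_right)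
    moreover have "V \<subseteq> {s. \<not> (indicator {0..1} s * \<phi> (linepath a b s) = 0)}"
      using \<phi>(3) by (auto simp: V_def)
    ultimately show False
      using open_not_negligible [of V] negligible_subset [OF N] by blast
  qed
  with prod show ?thesis
    by simp
qed

end

section \<open>Existence of the interpolant\<close>

lemma is_weak_curl_mono:
  assumes v: "is_weak_curl \<omega> v w" and sub: "\<omega>' \<subseteq> \<omega>" and m: "\<omega> \<in> sets lebesgue" "\<omega>' \<in> sets lebesgue"
  shows "is_weak_curl \<omega>' v w"
  unfolding is_weak_curl_def
proof
  fix \<phi> assume \<phi>: "\<phi> \<in> test_functions \<omega>'"
  then have "\<phi> \<in> test_functions \<omega>"
    using test_functions_mono [OF sub] by blast
  then have "(LINT x|lebesgue_on \<omega>. w x * \<phi> x) = (LINT x|lebesgue_on \<omega>. v x $ 1 * partial 2 \<phi> x - v x $ 2 * partial 1 \<phi> x)"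
    using v by (simp add: is_weak_curl_def)
  moreover have "(LINT x|lebesgue_on \<omega>. w x * \<phi> x) = (LINT x|lebesgue_on \<omega>'. w x * \<phi> x)"
    by (rule LINT_lebesgue_on_subset [OF sub m(2,1)]) (simp add: test_function_outside [OF \<phi>])
  moreover have "(LINT x|lebesgue_on \<omega>. v x $ 1 * partial 2 \<phi> x - v x $ 2 * partial 1 \<phi> x)
      = (LINT x|lebesgue_on \<omega>'. v x $ 1 * partial 2 \<phi> x - v x $ 2 * partial 1 \<phi> x)"
    by (rule LINT_lebesgue_on_subset [OF sub m(2,1)]) (simp add: test_function_partial_outside [OF \<phi>])
  ultimately show "(LINT x|lebesgue_on \<omega>'. w x * \<phi> x) = (LINT x|lebesgue_on \<omega>'. v x $ 1 * partial 2 \<phi> x - v x $ 2 * partial 1 \<phi> x)"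
    by simp
qed

lemma weak_curl_nd:
  assumes \<omega>: "open \<omega>" "bounded \<omega>" and w: "w \<in> L2 (lebesgue_on \<omega>)" "AE x in lebesgue_on \<omega>. w x = nd \<alpha> \<beta> x"
  shows "is_weak_curl \<omega> w (\<lambda>x. - 2 * \<beta>)"
proof -
  have "weak_grad \<omega> (\<lambda>x. w x $ i) (\<lambda>j. partial j (\<lambda>x. nd \<alpha> \<beta> x $ i))" for i
  proof (rule weak_grad_cong_AE [OF weak_grad_C1 [OF C1_nd \<omega>] \<omega>(1)])
    show "(\<lambda>x. w x $ i) \<in> borel_measurable (lebesgue_on \<omega>)"
      using w(1) L2_vec_iff L2_measurable by blast
    show "AE x in lebesgue_on \<omega>. nd \<alpha> \<beta> x $ i = w x $ i"
      using w(2) by eventually_elim simp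
  qed
  from is_weak_curl_weak_grad [OF \<omega>(1) this] show ?thesis
    unfolding partial_nd by simp
qed

lemma AE_open_nonempty:
  fixes \<omega> :: "(real^2) set"
  assumes "open \<omega>" "\<omega> \<noteq> {}" "AE x in lebesgue_on \<omega>. Q"
  shows Q
proof (rule ccontr)
  assume "\<not> Q"
  then have "negligible \<omega>"
    using assms(1,3) AE_lebesgue_on_negligible [of \<omega> "\<lambda>_. Q"] by (simp add: borel_open)
  then show False
    using open_not_negligible assms by blast
qed

lemma L2_indicator:
  fixes f :: "'a \<Rightarrow> real"
  assumes f: "f \<in> L2 M" and A: "A \<inter> space M \<in> sets M"
  shows "(\<lambda>x. indicator A x * f x) \<in> L2 M"
  unfolding L2_real_iff
proof
  have f': "f \<in> borel_measurable M" "integrable M (\<lambda>x. (f x)\<^sup>2)"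
    using f by (auto simp: L2_real_iff)
  have "(\<lambda>x. indicator (A \<inter> space M) x * f x) \<in> borel_measurable M"
    using A f'(1) by simp
  then show m: "(\<lambda>x. indicator A x * f x) \<in> borel_measurable M"
    by (rule measurable_cong [THEN iffD1, rotated]) (simp add: indicator_def)
  show "integrable M (\<lambda>x. (indicator A x * f x)\<^sup>2)"
    by (rule Bochner_Integration.integrable_bound [OF f'(2)]) (use m in \<open>auto simp: indicator_def\<close>)
qed

lemma L2_sum:
  fixes f :: "'i \<Rightarrow> 'a \<Rightarrow> real"
  assumes "finite I" "\<And>i. i \<in> I \<Longrightarrow> f i \<in> L2 M"
  shows "(\<lambda>x. \<Sum>i\<in>I. f i x) \<in> L2 M"
  using assms
proof (induction I rule: finite_induct)
  case empty
  then show ?case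
    by (simp add: L2_real_iff)
next
  case (insert i I)
  then show ?case
    using L2_add [of "f i" M "\<lambda>x. \<Sum>i\<in>I. f i x"] by simp
qed

text \<open>A closed ball around a point of S contains S and, being convex, its hull; the argument
  is repeated with the other point. It follows that the convex hull of P has the diameter h of
  P.\<close>

lemma dist_convex_hull_le:
  fixes S :: "'a::euclidean_space set"
  assumes S: "\<And>x y. x \<in> S \<Longrightarrow> y \<in> S \<Longrightarrow> dist x y \<le> d" and xy: "x \<in> convex hull S" "y \<in> convex hull S"
  shows "dist x y \<le> d"
proof -
  have 1: "dist x y \<le> d" if "x \<in> convex hull S" "y \<in> S" for x y
  proof -
    have "S \<subseteq> cball y d"
      using S that(2) by auto
    then show ?thesis
      using hull_minimal [of S "cball y d" convex] that(1) by (auto simp: dist_commute)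
  qed
  have "S \<subseteq> cball x d"
    using 1 xy(1) by auto
  then show ?thesis
    using hull_minimal [of S "cball x d" convex] xy(2) by auto
qed

section \<open>Line integrals of u along the edges of the triangulation\<close>

locale polygon_field = triangulated_polygon +
  fixes u :: "real^2 \<Rightarrow> real^2" and G :: "2 \<Rightarrow> 2 \<Rightarrow> real^2 \<Rightarrow> real"
  assumes jac: "weak_jacobian (convex hull P) u G"
begin

abbreviation \<Omega> where "\<Omega> \<equiv> convex hull P"

definition cu :: "real^2 \<Rightarrow> real" where
  "cu x = G 2 1 x - G 1 2 x"

text \<open>The line integral of u along e. It is defined without reference to a particular
  triangle, any apex in the hull giving the same value (\<open>U_eq\<close>), so the triangles on
  the two sides of an edge see the same number up to sign.\<close>

definition U :: "(real^2) \<times> (real^2) \<Rightarrow> real" where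
  "U e = edge_flux (SOME d. orient d (fst e) (snd e) \<noteq> 0 \<and> triangle d (fst e) (snd e) \<subseteq> \<Omega>) (fst e) (snd e) u G"

lemma hull_props: "open \<Omega>" "convex \<Omega>" "bounded \<Omega>" "P \<subseteq> \<Omega>" "\<Omega> \<noteq> {}"
  using jordan by (auto simp: open_convex_hull bounded_convex_hull hull_subset hull_inc)

lemma P_sets: "P \<in> sets borel" "P \<in> sets lebesgue" "\<Omega> \<in> sets lebesgue"
  using jordan(2) hull_props(1) by (auto simp: borel_open)

lemma interior_K_sets: "interior K \<in> sets borel" "interior K \<in> sets lebesgue"
  by (auto simp: borel_open)

lemma finite_P: "finite_measure (lebesgue_on P)"
  by (rule finite_measure_lebesgue_on [OF jordan(4) P_sets(2)])

lemma interior_K_\<Omega>: "K \<in> T \<Longrightarrow> interior K \<subseteq> \<Omega>"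
  using interior_K_subset hull_props(4) by blast

lemma jac_mono: "open \<omega> \<Longrightarrow> \<omega> \<subseteq> \<Omega> \<Longrightarrow> weak_jacobian \<omega> u G"
  using jac weak_grad_mono hull_props(1) unfolding weak_jacobian_def by blast

lemma jac_L2:
  assumes "open \<omega>" "\<omega> \<subseteq> \<Omega>"
  shows "(\<lambda>x. u x $ i) \<in> L2 (lebesgue_on \<omega>)" "G i j \<in> L2 (lebesgue_on \<omega>)"
proof -
  have "weak_grad \<omega> (\<lambda>x. u x $ i) (G i)"
    using jac_mono [OF assms] by (simp add: weak_jacobian_def)
  then show "(\<lambda>x. u x $ i) \<in> L2 (lebesgue_on \<omega>)" "G i j \<in> L2 (lebesgue_on \<omega>)"
    by (rule weak_gradD)+
qed

lemma cu_L2: "open \<omega> \<Longrightarrow> \<omega> \<subseteq> \<Omega> \<Longrightarrow> cu \<in> L2 (lebesgue_on \<omega>)"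
  unfolding cu_def [abs_def] by (intro L2_diff jac_L2)

lemma cu_weak_curl: "open \<omega> \<Longrightarrow> \<omega> \<subseteq> \<Omega> \<Longrightarrow> is_weak_curl \<omega> u cu"
  unfolding cu_def [abs_def] using jac_mono by (intro is_weak_curl_weak_grad) (auto simp: weak_jacobian_def)

lemma cu_integrable: "integrable (lebesgue_on P) cu"
  by (rule L2_integrable [OF finite_P cu_L2 [OF jordan(2) hull_props(4)]])

lemma U_eq:
  assumes "orient d a b \<noteq> 0" "triangle d a b \<subseteq> \<Omega>"
  shows "U (a, b) = edge_flux d a b u G"
proof -
  let ?Q = "\<lambda>d. orient d a b \<noteq> 0 \<and> triangle d a b \<subseteq> \<Omega>"
  have "?Q (SOME d. ?Q d)"
    using assms by (intro someI [of ?Q d]) simp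
  then have "edge_flux (SOME d. ?Q d) a b u G = edge_flux d a b u G"
    using edge_flux_opposite_vertex [OF hull_props(1-3) jac] assms by blast
  then show ?thesis
    by (simp add: U_def)
qed

lemma dir_edge_opposite:
  assumes K: "K \<in> T" and e: "(a, b) \<in> dir_edges K \<or> (b, a) \<in> dir_edges K"
  obtains d where "orient d a b \<noteq> 0" "triangle d a b = interior K"
  using e
proof
  assume "(a, b) \<in> dir_edges K"
  then obtain c where c: "orient a b c > 0" "K = convex hull {a, b, c}"
    by (rule dir_edgesE)
  have "triangle c a b = interior K"
    unfolding interior_eq_triangle [OF c(2)] by (rule triangle_perm(1))
  then show thesis
    using that [of c] c(1) by (simp add: orient_cycle)
next
  assume "(b, a) \<in> dir_edges K"
  then obtain c where c: "orient b a c > 0" "K = convex hull {b, a, c}"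
    by (rule dir_edgesE)
  have "triangle c a b = triangle a b c"
    by (rule triangle_perm(1))
  also have "\<dots> = interior K"
    unfolding interior_eq_triangle [OF c(2)] by (rule triangle_perm(2))
  finally show thesis
    using that [of c] c(1) orient_swap(1) [of a b c] by (simp add: orient_cycle)
qed

lemma U_swap:
  assumes "e \<in> edges T"
  shows "U (prod.swap e) = - U e"
proof -
  obtain a b where ab: "e = (a, b)"
    by (cases e)
  with assms obtain K where K: "K \<in> T" "(a, b) \<in> dir_edges K"
    by (auto simp: edges_def)
  obtain d where d: "orient d a b \<noteq> 0" "triangle d a b = interior K"
    by (rule dir_edge_opposite [OF K(1) disjI1 [OF K(2)]])
  have sub: "triangle d a b \<subseteq> \<Omega>" "triangle d b a \<subseteq> \<Omega>"
    using interior_K_\<Omega> [OF K(1)] d(2) triangle_perm(3) [of d a b] by auto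
  have "orient d b a \<noteq> 0"
    using d(1) orient_swap(2) [of d a b] by simp
  then show ?thesis
    using U_eq [OF d(1) sub(1)] U_eq [OF _ sub(2)] edge_flux_swap [of d b a u G] by (simp add: ab)
qed

lemma U_stokes:
  assumes K: "K \<in> T"
  shows "sum U (dir_edges K) = (LINT x|lebesgue_on (interior K). cu x)"
proof -
  obtain a b c where D: "orient a b c > 0" "K = convex hull {a, b, c}" "dir_edges K = {(a, b), (b, c), (c, a)}"
    using K by (rule triangleE)
  have i: "interior K = triangle a b c" "triangle a b c = triangle b c a" "triangle c a b = triangle a b c"
    by (rule interior_eq_triangle [OF D(2)] triangle_perm(1))+
  have sub: "triangle a b c \<subseteq> \<Omega>" "triangle b c a \<subseteq> \<Omega>" "triangle c a b \<subseteq> \<Omega>"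
    using interior_K_\<Omega> [OF K] i by simp_all
  have o: "orient a b c \<noteq> 0" "orient b c a \<noteq> 0" "orient c a b \<noteq> 0"
    using D(1) by (simp_all add: orient_cycle)
  have "sum U (dir_edges K) = edge_flux c a b u G + edge_flux a b c u G + edge_flux b c a u G"
    unfolding dir_edges_sum3 [OF D(1,3)]
    using U_eq [OF o(1) sub(1)] U_eq [OF o(2) sub(2)] U_eq [OF o(3) sub(3)] by simp
  also have "\<dots> = (LINT x|lebesgue_on (triangle a b c). G 2 1 x - G 1 2 x)"
    using stokes_triangle [OF o(1) jac_mono [OF open_triangle sub(1)]] D(1) by simp
  finally show ?thesis
    by (simp add: cu_def i(1))
qed

text \<open>The interpolation conditions, stated with traces from a triangle and from P, become
  equations between \<open>tangential\<close> and \<open>U\<close>.\<close>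

lemma edge_integrals:
  fixes w :: "real^2 \<Rightarrow> real^2"
  assumes K: "K \<in> T" and i: "i < length vs" "polygon_edge vs i \<subseteq> K"
    and w: "w \<in> L2 (lebesgue_on (interior K))" "AE x in lebesgue_on (interior K). w x = nd \<alpha> \<beta> x"
  shows "edge_integral (interior K) w (vs ! i) (next_vertex vs i) = tangential (nd \<alpha> \<beta>) (vs ! i, next_vertex vs i)"
    and "edge_integral P u (vs ! i) (next_vertex vs i) = U (vs ! i, next_vertex vs i)"
proof -
  let ?a = "vs ! i" and ?b = "next_vertex vs i"
  obtain d where d: "orient d ?a ?b \<noteq> 0" "triangle d ?a ?b = interior K"
    by (rule dir_edge_opposite [OF K polygon_edge_dir_edge [OF K i]])
  have "edge_integral (triangle d ?a ?b) w ?a ?b = segint (\<lambda>x. nd \<alpha> \<beta> x \<bullet> (?b - ?a)) ?a ?b"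
    by (rule edge_integral_cong_smooth [OF d(1) _ smooth_nd]) (simp_all only: d(2) w(2) L2_measurable [OF w(1)])
  then show "edge_integral (interior K) w ?a ?b = tangential (nd \<alpha> \<beta>) (?a, ?b)"
    by (simp add: d(2) segint_nd tangential_def)
  have "edge_integral P u ?a ?b = edge_flux d ?a ?b u G"
    by (rule edge_integral_convex [OF hull_props(1-3) jac jordan(2) hull_props(4) _ d(1)])
       (use d(2) interior_K_subset [OF K] in simp)
  also have "\<dots> = U (?a, ?b)"
    using U_eq [OF d(1)] d(2) interior_K_\<Omega> [OF K] by simp
  finally show "edge_integral P u ?a ?b = U (?a, ?b)" .
qed

lemma AE_interior_iff:
  assumes K: "K \<in> T"
  shows "(AE x in lebesgue_on K. Q x) \<longleftrightarrow> (AE x in lebesgue_on (interior K). Q x)"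
proof -
  have KL: "K \<in> sets lebesgue"
    using closed_K [OF K] by (simp add: borel_closed)
  have "negligible {x \<in> K. \<not> Q x} \<longleftrightarrow> negligible {x \<in> interior K. \<not> Q x}"
  proof
    assume "negligible {x \<in> K. \<not> Q x}"
    then show "negligible {x \<in> interior K. \<not> Q x}"
      by (rule negligible_subset) (use interior_subset in blast)
  next
    assume "negligible {x \<in> interior K. \<not> Q x}"
    then have "negligible ({x \<in> interior K. \<not> Q x} \<union> (K - interior K))"
      using negligible_frontier_interior_K [OF convex_K [OF K]] by (rule negligible_Un)
    then show "negligible {x \<in> K. \<not> Q x}"
      by (rule negligible_subset) blast
  qed
  then show ?thesis
    by (simp add: AE_lebesgue_on_negligible KL interior_K_sets)
qed

lemma exists_piecewise_nd:
  obtains w :: "real^2 \<Rightarrow> real^2" where "w \<in> L2 (lebesgue_on P)"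
    "\<And>K x. K \<in> T \<Longrightarrow> x \<in> interior K \<Longrightarrow> w x = nd (\<alpha> K) (\<beta> K) x"
proof
  let ?w = "\<lambda>x. \<Sum>K\<in>T. indicator (interior K) x *\<^sub>R nd (\<alpha> K) (\<beta> K) x"
  show "?w \<in> L2 (lebesgue_on P)"
  proof (subst L2_vec_iff, rule allI)
    fix i :: 2
    have "(\<lambda>x. \<Sum>K\<in>T. indicator (interior K) x * nd (\<alpha> K) (\<beta> K) x $ i) \<in> L2 (lebesgue_on P)"
    proof (rule L2_sum [OF finite_T])
      fix K
      show "(\<lambda>x. indicator (interior K) x * nd (\<alpha> K) (\<beta> K) x $ i) \<in> L2 (lebesgue_on P)"
        by (rule L2_indicator [OF bounded_continuous_L2 [OF jordan(4) P_sets(1) C1_continuous [OF C1_nd]]])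
           (auto simp: sets_restrict_space interior_K_sets intro!: image_eqI [of _ _ "interior K"])
    qed
    then show "(\<lambda>x. ?w x $ i) \<in> L2 (lebesgue_on P)"
      by simp
  qed
  fix K x assume K: "K \<in> T" and x: "x \<in> interior K"
  have "x \<notin> interior K'" if "K' \<in> T" "K' \<noteq> K" for K'
    using interior_Int_K [OF K that(1)] that(2) x interior_subset by blast
  then have "?w x = (\<Sum>K'\<in>T. if K' = K then nd (\<alpha> K) (\<beta> K) x else 0)"
    using x by (intro sum.cong refl) (auto simp: indicator_def)
  then show "?w x = nd (\<alpha> K) (\<beta> K) x"
    using K finite_T by simp
qed

lemma measure_interior_pos:
  assumes K: "K \<in> T"
  shows "0 < measure lebesgue (interior K)"
proof -
  obtain a b c where D: "orient a b c > 0" "K = convex hull {a, b, c}"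
    using K by (rule triangleE)
  show ?thesis
    unfolding measure_interior_K [OF K D] using D(1) by simp
qed

lemma LINT_const: "S \<in> sets lebesgue \<Longrightarrow> (LINT x|lebesgue_on S. c) = c * measure lebesgue S"
  by (simp add: measure_restrict_space)

lemma interior_measure_sum: "(\<Sum>K\<in>T. measure lebesgue (interior K)) = measure lebesgue P"
  using integral_P [of "\<lambda>_. 1"] finite_measure.integrable_const [OF finite_P, of "1::real"]
  by (simp only: LINT_const P_sets interior_K_sets mult_1)

lemma measure_P_pos: "0 < measure lebesgue P"
proof -
  have "T \<noteq> {}"
    using union_T jordan(1) by auto
  then show ?thesis
    unfolding interior_measure_sum [symmetric] using finite_T measure_interior_pos by (intro sum_pos) auto
qed

text \<open>The curl c has to be the mean of curl u. The line integrals of u are corrected by a flow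
  \<delta> on interior edges so that each triangle gets circulation c times its area. Since \<delta>
  vanishes on boundary edges the interpolation conditions hold; since it is antisymmetric the pieces
  fit tangentially and have weak curl c on P.\<close>

theorem exists_interpolant: "\<exists>w. is_interpolant vs T u w"
proof -
  define c where "c = (LINT x|lebesgue_on P. cu x) / measure lebesgue P"
  \<comment> \<open>The circulation missing on K; the total vanishes by the choice of c.\<close>
  define b where "b K = c * measure lebesgue (interior K) - (LINT x|lebesgue_on (interior K). cu x)" for K
  have "(\<Sum>K\<in>T. b K) = c * measure lebesgue P - (LINT x|lebesgue_on P. cu x)"
    unfolding b_def sum_subtractf integral_P [OF cu_integrable] sum_distrib_left [symmetric] interior_measure_sum ..
  also have "\<dots> = 0"
    using measure_P_pos by (simp add: c_def)
  finally have b0: "(\<Sum>K\<in>T. b K) = 0" .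
  obtain \<delta> :: "(real^2) \<times> (real^2) \<Rightarrow> real" where \<delta>: "\<And>e. \<delta> (prod.swap e) = - \<delta> e"
    "\<And>e. e \<in> edges T \<Longrightarrow> prod.swap e \<notin> edges T \<Longrightarrow> \<delta> e = 0" "\<And>K. K \<in> T \<Longrightarrow> sum \<delta> (dir_edges K) = b K"
    using exists_flow [OF b0] by blast
  define X where "X e = U e + \<delta> e" for e
  have "\<forall>K\<in>T. \<exists>p. \<forall>e\<in>dir_edges K. tangential (nd (fst p) (snd p)) e = X e"
  proof
    fix K assume "K \<in> T"
    then obtain a b c where D: "orient a b c > 0" "K = convex hull {a, b, c}" "dir_edges K = {(a, b), (b, c), (c, a)}"
      by (rule triangleE)
    obtain \<alpha> \<beta> where "nd \<alpha> \<beta> a \<bullet> (b - a) = X (a, b)" "nd \<alpha> \<beta> b \<bullet> (c - b) = X (b, c)" "nd \<alpha> \<beta> c \<bullet> (a - c) = X (c, a)"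
      using nd_exists [of a b c] D(1) by (metis less_irrefl)
    then have "\<forall>e\<in>dir_edges K. tangential (nd (fst (\<alpha>, \<beta>)) (snd (\<alpha>, \<beta>))) e = X e"
      by (simp add: D(3) tangential_def)
    then show "\<exists>p. \<forall>e\<in>dir_edges K. tangential (nd (fst p) (snd p)) e = X e"
      by (rule exI)
  qed
  from bchoice [OF this] obtain p where p: "\<And>K e. K \<in> T \<Longrightarrow> e \<in> dir_edges K \<Longrightarrow> tangential (nd (fst (p K)) (snd (p K))) e = X e"
    by blast
  define \<alpha> \<beta> where "\<alpha> K = fst (p K)" and "\<beta> K = snd (p K)" for K
  have X: "tangential (nd (\<alpha> K) (\<beta> K)) e = X e" if "K \<in> T" "e \<in> dir_edges K" for K e
    using p [OF that] by (simp add: \<alpha>_def \<beta>_def)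
  \<comment> \<open>The curl of a piece is its circulation divided by the area, which the correction
    has made equal to c on every triangle.\<close>
  have \<beta>: "- 2 * \<beta> K = c" if K: "K \<in> T" for K
  proof -
    have "- 2 * \<beta> K * measure lebesgue (interior K) = sum X (dir_edges K)"
      unfolding sum_tangential_nd [OF K, of "\<alpha> K", symmetric] by (rule sum.cong [OF refl X [OF K]])
    also have "\<dots> = c * measure lebesgue (interior K)"
      unfolding X_def sum.distrib U_stokes [OF K] \<delta>(3) [OF K] b_def by simp
    finally show ?thesis
      using measure_interior_pos [OF K] by (metis less_irrefl mult_right_cancel)
  qed
  obtain w where w: "w \<in> L2 (lebesgue_on P)" "\<And>K x. K \<in> T \<Longrightarrow> x \<in> interior K \<Longrightarrow> w x = nd (\<alpha> K) (\<beta> K) x"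
    using exists_piecewise_nd [where \<alpha> = \<alpha> and \<beta> = \<beta>] by blast
  have AE: "AE x in lebesgue_on (interior K). w x = nd (\<alpha> K) (\<beta> K) x" if "K \<in> T" for K
    using w(2) [OF that] by (intro AE_I2) simp
  have curl: "is_weak_curl P w (\<lambda>x. c)"
    by (rule piecewise_nd_weak_curl [OF w(1) AE \<beta> X]) (simp_all add: X_def U_swap \<delta>(1))
  have ND: "\<exists>q\<in>ND. AE x in lebesgue_on K. w x = q x" if K: "K \<in> T" for K
    using AE [OF K] AE_interior_iff [OF K] ND_iff by blast
  have "w \<in> Vh vs T"
    using w(1) curl L2_const [OF finite_P] ND by (auto simp: Vh_def Hcurl_def)
  moreover have "edge_integral (interior K) w (vs ! i) (next_vertex vs i) = edge_integral P u (vs ! i) (next_vertex vs i)"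
    if i: "i < length vs" and K: "K \<in> T" "polygon_edge vs i \<subseteq> K" for i K
  proof -
    let ?a = "vs ! i" and ?b = "next_vertex vs i"
    have wK: "w \<in> L2 (lebesgue_on (interior K))"
      using w(1) L2_lebesgue_on_mono(1) [OF _ interior_K_subset [OF K(1)] interior_K_sets(2) P_sets(2)]
        L2_vec_iff by blast
    have unp: "(q, p) \<notin> edges T" if "(p, q) \<in> dir_edges K" "closed_segment p q = polygon_edge vs i" for p q
      using polygon_edge_not_paired [OF K(1) _ that(1) _ i] that(2) by (auto simp: edges_def)
    have "tangential (nd (\<alpha> K) (\<beta> K)) (?a, ?b) = U (?a, ?b)"
      using polygon_edge_dir_edge [OF K(1) i K(2)]
    proof
      assume e: "(?a, ?b) \<in> dir_edges K"
      then have "(?b, ?a) \<notin> edges T"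
        by (rule unp) (simp add: polygon_edge_def)
      moreover have "(?a, ?b) \<in> edges T"
        using e K(1) by (auto simp: edges_def)
      ultimately show ?thesis
        using X [OF K(1) e] \<delta>(2) [of "(?a, ?b)"] by (simp add: X_def)
    next
      assume e: "(?b, ?a) \<in> dir_edges K"
      then have "(?a, ?b) \<notin> edges T"
        by (rule unp) (simp add: polygon_edge_def closed_segment_commute)
      moreover have eT: "(?b, ?a) \<in> edges T"
        using e K(1) by (auto simp: edges_def)
      ultimately have "tangential (nd (\<alpha> K) (\<beta> K)) (?b, ?a) = U (?b, ?a)"
        using X [OF K(1) e] \<delta>(2) [of "(?b, ?a)"] by (simp add: X_def)
      then show ?thesis
        using tangential_nd_swap [of "\<alpha> K" "\<beta> K" "(?b, ?a)"] U_swap [OF eT] by simp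
    qed
    then show ?thesis
      using edge_integrals [OF K(1) i K(2) wK AE [OF K(1)]] by simp
  qed
  ultimately show ?thesis
    unfolding is_interpolant_def by blast
qed

end

section \<open>The interpolation error\<close>

lemma L2_sq_integrable: "f \<in> L2 M \<Longrightarrow> integrable M (\<lambda>x. (f x)\<^sup>2)" for f :: "'a \<Rightarrow> real"
  by (simp add: L2_real_iff)

lemma edge_mean_lincomb:
  assumes f: "weak_grad (triangle d a b) f F" and g: "weak_grad (triangle d a b) g G"
  shows "edge_mean d a b (\<lambda>x. r * f x + s * g x) (\<lambda>i x. r * F i x + s * G i x)
    = r * edge_mean d a b f F + s * edge_mean d a b g G"
proof -
  let ?M = "lebesgue_on (triangle d a b)"
  have i: "integrable ?M f" "integrable ?M g"
    "integrable ?M (\<lambda>x. F j x * (x $ j - d $ j))" "integrable ?M (\<lambda>x. G j x * (x $ j - d $ j))" for j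
    using weak_gradD [OF f] weak_gradD [OF g]
    by (auto intro: L2_integrable L2_mult_integrable L2_triangle_coord)
  have "(LINT x|?M. (r * F j x + s * G j x) * (x $ j - d $ j))
      = r * (LINT x|?M. F j x * (x $ j - d $ j)) + s * (LINT x|?M. G j x * (x $ j - d $ j))" for j
  proof -
    have "(LINT x|?M. (r * F j x + s * G j x) * (x $ j - d $ j))
        = (LINT x|?M. r * (F j x * (x $ j - d $ j)) + s * (G j x * (x $ j - d $ j)))"
      by (rule Bochner_Integration.integral_cong) (simp_all add: algebra_simps)
    then show ?thesis
      using i(3,4) by simp
  qed
  moreover have "(LINT x|?M. r * f x + s * g x) = r * (LINT x|?M. f x) + s * (LINT x|?M. g x)"
    using i(1,2) by simp
  ultimately show ?thesis
    by (simp add: edge_mean_def add_divide_distrib algebra_simps)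
qed

text \<open>With k the cosine of the angle between s and t, the identity (1 - k^2) |v|^2 = p^2 + q^2
  - 2 k p q holds in the plane. Its right-hand side is at most (1 + |k|) (p^2 + q^2), and the factor
  1 + |k| cancels.\<close>

lemma inner_two_directions:
  fixes v s t :: "real^2"
  assumes s: "norm s = 1" and t: "norm t = 1"
  shows "(1 - \<bar>s \<bullet> t\<bar>) * (norm v)\<^sup>2 \<le> (v \<bullet> s)\<^sup>2 + (v \<bullet> t)\<^sup>2"
proof -
  define k p q where kpq: "k = s \<bullet> t" "p = v \<bullet> s" "q = v \<bullet> t"
  have st: "(s $ 1)\<^sup>2 + (s $ 2)\<^sup>2 = 1" "(t $ 1)\<^sup>2 + (t $ 2)\<^sup>2 = 1"
    using s t by (simp_all add: norm_vec_def L2_set_def sum_2)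
  have v: "(norm v)\<^sup>2 = (v $ 1)\<^sup>2 + (v $ 2)\<^sup>2"
    by (simp add: norm_vec_def L2_set_def sum_2)
  have "(1 - k\<^sup>2) * (norm v)\<^sup>2 = p\<^sup>2 + q\<^sup>2 - 2 * k * p * q"
    using st unfolding v kpq inner_vec_def sum_2 inner_real_def by algebra
  also have "\<dots> \<le> (1 + \<bar>k\<bar>) * (p\<^sup>2 + q\<^sup>2)"
  proof -
    have "- (k * (2 * p * q)) \<le> \<bar>k\<bar> * \<bar>2 * p * q\<bar>"
      by (metis abs_ge_minus_self abs_mult)
    also have "\<dots> \<le> \<bar>k\<bar> * (p\<^sup>2 + q\<^sup>2)"
    proof (rule mult_left_mono)
      show "\<bar>2 * p * q\<bar> \<le> p\<^sup>2 + q\<^sup>2"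
        using sum_squares_bound [of "\<bar>p\<bar>" "\<bar>q\<bar>"] by (simp add: abs_mult)
    qed simp
    finally show ?thesis
      by (simp add: algebra_simps)
  qed
  finally have "(1 + \<bar>k\<bar>) * ((1 - \<bar>k\<bar>) * (norm v)\<^sup>2) \<le> (1 + \<bar>k\<bar>) * (p\<^sup>2 + q\<^sup>2)"
    by (simp add: algebra_simps power2_eq_square)
  then show ?thesis
    unfolding kpq by (rule mult_left_le_imp_le) linarith
qed

lemma vertex_opposite_longest_edge:
  assumes D: "orient a b c > 0"
  obtains d p q where "orient d p q > 0" "convex hull {d, p, q} = convex hull {a, b, c}"
    "norm (p - d) \<le> norm (q - p)" "norm (q - d) \<le> norm (q - p)"
proof -
  have perm: "{b, c, a} = {a, b, c}" "{c, a, b} = {a, b, c}"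
    by auto
  consider "norm (b - a) \<le> norm (c - b)" "norm (c - a) \<le> norm (c - b)"
    | "norm (c - b) \<le> norm (a - c)" "norm (a - b) \<le> norm (a - c)"
    | "norm (a - c) \<le> norm (b - a)" "norm (b - c) \<le> norm (b - a)"
    using norm_minus_commute [of a b] norm_minus_commute [of b c] norm_minus_commute [of a c] by linarith
  then show thesis
  proof cases
    case 1
    then show thesis
      using that [of a b c] D by simp
  next
    case 2
    then show thesis
      using that [of b c a] D perm(1) by (simp add: orient_cycle)
  next
    case 3
    then show thesis
      using that [of c a b] D perm(2) by (simp add: orient_cycle)
  qed
qed

text \<open>The law of cosines bounds twice the inner product by the square of each adjacent side,
  and the smaller of these squares is at most the product of the two lengths.\<close>

lemma cos_opposite_longest_edge:
  fixes d p q :: "'a::real_inner"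
  assumes "p \<noteq> d" "q \<noteq> d" "norm (p - d) \<le> norm (q - p)" "norm (q - d) \<le> norm (q - p)"
  shows "((p - d) \<bullet> (q - d)) / (norm (p - d) * norm (q - d)) \<le> 1 / 2"
proof -
  define x y where xy: "x = p - d" "y = q - d"
  have le: "norm x \<le> norm (y - x)" "norm y \<le> norm (y - x)" and pos: "0 < norm x" "0 < norm y"
    using assms by (simp_all add: xy)
  have "(norm (y - x))\<^sup>2 = (norm y)\<^sup>2 + (norm x)\<^sup>2 - 2 * (x \<bullet> y)"
    by (simp add: power2_norm_eq_inner inner_diff inner_commute)
  moreover have "(norm x)\<^sup>2 \<le> (norm (y - x))\<^sup>2" "(norm y)\<^sup>2 \<le> (norm (y - x))\<^sup>2"
    using le by (auto intro: power_mono)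
  ultimately have "2 * (x \<bullet> y) \<le> (norm x)\<^sup>2" "2 * (x \<bullet> y) \<le> (norm y)\<^sup>2"
    by linarith+
  moreover have "(norm x)\<^sup>2 \<le> norm x * norm y \<or> (norm y)\<^sup>2 \<le> norm x * norm y"
    using pos by (cases "norm x \<le> norm y") (auto simp: power2_eq_square)
  ultimately have "2 * (x \<bullet> y) \<le> norm x * norm y"
    by linarith
  then show ?thesis
    using pos by (simp add: xy divide_simps mult.commute)
qed

text \<open>
  The angle opposite the longest edge is at least 60 degrees, so \<open>1/2\<close> bounds its cosine from above
  whatever the shape of the triangle, while the maximum angle bounds it from below.
\<close>

lemma cos_bound_opposite_longest_edge:
  fixes d p q :: "real^2"
  assumes ne: "p \<noteq> d" "q \<noteq> d" and le: "norm (p - d) \<le> norm (q - p)" "norm (q - d) \<le> norm (q - p)"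
    and \<theta>: "angle_at d p q \<le> \<theta>" "\<theta> < pi"
  defines "\<kappa> \<equiv> max (1 / 2) (- cos \<theta>)"
  shows "\<bar>((p - d) /\<^sub>R norm (p - d)) \<bullet> ((d - q) /\<^sub>R norm (d - q))\<bar> \<le> \<kappa>" "\<kappa> < 1"
proof -
  let ?x = "((p - d) \<bullet> (q - d)) / (norm (p - d) * norm (q - d))"
  have "\<bar>(p - d) \<bullet> (q - d)\<bar> \<le> norm (p - d) * norm (q - d)"
    by (rule Cauchy_Schwarz_ineq2)
  then have abs: "\<bar>?x\<bar> \<le> 1"
    using ne by (simp add: abs_mult divide_simps)
  have xb: "- 1 \<le> ?x" "?x \<le> 1"
    using abs unfolding abs_le_iff by linarith+
  have th: "arccos ?x \<le> \<theta>"
    using \<theta>(1) by (simp add: angle_at_def)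
  have nonneg: "0 \<le> arccos ?x"
    by (rule arccos_lbound [OF xb])
  have "cos \<theta> \<le> cos (arccos ?x)"
    using nonneg th \<theta>(2) by (intro cos_monotone_0_pi_le) auto
  then have lower: "cos \<theta> \<le> ?x"
    by (simp only: cos_arccos [OF xb])
  have upper: "?x \<le> 1 / 2"
    by (rule cos_opposite_longest_edge [OF ne le])
  have eq: "((p - d) /\<^sub>R norm (p - d)) \<bullet> ((d - q) /\<^sub>R norm (d - q)) = - ?x"
    using inner_minus_right [of "p - d" "q - d"] by (simp add: norm_minus_commute [of d q] divide_simps)
  show "\<bar>((p - d) /\<^sub>R norm (p - d)) \<bullet> ((d - q) /\<^sub>R norm (d - q))\<bar> \<le> \<kappa>"
    unfolding eq abs_minus_cancel \<kappa>_def abs_le_iff le_max_iff_disj using lower upper by linarith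
  have "cos pi < cos \<theta>"
    using nonneg th \<theta>(2) by (intro cos_monotone_0_pi) auto
  then show "\<kappa> < 1"
    by (simp add: \<kappa>_def)
qed

text \<open>Pythagoras: f - c has mean zero and is thus orthogonal to the constant c - m.\<close>

lemma LINT_square_shift:
  fixes f :: "'a \<Rightarrow> real"
  assumes M: "finite_measure M" and f: "f \<in> L2 M" and c: "(LINT x|M. f x - c) = 0"
  shows "(LINT x|M. (f x - m)\<^sup>2) = (LINT x|M. (f x - c)\<^sup>2) + (c - m)\<^sup>2 * measure M (space M)"
proof -
  have d: "(\<lambda>x. f x - c) \<in> L2 M"
    by (intro L2_diff f L2_const M)
  have i: "integrable M (\<lambda>x. (f x - c)\<^sup>2)" "integrable M (\<lambda>x. f x - c)"
    by (rule L2_sq_integrable [OF d] L2_integrable [OF M d])+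
  have "(LINT x|M. (f x - m)\<^sup>2) = (LINT x|M. ((f x - c)\<^sup>2 + 2 * (c - m) * (f x - c)) + (c - m)\<^sup>2)"
    by (rule Bochner_Integration.integral_cong) (auto simp: power2_eq_square algebra_simps)
  also have "\<dots> = (LINT x|M. (f x - c)\<^sup>2 + 2 * (c - m) * (f x - c)) + (LINT x|M. (c - m)\<^sup>2)"
    by (intro Bochner_Integration.integral_add Bochner_Integration.integrable_add i integrable_mult_right
        finite_measure.integrable_const M)
  also have "(LINT x|M. (f x - c)\<^sup>2 + 2 * (c - m) * (f x - c)) = (LINT x|M. (f x - c)\<^sup>2) + (LINT x|M. 2 * (c - m) * (f x - c))"
    by (intro Bochner_Integration.integral_add i integrable_mult_right)
  also have "(LINT x|M. 2 * (c - m) * (f x - c)) = 0"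
    unfolding Bochner_Integration.integral_mult_right_zero c by simp
  finally show ?thesis
    by (simp add: mult.commute)
qed

lemma sum_squares_lincomb_le: "(r * x + s * y)\<^sup>2 \<le> (r\<^sup>2 + s\<^sup>2) * (x\<^sup>2 + y\<^sup>2)" for r s x y :: real
proof -
  have "(r\<^sup>2 + s\<^sup>2) * (x\<^sup>2 + y\<^sup>2) - (r * x + s * y)\<^sup>2 = (r * y - s * x)\<^sup>2"
    by (simp add: power2_eq_square algebra_simps)
  then show ?thesis
    using zero_le_power2 [of "r * y - s * x"] by linarith
qed

lemma square_sum_le: "(x + y)\<^sup>2 \<le> 2 * x\<^sup>2 + 2 * y\<^sup>2" for x y :: real
  using sum_squares_lincomb_le [of 1 x 1 y] by simp

lemma norm_nd_diff: "norm (nd \<alpha> \<beta> d - nd \<alpha> \<beta> x) = \<bar>\<beta>\<bar> * dist x d"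
proof -
  have "nd \<alpha> \<beta> d - nd \<alpha> \<beta> x = (- \<beta>) *\<^sub>R vector [x $ 2 - d $ 2, - (x $ 1 - d $ 1)]"
    by (simp add: vec_eq_iff forall_2 algebra_simps)
  moreover have "norm (vector [x $ 2 - d $ 2, - (x $ 1 - d $ 1)] :: real^2) = dist x d"
    by (simp add: dist_norm norm_vec_def L2_set_def sum_2 add.commute power2_commute)
  ultimately show ?thesis
    by simp
qed

section \<open>Diameter, area and lengths of interior edges\<close>

context triangulated_polygon
begin

abbreviation h where "h \<equiv> diameter P"

lemma dist_le_h: "x \<in> closure P \<Longrightarrow> y \<in> closure P \<Longrightarrow> dist x y \<le> h"
  using diameter_bounded_bound [OF bounded_closure [OF jordan(4)], of x y] diameter_closure [OF jordan(4)] by simp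

lemma K_subset_closure: "K \<in> T \<Longrightarrow> K \<subseteq> closure P"
  using union_T jordan(6) by auto

lemma dist_hull_le_h: "x \<in> convex hull P \<Longrightarrow> y \<in> convex hull P \<Longrightarrow> dist x y \<le> h"
  by (rule dist_convex_hull_le [OF diameter_bounded_bound [OF jordan(4)]])

lemma h_pos: "0 < h"
proof -
  obtain x r where x: "r > 0" "cball x r \<subseteq> P"
    using jordan(1,2) open_contains_cball by blast
  have "x + r *\<^sub>R axis 1 1 \<in> P" "x \<in> P"
    using x by (auto simp: dist_norm norm_axis_1 subset_iff)
  then have "dist (x + r *\<^sub>R axis 1 1) x \<le> h"
    by (rule diameter_bounded_bound [OF jordan(4)])
  then show ?thesis
    using x(1) by (simp add: dist_norm norm_axis_1)
qed

text \<open>P lies in the square of side 2 h centred at any of its points.\<close>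

lemma measure_P_le: "measure lebesgue P \<le> 4 * h\<^sup>2"
proof -
  obtain x where x: "x \<in> P"
    using jordan(1) by blast
  let ?a = "\<chi> i. x $ i - h" and ?b = "\<chi> i. x $ i + h"
  have "P \<subseteq> cbox ?a ?b"
  proof
    fix y assume "y \<in> P"
    then have "norm (y - x) \<le> h"
      using diameter_bounded_bound [OF jordan(4) _ x] by (simp add: dist_norm)
    then have "\<bar>y $ i - x $ i\<bar> \<le> h" for i
      using component_le_norm_cart [of "y - x" i] by simp
    then show "y \<in> cbox ?a ?b"
      by (simp add: mem_box_cart abs_le_iff) (smt (verit))
  qed
  then have "measure lebesgue P \<le> measure lebesgue (cbox ?a ?b)"
    using jordan(2) by (intro measure_mono_fmeasurable) (auto simp: borel_open)
  also have "cbox ?a ?b \<noteq> {}"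
    using x \<open>P \<subseteq> cbox ?a ?b\<close> by blast
  then have "measure lebesgue (cbox ?a ?b) = 4 * h\<^sup>2"
    by (simp add: content_cbox_cart UNIV_2 power2_eq_square)
  finally show ?thesis .
qed

lemma edge_length:
  assumes C': "no_short_interior_edges C' vs T" and K: "K \<in> T" "(a, b) \<in> dir_edges K" "(b, a) \<in> edges T"
  shows "h \<le> C' * norm (b - a)"
proof -
  obtain K' where K': "K' \<in> T" "(b, a) \<in> dir_edges K'"
    using K(3) by (auto simp: edges_def)
  obtain c where c: "orient a b c > 0" "K = convex hull {a, b, c}"
    using K(2) by (rule dir_edgesE)
  have ab: "a \<noteq> b"
    using dir_edge_vertices(3) [OF K(1,2)] .
  have "convex hull {a, b} face_of convex hull {a, b, c}"
    using face_of_convex_hull_affine_independent [OF affine_independent_orient [of a b c], of "convex hull {a, b}"] c(1)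
    by (metis insert_mono empty_subsetI less_irrefl)
  moreover have "aff_dim (convex hull {a, b}) = 1"
    using ab by (simp add: aff_dim_convex_hull)
  ultimately have "closed_segment a b edge_of K"
    by (simp add: edge_of_def c(2) segment_convex_hull)
  moreover have "\<not> closed_segment a b \<subseteq> B"
  proof
    assume "closed_segment a b \<subseteq> B"
    moreover have "midpoint a b \<in> P"
      using paired_edge_interior [OF K(1) K'(1) K(2) K'(2)] ab by auto
    moreover have "midpoint a b \<in> closed_segment a b"
      by simp
    ultimately show False
      using jordan(5) by blast
  qed
  ultimately have le: "h \<le> C' * diameter (closed_segment a b)"
    using C' K(1) by (auto simp: no_short_interior_edges_def)
  have "diameter (closed_segment a b) \<le> norm (b - a)"
  proof (rule diameter_le)
    fix x y assume "x \<in> closed_segment a b" "y \<in> closed_segment a b"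
    then have "dist x y \<le> dist a b"
      unfolding segment_convex_hull by (rule dist_convex_hull_le [rotated]) (auto simp: dist_commute)
    then show "norm (x - y) \<le> norm (b - a)"
      by (simp add: dist_norm norm_minus_commute)
  qed simp
  moreover have "0 \<le> diameter (closed_segment a b)"
    by (intro diameter_ge_0 bounded_closed_segment)
  \<comment> \<open>For a negative \<open>C'\<close> the right-hand side of the bound on edge
    lengths could not reach h, which is positive.\<close>
  then have "0 \<le> C'"
    using le h_pos by (smt (verit) mult_nonneg_nonneg mult_nonpos_nonneg)
  ultimately show ?thesis
    using le mult_left_mono [of _ "norm (b - a)" C'] by fastforce
qed

end

section \<open>The error on a single triangle\<close>

context polygon_field
begin

definition gg :: "real^2 \<Rightarrow> real" where
  "gg x = (G 1 1 x)\<^sup>2 + (G 1 2 x)\<^sup>2 + (G 2 1 x)\<^sup>2 + (G 2 2 x)\<^sup>2"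

lemma gg_nonneg: "0 \<le> gg x"
  by (simp add: gg_def)

lemma jac_sq_integrable: "open \<omega> \<Longrightarrow> \<omega> \<subseteq> \<Omega> \<Longrightarrow> integrable (lebesgue_on \<omega>) (\<lambda>x. (G i j x)\<^sup>2)"
  by (rule L2_sq_integrable [OF jac_L2(2)])

lemma gg_integrable: "open \<omega> \<Longrightarrow> \<omega> \<subseteq> \<Omega> \<Longrightarrow> integrable (lebesgue_on \<omega>) gg"
  unfolding gg_def [abs_def] by (intro Bochner_Integration.integrable_add jac_sq_integrable)

text \<open>The component f of u along the edge has edge mean U / |b - a|, whereas z has the
  component (U + \<delta>) / |b - a|. So the error in this direction is f minus its edge mean, up to
  the constant \<delta> / |b - a|. \<open>edge_poincare\<close> gives 5 h^2, and the square of a sum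
  doubles both contributions.\<close>

lemma edge_error:
  assumes K: "K \<in> T" "(a, b) \<in> dir_edges K" and z: "z \<bullet> (b - a) = U (a, b) + \<delta>"
  defines "t \<equiv> (b - a) /\<^sub>R norm (b - a)" and "I \<equiv> interior K"
  shows "(\<lambda>x. (u x - z) \<bullet> t) \<in> L2 (lebesgue_on I)"
    and "(LINT x|lebesgue_on I. ((u x - z) \<bullet> t)\<^sup>2)
      \<le> 10 * h\<^sup>2 * (LINT x|lebesgue_on I. gg x) + 2 * (\<delta> / norm (b - a))\<^sup>2 * measure lebesgue I"
proof -
  let ?n = "norm (b - a)" and ?M = "lebesgue_on I"
  have n: "?n > 0"
    using dir_edge_vertices(3) [OF K] by simp
  obtain c where D: "orient c a b \<noteq> 0" "triangle c a b = I"
    unfolding I_def by (rule dir_edge_opposite [OF K(1) disjI1 [OF K(2)]])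
  have I: "open I" "I \<subseteq> \<Omega>" "I \<subseteq> K" "I \<in> sets lebesgue" "finite_measure ?M"
    using interior_K_\<Omega> [OF K(1)] interior_subset [of K] finite_measure_triangle [of c a b]
    by (auto simp: I_def D(2) interior_K_sets)
  have gr: "weak_grad I (\<lambda>x. u x $ i) (G i)" for i
    using jac_mono [OF I(1,2)] by (simp add: weak_jacobian_def)
  have "norm t = 1"
    using n by (simp add: t_def)
  then have t: "(t $ 1)\<^sup>2 + (t $ 2)\<^sup>2 = 1"
    by (simp add: norm_vec_def L2_set_def sum_2)
  define f where "f x = t $ 1 * u x $ 1 + t $ 2 * u x $ 2" for x
  define F where "F j x = t $ 1 * G 1 j x + t $ 2 * G 2 j x" for j x
  have F: "weak_grad I f F"
    unfolding f_def [abs_def] F_def [abs_def] by (rule weak_grad_lincomb [OF gr gr I(1)])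
  define m where "m = edge_mean c a b f F"
  have "m = t $ 1 * edge_mean c a b (\<lambda>x. u x $ 1) (G 1) + t $ 2 * edge_mean c a b (\<lambda>x. u x $ 2) (G 2)"
    unfolding m_def f_def [abs_def] F_def [abs_def] by (rule edge_mean_lincomb) (simp_all only: D(2) gr)
  also have "\<dots> = edge_flux c a b u G / ?n"
    by (simp add: t_def edge_flux_def divide_simps)
  also have "edge_flux c a b u G = U (a, b)"
    using U_eq [OF D(1)] D(2) I(2) by simp
  finally have m: "m = U (a, b) / ?n" .
  have e: "(u x - z) \<bullet> t = (f x - m) + - (\<delta> / ?n)" for x
  proof -
    have "z \<bullet> t = (U (a, b) + \<delta>) / ?n"
      using z by (simp add: t_def divide_simps)
    moreover have "u x \<bullet> t = f x"
      by (simp add: f_def inner_vec_def sum_2 mult.commute)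
    ultimately show ?thesis
      by (simp add: inner_diff_left m add_divide_distrib)
  qed
  have L: "(\<lambda>x. f x - m) \<in> L2 ?M"
    by (intro L2_diff L2_const weak_gradD(1) [OF F] I(5))
  show eL: "(\<lambda>x. (u x - z) \<bullet> t) \<in> L2 ?M"
    unfolding e by (intro L2_add L L2_const I(5))
  have c: "c \<in> K"
  proof -
    have "c \<in> convex hull {c, a, b}"
      by (simp add: hull_inc)
    also have "convex hull {c, a, b} \<subseteq> closure (triangle c a b)"
    proof -
      have "interior (convex hull {c, a, b}) \<noteq> {}"
        using D interior_nonempty [OF K(1)] by (simp add: triangle_def I_def)
      then show ?thesis
        unfolding triangle_def using convex_closure_interior [OF convex_convex_hull] closure_subset by metis
    qed
    finally show ?thesis
      using D(2) closure_interior_K [OF K(1)] by (simp add: I_def)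
  qed
  have cl: "K \<subseteq> closure P"
    by (rule K_subset_closure [OF K(1)])
  have "(L2_norm ?M (\<lambda>x. f x - m))\<^sup>2 \<le> 5 * h\<^sup>2 * ((L2_norm ?M (F 1))\<^sup>2 + (L2_norm ?M (F 2))\<^sup>2)"
    unfolding m_def D(2) [symmetric]
  proof (rule edge_poincare [OF D(1)])
    show "dist x y \<le> h" if "x \<in> triangle c a b" "y \<in> triangle c a b" for x y
      using that I(3) cl dist_le_h unfolding D(2) by blast
    show "dist x c \<le> h" if "x \<in> triangle c a b" for x
      using that I(3) cl c dist_le_h unfolding D(2) by blast
  qed (simp add: D(2) F)
  also have "(L2_norm ?M (F 1))\<^sup>2 + (L2_norm ?M (F 2))\<^sup>2 \<le> (LINT x|?M. gg x)"
  proof -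
    have Fi: "integrable ?M (\<lambda>x. (F j x)\<^sup>2)" for j
      by (rule L2_sq_integrable [OF weak_gradD(2) [OF F]])
    have "(L2_norm ?M (F 1))\<^sup>2 + (L2_norm ?M (F 2))\<^sup>2 = (LINT x|?M. (F 1 x)\<^sup>2 + (F 2 x)\<^sup>2)"
      using Fi by (simp add: L2_norm_sq)
    also have "\<dots> \<le> (LINT x|?M. gg x)"
    proof (rule integral_mono)
      fix x
      have "(F j x)\<^sup>2 \<le> (G 1 j x)\<^sup>2 + (G 2 j x)\<^sup>2" for j
        using sum_squares_lincomb_le [of "t $ 1" "G 1 j x" "t $ 2" "G 2 j x"] by (simp add: F_def t)
      from this [of 1] this [of 2] show "(F 1 x)\<^sup>2 + (F 2 x)\<^sup>2 \<le> gg x"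
        by (simp add: gg_def)
    qed (use Fi gg_integrable [OF I(1,2)] in auto)
    finally show ?thesis .
  qed
  finally have A: "(L2_norm ?M (\<lambda>x. f x - m))\<^sup>2 \<le> 5 * h\<^sup>2 * (LINT x|?M. gg x)"
    by (simp add: mult_left_mono)
  have Li: "integrable ?M (\<lambda>x. (f x - m)\<^sup>2)" "integrable ?M (\<lambda>x. ((u x - z) \<bullet> t)\<^sup>2)"
    by (rule L2_sq_integrable [OF L] L2_sq_integrable [OF eL])+
  have "(LINT x|?M. ((u x - z) \<bullet> t)\<^sup>2) \<le> (LINT x|?M. 2 * (f x - m)\<^sup>2 + 2 * (\<delta> / ?n)\<^sup>2)"
  proof (rule integral_mono [OF Li(2)])
    show "integrable ?M (\<lambda>x. 2 * (f x - m)\<^sup>2 + 2 * (\<delta> / ?n)\<^sup>2)"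
      by (intro Bochner_Integration.integrable_add integrable_mult_right Li finite_measure.integrable_const I(5))
    show "((u x - z) \<bullet> t)\<^sup>2 \<le> 2 * (f x - m)\<^sup>2 + 2 * (\<delta> / ?n)\<^sup>2" for x
      unfolding e using square_sum_le [of "f x - m" "- (\<delta> / ?n)"] by simp
  qed
  also have "\<dots> = 2 * (LINT x|?M. (f x - m)\<^sup>2) + 2 * (\<delta> / ?n)\<^sup>2 * measure lebesgue I"
    using Bochner_Integration.integral_add [OF integrable_mult_right [OF Li(1), of 2] finite_measure.integrable_const [OF I(5), of "2 * (\<delta> / ?n)\<^sup>2"]]
    by (simp only: LINT_const [OF I(4)] Bochner_Integration.integral_mult_right_zero)
  also have "\<dots> \<le> 10 * h\<^sup>2 * (LINT x|?M. gg x) + 2 * (\<delta> / ?n)\<^sup>2 * measure lebesgue I"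
    using A unfolding L2_norm_sq by linarith
  finally show "(LINT x|?M. ((u x - z) \<bullet> t)\<^sup>2)
      \<le> 10 * h\<^sup>2 * (LINT x|?M. gg x) + 2 * (\<delta> / ?n)\<^sup>2 * measure lebesgue I" .
qed

lemma L2_vec_sq_integrable:
  fixes v :: "real^2 \<Rightarrow> real^2"
  assumes "\<And>i. (\<lambda>x. v x $ i) \<in> L2 M"
  shows "integrable M (\<lambda>x. (norm (v x))\<^sup>2)"
  using assms L2_vec_iff [of v M] by (auto simp: L2_def)

text \<open>The field \<open>nd \<alpha> \<beta>\<close> is compared with its value z at the vertex
  d opposite the longest edge. Both edges at d see the tangential components of z, so
  \<open>edge_error\<close> treats u - z in two directions, and their angle allows the passage to
  the full vector at the cost of 1 / (1 - \<kappa>). Replacing z by the field itself costs at most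
  |\<beta>| h pointwise.\<close>

lemma element_error:
  assumes K: "K \<in> T" and \<theta>: "angles_bounded \<theta> T" "\<theta> < pi"
    and \<eta>: "\<And>a b. (a, b) \<in> dir_edges K \<Longrightarrow> ((tangential (nd \<alpha> \<beta>) (a, b) - U (a, b)) / norm (b - a))\<^sup>2 \<le> \<eta>"
  defines "\<kappa> \<equiv> max (1 / 2) (- cos \<theta>)" and "I \<equiv> interior K"
  shows "(LINT x|lebesgue_on I. (norm (u x - nd \<alpha> \<beta> x))\<^sup>2)
    \<le> (40 * h\<^sup>2 * (LINT x|lebesgue_on I. gg x) + 8 * \<eta> * measure lebesgue I) / (1 - \<kappa>) + 2 * \<beta>\<^sup>2 * h\<^sup>2 * measure lebesgue I"
    and "\<kappa> < 1"
proof -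
  obtain a b c where D0: "orient a b c > 0" "K = convex hull {a, b, c}"
    using K by (rule triangleE)
  obtain d p q where D: "orient d p q > 0" "K = convex hull {d, p, q}"
    and le: "norm (p - d) \<le> norm (q - p)" "norm (q - d) \<le> norm (q - p)"
    using vertex_opposite_longest_edge [OF D0(1)] D0(2) by metis
  have edges: "dir_edges K = {(d, p), (p, q), (q, d)}"
    unfolding D(2) by (rule dir_edges_hull [OF D(1)])
  have ne: "p \<noteq> d" "q \<noteq> d" "p \<noteq> q"
    using D(1) by auto
  have ext: "{x. x extreme_point_of K} = {d, p, q}"
    unfolding D(2) using D(1) by (intro extreme_points_hull) simp
  then have "d extreme_point_of K" "p extreme_point_of K" "q extreme_point_of K"
    by auto
  then have angle: "angle_at d p q \<le> \<theta>"
    using \<theta>(1) K ne unfolding angles_bounded_def by metis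
  define t1 t2 where t: "t1 = (p - d) /\<^sub>R norm (p - d)" "t2 = (d - q) /\<^sub>R norm (d - q)"
  have \<kappa>: "\<bar>t1 \<bullet> t2\<bar> \<le> \<kappa>" "\<kappa> < 1"
    unfolding t \<kappa>_def by (rule cos_bound_opposite_longest_edge [OF ne(1,2) le angle \<theta>(2)])+
  show "\<kappa> < 1"
    by (rule \<kappa>(2))
  have unit: "norm t1 = 1" "norm t2 = 1"
    using ne by (simp_all add: t)
  let ?M = "lebesgue_on I" and ?z = "nd \<alpha> \<beta> d" and ?E = "\<lambda>e. tangential (nd \<alpha> \<beta>) e - U e"
  let ?g = "LINT x|?M. gg x" and ?m = "measure lebesgue I"
  have z: "?z \<bullet> (p - d) = U (d, p) + ?E (d, p)" "?z \<bullet> (d - q) = U (q, d) + ?E (q, d)"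
    using nd_tangential_swap [of \<alpha> \<beta> d q] by (simp_all add: tangential_def inner_diff_right)
  have mem: "(d, p) \<in> dir_edges K" "(q, d) \<in> dir_edges K"
    by (simp_all add: edges)
  note e1 = edge_error [OF K mem(1) z(1), folded t I_def]
  note e2 = edge_error [OF K mem(2) z(2), folded t I_def]
  have I: "open I" "I \<subseteq> \<Omega>" "I \<subseteq> K" "I \<in> sets lebesgue" "I \<in> sets borel" "bounded I"
    using interior_K_\<Omega> [OF K] interior_subset [of K] compact_imp_bounded [OF compact_K [OF K]]
    by (auto simp: I_def interior_K_sets intro: bounded_subset)
  have fin: "finite_measure ?M"
    by (rule finite_measure_lebesgue_on [OF I(6,4)])
  have i12: "integrable ?M (\<lambda>x. ((u x - ?z) \<bullet> t1)\<^sup>2)" "integrable ?M (\<lambda>x. ((u x - ?z) \<bullet> t2)\<^sup>2)"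
    by (rule L2_sq_integrable [OF e1(1)] L2_sq_integrable [OF e2(1)])+
  have "(LINT x|?M. (norm (u x - nd \<alpha> \<beta> x))\<^sup>2)
      \<le> (LINT x|?M. 2 / (1 - \<kappa>) * (((u x - ?z) \<bullet> t1)\<^sup>2 + ((u x - ?z) \<bullet> t2)\<^sup>2) + 2 * \<beta>\<^sup>2 * h\<^sup>2)"
  proof (rule integral_mono)
    have "(\<lambda>x. nd \<alpha> \<beta> x $ i) \<in> L2 ?M" for i
      by (rule bounded_continuous_L2 [OF I(6,5) C1_continuous [OF C1_nd]])
    then have "(\<lambda>x. (u x - nd \<alpha> \<beta> x) $ i) \<in> L2 ?M" for i
      unfolding vector_minus_component by (intro L2_diff jac_L2(1) I)
    then show "integrable ?M (\<lambda>x. (norm (u x - nd \<alpha> \<beta> x))\<^sup>2)"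
      by (rule L2_vec_sq_integrable)
    show "integrable ?M (\<lambda>x. 2 / (1 - \<kappa>) * (((u x - ?z) \<bullet> t1)\<^sup>2 + ((u x - ?z) \<bullet> t2)\<^sup>2) + 2 * \<beta>\<^sup>2 * h\<^sup>2)"
      by (intro Bochner_Integration.integrable_add integrable_mult_right i12 finite_measure.integrable_const fin)
  next
    fix x assume "x \<in> space ?M"
    then have x: "x \<in> K"
      using I(3) by auto
    have "dist x d \<le> h"
    proof (rule dist_le_h)
      show "x \<in> closure P" "d \<in> closure P"
        using x K_subset_closure [OF K] D(2) hull_inc [of d "{d, p, q}" convex] by auto
    qed
    then have n: "(norm (?z - nd \<alpha> \<beta> x))\<^sup>2 \<le> \<beta>\<^sup>2 * h\<^sup>2"
      unfolding norm_nd_diff power_mult_distrib by (simp add: mult_left_mono power_mono)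
    have "norm (u x - nd \<alpha> \<beta> x) \<le> norm (u x - ?z) + norm (?z - nd \<alpha> \<beta> x)"
      using norm_triangle_ineq [of "u x - ?z" "?z - nd \<alpha> \<beta> x"] by simp
    then have "(norm (u x - nd \<alpha> \<beta> x))\<^sup>2 \<le> (norm (u x - ?z) + norm (?z - nd \<alpha> \<beta> x))\<^sup>2"
      by (intro power_mono) auto
    also have "\<dots> \<le> 2 * (norm (u x - ?z))\<^sup>2 + 2 * (norm (?z - nd \<alpha> \<beta> x))\<^sup>2"
      by (rule square_sum_le)
    also have "\<dots> \<le> 2 * (norm (u x - ?z))\<^sup>2 + 2 * \<beta>\<^sup>2 * h\<^sup>2"
      using n by simp
    also have "(norm (u x - ?z))\<^sup>2 \<le> (((u x - ?z) \<bullet> t1)\<^sup>2 + ((u x - ?z) \<bullet> t2)\<^sup>2) / (1 - \<kappa>)"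
    proof -
      have "(1 - \<kappa>) * (norm (u x - ?z))\<^sup>2 \<le> (1 - \<bar>t1 \<bullet> t2\<bar>) * (norm (u x - ?z))\<^sup>2"
        using \<kappa>(1) by (intro mult_right_mono) auto
      also have "\<dots> \<le> ((u x - ?z) \<bullet> t1)\<^sup>2 + ((u x - ?z) \<bullet> t2)\<^sup>2"
        by (rule inner_two_directions [OF unit])
      finally show ?thesis
        using \<kappa>(2) by (simp add: pos_le_divide_eq mult.commute)
    qed
    finally show "(norm (u x - nd \<alpha> \<beta> x))\<^sup>2
        \<le> 2 / (1 - \<kappa>) * (((u x - ?z) \<bullet> t1)\<^sup>2 + ((u x - ?z) \<bullet> t2)\<^sup>2) + 2 * \<beta>\<^sup>2 * h\<^sup>2"
      by simp
  qed
  also have "\<dots> = 2 / (1 - \<kappa>) * ((LINT x|?M. ((u x - ?z) \<bullet> t1)\<^sup>2) + (LINT x|?M. ((u x - ?z) \<bullet> t2)\<^sup>2)) + 2 * \<beta>\<^sup>2 * h\<^sup>2 * ?m"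
    unfolding Bochner_Integration.integral_add [OF integrable_mult_right [OF Bochner_Integration.integrable_add [OF i12], of "2 / (1 - \<kappa>)"]
        finite_measure.integrable_const [OF fin, of "2 * \<beta>\<^sup>2 * h\<^sup>2"]]
      Bochner_Integration.integral_mult_right_zero Bochner_Integration.integral_add [OF i12] LINT_const [OF I(4)]
    by simp
  also have "\<dots> \<le> 2 / (1 - \<kappa>) * (20 * h\<^sup>2 * ?g + 4 * \<eta> * ?m) + 2 * \<beta>\<^sup>2 * h\<^sup>2 * ?m"
  proof -
    have "2 * (?E (d, p) / norm (p - d))\<^sup>2 * ?m \<le> 2 * \<eta> * ?m" "2 * (?E (q, d) / norm (d - q))\<^sup>2 * ?m \<le> 2 * \<eta> * ?m"
      using \<eta> [OF mem(1)] \<eta> [OF mem(2)] by (intro mult_right_mono; simp)+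
    then have "(LINT x|?M. ((u x - ?z) \<bullet> t1)\<^sup>2) + (LINT x|?M. ((u x - ?z) \<bullet> t2)\<^sup>2) \<le> 20 * h\<^sup>2 * ?g + 4 * \<eta> * ?m"
      using e1(2) e2(2) by linarith
    then show ?thesis
      using \<kappa>(2) by (intro add_right_mono mult_left_mono) auto
  qed
  also have "\<dots> = (40 * h\<^sup>2 * ?g + 8 * \<eta> * ?m) / (1 - \<kappa>) + 2 * \<beta>\<^sup>2 * h\<^sup>2 * ?m"
    by (simp add: add_divide_distrib distrib_left)
  finally show "(LINT x|?M. (norm (u x - nd \<alpha> \<beta> x))\<^sup>2)
    \<le> (40 * h\<^sup>2 * ?g + 8 * \<eta> * ?m) / (1 - \<kappa>) + 2 * \<beta>\<^sup>2 * h\<^sup>2 * ?m" .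
qed

end

lemma L2_vec_nth: "f \<in> L2 M \<Longrightarrow> (\<lambda>x. f x $ i) \<in> L2 M" for f :: "'a \<Rightarrow> real^2"
  using L2_vec_iff by blast

lemma L2_vecI: "(\<And>i. (\<lambda>x. f x $ i) \<in> L2 M) \<Longrightarrow> f \<in> L2 M" for f :: "'a \<Rightarrow> real^2"
  using L2_vec_iff by blast

lemma weak_curlI:
  assumes "g \<in> L2 (lebesgue_on \<omega>)" "is_weak_curl \<omega> v g"
  shows "weak_curl \<omega> v \<in> L2 (lebesgue_on \<omega>)" "is_weak_curl \<omega> v (weak_curl \<omega> v)"
proof -
  have "weak_curl \<omega> v \<in> L2 (lebesgue_on \<omega>) \<and> is_weak_curl \<omega> v (weak_curl \<omega> v)"
    unfolding weak_curl_def by (rule someI [of _ g]) (use assms in simp)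
  then show "weak_curl \<omega> v \<in> L2 (lebesgue_on \<omega>)" "is_weak_curl \<omega> v (weak_curl \<omega> v)"
    by simp_all
qed

section \<open>Deviation of the interpolant on interior edges\<close>

text \<open>The consequences of being an interpolant that the estimate is built on, with the pieces
  and the constant curl named; \<open>interpolantD\<close> derives them from
  \<open>is_interpolant\<close>.\<close>

locale polygon_interpolant = polygon_field +
  fixes w :: "real^2 \<Rightarrow> real^2" and \<alpha> :: "(real^2) set \<Rightarrow> real^2" and \<beta> :: "(real^2) set \<Rightarrow> real" and c :: real
  assumes w_L2: "w \<in> L2 (lebesgue_on P)"
    and w_nd: "\<And>K. K \<in> T \<Longrightarrow> AE x in lebesgue_on (interior K). w x = nd (\<alpha> K) (\<beta> K) x"
    and \<beta>_eq: "\<And>K. K \<in> T \<Longrightarrow> - 2 * \<beta> K = c"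
    and w_curl: "is_weak_curl P w (\<lambda>x. c)"
    and w_boundary: "\<And>K e. K \<in> T \<Longrightarrow> e \<in> dir_edges K \<Longrightarrow> prod.swap e \<notin> edges T \<Longrightarrow>
      tangential (nd (\<alpha> K) (\<beta> K)) e = U e"
begin

text \<open>The excess of the line integral of the interpolant over that of u along e. The triangle
  to the left of e is unique, so the description is definite.\<close>

definition \<delta> :: "(real^2) \<times> (real^2) \<Rightarrow> real" where
  "\<delta> e = (let K = THE K. K \<in> T \<and> e \<in> dir_edges K in tangential (nd (\<alpha> K) (\<beta> K)) e - U e)"

lemma \<delta>_eq:
  assumes "K \<in> T" "e \<in> dir_edges K"
  shows "\<delta> e = tangential (nd (\<alpha> K) (\<beta> K)) e - U e"
proof -
  have "(THE K. K \<in> T \<and> e \<in> dir_edges K) = K"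
    using dir_edge_unique assms by (intro the_equality) blast+
  then show ?thesis
    by (simp add: \<delta>_def)
qed

lemma \<delta>_zero:
  assumes "e \<in> edges T" "prod.swap e \<notin> edges T"
  shows "\<delta> e = 0"
proof -
  obtain K where K: "K \<in> T" "e \<in> dir_edges K"
    using assms(1) by (auto simp: edges_def)
  then show ?thesis
    using \<delta>_eq [OF K] w_boundary [OF K assms(2)] by simp
qed

lemma \<delta>_swap:
  assumes "e \<in> edges T" "prod.swap e \<in> edges T"
  shows "\<delta> (prod.swap e) = - \<delta> e"
proof -
  obtain a b where ab: "e = (a, b)"
    by (cases e)
  obtain K where K: "K \<in> T" "(a, b) \<in> dir_edges K"
    using assms(1) by (auto simp: edges_def ab)
  obtain K' where K': "K' \<in> T" "(b, a) \<in> dir_edges K'"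
    using assms(2) by (auto simp: edges_def ab)
  have "tangential (nd (\<alpha> K') (\<beta> K')) (b, a) = - tangential (nd (\<alpha> K) (\<beta> K)) (a, b)"
    by (rule piecewise_nd_tangential_continuous [OF w_L2 w_nd \<beta>_eq w_curl K K'])
  then show ?thesis
    using \<delta>_eq [OF K] \<delta>_eq [OF K'] U_swap [OF assms(1)] by (simp add: ab)
qed

definition E where "E = (LINT x|lebesgue_on P. (cu x - c)\<^sup>2)"

lemma curl_error_L2: "(\<lambda>x. cu x - c) \<in> L2 (lebesgue_on P)"
  by (intro L2_diff L2_const finite_P cu_L2 jordan(2) hull_props(4))

lemma curl_error_integrable: "integrable (lebesgue_on P) (\<lambda>x. cu x - c)"
  by (rule L2_integrable [OF finite_P curl_error_L2])

lemma \<delta>_sum: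
  assumes K: "K \<in> T"
  shows "sum \<delta> (dir_edges K) = - (LINT x|lebesgue_on (interior K). cu x - c)"
proof -
  have fin: "finite_measure (lebesgue_on (interior K))"
    using compact_imp_bounded [OF compact_K [OF K]] interior_subset [of K]
    by (intro finite_measure_lebesgue_on interior_K_sets) (rule bounded_subset)
  have cui: "integrable (lebesgue_on (interior K)) cu"
    by (rule L2_integrable [OF fin cu_L2 [OF open_interior interior_K_\<Omega> [OF K]]])
  have "sum \<delta> (dir_edges K) = sum (tangential (nd (\<alpha> K) (\<beta> K))) (dir_edges K) - sum U (dir_edges K)"
    using \<delta>_eq [OF K] by (simp add: sum_subtractf)
  also have "\<dots> = c * measure lebesgue (interior K) - (LINT x|lebesgue_on (interior K). cu x)"
    unfolding sum_tangential_nd [OF K] \<beta>_eq [OF K] U_stokes [OF K] ..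
  also have "\<dots> = - (LINT x|lebesgue_on (interior K). cu x - c)"
    unfolding Bochner_Integration.integral_diff [OF cui finite_measure.integrable_const [OF fin]]
      LINT_const [OF interior_K_sets(2)] by simp
  finally show ?thesis .
qed

lemma \<delta>_sum_unpaired:
  assumes "S \<subseteq> T"
  shows "(\<Sum>K\<in>S. sum \<delta> (dir_edges K)) = sum \<delta> {e \<in> edges S. prod.swap e \<notin> edges S}"
proof (rule sum_dir_edges [OF assms])
  have "edges S \<subseteq> edges T"
    using assms by (auto simp: edges_def)
  then show "\<delta> (prod.swap e) = - \<delta> e" if "e \<in> edges S" "prod.swap e \<in> edges S" for e
    using that by (intro \<delta>_swap) auto
qed

text \<open>Stokes' theorem on all of P: the deviations cancel on interior edges and vanish on the
  boundary.\<close>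

lemma curl_mean: "(LINT x|lebesgue_on P. cu x - c) = 0"
proof -
  have "- (LINT x|lebesgue_on P. cu x - c) = (\<Sum>K\<in>T. sum \<delta> (dir_edges K))"
    unfolding integral_P [OF curl_error_integrable] sum_negf [symmetric] by (rule sum.cong [OF refl]) (simp only: \<delta>_sum)
  also have "\<dots> = 0"
    unfolding \<delta>_sum_unpaired [OF subset_refl] by (rule sum.neutral) (simp add: \<delta>_zero)
  finally show ?thesis
    by simp
qed

text \<open>Stokes' theorem on the subpolygon cut off by the chord e. Every other edge of its
  boundary lies on the boundary of P, where the deviation is zero, so the deviation on the chord is
  the whole boundary sum and equals, up to sign, the integral of curl u - c over the
  subpolygon.\<close>

lemma \<delta>_le:
  assumes "e \<in> edges T"
  shows "\<bar>\<delta> e\<bar> \<le> (LINT x|lebesgue_on P. \<bar>cu x - c\<bar>)"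
proof (cases "prod.swap e \<in> edges T")
  case False
  then show ?thesis
    using \<delta>_zero [OF assms] by (simp add: Bochner_Integration.integral_nonneg)
next
  case True
  obtain a b where ab: "e = (a, b)"
    by (cases e)
  obtain K where K: "K \<in> T" "(a, b) \<in> dir_edges K"
    using assms by (auto simp: edges_def ab)
  obtain K' where K': "K' \<in> T" "(b, a) \<in> dir_edges K'"
    using True by (auto simp: edges_def ab)
  obtain S e0 where S: "S \<subseteq> T" "e0 = (a, b) \<or> e0 = (b, a)" "e0 \<in> edges S" "prod.swap e0 \<notin> edges S"
    and only: "\<And>e. e \<in> edges S \<Longrightarrow> prod.swap e \<notin> edges S \<Longrightarrow> prod.swap e \<in> edges T \<Longrightarrow> e = e0"
    using chord_split [OF K K'] by blast
  have sub: "edges S \<subseteq> edges T"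
    using S(1) by (auto simp: edges_def)
  have abs: "\<bar>\<delta> e\<bar> = \<bar>\<delta> e0\<bar>"
    using S(2) \<delta>_swap [OF assms True] by (auto simp: ab)
  let ?A = "{e \<in> edges S. prod.swap e \<notin> edges S}"
  have "finite ?A"
    using finite_edges [OF S(1)] by simp
  moreover have "e0 \<in> ?A"
    using S by simp
  moreover have "sum \<delta> (?A - {e0}) = 0"
    using only sub \<delta>_zero by (intro sum.neutral) blast
  ultimately have "\<delta> e0 = sum \<delta> ?A"
    by (simp add: sum.remove)
  also have "\<dots> = - (\<Sum>K\<in>S. LINT x|lebesgue_on (interior K). cu x - c)"
    unfolding \<delta>_sum_unpaired [OF S(1), symmetric] sum_negf [symmetric]
    using S(1) \<delta>_sum by (intro sum.cong refl) blast
  finally have "\<bar>\<delta> e0\<bar> = \<bar>\<Sum>K\<in>S. LINT x|lebesgue_on (interior K). cu x - c\<bar>"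
    by simp
  also have "\<dots> \<le> (\<Sum>K\<in>S. \<bar>LINT x|lebesgue_on (interior K). cu x - c\<bar>)"
    by (rule sum_abs)
  also have "\<dots> \<le> (\<Sum>K\<in>S. LINT x|lebesgue_on (interior K). \<bar>cu x - c\<bar>)"
    by (intro sum_mono integral_abs_bound)
  also have "\<dots> \<le> (\<Sum>K\<in>T. LINT x|lebesgue_on (interior K). \<bar>cu x - c\<bar>)"
    by (intro sum_mono2 finite_T S(1) Bochner_Integration.integral_nonneg) simp
  also have "\<dots> = (LINT x|lebesgue_on P. \<bar>cu x - c\<bar>)"
    by (rule integral_P [symmetric]) (rule integrable_abs [OF curl_error_integrable])
  finally show ?thesis
    using abs by simp
qed

lemma E_nonneg: "0 \<le> E"
  unfolding E_def by (rule Bochner_Integration.integral_nonneg) simp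

lemma \<delta>_sq_le:
  assumes "e \<in> edges T"
  shows "(\<delta> e)\<^sup>2 \<le> measure lebesgue P * E"
proof -
  have L: "(\<lambda>x. \<bar>cu x - c\<bar>) \<in> L2 (lebesgue_on P)"
    using curl_error_L2 borel_measurable_abs [OF L2_measurable [OF curl_error_L2]] by (simp add: L2_real_iff)
  have "(\<delta> e)\<^sup>2 \<le> (LINT x|lebesgue_on P. 1 * \<bar>cu x - c\<bar>)\<^sup>2"
    using \<delta>_le [OF assms] by (simp add: abs_le_square_iff [symmetric] Bochner_Integration.integral_nonneg)
  also have "\<dots> \<le> (LINT x|lebesgue_on P. 1\<^sup>2) * (LINT x|lebesgue_on P. \<bar>cu x - c\<bar>\<^sup>2)"
    by (rule L2_cauchy_schwarz_sq [OF L2_const [OF finite_P] L])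
  also have "\<dots> = measure lebesgue P * E"
    unfolding E_def power2_abs LINT_const [OF P_sets(2)] by simp
  finally show ?thesis .
qed

text \<open>Used twice: for arbitrary m it shows that c is the best constant, and for m = 0 it
  bounds both the curl error and c^2 |P| by the integral of the squared curl.\<close>

lemma E_shift: "(LINT x|lebesgue_on P. (cu x - m)\<^sup>2) = E + (c - m)\<^sup>2 * measure lebesgue P"
proof -
  have m: "measure (lebesgue_on P) (space (lebesgue_on P)) = measure lebesgue P"
    by (simp add: measure_restrict_space P_sets)
  show ?thesis
    unfolding E_def LINT_square_shift [OF finite_P cu_L2 [OF jordan(2) hull_props(4)] curl_mean, of m] m ..
qed

lemma E_le: "E \<le> (LINT x|lebesgue_on P. (cu x - m)\<^sup>2)"
  unfolding E_shift using measure_P_pos by simp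

lemma cu_sq_le: "(LINT x|lebesgue_on P. (cu x)\<^sup>2) \<le> 2 * (LINT x|lebesgue_on P. gg x)"
proof -
  have gi: "integrable (lebesgue_on P) gg"
    by (rule gg_integrable [OF jordan(2) hull_props(4)])
  have "(LINT x|lebesgue_on P. (cu x)\<^sup>2) \<le> (LINT x|lebesgue_on P. 2 * gg x)"
  proof (rule integral_mono)
    show "integrable (lebesgue_on P) (\<lambda>x. (cu x)\<^sup>2)"
      by (rule L2_sq_integrable [OF cu_L2 [OF jordan(2) hull_props(4)]])
    show "(cu x)\<^sup>2 \<le> 2 * gg x" for x
    proof -
      have "(cu x)\<^sup>2 \<le> 2 * (G 2 1 x)\<^sup>2 + 2 * (G 1 2 x)\<^sup>2"
        using square_sum_le [of "G 2 1 x" "- G 1 2 x"] by (simp add: cu_def)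
      then show ?thesis
        unfolding gg_def by (rule order_trans) simp
    qed
  qed (use gi in simp)
  then show ?thesis
    by simp
qed

text \<open>Here the absence of short interior edges pays off: the squared deviation is at most |P|
  E <= 4 h^2 E, and h is at most \<open>C'\<close> times the length of the edge, so h disappears
  from the quotient.\<close>

lemma edge_deviation:
  assumes C': "no_short_interior_edges C' vs T" and K: "K \<in> T" "(a, b) \<in> dir_edges K"
  shows "(\<delta> (a, b) / norm (b - a))\<^sup>2 \<le> 4 * C'\<^sup>2 * E"
proof (cases "(b, a) \<in> edges T")
  case False
  have "(a, b) \<in> edges T"
    using K by (auto simp: edges_def)
  then have "\<delta> (a, b) = 0"
    using False by (intro \<delta>_zero) simp_all
  then show ?thesis
    using E_nonneg by simp
next
  case True
  let ?n = "norm (b - a)"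
  have n: "?n > 0"
    using dir_edge_vertices(3) [OF K] by simp
  have e: "(a, b) \<in> edges T"
    using K by (auto simp: edges_def)
  have "(\<delta> (a, b))\<^sup>2 \<le> (4 * h\<^sup>2) * E"
    by (rule order_trans [OF \<delta>_sq_le [OF e] mult_right_mono [OF measure_P_le E_nonneg]])
  also have "\<dots> \<le> (4 * (C' * ?n)\<^sup>2) * E"
    using edge_length [OF C' K True] h_pos by (intro mult_right_mono E_nonneg mult_left_mono power_mono) auto
  finally have "(\<delta> (a, b))\<^sup>2 \<le> (4 * C'\<^sup>2 * E) * ?n\<^sup>2"
    by (simp add: power_mult_distrib mult_ac)
  then show ?thesis
    using n by (simp add: power_divide pos_divide_le_eq)
qed

text \<open>\<open>element_error\<close> is summed over the triangles, with g the integral of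
  \<open>gg\<close> over P. The deviation term contributes 8 \<eta> |P| with \<eta> = 4 C'^2 E, E <=
  2 g and |P| <= 4 h^2, which is 256 C'^2 h^2 g. As \<beta> = -c / 2, the last term is h^2 c^2 |P| /
  2 <= h^2 g.\<close>

lemma L2_error:
  assumes \<theta>: "angles_bounded \<theta> T" "\<theta> < pi" and C': "no_short_interior_edges C' vs T"
  defines "\<kappa> \<equiv> max (1 / 2) (- cos \<theta>)"
  shows "(LINT x|lebesgue_on P. (norm (u x - w x))\<^sup>2)
    \<le> ((40 + 256 * C'\<^sup>2) / (1 - \<kappa>) + 1) * h\<^sup>2 * (LINT x|lebesgue_on P. gg x)"
proof -
  let ?g = "LINT x|lebesgue_on P. gg x" and ?F = "LINT x|lebesgue_on P. (cu x)\<^sup>2" and ?m = "measure lebesgue P"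
  define \<eta> where "\<eta> = 4 * C'\<^sup>2 * E"
  have uw: "(\<lambda>x. (u x - w x) $ i) \<in> L2 (lebesgue_on P)" for i
    unfolding vector_minus_component
    by (intro L2_diff jac_L2(1) L2_vec_nth w_L2 jordan(2) hull_props(4))
  have gi: "integrable (lebesgue_on P) gg"
    by (rule gg_integrable [OF jordan(2) hull_props(4)])
  obtain K0 where "K0 \<in> T"
    using union_T jordan(1) by blast
  have el: "(LINT x|lebesgue_on (interior K). (norm (u x - nd (\<alpha> K) (\<beta> K) x))\<^sup>2)
      \<le> (40 * h\<^sup>2 * (LINT x|lebesgue_on (interior K). gg x) + 8 * \<eta> * measure lebesgue (interior K)) / (1 - \<kappa>)
        + 2 * (\<beta> K)\<^sup>2 * h\<^sup>2 * measure lebesgue (interior K)" and \<kappa>: "\<kappa> < 1"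
    if K: "K \<in> T" for K
  proof -
    have "((tangential (nd (\<alpha> K) (\<beta> K)) (a, b) - U (a, b)) / norm (b - a))\<^sup>2 \<le> \<eta>" if "(a, b) \<in> dir_edges K" for a b
      using edge_deviation [OF C' K that] \<delta>_eq [OF K that] by (simp add: \<eta>_def)
    from element_error [OF K \<theta> this]
    show "(LINT x|lebesgue_on (interior K). (norm (u x - nd (\<alpha> K) (\<beta> K) x))\<^sup>2)
      \<le> (40 * h\<^sup>2 * (LINT x|lebesgue_on (interior K). gg x) + 8 * \<eta> * measure lebesgue (interior K)) / (1 - \<kappa>)
        + 2 * (\<beta> K)\<^sup>2 * h\<^sup>2 * measure lebesgue (interior K)" "\<kappa> < 1"
      unfolding \<kappa>_def by blast+
  qed
  have \<kappa>1: "\<kappa> < 1"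
    by (rule \<kappa> [OF \<open>K0 \<in> T\<close>])
  have "(LINT x|lebesgue_on P. (norm (u x - w x))\<^sup>2) = (\<Sum>K\<in>T. LINT x|lebesgue_on (interior K). (norm (u x - w x))\<^sup>2)"
    by (rule integral_P [OF L2_vec_sq_integrable [OF uw]])
  also have "\<dots> \<le> (\<Sum>K\<in>T. (40 * h\<^sup>2 / (1 - \<kappa>)) * (LINT x|lebesgue_on (interior K). gg x)
      + (8 * \<eta> / (1 - \<kappa>) + c\<^sup>2 / 2 * h\<^sup>2) * measure lebesgue (interior K))"
  proof (rule sum_mono)
    fix K assume K: "K \<in> T"
    have uwi: "(\<lambda>x. (u x - w x) $ i) \<in> L2 (lebesgue_on (interior K))" for i
      by (rule L2_lebesgue_on_mono(1) [OF uw interior_K_subset [OF K] interior_K_sets(2) P_sets(2)])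
    have "(LINT x|lebesgue_on (interior K). (norm (u x - w x))\<^sup>2)
        = (LINT x|lebesgue_on (interior K). (norm (u x - nd (\<alpha> K) (\<beta> K) x))\<^sup>2)"
    proof (rule integral_cong_AE)
      show "(\<lambda>x. (norm (u x - w x))\<^sup>2) \<in> borel_measurable (lebesgue_on (interior K))"
        by (rule borel_measurable_integrable [OF L2_vec_sq_integrable [OF uwi]])
      have [measurable]: "nd (\<alpha> K) (\<beta> K) \<in> borel_measurable (lebesgue_on (interior K))"
        by (intro borel_measurable_lebesgue_on borel_measurable_continuous_onI continuous_nd)
      have [measurable]: "u \<in> borel_measurable (lebesgue_on (interior K))"
        by (intro L2_measurable L2_vecI jac_L2(1) open_interior interior_K_\<Omega> [OF K])
      show "(\<lambda>x. (norm (u x - nd (\<alpha> K) (\<beta> K) x))\<^sup>2) \<in> borel_measurable (lebesgue_on (interior K))"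
        by measurable
      show "AE x in lebesgue_on (interior K). (norm (u x - w x))\<^sup>2 = (norm (u x - nd (\<alpha> K) (\<beta> K) x))\<^sup>2"
        using w_nd [OF K] by eventually_elim simp
    qed
    also have "\<dots> \<le> (40 * h\<^sup>2 * (LINT x|lebesgue_on (interior K). gg x) + 8 * \<eta> * measure lebesgue (interior K)) / (1 - \<kappa>)
        + 2 * (\<beta> K)\<^sup>2 * h\<^sup>2 * measure lebesgue (interior K)"
      by (rule el [OF K])
    also have "2 * (\<beta> K)\<^sup>2 = c\<^sup>2 / 2"
      unfolding \<beta>_eq [OF K, symmetric] by (simp add: power2_eq_square)
    also have "(40 * h\<^sup>2 * (LINT x|lebesgue_on (interior K). gg x) + 8 * \<eta> * measure lebesgue (interior K)) / (1 - \<kappa>)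
          + c\<^sup>2 / 2 * h\<^sup>2 * measure lebesgue (interior K)
        = (40 * h\<^sup>2 / (1 - \<kappa>)) * (LINT x|lebesgue_on (interior K). gg x)
          + (8 * \<eta> / (1 - \<kappa>) + c\<^sup>2 / 2 * h\<^sup>2) * measure lebesgue (interior K)"
      by (simp only: add_divide_distrib distrib_right times_divide_eq_left add.assoc)
    finally show "(LINT x|lebesgue_on (interior K). (norm (u x - w x))\<^sup>2)
        \<le> (40 * h\<^sup>2 / (1 - \<kappa>)) * (LINT x|lebesgue_on (interior K). gg x)
          + (8 * \<eta> / (1 - \<kappa>) + c\<^sup>2 / 2 * h\<^sup>2) * measure lebesgue (interior K)" .
  qed
  also have "\<dots> = (40 * h\<^sup>2 / (1 - \<kappa>)) * ?g + (8 * \<eta> / (1 - \<kappa>) + c\<^sup>2 / 2 * h\<^sup>2) * ?m"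
    unfolding sum.distrib sum_distrib_left [symmetric] interior_measure_sum integral_P [OF gi, symmetric] ..
  also have "\<dots> = (40 * h\<^sup>2 / (1 - \<kappa>)) * ?g + (8 * \<eta> * ?m) / (1 - \<kappa>) + h\<^sup>2 / 2 * (c\<^sup>2 * ?m)"
    by (simp add: algebra_simps)
  also have "\<dots> \<le> (40 * h\<^sup>2 / (1 - \<kappa>)) * ?g + (256 * C'\<^sup>2 * h\<^sup>2 * ?g) / (1 - \<kappa>) + h\<^sup>2 / 2 * (2 * ?g)"
  proof (intro add_mono order_refl mult_left_mono divide_right_mono)
    \<comment> \<open>The squared curl splits orthogonally into the error E and the mean part, so
      each of them is at most the whole.\<close>
    have F: "?F = E + c\<^sup>2 * ?m"
      using E_shift [of 0] by (simp only: diff_0_right)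
    have "0 \<le> c\<^sup>2 * ?m"
      by (intro mult_nonneg_nonneg measure_nonneg) simp
    then have E: "E \<le> 2 * ?g" "c\<^sup>2 * ?m \<le> 2 * ?g"
      using F cu_sq_le E_nonneg by linarith+
    show "c\<^sup>2 * ?m \<le> 2 * ?g"
      by (rule E(2))
    have Em: "E * ?m \<le> (2 * ?g) * (4 * h\<^sup>2)"
      by (rule mult_mono [OF E(1) measure_P_le]) (use E(1) E_nonneg in \<open>auto simp: measure_nonneg\<close>)
    have "8 * \<eta> * ?m = 32 * C'\<^sup>2 * (E * ?m)"
      by (simp add: \<eta>_def)
    also have "\<dots> \<le> 32 * C'\<^sup>2 * ((2 * ?g) * (4 * h\<^sup>2))"
      by (intro mult_left_mono Em) simp
    finally show "8 * \<eta> * ?m \<le> 256 * C'\<^sup>2 * h\<^sup>2 * ?g"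
      by (simp add: mult_ac)
  qed (use \<kappa>1 in auto)
  also have "\<dots> = ((40 + 256 * C'\<^sup>2) / (1 - \<kappa>) + 1) * h\<^sup>2 * ?g"
    by (simp only: add_divide_distrib) (simp add: algebra_simps)
  finally show ?thesis .
qed

text \<open>Since c is the best constant on P, it may be replaced by the mean over the convex hull;
  then the integral is enlarged to the hull, where the Poincare inequality with diameter h
  applies.\<close>

lemma curl_error:
  assumes Gc: "weak_grad \<Omega> cu Gc"
  shows "E \<le> 2 * h\<^sup>2 * ((L2_norm (lebesgue_on \<Omega>) (Gc 1))\<^sup>2 + (L2_norm (lebesgue_on \<Omega>) (Gc 2))\<^sup>2)"
proof -
  define m where "m = (LINT x|lebesgue_on \<Omega>. cu x) / measure lebesgue \<Omega>"
  have fin: "finite_measure (lebesgue_on \<Omega>)"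
    by (rule finite_measure_lebesgue_on [OF hull_props(3) P_sets(3)])
  have "measure lebesgue P \<le> measure lebesgue \<Omega>"
    by (rule measure_mono_fmeasurable [OF hull_props(4) P_sets(2)]) (simp add: bounded_set_imp_lmeasurable hull_props(3) P_sets(3))
  then have m: "m * measure lebesgue \<Omega> = (LINT x|lebesgue_on \<Omega>. cu x)"
    using measure_P_pos by (simp only: m_def) (simp add: less_le_trans)
  have L: "(\<lambda>x. cu x - m) \<in> L2 (lebesgue_on \<Omega>)"
    by (intro L2_diff L2_const fin weak_gradD(1) [OF Gc])
  have "E \<le> (LINT x|lebesgue_on P. (cu x - m)\<^sup>2)"
    by (rule E_le)
  also have "\<dots> \<le> (LINT x|lebesgue_on \<Omega>. (cu x - m)\<^sup>2)"
    by (rule LINT_lebesgue_on_mono [OF L2_sq_integrable [OF L] hull_props(4) P_sets(2,3)]) simp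
  also have "\<dots> = (L2_norm (lebesgue_on \<Omega>) (\<lambda>x. cu x - m))\<^sup>2"
    by (rule L2_norm_sq [symmetric])
  also have "\<dots> \<le> 2 * h\<^sup>2 * ((L2_norm (lebesgue_on \<Omega>) (Gc 1))\<^sup>2 + (L2_norm (lebesgue_on \<Omega>) (Gc 2))\<^sup>2)"
    by (rule poincare [OF hull_props(1-3,5) dist_hull_le_h Gc m])
  finally show ?thesis .
qed

end

section \<open>The estimate for an arbitrary interpolant\<close>

context polygon_field
begin

text \<open>On each triangle both -2 \<beta> and c are weak curls of w; uniqueness equates them, so
  \<beta> is the same everywhere. An edge without a partner is an edge of the polygon, possibly
  traversed backwards, and there the interpolation condition gives the value of U.\<close>

lemma interpolantD:
  assumes w: "is_interpolant vs T u w"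
  obtains \<alpha> \<beta> c where "polygon_interpolant vs T u G w \<alpha> \<beta> c"
proof -
  have V: "w \<in> L2 (lebesgue_on P)" "\<And>K. K \<in> T \<Longrightarrow> \<exists>p\<in>ND. AE x in lebesgue_on K. w x = p x"
    using w by (auto simp: is_interpolant_def Vh_def Hcurl_def)
  obtain c where c: "is_weak_curl P w (\<lambda>_. c)"
    using w by (auto simp: is_interpolant_def Vh_def)
  have "\<forall>K\<in>T. \<exists>p. AE x in lebesgue_on (interior K). w x = nd (fst p) (snd p) x"
  proof
    fix K assume K: "K \<in> T"
    obtain q where q: "q \<in> ND" "AE x in lebesgue_on K. w x = q x"
      using V(2) [OF K] by blast
    obtain a b where "q = nd a b"
      using q(1) ND_iff by blast
    then have "AE x in lebesgue_on (interior K). w x = nd (fst (a, b)) (snd (a, b)) x"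
      using q(2) AE_interior_iff [OF K] by simp
    then show "\<exists>p. AE x in lebesgue_on (interior K). w x = nd (fst p) (snd p) x"
      by (rule exI)
  qed
  from bchoice [OF this] obtain p where p: "\<And>K. K \<in> T \<Longrightarrow> AE x in lebesgue_on (interior K). w x = nd (fst (p K)) (snd (p K)) x"
    by blast
  define \<alpha> \<beta> where "\<alpha> K = fst (p K)" and "\<beta> K = snd (p K)" for K
  have nd: "AE x in lebesgue_on (interior K). w x = nd (\<alpha> K) (\<beta> K) x" if "K \<in> T" for K
    using p [OF that] by (simp add: \<alpha>_def \<beta>_def)
  have wK: "w \<in> L2 (lebesgue_on (interior K))" if K: "K \<in> T" for K
    by (intro L2_vecI L2_lebesgue_on_mono(1) [OF L2_vec_nth [OF V(1)] interior_K_subset [OF K] interior_K_sets(2) P_sets(2)])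
  have bnd: "bounded (interior K)" if K: "K \<in> T" for K
    using compact_imp_bounded [OF compact_K [OF K]] interior_subset bounded_subset by blast
  have \<beta>: "- 2 * \<beta> K = c" if K: "K \<in> T" for K
  proof -
    have fin: "finite_measure (lebesgue_on (interior K))"
      by (rule finite_measure_lebesgue_on [OF bnd [OF K] interior_K_sets(2)])
    have "AE x in lebesgue_on (interior K). - 2 * \<beta> K = c"
      by (rule weak_curl_unique [OF open_interior L2_const [OF fin] L2_const [OF fin]
            weak_curl_nd [OF open_interior bnd [OF K] wK [OF K] nd [OF K]]
            is_weak_curl_mono [OF c interior_K_subset [OF K] P_sets(2) interior_K_sets(2)]])
    then show ?thesis
      by (rule AE_open_nonempty [OF open_interior interior_nonempty [OF K]])
  qed
  have bd: "tangential (nd (\<alpha> K) (\<beta> K)) e = U e" if K: "K \<in> T" and e: "e \<in> dir_edges K" "prod.swap e \<notin> edges T" for K e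
  proof -
    obtain a b where ab: "e = (a, b)"
      by (cases e)
    have eT: "(a, b) \<in> edges T"
      using K e(1) by (auto simp: edges_def ab)
    have e': "(a, b) \<in> dir_edges K" "(b, a) \<notin> edges T"
      using e by (simp_all add: ab)
    obtain i where i: "i < length vs" "(a, b) = (vs ! i, next_vertex vs i) \<or> (b, a) = (vs ! i, next_vertex vs i)"
      "polygon_edge vs i \<subseteq> K"
      using unpaired_edge_polygon [OF K e'] by metis
    have "edge_integral (interior K) w (vs ! i) (next_vertex vs i) = edge_integral P u (vs ! i) (next_vertex vs i)"
      using w i(1,3) K by (simp add: is_interpolant_def)
    then have eq: "tangential (nd (\<alpha> K) (\<beta> K)) (vs ! i, next_vertex vs i) = U (vs ! i, next_vertex vs i)"
      using edge_integrals [OF K i(1,3) wK [OF K] nd [OF K]] by simp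
    show ?thesis
      using i(2)
    proof
      assume "(a, b) = (vs ! i, next_vertex vs i)"
      then show ?thesis
        using eq by (simp only: ab)
    next
      assume "(b, a) = (vs ! i, next_vertex vs i)"
      then have "tangential (nd (\<alpha> K) (\<beta> K)) (b, a) = U (b, a)"
        using eq by (simp only:)
      then show ?thesis
        using tangential_nd_swap [of "\<alpha> K" "\<beta> K" "(a, b)"] U_swap [OF eT] by (simp add: ab)
    qed
  qed
  have "polygon_interpolant vs T u G w \<alpha> \<beta> c"
    by unfold_locales (rule V(1) nd \<beta> c bd; assumption)+
  then show thesis
    by (rule that)
qed

lemma jacobian_H1_bound: "(LINT x|lebesgue_on \<Omega>. gg x) \<le> (H1_vec_norm \<Omega> u)\<^sup>2"
proof -
  have G: "weak_grad \<Omega> (\<lambda>x. u x $ i) (G i)" for i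
    using jac by (simp add: weak_jacobian_def)
  note Gi = jac_sq_integrable [OF hull_props(1) subset_refl]
  have "(LINT x|lebesgue_on \<Omega>. gg x) = (\<Sum>i\<in>UNIV. (L2_norm (lebesgue_on \<Omega>) (G i 1))\<^sup>2 + (L2_norm (lebesgue_on \<Omega>) (G i 2))\<^sup>2)"
    unfolding L2_norm_sq sum_2 gg_def using Gi by simp
  also have "\<dots> \<le> (\<Sum>i\<in>UNIV. (H1_norm \<Omega> (\<lambda>x. u x $ i))\<^sup>2)"
    by (rule sum_mono) (simp add: H1_norm_sq [OF hull_props(1) G])
  also have "\<dots> = (H1_vec_norm \<Omega> u)\<^sup>2"
    by (simp add: H1_vec_norm_def sum_nonneg)
  finally show ?thesis .
qed

text \<open>The squared error splits into the L^2 part, bounded through the first derivatives of u,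
  and the curl part, bounded through the gradient of curl u. The common constant |k| + 3 majorises
  both k + 1 from \<open>L2_error\<close> and 2 from \<open>curl_error\<close>.\<close>

lemma interpolation_error:
  assumes w: "is_interpolant vs T u w" and \<theta>: "angles_bounded \<theta> T" "\<theta> < pi" and C': "no_short_interior_edges C' vs T"
    and u: "u \<in> H1curl \<Omega>"
  shows "(\<lambda>x. u x - w x) \<in> Hcurl P"
    and "(Hcurl_norm P (\<lambda>x. u x - w x))\<^sup>2
      \<le> (\<bar>(40 + 256 * C'\<^sup>2) / (1 - max (1 / 2) (- cos \<theta>))\<bar> + 3) * h\<^sup>2 * (H1curl_norm \<Omega> u)\<^sup>2"
proof -
  obtain \<alpha> \<beta> c where "polygon_interpolant vs T u G w \<alpha> \<beta> c"
    using interpolantD [OF w] by blast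
  then interpret I: polygon_interpolant vs T u G w \<alpha> \<beta> c .
  define k where k: "k = (40 + 256 * C'\<^sup>2) / (1 - max (1 / 2) (- cos \<theta>))"
  have uw: "(\<lambda>x. (u x - w x) $ i) \<in> L2 (lebesgue_on P)" for i
    unfolding vector_minus_component
    by (intro L2_diff jac_L2(1) L2_vec_nth I.w_L2 jordan(2) hull_props(4))
  then have uwL: "(\<lambda>x. u x - w x) \<in> L2 (lebesgue_on P)"
    by (rule L2_vecI)
  have curl: "is_weak_curl P (\<lambda>x. u x - w x) (\<lambda>x. cu x - c)"
    unfolding is_weak_curl_def
  proof
    fix \<phi> assume \<phi>: "\<phi> \<in> test_functions P"
    note \<phi>L = test_function_L2 [OF \<phi> P_sets(1)]
    have ui: "(\<lambda>x. u x $ i) \<in> L2 (lebesgue_on P)" and wi: "(\<lambda>x. w x $ i) \<in> L2 (lebesgue_on P)" for i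
      by (rule jac_L2(1) [OF jordan(2) hull_props(4)] L2_vec_nth [OF I.w_L2])+
    have i: "integrable (lebesgue_on P) (\<lambda>x. cu x * \<phi> x)" "integrable (lebesgue_on P) (\<lambda>x. c * \<phi> x)"
      by (intro L2_mult_integrable cu_L2 jordan(2) hull_props(4) \<phi>L L2_const finite_P)+
    have j: "integrable (lebesgue_on P) (\<lambda>x. u x $ 1 * partial 2 \<phi> x - u x $ 2 * partial 1 \<phi> x)"
      "integrable (lebesgue_on P) (\<lambda>x. w x $ 1 * partial 2 \<phi> x - w x $ 2 * partial 1 \<phi> x)"
      by (intro Bochner_Integration.integrable_diff L2_mult_integrable ui wi \<phi>L)+
    have "(LINT x|lebesgue_on P. (cu x - c) * \<phi> x) = (LINT x|lebesgue_on P. cu x * \<phi> x) - (LINT x|lebesgue_on P. c * \<phi> x)"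
      unfolding left_diff_distrib by (rule Bochner_Integration.integral_diff [OF i])
    also have "\<dots> = (LINT x|lebesgue_on P. u x $ 1 * partial 2 \<phi> x - u x $ 2 * partial 1 \<phi> x)
        - (LINT x|lebesgue_on P. w x $ 1 * partial 2 \<phi> x - w x $ 2 * partial 1 \<phi> x)"
      using bspec [OF cu_weak_curl [OF jordan(2) hull_props(4), unfolded is_weak_curl_def] \<phi>]
        bspec [OF I.w_curl [unfolded is_weak_curl_def] \<phi>] by (simp only:)
    also have "\<dots> = (LINT x|lebesgue_on P. (u x - w x) $ 1 * partial 2 \<phi> x - (u x - w x) $ 2 * partial 1 \<phi> x)"
      unfolding Bochner_Integration.integral_diff [OF j, symmetric]
      by (rule Bochner_Integration.integral_cong) (simp_all add: algebra_simps)
    finally show "(LINT x|lebesgue_on P. (cu x - c) * \<phi> x)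
        = (LINT x|lebesgue_on P. (u x - w x) $ 1 * partial 2 \<phi> x - (u x - w x) $ 2 * partial 1 \<phi> x)" .
  qed
  show "(\<lambda>x. u x - w x) \<in> Hcurl P"
    using uwL curl I.curl_error_L2 by (auto simp: Hcurl_def)
  have wc: "weak_curl P (\<lambda>x. u x - w x) \<in> L2 (lebesgue_on P)" "is_weak_curl P (\<lambda>x. u x - w x) (weak_curl P (\<lambda>x. u x - w x))"
    by (rule weak_curlI [OF I.curl_error_L2 curl])+
  have "L2_norm (lebesgue_on P) (weak_curl P (\<lambda>x. u x - w x)) = L2_norm (lebesgue_on P) (\<lambda>x. cu x - c)"
    by (rule L2_norm_cong_AE [OF L2_measurable [OF wc(1)] L2_measurable [OF I.curl_error_L2]
        weak_curl_unique [OF jordan(2) wc(1) I.curl_error_L2 wc(2) curl]])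
  then have curlE: "(L2_norm (lebesgue_on P) (weak_curl P (\<lambda>x. u x - w x)))\<^sup>2 = I.E"
    unfolding I.E_def L2_norm_sq [symmetric] by (simp only:)
  have cu\<Omega>: "cu \<in> L2 (lebesgue_on \<Omega>)" "is_weak_curl \<Omega> u cu"
    by (rule cu_L2 [OF hull_props(1) subset_refl] cu_weak_curl [OF hull_props(1) subset_refl])+
  obtain v where v: "v \<in> H1 \<Omega>" "is_weak_curl \<Omega> u v"
    using u by (auto simp: H1curl_def)
  obtain Gc where Gc: "weak_grad \<Omega> v Gc"
    using v(1) H1_iff by blast
  \<comment> \<open>The explicit curl \<open>cu\<close> inherits the H^1 regularity because it
    agrees almost everywhere with the weak curl v that lies in H^1.\<close>
  have "weak_grad \<Omega> cu Gc"
    by (rule weak_grad_cong_AE [OF Gc hull_props(1) L2_measurable [OF cu\<Omega>(1)]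
        weak_curl_unique [OF hull_props(1) weak_gradD(1) [OF Gc] cu\<Omega>(1) v(2) cu\<Omega>(2)]])
  note Ec = I.curl_error [OF this]
  have wu: "weak_curl \<Omega> u \<in> L2 (lebesgue_on \<Omega>)" "is_weak_curl \<Omega> u (weak_curl \<Omega> u)"
    by (rule weak_curlI [OF cu\<Omega>])+
  have "weak_grad \<Omega> (weak_curl \<Omega> u) Gc"
    by (rule weak_grad_cong_AE [OF Gc hull_props(1) L2_measurable [OF wu(1)]
        weak_curl_unique [OF hull_props(1) weak_gradD(1) [OF Gc] wu(1) v(2) wu(2)]])
  from H1_norm_sq [OF hull_props(1) this]
  have Gc_le: "(L2_norm (lebesgue_on \<Omega>) (Gc 1))\<^sup>2 + (L2_norm (lebesgue_on \<Omega>) (Gc 2))\<^sup>2 \<le> (H1_norm \<Omega> (weak_curl \<Omega> u))\<^sup>2"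
    by simp
  let ?N1 = "(H1_vec_norm \<Omega> u)\<^sup>2" and ?N2 = "(H1_norm \<Omega> (weak_curl \<Omega> u))\<^sup>2"
  have N: "(H1curl_norm \<Omega> u)\<^sup>2 = ?N1 + ?N2"
    by (simp add: H1curl_norm_def)
  have "(Hcurl_norm P (\<lambda>x. u x - w x))\<^sup>2 = (LINT x|lebesgue_on P. (norm (u x - w x))\<^sup>2) + I.E"
  proof -
    have "(L2_norm (lebesgue_on P) (\<lambda>x. u x - w x))\<^sup>2 = (LINT x|lebesgue_on P. (norm (u x - w x))\<^sup>2)"
      by (simp add: L2_norm_def Bochner_Integration.integral_nonneg)
    then show ?thesis
      by (simp add: Hcurl_norm_def curlE I.E_nonneg Bochner_Integration.integral_nonneg)
  qed
  also have "\<dots> \<le> (\<bar>k\<bar> + 3) * h\<^sup>2 * ?N1 + (\<bar>k\<bar> + 3) * h\<^sup>2 * ?N2"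
  proof (rule add_mono)
    have g0: "0 \<le> (LINT x|lebesgue_on P. gg x)"
      by (rule Bochner_Integration.integral_nonneg) (rule gg_nonneg)
    have "(LINT x|lebesgue_on P. gg x) \<le> (LINT x|lebesgue_on \<Omega>. gg x)"
      by (rule LINT_lebesgue_on_mono [OF gg_integrable [OF hull_props(1) subset_refl] hull_props(4) P_sets(2,3) gg_nonneg])
    then have g1: "(LINT x|lebesgue_on P. gg x) \<le> ?N1"
      using jacobian_H1_bound by (rule order_trans)
    have "(LINT x|lebesgue_on P. (norm (u x - w x))\<^sup>2) \<le> (k + 1) * h\<^sup>2 * (LINT x|lebesgue_on P. gg x)"
      unfolding k by (rule I.L2_error [OF \<theta> C'])
    also have "\<dots> \<le> (\<bar>k\<bar> + 3) * h\<^sup>2 * (LINT x|lebesgue_on P. gg x)"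
      by (intro mult_right_mono g0 zero_le_power2) linarith
    also have "\<dots> \<le> (\<bar>k\<bar> + 3) * h\<^sup>2 * ?N1"
      by (intro mult_left_mono g1 mult_nonneg_nonneg zero_le_power2) linarith
    finally show "(LINT x|lebesgue_on P. (norm (u x - w x))\<^sup>2) \<le> (\<bar>k\<bar> + 3) * h\<^sup>2 * ?N1" .
    have "2 * h\<^sup>2 * ((L2_norm (lebesgue_on \<Omega>) (Gc 1))\<^sup>2 + (L2_norm (lebesgue_on \<Omega>) (Gc 2))\<^sup>2) \<le> 2 * h\<^sup>2 * ?N2"
      by (intro mult_left_mono Gc_le) simp
    also have "\<dots> \<le> (\<bar>k\<bar> + 3) * h\<^sup>2 * ?N2"
      by (intro mult_right_mono zero_le_power2) linarith
    finally show "I.E \<le> (\<bar>k\<bar> + 3) * h\<^sup>2 * ?N2"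
      using Ec by linarith
  qed
  finally show "(Hcurl_norm P (\<lambda>x. u x - w x))\<^sup>2
      \<le> (\<bar>(40 + 256 * C'\<^sup>2) / (1 - max (1 / 2) (- cos \<theta>))\<bar> + 3) * h\<^sup>2 * (H1curl_norm \<Omega> u)\<^sup>2"
    unfolding N distrib_left k .
qed

end

theorem lemma5p2:
  fixes \<theta> C' H :: real and n :: nat
  assumes "\<theta> < pi"
  shows "\<exists>C::real. \<forall>(vs :: (real^2) list) (T :: (real^2) set set) (u :: real^2 \<Rightarrow> real^2).
    simple_polygon vs \<and> length vs = n \<and>
    polygon_triangulation vs T \<and> angles_bounded \<theta> T \<and> no_short_interior_edges C' vs T \<and>
    diameter (polygon_region vs) \<le> H \<and>
    u \<in> H1curl (convex hull (polygon_region vs)) \<longrightarrow>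
      is_interpolant vs T u (interpolation vs T u) \<and>
      (\<lambda>x. u x - interpolation vs T u x) \<in> Hcurl (polygon_region vs) \<and>
      Hcurl_norm (polygon_region vs) (\<lambda>x. u x - interpolation vs T u x)
        \<le> C * diameter (polygon_region vs) * H1curl_norm (convex hull (polygon_region vs)) u"
proof -
  define k where "k = \<bar>(40 + 256 * C'\<^sup>2) / (1 - max (1 / 2) (- cos \<theta>))\<bar> + 3"
  show ?thesis
  proof (intro exI [of _ "sqrt k"] allI impI)
    fix vs :: "(real^2) list" and T :: "(real^2) set set" and u :: "real^2 \<Rightarrow> real^2"
    assume A: "simple_polygon vs \<and> length vs = n \<and>
      polygon_triangulation vs T \<and> angles_bounded \<theta> T \<and> no_short_interior_edges C' vs T \<and>
      diameter (polygon_region vs) \<le> H \<and> u \<in> H1curl (convex hull (polygon_region vs))"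
    let ?P = "polygon_region vs" and ?w = "interpolation vs T u"
    have "\<exists>G. weak_grad (convex hull ?P) (\<lambda>x. u x $ i) G" for i
      unfolding H1_iff [symmetric] using A by (simp add: H1curl_def H1_vec_def)
    then obtain G where G: "\<And>i. weak_grad (convex hull ?P) (\<lambda>x. u x $ i) (G i)"
      by metis
    interpret polygon_field vs T u G
    proof unfold_locales
      show "simple_polygon vs" "polygon_triangulation vs T"
        using A by blast+
      show "weak_jacobian (convex hull ?P) u G"
        unfolding weak_jacobian_def using G by (rule allI)
    qed
    \<comment> \<open>The choice in \<open>interpolation\<close> is meaningful because an
      interpolant exists. The estimate holds for every interpolant, so it does not matter which one
      is chosen.\<close>
    have w: "is_interpolant vs T u ?w"
      unfolding interpolation_def by (rule someI_ex [OF exists_interpolant])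
    have err: "(\<lambda>x. u x - ?w x) \<in> Hcurl ?P"
      "(Hcurl_norm ?P (\<lambda>x. u x - ?w x))\<^sup>2 \<le> k * (diameter ?P)\<^sup>2 * (H1curl_norm (convex hull ?P) u)\<^sup>2"
      unfolding k_def using A by (intro interpolation_error [OF w _ assms]; blast)+
    have "0 \<le> H1curl_norm (convex hull ?P) u"
      by (simp add: H1curl_norm_def)
    then have "Hcurl_norm ?P (\<lambda>x. u x - ?w x) \<le> sqrt k * diameter ?P * H1curl_norm (convex hull ?P) u"
      using real_le_rsqrt [OF err(2)] h_pos by (simp add: real_sqrt_mult)
    with w err(1) show "is_interpolant vs T u ?w \<and> (\<lambda>x. u x - ?w x) \<in> Hcurl ?P \<and>
        Hcurl_norm ?P (\<lambda>x. u x - ?w x) \<le> sqrt k * diameter ?P * H1curl_norm (convex hull ?P) u"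
      by blast
  qed
qed

end
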